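(* Let $D$ be a connected locally-finite triangle-free digraph with more than one end. If $D$ is connected-homogeneous then: (i) $D$ is highly arc-transitive; (ii) the reachability relation $\mathcal{A}$ on $ED$ is not universal, and hence $\Delta(D)$ is bipartite; (iii) in particular $\Delta(D)$ (viewed as an undirected bipartite graph) is isomorphic to one of: a cycle $C_m$ with $m$ even, a complete bipartite graph $K_{m,n}$ ($m,n\in\mathbb{N}$), the complement of a perfect matching $CP_n$ ($n\in\mathbb{N}$), or an infinite semiregular tree $T_{a,b}$ ($a,b\in\mathbb{N}$); (iv) conversely, for every bipartite graph $B$ listed in (iii), the digraph $DL(B)$ is a connected triangle-free locally-finite connected-homogeneous digraph with $\Delta(DL(B))$ isomorphic to $B$. In addition, if $D$ has more than two ends then (v) for every vertex $u\in VD$ the subdigraphs induced by $\mathrm{desc}(u)$ and by $\mathrm{anc}(u)$ are trees.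
   Context: A digraph is a set $VD$ with an irreflexive antisymmetric binary relation $ED$ (arcs); write $x\to y$ for $(x,y)\in ED$. $D^+(v)=\{w:v\to w\}$, $D^-(v)=\{w:w\to v\}$; $D$ is locally-finite if all these are finite. Connectivity, ends, "triangle-free" (no three mutually adjacent vertices) and "tree" refer to the underlying undirected graph. The ends of a connected locally-finite graph are equivalence classes of rays (one-way infinite paths), two rays being equivalent if some third ray meets each of them infinitely often. A digraph is connected-homogeneous if every isomorphism between finite connected induced subdigraphs extends to an automorphism. A $k$-arc is a sequence $(x_0,\dots,x_k)$ with $x_i\to x_{i+1}$; $D$ is highly arc-transitive if for every $k$ its automorphism group is transitive on $k$-arcs. An alternating walk is a sequence $(x_1,\dots,x_n)$ whose consecutive arcs alternate in direction; arcs $e,e'$ are related by $\mathcal{A}$ if some alternating walk has first arc $e$ and last arc $e'$; $\mathcal{A}$ is an equivalence relation on $ED$. For arc-transitive $D$, $\Delta(D)$ denotes the (common up to isomorphism) subdigraph induced by an $\mathcal{A}$-class; it is called bipartite if its vertex set splits into $X\cup Y$ with all arcs from $X$ to $Y$. $CP_n$ is the bipartite graph with parts $X,Y$ of size $n$, a bijection $\eta:X\to Y$, and $x\sim y$ iff $y\ne\eta(x)$. $T_{a,b}$ is the infinite tree in which vertices of one part of the bipartition have degree $a$ and those of the other have degree $b$. $\mathrm{desc}(u)$ is the set of vertices reachable from $u$ by a directed path; $\mathrm{anc}(u)$ the set of vertices from which $u$ is reachable by a directed path. Construction $DL(\Delta)$: for an edge-transitive connected bipartite graph $\Delta$ with bipartition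 $X\cup Y$, let $T$ be a directed tree with every in-degree $|X|$ and every out-degree $|Y|$; for each $t\in VT$ fix bijections $\varphi_t:T^-(t)\to X$, $\psi_t:T^+(t)\to Y$; $DL(\Delta)$ has vertex set $ET$ and an arc $(a,b)\to(c,d)$ iff $b=c$ and $\{\psi_b(a),\varphi_b(d)\}$ is an edge of $\Delta$ (up to isomorphism independent of choices). Here the bipartition of $B$ in (iv) is the natural one.
   Formalization: In (iv), B is assumed connected, which excludes CP_1 and CP_2, for which DL(B) is undefined or disconnected; and the arc rule of DL is read as {φ_b(a), ψ_b(d)} being an edge, since ψ_b(a) and φ_b(d) are undefined as printed. *)

theory Defs
  imports Main
begin

section \<open>Digraphs\<close>

text \<open>A digraph: a vertex set with an arc relation. The underlying undirected
graph has x ~ y iff there is an arc in either direction.\<close>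

record 'a dg =
  verts :: "'a set"
  arcs  :: "('a \<times> 'a) set"

definition wf_digraph :: "'a dg \<Rightarrow> bool" where
  "wf_digraph D \<longleftrightarrow> arcs D \<subseteq> verts D \<times> verts D
     \<and> (\<forall>x. (x, x) \<notin> arcs D)
     \<and> (\<forall>x y. (x, y) \<in> arcs D \<longrightarrow> (y, x) \<notin> arcs D)"

definition uadj :: "'a dg \<Rightarrow> 'a \<Rightarrow> 'a \<Rightarrow> bool" where
  "uadj D x y \<longleftrightarrow> (x, y) \<in> arcs D \<or> (y, x) \<in> arcs D"

definition out_nbrs :: "'a dg \<Rightarrow> 'a \<Rightarrow> 'a set" where
  "out_nbrs D v = {w. (v, w) \<in> arcs D}"

definition in_nbrs :: "'a dg \<Rightarrow> 'a \<Rightarrow> 'a set" where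
  "in_nbrs D v = {w. (w, v) \<in> arcs D}"

definition locally_finite :: "'a dg \<Rightarrow> bool" where
  "locally_finite D \<longleftrightarrow> (\<forall>v\<in>verts D. finite (out_nbrs D v) \<and> finite (in_nbrs D v))"

text \<open>Connectivity of the underlying undirected graph (nonempty).\<close>
definition uconnected :: "'a dg \<Rightarrow> bool" where
  "uconnected D \<longleftrightarrow> verts D \<noteq> {} \<and>
     (\<forall>x\<in>verts D. \<forall>y\<in>verts D.
        (x, y) \<in> {(u, v). u \<in> verts D \<and> v \<in> verts D \<and> uadj D u v}\<^sup>*)"

text \<open>No cycle (of length at least 3) in the underlying undirected graph.\<close>
definition uacyclic :: "'a dg \<Rightarrow> bool" where
  "uacyclic D \<longleftrightarrow> \<not> (\<exists>xs. length xs \<ge> 3 \<and> distinct xs \<and> set xs \<subseteq> verts D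
       \<and> (\<forall>i. Suc i < length xs \<longrightarrow> uadj D (xs ! i) (xs ! Suc i))
       \<and> uadj D (last xs) (hd xs))"

definition is_tree :: "'a dg \<Rightarrow> bool" where
  "is_tree D \<longleftrightarrow> uconnected D \<and> uacyclic D"

definition triangle_free :: "'a dg \<Rightarrow> bool" where
  "triangle_free D \<longleftrightarrow> \<not> (\<exists>x\<in>verts D. \<exists>y\<in>verts D. \<exists>z\<in>verts D.
       uadj D x y \<and> uadj D y z \<and> uadj D x z)"

definition induced :: "'a dg \<Rightarrow> 'a set \<Rightarrow> 'a dg" where
  "induced D S = \<lparr>verts = S, arcs = arcs D \<inter> (S \<times> S)\<rparr>"

section \<open>Isomorphisms and automorphisms\<close>

definition dg_iso :: "('a \<Rightarrow> 'b) \<Rightarrow> 'a dg \<Rightarrow> 'b dg \<Rightarrow> bool" where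
  "dg_iso f D H \<longleftrightarrow> bij_betw f (verts D) (verts H) \<and>
     (\<forall>x\<in>verts D. \<forall>y\<in>verts D. (x, y) \<in> arcs D \<longleftrightarrow> (f x, f y) \<in> arcs H)"

definition automorphism :: "('a \<Rightarrow> 'a) \<Rightarrow> 'a dg \<Rightarrow> bool" where
  "automorphism g D \<longleftrightarrow> dg_iso g D D"

text \<open>Isomorphism of the underlying undirected graphs.\<close>
definition u_isomorphic :: "'a dg \<Rightarrow> 'b dg \<Rightarrow> bool" where
  "u_isomorphic D H \<longleftrightarrow> (\<exists>f. bij_betw f (verts D) (verts H) \<and>
     (\<forall>x\<in>verts D. \<forall>y\<in>verts D. uadj D x y \<longleftrightarrow> uadj H (f x) (f y)))"

definition connected_homogeneous :: "'a dg \<Rightarrow> bool" where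
  "connected_homogeneous D \<longleftrightarrow>
     (\<forall>A B f. A \<subseteq> verts D \<and> B \<subseteq> verts D \<and> finite A \<and> finite B
        \<and> uconnected (induced D A) \<and> uconnected (induced D B)
        \<and> dg_iso f (induced D A) (induced D B)
        \<longrightarrow> (\<exists>g. automorphism g D \<and> (\<forall>x\<in>A. g x = f x)))"

text \<open>A k-arc is a list (x_0,...,x_k) with x_i -> x_(i+1).\<close>
definition is_k_arc :: "'a dg \<Rightarrow> nat \<Rightarrow> 'a list \<Rightarrow> bool" where
  "is_k_arc D k xs \<longleftrightarrow> length xs = Suc k \<and> set xs \<subseteq> verts D \<and>
     (\<forall>i<k. (xs ! i, xs ! Suc i) \<in> arcs D)"

definition highly_arc_transitive :: "'a dg \<Rightarrow> bool" where
  "highly_arc_transitive D \<longleftrightarrow>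
     (\<forall>k xs ys. is_k_arc D k xs \<and> is_k_arc D k ys
        \<longrightarrow> (\<exists>g. automorphism g D \<and> map g xs = ys))"

section \<open>Alternating walks and the relation A\<close>

definition fwd_step :: "'a dg \<Rightarrow> 'a list \<Rightarrow> nat \<Rightarrow> bool" where
  "fwd_step D xs i \<longleftrightarrow> (xs ! i, xs ! Suc i) \<in> arcs D"

definition step_arc :: "'a dg \<Rightarrow> 'a list \<Rightarrow> nat \<Rightarrow> 'a \<times> 'a" where
  "step_arc D xs i = (if fwd_step D xs i then (xs ! i, xs ! Suc i) else (xs ! Suc i, xs ! i))"

definition alt_walk :: "'a dg \<Rightarrow> 'a list \<Rightarrow> bool" where
  "alt_walk D xs \<longleftrightarrow> length xs \<ge> 2 \<and>
     (\<forall>i. Suc i < length xs \<longrightarrow> uadj D (xs ! i) (xs ! Suc i)) \<and>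
     (\<forall>i. Suc (Suc i) < length xs \<longrightarrow> (fwd_step D xs i \<longleftrightarrow> \<not> fwd_step D xs (Suc i)))"

definition rel_A :: "'a dg \<Rightarrow> ('a \<times> 'a) \<Rightarrow> ('a \<times> 'a) \<Rightarrow> bool" where
  "rel_A D e e' \<longleftrightarrow> (\<exists>xs. alt_walk D xs \<and> step_arc D xs 0 = e
       \<and> step_arc D xs (length xs - 2) = e')"

definition A_class :: "'a dg \<Rightarrow> ('a \<times> 'a) \<Rightarrow> ('a \<times> 'a) set" where
  "A_class D e = {e'. rel_A D e e'}"

text \<open>The subdigraph spanned by a set of arcs C (vertices: the endpoints).\<close>
definition Delta_of :: "('a \<times> 'a) set \<Rightarrow> 'a dg" where
  "Delta_of C = \<lparr>verts = fst ` C \<union> snd ` C, arcs = C\<rparr>"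

definition bipartite_parts :: "'a dg \<Rightarrow> 'a set \<Rightarrow> 'a set \<Rightarrow> bool" where
  "bipartite_parts G X Y \<longleftrightarrow> X \<inter> Y = {} \<and> X \<union> Y = verts G \<and> arcs G \<subseteq> X \<times> Y"

definition bipartite_dg :: "'a dg \<Rightarrow> bool" where
  "bipartite_dg G \<longleftrightarrow> (\<exists>X Y. bipartite_parts G X Y)"

section \<open>Ends\<close>

definition is_ray :: "'a dg \<Rightarrow> (nat \<Rightarrow> 'a) \<Rightarrow> bool" where
  "is_ray D r \<longleftrightarrow> inj r \<and> range r \<subseteq> verts D \<and> (\<forall>i. uadj D (r i) (r (Suc i)))"

definition equiv_rays :: "'a dg \<Rightarrow> (nat \<Rightarrow> 'a) \<Rightarrow> (nat \<Rightarrow> 'a) \<Rightarrow> bool" where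
  "equiv_rays D r s \<longleftrightarrow> (\<exists>t. is_ray D t \<and> infinite (range t \<inter> range r)
       \<and> infinite (range t \<inter> range s))"

definition more_than_one_end :: "'a dg \<Rightarrow> bool" where
  "more_than_one_end D \<longleftrightarrow> (\<exists>r s. is_ray D r \<and> is_ray D s \<and> \<not> equiv_rays D r s)"

definition more_than_two_ends :: "'a dg \<Rightarrow> bool" where
  "more_than_two_ends D \<longleftrightarrow> (\<exists>r s t. is_ray D r \<and> is_ray D s \<and> is_ray D t
       \<and> \<not> equiv_rays D r s \<and> \<not> equiv_rays D r t \<and> \<not> equiv_rays D s t)"

section \<open>Descendants and ancestors\<close>

definition desc :: "'a dg \<Rightarrow> 'a \<Rightarrow> 'a set" where
  "desc D u = {v. (u, v) \<in> (arcs D)\<^sup>*}"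

definition anc :: "'a dg \<Rightarrow> 'a \<Rightarrow> 'a set" where
  "anc D u = {v. (v, u) \<in> (arcs D)\<^sup>*}"

section \<open>The bipartite graphs of the list\<close>

text \<open>Models (only the underlying undirected graphs matter).\<close>
definition cycle_graph :: "nat \<Rightarrow> nat dg" where
  "cycle_graph m = \<lparr>verts = {..<m}, arcs = {(i, Suc i mod m) | i. i < m}\<rparr>"

definition K_bip :: "nat \<Rightarrow> nat \<Rightarrow> (bool \<times> nat) dg" where
  "K_bip m n = \<lparr>verts = {(False, i) | i. i < m} \<union> {(True, j) | j. j < n},
     arcs = {((False, i), (True, j)) | i j. i < m \<and> j < n}\<rparr>"

definition CP_graph :: "nat \<Rightarrow> (bool \<times> nat) dg" where
  "CP_graph n = \<lparr>verts = {(False, i) | i. i < n} \<union> {(True, j) | j. j < n},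
     arcs = {((False, i), (True, j)) | i j. i < n \<and> j < n \<and> i \<noteq> j}\<rparr>"

text \<open>G (undirected) is the infinite semiregular tree T_{a,b}.\<close>
definition is_T_ab :: "'a dg \<Rightarrow> nat \<Rightarrow> nat \<Rightarrow> bool" where
  "is_T_ab G a b \<longleftrightarrow> is_tree G \<and> infinite (verts G) \<and>
     (\<exists>X Y. X \<inter> Y = {} \<and> X \<union> Y = verts G
        \<and> (\<forall>x\<in>verts G. \<forall>y\<in>verts G. uadj G x y \<longrightarrow> (x \<in> X \<longleftrightarrow> y \<in> Y))
        \<and> (\<forall>x\<in>X. finite {w. uadj G x w} \<and> card {w. uadj G x w} = a)
        \<and> (\<forall>y\<in>Y. finite {w. uadj G y w} \<and> card {w. uadj G y w} = b))"

definition listed_graph :: "'a dg \<Rightarrow> bool" where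
  "listed_graph G \<longleftrightarrow>
     (\<exists>m. even m \<and> m \<ge> 4 \<and> u_isomorphic G (cycle_graph m))
   \<or> (\<exists>m n. m \<ge> 1 \<and> n \<ge> 1 \<and> u_isomorphic G (K_bip m n))
   \<or> (\<exists>n. n \<ge> 1 \<and> u_isomorphic G (CP_graph n))
   \<or> (\<exists>a b. a \<ge> 1 \<and> b \<ge> 1 \<and> is_T_ab G a b)"

section \<open>The construction DL\<close>

text \<open>Admissible data for DL(B): T a directed tree, phi t : T^-(t) -> X and
psi t : T^+(t) -> Y bijections.\<close>
definition DL_data :: "'b set \<Rightarrow> 'b set \<Rightarrow> 't dg \<Rightarrow> ('t \<Rightarrow> 't \<Rightarrow> 'b) \<Rightarrow> ('t \<Rightarrow> 't \<Rightarrow> 'b) \<Rightarrow> bool" where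
  "DL_data X Y T \<phi> \<psi> \<longleftrightarrow> wf_digraph T \<and> is_tree T \<and>
     (\<forall>t\<in>verts T. bij_betw (\<phi> t) (in_nbrs T t) X \<and> bij_betw (\<psi> t) (out_nbrs T t) Y)"

text \<open>Vertex set ET; (a,b) -> (c,d) iff b = c and phi_b(a) -> psi_b(d) in B.\<close>
definition DL :: "'b dg \<Rightarrow> 't dg \<Rightarrow> ('t \<Rightarrow> 't \<Rightarrow> 'b) \<Rightarrow> ('t \<Rightarrow> 't \<Rightarrow> 'b) \<Rightarrow> ('t \<times> 't) dg" where
  "DL B T \<phi> \<psi> = \<lparr>verts = arcs T,
     arcs = {((a, b), (c, d)) | a b c d. (a, b) \<in> arcs T \<and> (c, d) \<in> arcs T \<and> b = c
               \<and> (\<phi> b a, \<psi> b d) \<in> arcs B}\<rparr>"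

end

theory Submission
  imports Defs
begin

text \<open>Among the finite edge cuts with two infinite sides, take those of minimum size and, among these,
  those that cross the fewest others: they form a nested family \<open>E\<close> invariant under automorphisms.
  Homogeneity makes the automorphism group transitive on 2-arcs and on pairs of arcs with a common
  source or sink, so the number of cuts in \<open>E\<close> separating such vertices is constant. Together with
  nestedness this shows that no cut in \<open>E\<close> separates the middle vertex of a 2-arc from both ends;
  hence a directed path crosses every cut at most once, and directed paths are induced, which gives (i).
  Counting the cuts shared by two arcs with a common source and by two arcs with a common sink leaves
  two possibilities: either every edge is a bridge and \<open>D\<close> is a tree, or all arcs of a reachability
  class pass through one point of the structure tree of \<open>E\<close>. In both cases no vertex is a source and a
  sink of the same class, which is (ii); in the second case a class is an induced subdigraph, inherits
  homogeneity and can be classified by its girth and codegrees, which is (iii). If two directed paths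
  with common ends exist, then the vertices lie on finite levels indexed by the integers and there are at
  most two ends, which is (v). In \<open>DL\<close> the copies of \<open>B\<close> are glued along cut vertices in a tree-like
  way, so partial isomorphisms between connected sets extend by one vertex at a time, and Zorn's lemma
  gives (iv).\<close>

section \<open>Edge cuts in connected graphs\<close>

text \<open>No structure tree is built. Nestedness of \<open>E\<close> enters only as the statement
  that two cuts never have all four corners inhabited, and most arguments share one shape:
  homogeneity makes two finite families of separating cuts equinumerous, a cut in one family only is
  matched by a cut in the other family only (\<open>card_exchange\<close>), and four vertices then
  occupy the four corners of these two cuts. Cuts of minimum size have connected sides, so only
  finitely many separate two given vertices and the counts make sense. The properties of
  \<open>E\<close> are unchanged when all arcs are reversed, so statements on out-neighbours also
  give statements on in-neighbours. The dichotomy \<open>fat\<close> arises because the extension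
  argument inside a reachability class relies on the class being an induced subdigraph, and this is
  derived from \<open>fat\<close>; if \<open>fat\<close> fails, acyclicity and constant degrees
  identify the class. In the converse direction a maximal partial isomorphism may meet a block in an
  infinite set, so the extension properties speak of arbitrary connected sets.\<close>

definition connected_on :: "('a \<times> 'a) set \<Rightarrow> 'a set \<Rightarrow> bool" where
  "connected_on R S \<longleftrightarrow> (\<forall>x\<in>S. \<forall>y\<in>S. (x, y) \<in> (R \<inter> S \<times> S)\<^sup>*)"

definition boundary :: "('a \<times> 'a) set \<Rightarrow> 'a set \<Rightarrow> ('a \<times> 'a) set" where
  "boundary R C = {(x, y) \<in> R. x \<in> C \<and> y \<notin> C}"

lemma rtrancl_finite_subset:
  "(x, y) \<in> R\<^sup>* \<Longrightarrow> \<exists>F. finite F \<and> F \<subseteq> R \<and> (x, y) \<in> F\<^sup>*"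
proof (induction rule: rtrancl_induct)
  case base
  show ?case by (rule exI[of _ "{}"]) simp
next
  case (step y z)
  then obtain F where F: "finite F" "F \<subseteq> R" "(x, y) \<in> F\<^sup>*" by blast
  have "(x, z) \<in> (insert (y, z) F)\<^sup>*"
    using F(3) by (meson insertI1 rtrancl.rtrancl_into_rtrancl rtrancl_mono subsetD subset_insertI)
  with F step.hyps show ?case by (intro exI[of _ "insert (y, z) F"]) auto
qed

lemma rtrancl_leaves:
  assumes "(x, y) \<in> F\<^sup>*" "x \<in> C" "y \<notin> C"
  shows "\<exists>u v. (u, v) \<in> F \<and> u \<in> C \<and> v \<notin> C"
  using assms by (induction rule: rtrancl_induct) auto

lemma rtrancl_stays:
  assumes "(x, y) \<in> F\<^sup>*" "x \<in> C" "\<And>u v. (u, v) \<in> F \<Longrightarrow> u \<in> C \<Longrightarrow> v \<in> C"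
  shows "y \<in> C"
  using assms(1,2) by (induction rule: rtrancl_induct) (auto dest: assms(3))

lemma rtrancl_sym_swap: "sym R \<Longrightarrow> (x, y) \<in> R\<^sup>* \<Longrightarrow> (y, x) \<in> R\<^sup>*"
  by (meson symD sym_rtrancl)

lemma connected_on_via:
  assumes "sym R" "z \<in> S" "\<And>x. x \<in> S \<Longrightarrow> (z, x) \<in> (R \<inter> S \<times> S)\<^sup>*"
  shows "connected_on R S"
proof -
  have "sym (R \<inter> S \<times> S)" using assms(1) by (auto simp: sym_def)
  then show ?thesis unfolding connected_on_def
    using assms(3) by (meson rtrancl_trans rtrancl_sym_swap)
qed

lemma connected_on_rtrancl:
  assumes "connected_on R S" "x \<in> S" "y \<in> S" shows "(x, y) \<in> R\<^sup>*"
proof -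
  have "(x, y) \<in> (R \<inter> S \<times> S)\<^sup>*" using assms by (simp add: connected_on_def)
  then show ?thesis using rtrancl_mono[of "R \<inter> S \<times> S" R] by blast
qed

text \<open>Induction on \<open>k\<close> by deleting the edge \<open>xy\<close>, which lies in
  every boundary counted. If the rest is connected, each cut must also cross one of the finitely
  many edges of a fixed path from \<open>x\<close> to \<open>y\<close>, and the induction hypothesis
  bounds the cuts through each of these. Otherwise the side of \<open>x\<close> can only be its
  component.\<close>

lemma boundary_finite_connected_cuts:
  assumes "sym R" "R \<subseteq> V \<times> V" "connected_on R V" "(x, y) \<in> R"
  shows "finite {C. C \<subseteq> V \<and> x \<in> C \<and> y \<notin> C \<and> connected_on R C \<and> connected_on R (V - C)
            \<and> finite (boundary R C) \<and> card (boundary R C) = k}"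
  using assms
proof (induction k arbitrary: R x y)
  case 0
  have "{C. C \<subseteq> V \<and> x \<in> C \<and> y \<notin> C \<and> connected_on R C \<and> connected_on R (V - C)
            \<and> finite (boundary R C) \<and> card (boundary R C) = 0} = {}"
    using 0 by (auto simp: boundary_def)
  then show ?case by (simp only: finite.emptyI)
next
  case (Suc k)
  let ?cuts = "\<lambda>R x y k. {C. C \<subseteq> V \<and> x \<in> C \<and> y \<notin> C \<and> connected_on R C \<and> connected_on R (V - C)
            \<and> finite (boundary R C) \<and> card (boundary R C) = k}"
  define R' where "R' = R - {(x, y), (y, x)}"
  have sym': "sym R'" using Suc.prems(1) by (auto simp: R'_def sym_def)
  have sub': "R' \<subseteq> V \<times> V" using Suc.prems(2) by (auto simp: R'_def)
  have restr: "R' \<inter> C \<times> C = R \<inter> C \<times> C" "R' \<inter> (V - C) \<times> (V - C) = R \<inter> (V - C) \<times> (V - C)"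
    "boundary R' C = boundary R C - {(x, y)}" "(x, y) \<in> boundary R C"
    if "x \<in> C" "y \<notin> C" for C
    using that Suc.prems(4) by (auto simp: R'_def boundary_def)
  show ?case
  proof (cases "connected_on R' V")
    case True
    then have "(x, y) \<in> R'\<^sup>*"
      by (rule connected_on_rtrancl) (use Suc.prems(2,4) in blast)+
    from rtrancl_finite_subset[OF this] obtain F where F: "finite F" "F \<subseteq> R'" "(x, y) \<in> F\<^sup>*" by (elim exE conjE)
    have "?cuts R x y (Suc k) \<subseteq> (\<Union>(u, v)\<in>F. ?cuts R' u v k)"
    proof
      fix C assume C: "C \<in> ?cuts R x y (Suc k)"
      then have "x \<in> C" "y \<notin> C" by simp_all
      from rtrancl_leaves[OF F(3) this]
      obtain u v where uv: "(u, v) \<in> F" "u \<in> C" "v \<notin> C" by (elim exE conjE)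
      have "C \<in> ?cuts R' u v k"
        using C uv restr[of C] by (auto simp: connected_on_def)
      then show "C \<in> (\<Union>(u, v)\<in>F. ?cuts R' u v k)" using uv by blast
    qed
    moreover have "finite (\<Union>(u, v)\<in>F. ?cuts R' u v k)"
      using F Suc.IH[OF sym' sub' True] by auto
    ultimately show ?thesis by (rule finite_subset)
  next
    case False
    have "?cuts R x y (Suc k) \<subseteq> {{z. (x, z) \<in> R'\<^sup>*}}"
    proof
      fix C assume C: "C \<in> ?cuts R x y (Suc k)"
      then have xC: "x \<in> C" "y \<notin> C" "C \<subseteq> V" by auto
      have cC: "connected_on R' C" "connected_on R' (V - C)"
        using C restr[OF xC(1,2)] by (auto simp: connected_on_def)
      \<comment> \<open>An edge leaving \<open>C\<close> in the smaller graph would join the two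
        connected sides and make that graph connected.\<close>
      have no: "boundary R' C = {}"
      proof (rule ccontr)
        assume "boundary R' C \<noteq> {}"
        then obtain u v where uv: "(u, v) \<in> R'" "u \<in> C" "v \<notin> C" by (auto simp: boundary_def)
        have *: "(R' \<inter> C \<times> C)\<^sup>* \<subseteq> (R' \<inter> V \<times> V)\<^sup>*" "(R' \<inter> (V - C) \<times> (V - C))\<^sup>* \<subseteq> (R' \<inter> V \<times> V)\<^sup>*"
          using xC by (auto intro!: rtrancl_mono)
        have uvV: "(u, v) \<in> R' \<inter> V \<times> V" using uv sub' by auto
        have "connected_on R' V"
        proof (rule connected_on_via[OF sym', of u])
          show "u \<in> V" using uvV by auto
          fix z assume z: "z \<in> V"
          show "(u, z) \<in> (R' \<inter> V \<times> V)\<^sup>*"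
          proof (cases "z \<in> C")
            case True
            then show ?thesis using cC(1) uv * by (auto simp: connected_on_def)
          next
            case False
            then have "(v, z) \<in> (R' \<inter> V \<times> V)\<^sup>*" using cC(2) uv uvV z * by (auto simp: connected_on_def)
            then show ?thesis using uvV by (rule converse_rtrancl_into_rtrancl[rotated])
          qed
        qed
        then show False using False by simp
      qed
      have "z \<in> C" if "(x, z) \<in> R'\<^sup>*" for z
        using that xC no by (auto elim!: rtrancl_stays simp: boundary_def)
      moreover have "(x, z) \<in> R'\<^sup>*" if "z \<in> C" for z
        using connected_on_rtrancl[OF cC(1) xC(1) that] .
      ultimately show "C \<in> {{z. (x, z) \<in> R'\<^sup>*}}" by blast
    qed
    then show ?thesis by (rule finite_subset) simp
  qed
qed

section \<open>Minimum edge cuts with two infinite sides\<close>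

locale connected_graph =
  fixes V :: "'a set" and R :: "('a \<times> 'a) set"
  assumes R_sym: "sym R" and R_sub: "R \<subseteq> V \<times> V" and R_conn: "connected_on R V"
begin

definition is_cut :: "'a set \<Rightarrow> bool" where
  "is_cut C \<longleftrightarrow> C \<subseteq> V \<and> infinite C \<and> infinite (V - C) \<and> finite (boundary R C)"

definition min_cuts :: "'a set set" where
  "min_cuts = {C. is_cut C \<and> (\<forall>D. is_cut D \<longrightarrow> card (boundary R C) \<le> card (boundary R D))}"

definition crosses :: "'a set \<Rightarrow> 'a set \<Rightarrow> bool" where
  "crosses C D \<longleftrightarrow> C \<inter> D \<noteq> {} \<and> C - D \<noteq> {} \<and> D - C \<noteq> {} \<and> V - (C \<union> D) \<noteq> {}"

definition crossing_number :: "'a set \<Rightarrow> nat" where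
  "crossing_number C = card {D \<in> min_cuts. crosses C D}"

definition optimal_cuts :: "'a set set" where
  "optimal_cuts = {C \<in> min_cuts. \<forall>D\<in>min_cuts. crossing_number C \<le> crossing_number D}"

lemma boundary_compl: "C \<subseteq> V \<Longrightarrow> boundary R (V - C) = (boundary R C)\<inverse>"
  using R_sym R_sub by (auto simp: boundary_def sym_def)

lemma is_cut_compl: "is_cut C \<Longrightarrow> is_cut (V - C)"
  by (auto simp: is_cut_def boundary_compl double_diff)

lemma card_boundary_compl: "C \<subseteq> V \<Longrightarrow> card (boundary R (V - C)) = card (boundary R C)"
  by (simp add: boundary_compl card_inverse)

lemma min_cuts_sub: "C \<in> min_cuts \<Longrightarrow> C \<subseteq> V"
  by (simp add: min_cuts_def is_cut_def)

lemma min_cuts_compl: "C \<in> min_cuts \<Longrightarrow> V - C \<in> min_cuts"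
  by (auto simp: min_cuts_def is_cut_compl)
     (metis card_boundary_compl is_cut_def)

lemma min_cuts_exist: "is_cut C \<Longrightarrow> \<exists>C. C \<in> min_cuts"
  using ex_has_least_nat[of is_cut C "\<lambda>C. card (boundary R C)"]
  by (auto simp: min_cuts_def)

text \<open>Each component \<open>K x\<close> of \<open>C\<close> has a nonempty boundary contained
  in that of \<open>C\<close>, so there are finitely many components and one of them is infinite.
  That component is itself a cut; by minimality it owns the whole boundary and leaves no edge for
  any other component.\<close>

lemma min_cut_connected:
  assumes C: "C \<in> min_cuts" shows "connected_on R C"
proof -
  define K where "K x = {y. (x, y) \<in> (R \<inter> C \<times> C)\<^sup>*}" for x
  have symC: "sym (R \<inter> C \<times> C)" using R_sym by (auto simp: sym_def)
  have cut: "is_cut C" using C by (simp add: min_cuts_def)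
  then have CV: "C \<subseteq> V" by (simp add: is_cut_def)
  have KC: "K x \<subseteq> C" if "x \<in> C" for x
    using that by (auto simp: K_def elim!: rtrancl_stays)
  have bK: "boundary R (K x) \<subseteq> boundary R C" if "x \<in> C" for x
  proof
    fix e assume "e \<in> boundary R (K x)"
    then obtain u v where e: "e = (u, v)" "(u, v) \<in> R" "u \<in> K x" "v \<notin> K x"
      by (auto simp: boundary_def)
    have "v \<notin> C"
    proof
      assume "v \<in> C"
      then have "(u, v) \<in> R \<inter> C \<times> C" using e KC[OF that] by auto
      moreover have "(x, u) \<in> (R \<inter> C \<times> C)\<^sup>*" using e by (simp add: K_def)
      ultimately have "(x, v) \<in> (R \<inter> C \<times> C)\<^sup>*" by (rule rtrancl_into_rtrancl[rotated])
      then show False using e by (simp add: K_def)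
    qed
    then show "e \<in> boundary R C" using e KC[OF that] by (auto simp: boundary_def)
  qed
  have nonempty: "\<exists>u v. (u, v) \<in> boundary R (K x)" if "x \<in> C" for x
  proof -
    obtain y where y: "y \<in> V - C" using cut by (metis infinite_imp_nonempty is_cut_def ex_in_conv)
    have "(x, y) \<in> (R \<inter> V \<times> V)\<^sup>*" using R_conn that y CV by (auto simp: connected_on_def)
    moreover have "x \<in> K x" "y \<notin> K x" using KC[OF that] y by (auto simp: K_def)
    ultimately show ?thesis using rtrancl_leaves[of x y "R \<inter> V \<times> V" "K x"]
      by (auto simp: boundary_def)
  qed
  have K_sym: "K u = K x" if "u \<in> K x" for u x
    using that symC by (auto simp: K_def intro: rtrancl_trans rtrancl_sym_swap)
  have "C \<subseteq> (\<Union>e\<in>boundary R C. K (fst e))"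
  proof
    fix x assume x: "x \<in> C"
    then obtain u v where uv: "(u, v) \<in> boundary R (K x)" using nonempty by blast
    then have "K u = K x" using K_sym by (auto simp: boundary_def)
    then have "x \<in> K u" by (auto simp: K_def)
    then show "x \<in> (\<Union>e\<in>boundary R C. K (fst e))" using uv bK[OF x] by force
  qed
  then have "infinite (\<Union>e\<in>boundary R C. K (fst e))"
    using cut by (metis infinite_super is_cut_def)
  then obtain u v where uv: "(u, v) \<in> boundary R C" "infinite (K u)"
    using cut by (auto simp: is_cut_def)
  then have uC: "u \<in> C" by (auto simp: boundary_def)
  have "infinite (V - K u)"
    using cut KC[OF uC] by (metis Diff_mono finite_subset is_cut_def order_refl)
  then have "is_cut (K u)"
    using cut uv KC[OF uC] bK[OF uC] CV by (auto simp: is_cut_def intro: finite_subset)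
  then have "card (boundary R C) \<le> card (boundary R (K u))"
    using C by (auto simp: min_cuts_def)
  then have beq: "boundary R (K u) = boundary R C"
    using bK[OF uC] cut by (metis card_seteq is_cut_def)
  have "C \<subseteq> K u"
  proof
    fix x assume x: "x \<in> C"
    then obtain a b where ab: "(a, b) \<in> boundary R (K x)" using nonempty by blast
    then have "(a, b) \<in> boundary R (K u)" using bK[OF x] beq by auto
    then have "K a = K u" "K a = K x" using ab K_sym by (auto simp: boundary_def)
    then show "x \<in> K u" by (auto simp: K_def)
  qed
  then show ?thesis
    using uC by (intro connected_on_via[OF R_sym, of u]) (auto simp: K_def)
qed

text \<open>All minimum cuts have the same size and connected sides, so each of them is among the
  finitely many cuts through an edge of a fixed path from \<open>x\<close> to
  \<open>y\<close>.\<close>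

lemma finite_min_cuts_separating:
  assumes "x \<in> V" "y \<in> V"
  shows "finite {C \<in> min_cuts. x \<in> C \<and> y \<notin> C}"
proof (cases "min_cuts = {}")
  case False
  then obtain C0 where C0: "C0 \<in> min_cuts" by blast
  define k where "k = card (boundary R C0)"
  have k: "card (boundary R C) = k" if "C \<in> min_cuts" for C
    using that C0 by (auto simp: min_cuts_def k_def intro: antisym)
  have "(x, y) \<in> R\<^sup>*" using connected_on_rtrancl[OF R_conn assms] .
  from rtrancl_finite_subset[OF this] obtain F where F: "finite F" "F \<subseteq> R" "(x, y) \<in> F\<^sup>*" by (elim exE conjE)
  let ?cuts = "\<lambda>x y. {C. C \<subseteq> V \<and> x \<in> C \<and> y \<notin> C \<and> connected_on R C \<and> connected_on R (V - C)
            \<and> finite (boundary R C) \<and> card (boundary R C) = k}"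
  have "{C \<in> min_cuts. x \<in> C \<and> y \<notin> C} \<subseteq> (\<Union>(u, v)\<in>F. ?cuts u v)"
  proof
    fix C assume "C \<in> {C \<in> min_cuts. x \<in> C \<and> y \<notin> C}"
    then have C: "C \<in> min_cuts" "x \<in> C" "y \<notin> C" by auto
    then obtain u v where "(u, v) \<in> F" "u \<in> C" "v \<notin> C"
      using rtrancl_leaves[OF F(3) C(2,3)] by (elim exE conjE)
    moreover have "connected_on R C" "connected_on R (V - C)"
      by (rule min_cut_connected[OF C(1)], rule min_cut_connected[OF min_cuts_compl[OF C(1)]])
    moreover have "C \<subseteq> V" "finite (boundary R C)"
      using C(1) by (simp_all add: min_cuts_def is_cut_def)
    moreover have "card (boundary R C) = k" by (rule k[OF C(1)])
    ultimately have "C \<in> ?cuts u v" by simp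
    with \<open>(u, v) \<in> F\<close> show "C \<in> (\<Union>(u, v)\<in>F. ?cuts u v)" by (intro UN_I[of "(u, v)"]) simp_all
  qed
  moreover have "finite (\<Union>(u, v)\<in>F. ?cuts u v)"
    using F boundary_finite_connected_cuts[OF R_sym R_sub R_conn] by auto
  ultimately show ?thesis by (rule finite_subset)
qed simp

text \<open>A crossing cut \<open>D\<close> is connected and meets both \<open>C\<close> and its
  complement, so it contains an end of a boundary edge of \<open>C\<close>; so does its complement.
  There are finitely many pairs of such ends.\<close>

lemma finite_crossing:
  assumes C: "C \<in> min_cuts"
  shows "finite {D \<in> min_cuts. crosses C D}"
proof -
  define U where "U = fst ` boundary R C \<union> snd ` boundary R C"
  have "finite U" using C by (auto simp: U_def min_cuts_def is_cut_def)
  have UV: "U \<subseteq> V" using R_sub by (auto simp: U_def boundary_def)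
  have meets: "\<exists>u\<in>U. u \<in> D" if D: "D \<in> min_cuts" "C \<inter> D \<noteq> {}" "D - C \<noteq> {}" for D
  proof -
    obtain x y where xy: "x \<in> C \<inter> D" "y \<in> D - C" using D by blast
    then have "(x, y) \<in> (R \<inter> D \<times> D)\<^sup>*"
      using min_cut_connected[OF D(1)] by (auto simp: connected_on_def)
    then obtain u v where "(u, v) \<in> R \<inter> D \<times> D" "u \<in> C" "v \<notin> C"
      using rtrancl_leaves[of x y _ C] xy by blast
    then show ?thesis by (force simp: U_def boundary_def)
  qed
  have "{D \<in> min_cuts. crosses C D} \<subseteq> (\<Union>(u, v)\<in>U\<times>U. {D \<in> min_cuts. u \<in> D \<and> v \<notin> D})"
  proof
    fix D assume "D \<in> {D \<in> min_cuts. crosses C D}"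
    then have D: "D \<in> min_cuts" "crosses C D" by auto
    obtain u where u: "u \<in> U" "u \<in> D"
      using meets[of D] D by (auto simp: crosses_def)
    have "C \<inter> (V - D) \<noteq> {}" "V - D - C \<noteq> {}"
      using D min_cuts_sub[OF C] by (auto simp: crosses_def)
    then obtain v where v: "v \<in> U" "v \<in> V - D"
      using meets[of "V - D"] min_cuts_compl[OF D(1)] by blast
    show "D \<in> (\<Union>(u, v)\<in>U\<times>U. {D \<in> min_cuts. u \<in> D \<and> v \<notin> D})" using u v D by auto
  qed
  moreover have "finite (\<Union>(u, v)\<in>U\<times>U. {D \<in> min_cuts. u \<in> D \<and> v \<notin> D})"
    using \<open>finite U\<close> UV finite_min_cuts_separating by auto
  ultimately show ?thesis by (rule finite_subset)
qed

text \<open>This and its strict variant turn inclusions between unions and intersections into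
  inequalities of sums; the first serves for boundaries, the second for crossing numbers.\<close>

lemma card_add_le:
  assumes "finite A" "finite B" "P \<union> Q \<subseteq> A \<union> B" "P \<inter> Q \<subseteq> A \<inter> B"
  shows "card P + card Q \<le> card A + card B"
proof -
  have fin: "finite P" "finite Q" using assms by (meson finite_Un finite_subset)+
  have "card P + card Q = card (P \<union> Q) + card (P \<inter> Q)" using fin by (rule card_Un_Int)
  also have "\<dots> \<le> card (A \<union> B) + card (A \<inter> B)"
    using assms by (intro add_mono card_mono) auto
  also have "\<dots> = card A + card B" by (rule card_Un_Int[OF assms(1,2), symmetric])
  finally show ?thesis .
qed

lemma card_add_less:
  assumes "finite A" "finite B" "P \<union> Q \<subset> A \<union> B" "P \<inter> Q \<subseteq> A \<inter> B"
  shows "card P + card Q < card A + card B"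
proof -
  have fin: "finite P" "finite Q" using assms by (meson finite_Un finite_subset psubset_imp_subset)+
  have "card P + card Q = card (P \<union> Q) + card (P \<inter> Q)" using fin by (rule card_Un_Int)
  also have "\<dots> < card (A \<union> B) + card (A \<inter> B)"
    using assms by (intro add_less_le_mono psubset_card_mono card_mono) auto
  also have "\<dots> = card A + card B" by (rule card_Un_Int[OF assms(1,2), symmetric])
  finally show ?thesis .
qed

text \<open>Submodularity: an edge leaving one of the corners leaves \<open>C\<close> or
  \<open>D\<close>, and an edge leaving both leaves both. As the corners are cuts, minimality forces
  equality throughout.\<close>

lemma min_cuts_corners:
  assumes C: "C \<in> min_cuts" and D: "D \<in> min_cuts"
    and inf: "infinite (C \<inter> D)" "infinite (V - (C \<union> D))"
  shows "C \<inter> D \<in> min_cuts" "C \<union> D \<in> min_cuts"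
proof -
  have cuts: "is_cut C" "is_cut D" using C D by (auto simp: min_cuts_def)
  then have fin: "finite (boundary R C)" "finite (boundary R D)" by (auto simp: is_cut_def)
  have sub: "boundary R (C \<inter> D) \<union> boundary R (C \<union> D) \<subseteq> boundary R C \<union> boundary R D"
    "boundary R (C \<inter> D) \<inter> boundary R (C \<union> D) \<subseteq> boundary R C \<inter> boundary R D"
    by (auto simp: boundary_def)
  have fin2: "finite (boundary R (C \<inter> D))" "finite (boundary R (C \<union> D))"
    using sub(1) fin by (meson finite_Un finite_subset)+
  have "infinite (V - C \<inter> D)" using cuts(1) by (metis Diff_mono Int_lower1 finite_subset is_cut_def order_refl)
  then have cI: "is_cut (C \<inter> D)" using cuts inf fin2 by (auto simp: is_cut_def)
  have cU: "is_cut (C \<union> D)" using cuts inf fin2 by (auto simp: is_cut_def)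
  have le: "card (boundary R (C \<inter> D)) + card (boundary R (C \<union> D)) \<le> card (boundary R C) + card (boundary R D)"
    by (rule card_add_le[OF fin sub])
  have eq: "card (boundary R C) = card (boundary R D)" using C D by (auto simp: min_cuts_def intro: antisym)
  have ge: "card (boundary R C) \<le> card (boundary R (C \<inter> D))" "card (boundary R C) \<le> card (boundary R (C \<union> D))"
    using C cI cU by (auto simp: min_cuts_def)
  have "card (boundary R (C \<inter> D)) = card (boundary R C)" "card (boundary R (C \<union> D)) = card (boundary R C)"
    using le eq ge by auto
  then show "C \<inter> D \<in> min_cuts" "C \<union> D \<in> min_cuts" using C cI cU by (auto simp: min_cuts_def)
qed

section \<open>Uncrossing minimum cuts\<close>

lemma crosses_compl: "C \<subseteq> V \<Longrightarrow> D \<subseteq> V \<Longrightarrow> crosses C (V - D) \<longleftrightarrow> crosses C D"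
  by (auto simp: crosses_def)

lemma crosses_commute: "crosses C D \<longleftrightarrow> crosses D C"
  by (auto simp: crosses_def Un_commute)

lemma crossing_number_compl: "C \<in> min_cuts \<Longrightarrow> crossing_number (V - C) = crossing_number C"
proof -
  assume C: "C \<in> min_cuts"
  have "{D \<in> min_cuts. crosses (V - C) D} = {D \<in> min_cuts. crosses C D}"
    using crosses_compl crosses_commute min_cuts_sub C by metis
  then show ?thesis by (simp add: crossing_number_def)
qed

lemma optimal_cuts_compl: "C \<in> optimal_cuts \<Longrightarrow> V - C \<in> optimal_cuts"
  by (auto simp: optimal_cuts_def min_cuts_compl crossing_number_compl)

text \<open>Replacing crossing cuts by their corners strictly lowers the total number of crossings, so
  cuts with the fewest crossings are nested.\<close>

lemma optimal_cuts_not_crossing_aux: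
  assumes C: "C \<in> optimal_cuts" and D: "D \<in> optimal_cuts"
    and cr: "crosses C D" and inf: "infinite (C \<inter> D)" "infinite (V - (C \<union> D))"
  shows False
proof -
  let ?X = "\<lambda>C. {F \<in> min_cuts. crosses C F}"
  have CM: "C \<in> min_cuts" "D \<in> min_cuts" using C D by (auto simp: optimal_cuts_def)
  note EM = min_cuts_corners[OF CM inf]
  have V: "C \<subseteq> V" "D \<subseteq> V" using CM min_cuts_sub by auto
  \<comment> \<open>A cut nested with both \<open>C\<close> and \<open>D\<close> is nested with both
    corners.\<close>
  have sub: "?X (C \<inter> D) \<union> ?X (C \<union> D) \<subseteq> ?X C \<union> ?X D"
  proof
    fix F assume F: "F \<in> ?X (C \<inter> D) \<union> ?X (C \<union> D)"
    then have "F \<in> min_cuts" by auto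
    then have "F \<subseteq> V" using min_cuts_sub by blast
    show "F \<in> ?X C \<union> ?X D"
    proof (rule ccontr)
      assume "F \<notin> ?X C \<union> ?X D"
      then have n: "\<not> crosses C F" "\<not> crosses D F" using \<open>F \<in> min_cuts\<close> by auto
      have 1: "F \<subseteq> C \<or> C \<subseteq> F \<or> F \<inter> C = {} \<or> F \<union> C = V"
        using n(1) V \<open>F \<subseteq> V\<close> unfolding crosses_def by blast
      have 2: "F \<subseteq> D \<or> D \<subseteq> F \<or> F \<inter> D = {} \<or> F \<union> D = V"
        using n(2) V \<open>F \<subseteq> V\<close> unfolding crosses_def by blast
      have cr': "\<not> C \<subseteq> D" "\<not> D \<subseteq> C" "C \<inter> D \<noteq> {}" "C \<union> D \<noteq> V" using cr by (auto simp: crosses_def)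
      have F': "crosses (C \<inter> D) F \<or> crosses (C \<union> D) F" using F by auto
      from 1 2 have "\<not> crosses (C \<inter> D) F \<and> \<not> crosses (C \<union> D) F"
        apply (elim disjE) using cr' V \<open>F \<subseteq> V\<close> unfolding crosses_def by blast+
      then show False using F' by blast
    qed
  qed
  have sub2: "?X (C \<inter> D) \<inter> ?X (C \<union> D) \<subseteq> ?X C \<inter> ?X D"
  proof
    fix F assume F: "F \<in> ?X (C \<inter> D) \<inter> ?X (C \<union> D)"
    then have M: "F \<in> min_cuts" "crosses (C \<inter> D) F" "crosses (C \<union> D) F" by auto
    have "crosses C F" using M(2,3) V unfolding crosses_def by blast
    moreover have "crosses D F" using M(2,3) V unfolding crosses_def by blast
    ultimately show "F \<in> ?X C \<inter> ?X D" using M by blast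
  qed
  \<comment> \<open>Strictness: \<open>C\<close> crosses \<open>D\<close>, but it is comparable with
    both corners and so crosses neither.\<close>
  have "C \<in> ?X D" using CM cr crosses_commute by blast
  moreover have "C \<notin> ?X (C \<inter> D) \<union> ?X (C \<union> D)" by (auto simp: crosses_def)
  ultimately have "?X (C \<inter> D) \<union> ?X (C \<union> D) \<subset> ?X C \<union> ?X D" using sub by blast
  then have "crossing_number (C \<inter> D) + crossing_number (C \<union> D) < crossing_number C + crossing_number D"
    unfolding crossing_number_def
    by (intro card_add_less finite_crossing CM sub2)
  moreover have "crossing_number C \<le> crossing_number (C \<inter> D)" "crossing_number D \<le> crossing_number (C \<union> D)"
    using C D EM by (auto simp: optimal_cuts_def)
  ultimately show False by linarith
qed

text \<open>The previous argument needs two opposite infinite corners. Both cuts and both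
  complements are infinite, so if one diagonal contains a finite corner, then the other diagonal is
  infinite; replacing \<open>D\<close> by its complement exchanges the diagonals.\<close>

lemma optimal_cuts_not_crossing:
  assumes C: "C \<in> optimal_cuts" and D: "D \<in> optimal_cuts"
  shows "\<not> crosses C D"
proof
  assume cr: "crosses C D"
  have CM: "C \<in> min_cuts" "D \<in> min_cuts" using C D by (auto simp: optimal_cuts_def)
  then have V: "C \<subseteq> V" "D \<subseteq> V" and inf: "infinite C" "infinite D" "infinite (V - C)" "infinite (V - D)"
    by (auto simp: min_cuts_def is_cut_def)
  have split: "infinite (C \<inter> D) \<or> infinite (C - D)" "infinite (C \<inter> D) \<or> infinite (D - C)"
     "infinite (V - (C \<union> D)) \<or> infinite (D - C)" "infinite (V - (C \<union> D)) \<or> infinite (C - D)"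
  proof -
    have "C = C \<inter> D \<union> (C - D)" "D = C \<inter> D \<union> (D - C)" "V - C = (V - (C \<union> D)) \<union> (D - C)"
      "V - D = (V - (C \<union> D)) \<union> (C - D)" using V by auto
    then show "infinite (C \<inter> D) \<or> infinite (C - D)" "infinite (C \<inter> D) \<or> infinite (D - C)"
     "infinite (V - (C \<union> D)) \<or> infinite (D - C)" "infinite (V - (C \<union> D)) \<or> infinite (C - D)"
      using inf by (metis finite_Un)+
  qed
  show False
  proof (cases "infinite (C \<inter> D) \<and> infinite (V - (C \<union> D))")
    case True
    then show ?thesis using optimal_cuts_not_crossing_aux[OF C D cr] by blast
  next
    case False
    then have "infinite (C - D)" "infinite (D - C)" using split by auto
    moreover have "C \<inter> (V - D) = C - D" "V - (C \<union> (V - D)) = D - C" using V by auto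
    ultimately show ?thesis
      using optimal_cuts_not_crossing_aux[OF C optimal_cuts_compl[OF D]] cr crosses_compl[OF V] by auto
  qed
qed

lemma optimal_cuts_exist:
  assumes "is_cut C" shows "\<exists>C. C \<in> optimal_cuts"
proof -
  obtain C' where "C' \<in> min_cuts" using min_cuts_exist[OF assms] by (elim exE)
  from ex_has_least_nat[of "\<lambda>C. C \<in> min_cuts", OF this, of crossing_number]
  show ?thesis unfolding optimal_cuts_def by blast
qed

section \<open>Invariance of the optimal cuts under automorphisms\<close>

definition graph_aut :: "('a \<Rightarrow> 'a) \<Rightarrow> bool" where
  "graph_aut g \<longleftrightarrow> bij_betw g V V \<and> (\<forall>x\<in>V. \<forall>y\<in>V. (x, y) \<in> R \<longleftrightarrow> (g x, g y) \<in> R)"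

lemma graph_aut_inv:
  assumes g: "graph_aut g" shows "graph_aut (inv_into V g)"
proof -
  have b: "bij_betw g V V" using g by (simp add: graph_aut_def)
  then have b': "bij_betw (inv_into V g) V V" by (rule bij_betw_inv_into)
  have "inv_into V g x \<in> V" "g (inv_into V g x) = x" if "x \<in> V" for x
    using b that by (auto simp: bij_betw_def f_inv_into_f inv_into_into)
  then show ?thesis using g b' by (auto simp: graph_aut_def)
qed

lemma graph_aut_boundary:
  assumes g: "graph_aut g" and C: "C \<subseteq> V"
  shows "boundary R (g ` C) = map_prod g g ` boundary R C"
proof -
  have inj: "inj_on g V" and im: "g ` V = V" using g by (auto simp: graph_aut_def bij_betw_def)
  show ?thesis
  proof (intro set_eqI iffI)
    fix e assume "e \<in> boundary R (g ` C)"
    then obtain a b where e: "e = (a, b)" "(a, b) \<in> R" "a \<in> g ` C" "b \<notin> g ` C" by (auto simp: boundary_def)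
    then obtain x where x: "x \<in> C" "a = g x" by blast
    have "b \<in> V" using e R_sub by auto
    then obtain y where y: "y \<in> V" "b = g y" using im by blast
    have "(x, y) \<in> R" using e x y g C by (auto simp: graph_aut_def)
    then show "e \<in> map_prod g g ` boundary R C" using e x y by (auto simp: boundary_def intro!: image_eqI[of _ _ "(x, y)"])
  next
    fix e assume "e \<in> map_prod g g ` boundary R C"
    then obtain x y where e: "e = (g x, g y)" "(x, y) \<in> R" "x \<in> C" "y \<notin> C" by (auto simp: boundary_def)
    moreover have "x \<in> V" "y \<in> V" using e R_sub by auto
    moreover have "g y \<notin> g ` C" using inj_on_image_mem_iff[OF inj] e C calculation by blast
    ultimately show "e \<in> boundary R (g ` C)" using g by (auto simp: boundary_def graph_aut_def)
  qed
qed

lemma graph_aut_min_cuts: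
  assumes g: "graph_aut g" and C: "C \<in> min_cuts" shows "g ` C \<in> min_cuts"
proof -
  have inj: "inj_on g V" and im: "g ` V = V" using g by (auto simp: graph_aut_def bij_betw_def)
  have cut: "is_cut C" using C by (simp add: min_cuts_def)
  then have CV: "C \<subseteq> V" by (simp add: is_cut_def)
  have "V - g ` C = g ` (V - C)"
    using inj_on_image_set_diff[OF inj, of V C] CV im by auto
  then have "infinite (V - g ` C)" "infinite (g ` C)"
    using cut inj CV by (auto simp: is_cut_def finite_image_iff inj_on_subset)
  moreover have "inj_on (map_prod g g) (boundary R C)"
    using R_sub by (intro inj_on_subset[OF map_prod_inj_on[OF inj inj]]) (auto simp: boundary_def)
  then have "card (boundary R (g ` C)) = card (boundary R C)"
    by (simp add: graph_aut_boundary[OF g CV] card_image)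
  moreover have "finite (boundary R (g ` C))"
    using cut by (simp add: graph_aut_boundary[OF g CV] is_cut_def)
  ultimately show ?thesis using C CV im by (auto simp: min_cuts_def is_cut_def)
qed

lemma graph_aut_crosses:
  assumes g: "graph_aut g" and CD: "C \<subseteq> V" "D \<subseteq> V" "crosses C D"
  shows "crosses (g ` C) (g ` D)"
proof -
  have inj: "inj_on g V" and im: "g ` V = V" using g by (auto simp: graph_aut_def bij_betw_def)
  have "g ` C \<inter> g ` D = g ` (C \<inter> D)" "g ` C - g ` D = g ` (C - D)" "g ` D - g ` C = g ` (D - C)"
     "V - (g ` C \<union> g ` D) = g ` (V - (C \<union> D))"
    using CD im by (simp_all add: inj_on_image_Int[OF inj] inj_on_image_set_diff[OF inj] image_Un Diff_subset_conv le_supI2)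
  then show ?thesis using CD by (simp add: crosses_def)
qed

text \<open>The inequality suffices: applied to the inverse automorphism it gives the opposite
  one.\<close>

lemma graph_aut_crossing_number_le:
  assumes g: "graph_aut g" and C: "C \<in> min_cuts"
  shows "crossing_number C \<le> crossing_number (g ` C)"
  unfolding crossing_number_def
proof (rule card_inj_on_le[where f = "image g"])
  have "inj_on g V" using g by (auto simp: graph_aut_def bij_betw_def)
  then show "inj_on (image g) {D \<in> min_cuts. crosses C D}"
    by (intro inj_onI) (metis (no_types, lifting) inj_on_image_eq_iff min_cuts_sub mem_Collect_eq)
  show "image g ` {D \<in> min_cuts. crosses C D} \<subseteq> {D \<in> min_cuts. crosses (g ` C) D}"
    using graph_aut_crosses[OF g] graph_aut_min_cuts[OF g] C min_cuts_sub by auto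
  show "finite {D \<in> min_cuts. crosses (g ` C) D}"
    by (intro finite_crossing graph_aut_min_cuts g C)
qed

lemma graph_aut_optimal_cuts:
  assumes g: "graph_aut g" and C: "C \<in> optimal_cuts" shows "g ` C \<in> optimal_cuts"
proof -
  have M: "C \<in> min_cuts" using C by (simp add: optimal_cuts_def)
  have gM: "g ` C \<in> min_cuts" by (rule graph_aut_min_cuts[OF g M])
  have "inv_into V g ` (g ` C) = C"
    using g min_cuts_sub[OF M] by (simp add: graph_aut_def bij_betw_def inv_into_image_cancel)
  then have "crossing_number (g ` C) \<le> crossing_number C"
    using graph_aut_crossing_number_le[OF graph_aut_inv[OF g] gM] by simp
  then show ?thesis using C gM by (auto simp: optimal_cuts_def intro: order_trans)
qed

end

section \<open>Digraphs, walks and automorphisms\<close>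

definition ugraph :: "'a dg \<Rightarrow> ('a \<times> 'a) set" where
  "ugraph D = {(x, y). uadj D x y}"

definition path_between :: "('a \<times> 'a) set \<Rightarrow> 'a \<Rightarrow> 'a \<Rightarrow> 'a list \<Rightarrow> bool" where
  "path_between R x y xs \<longleftrightarrow> xs \<noteq> [] \<and> distinct xs \<and> hd xs = x \<and> last xs = y
     \<and> successively (\<lambda>u v. (u, v) \<in> R) xs"

lemma rtrancl_path_between:
  assumes "(x, y) \<in> R\<^sup>*" shows "\<exists>xs. path_between R x y xs"
  using assms
proof (induction rule: converse_rtrancl_induct)
  case base
  show ?case by (rule exI[of _ "[y]"]) (simp add: path_between_def)
next
  case (step x x')
  then obtain xs where xs: "path_between R x' y xs" by (elim exE)
  show ?case
  proof (cases "x \<in> set xs")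
    case False
    then have "path_between R x y (x # xs)"
      using xs step.hyps(1) by (cases xs) (auto simp: path_between_def)
    then show ?thesis by (rule exI)
  next
    case True
    then obtain ys zs where "xs = ys @ x # zs" by (meson split_list)
    then have "path_between R x y (x # zs)"
      using xs by (auto simp: path_between_def successively_append_iff)
    then show ?thesis by (rule exI)
  qed
qed

lemma successively_restrict:
  assumes "successively (\<lambda>u v. (u, v) \<in> R \<inter> S \<times> S) xs" "xs \<noteq> []" "hd xs \<in> S"
  shows "set xs \<subseteq> S \<and> successively (\<lambda>u v. (u, v) \<in> R) xs"
  using assms by (induction xs rule: induct_list012) auto

lemma connected_on_path:
  assumes "connected_on R S" "x \<in> S" "y \<in> S"
  shows "\<exists>xs. path_between R x y xs \<and> set xs \<subseteq> S"
proof -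
  have "(x, y) \<in> (R \<inter> S \<times> S)\<^sup>*" using assms by (simp add: connected_on_def)
  from rtrancl_path_between[OF this] obtain xs where xs: "path_between (R \<inter> S \<times> S) x y xs" by (elim exE)
  then show ?thesis using successively_restrict[of R S xs] assms(2)
    by (auto simp: path_between_def)
qed

lemma sym_ugraph: "sym (ugraph D)"
  by (auto simp: ugraph_def sym_def uadj_def)

lemma uadj_commute: "uadj D x y \<longleftrightarrow> uadj D y x"
  by (auto simp: uadj_def)

lemma ugraph_sub: "wf_digraph D \<Longrightarrow> ugraph D \<subseteq> verts D \<times> verts D"
  by (auto simp: ugraph_def uadj_def wf_digraph_def)

lemma uadj_in_verts: "wf_digraph D \<Longrightarrow> uadj D x y \<Longrightarrow> x \<in> verts D \<and> y \<in> verts D"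
  by (auto simp: uadj_def wf_digraph_def)

lemma arcs_in_verts: "wf_digraph D \<Longrightarrow> (x, y) \<in> arcs D \<Longrightarrow> x \<in> verts D \<and> y \<in> verts D"
  by (auto simp: wf_digraph_def)

lemma uconnected_iff: "uconnected D \<longleftrightarrow> verts D \<noteq> {} \<and> connected_on (ugraph D) (verts D)"
proof -
  have "{(u, v). u \<in> verts D \<and> v \<in> verts D \<and> uadj D u v} = ugraph D \<inter> verts D \<times> verts D"
    by (auto simp: ugraph_def)
  then show ?thesis by (simp add: uconnected_def connected_on_def)
qed

lemma verts_induced [simp]: "verts (induced D S) = S" and arcs_induced: "arcs (induced D S) = arcs D \<inter> S \<times> S"
  by (auto simp: induced_def)

lemma uadj_induced: "uadj (induced D S) x y \<longleftrightarrow> uadj D x y \<and> x \<in> S \<and> y \<in> S"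
  by (auto simp: uadj_def arcs_induced)

lemma uconnected_induced_iff:
  "uconnected (induced D S) \<longleftrightarrow> S \<noteq> {} \<and> connected_on (ugraph D) S"
proof -
  have "ugraph (induced D S) \<inter> S \<times> S = ugraph D \<inter> S \<times> S"
    by (auto simp: ugraph_def uadj_induced)
  then show ?thesis by (simp add: uconnected_iff connected_on_def)
qed

lemma connected_on_list:
  assumes "sym R" "\<And>i. 0 < i \<Longrightarrow> i < length xs \<Longrightarrow> \<exists>j<i. (xs ! j, xs ! i) \<in> R"
  shows "connected_on R (set xs)"
proof (cases "xs = []")
  case False
  have "(xs ! 0, xs ! i) \<in> (R \<inter> set xs \<times> set xs)\<^sup>*" if "i < length xs" for i
    using that
  proof (induction i rule: less_induct)
    case (less i)
    show ?case
    proof (cases "i = 0")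
      case False
      then obtain j where j: "j < i" "(xs ! j, xs ! i) \<in> R" using assms(2) less.prems by blast
      then have "(xs ! 0, xs ! j) \<in> (R \<inter> set xs \<times> set xs)\<^sup>*" using less by simp
      then show ?thesis by (rule rtrancl_into_rtrancl) (use j less.prems in simp)
    qed simp
  qed
  then show ?thesis using assms(1) False
    by (intro connected_on_via[of R "xs ! 0"]) (auto simp: in_set_conv_nth)
qed (simp add: connected_on_def)

lemma automorphism_bij: "automorphism g D \<Longrightarrow> bij_betw g (verts D) (verts D)"
  by (simp add: automorphism_def dg_iso_def)

lemma automorphism_arcs:
  "automorphism g D \<Longrightarrow> x \<in> verts D \<Longrightarrow> y \<in> verts D \<Longrightarrow> (g x, g y) \<in> arcs D \<longleftrightarrow> (x, y) \<in> arcs D"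
  by (simp add: automorphism_def dg_iso_def)

lemma automorphism_uadj:
  "automorphism g D \<Longrightarrow> x \<in> verts D \<Longrightarrow> y \<in> verts D \<Longrightarrow> uadj D (g x) (g y) \<longleftrightarrow> uadj D x y"
  by (simp add: uadj_def automorphism_arcs)

text \<open>Homogeneity in the form used later. A finite connected set is listed so that every
  vertex after the first has an earlier neighbour, and the isomorphism is checked index by
  index.\<close>

lemma homogeneous_list:
  assumes hom: "connected_homogeneous D"
    and xs: "distinct xs" "set xs \<subseteq> verts D" "xs \<noteq> []"
    and ys: "distinct ys" "set ys \<subseteq> verts D" "length ys = length xs"
    and conn: "\<And>i. 0 < i \<Longrightarrow> i < length xs \<Longrightarrow> \<exists>j<i. uadj D (xs ! j) (xs ! i)"
    and iso: "\<And>i j. i < length xs \<Longrightarrow> j < length xs \<Longrightarrow>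
               (xs ! i, xs ! j) \<in> arcs D \<longleftrightarrow> (ys ! i, ys ! j) \<in> arcs D"
  shows "\<exists>g. automorphism g D \<and> map g xs = ys"
proof -
  define f where "f z = the (map_of (zip xs ys) z)" for z
  have f: "f (xs ! i) = ys ! i" if "i < length xs" for i
    using that xs ys by (simp add: f_def map_of_zip_nth)
  have conn': "\<And>i. 0 < i \<Longrightarrow> i < length ys \<Longrightarrow> \<exists>j<i. uadj D (ys ! j) (ys ! i)"
    using conn iso ys(3) unfolding uadj_def by (metis less_trans)
  have bij: "bij_betw f (set xs) (set ys)"
  proof (rule bij_betw_imageI)
    show "inj_on f (set xs)"
      using f ys by (auto intro!: inj_onI simp: in_set_conv_nth nth_eq_iff_index_eq)
    show "f ` set xs = set ys" 
      using f ys(3) by (force simp: in_set_conv_nth image_iff)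
  qed
  have arcs: "(x, y) \<in> arcs D \<longleftrightarrow> (f x, f y) \<in> arcs D" if "x \<in> set xs" "y \<in> set xs" for x y
    using that f iso by (auto simp: in_set_conv_nth)
  have "dg_iso f (induced D (set xs)) (induced D (set ys))"
    using bij arcs bij_betwE[OF bij] by (auto simp: dg_iso_def arcs_induced)
  moreover have "connected_on (ugraph D) (set xs)" "connected_on (ugraph D) (set ys)"
    using conn conn' by (intro connected_on_list sym_ugraph; simp add: ugraph_def)+
  ultimately obtain g where g: "automorphism g D" "\<forall>x\<in>set xs. g x = f x"
    using hom xs ys unfolding connected_homogeneous_def uconnected_induced_iff
    by (metis finite_set length_0_conv set_empty)
  have "map g xs = ys" using g f ys by (intro nth_equalityI) auto
  then show ?thesis using g by blast
qed

lemma connected_graph_digraph: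
  "wf_digraph D \<Longrightarrow> uconnected D \<Longrightarrow> connected_graph (verts D) (ugraph D)"
  by (simp add: connected_graph_def sym_ugraph ugraph_sub uconnected_iff)

section \<open>The reachability relation as a closure\<close>

text \<open>The reflexive transitive closure of this relation is the reachability relation
  (\<open>rel_A_iff\<close>), which frees later proofs from the bookkeeping of alternating
  walks.\<close>

definition share :: "'a dg \<Rightarrow> (('a \<times> 'a) \<times> ('a \<times> 'a)) set" where
  "share D = {(e, e'). e \<in> arcs D \<and> e' \<in> arcs D \<and> (fst e = fst e' \<or> snd e = snd e')}"

lemma sym_share: "sym (share D)"
  by (auto simp: share_def sym_def)

lemma step_arc_in_arcs:
  assumes "alt_walk D xs" "Suc i < length xs" shows "step_arc D xs i \<in> arcs D"
  using assms by (auto simp: alt_walk_def step_arc_def fwd_step_def uadj_def)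

lemma alt_walk_share:
  assumes "alt_walk D xs" "Suc i < length xs"
  shows "(step_arc D xs 0, step_arc D xs i) \<in> (share D)\<^sup>*"
  using assms(2)
proof (induction i)
  case (Suc i)
  have "(step_arc D xs i, step_arc D xs (Suc i)) \<in> share D"
    using step_arc_in_arcs[OF assms(1), of i] step_arc_in_arcs[OF assms(1), of "Suc i"] Suc.prems assms(1)
    by (auto simp: share_def step_arc_def alt_walk_def)
  then show ?case using Suc by (meson Suc_lessD rtrancl.rtrancl_into_rtrancl)
qed simp

lemma alt_walk_snoc:
  assumes xs: "alt_walk D xs" and n: "length xs = Suc (Suc n)"
    and z: "uadj D (xs ! Suc n) z" "(xs ! Suc n, z) \<in> arcs D \<longleftrightarrow> \<not> fwd_step D xs n"
  shows "alt_walk D (xs @ [z])" "step_arc D (xs @ [z]) 0 = step_arc D xs 0"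
    "fwd_step D (xs @ [z]) (Suc n) \<longleftrightarrow> \<not> fwd_step D xs n"
    "step_arc D (xs @ [z]) (Suc n) = (if (xs ! Suc n, z) \<in> arcs D then (xs ! Suc n, z) else (z, xs ! Suc n))"
proof -
  have f: "fwd_step D (xs @ [z]) i = fwd_step D xs i" if "i \<le> n" for i
    using that n by (simp add: fwd_step_def nth_append)
  show last: "fwd_step D (xs @ [z]) (Suc n) \<longleftrightarrow> \<not> fwd_step D xs n"
    using z n by (simp add: fwd_step_def nth_append)
  show "step_arc D (xs @ [z]) 0 = step_arc D xs 0"
    using n f[of 0] by (simp add: step_arc_def nth_append)
  show "step_arc D (xs @ [z]) (Suc n) = (if (xs ! Suc n, z) \<in> arcs D then (xs ! Suc n, z) else (z, xs ! Suc n))"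
    using n by (simp add: step_arc_def fwd_step_def nth_append)
  have adj: "uadj D ((xs @ [z]) ! i) ((xs @ [z]) ! Suc i)" if "Suc i < length (xs @ [z])" for i
  proof (cases "i = Suc n")
    case True
    then show ?thesis using z n by (simp add: nth_append)
  next
    case False
    then have "Suc i < length xs" using that n by simp
    then show ?thesis using xs by (simp add: nth_append alt_walk_def)
  qed
  have alt: "fwd_step D (xs @ [z]) i \<longleftrightarrow> \<not> fwd_step D (xs @ [z]) (Suc i)"
    if "Suc (Suc i) < length (xs @ [z])" for i
  proof (cases "i = n")
    case True
    then show ?thesis using last f[of n] by simp
  next
    case False
    then have "Suc (Suc i) < length xs" using that n by simp
    then show ?thesis using xs f[of i] f[of "Suc i"] n by (simp add: alt_walk_def)
  qed
  show "alt_walk D (xs @ [z])" using n adj alt by (auto simp: alt_walk_def)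
qed

text \<open>In an alternating walk the orientation of the last step decides whether the next arc
  shares its target or its source with it. The closure keeps no such record, so the induction
  carries walks ending in either orientation.\<close>

lemma rel_A_iff:
  assumes wf: "wf_digraph D"
  shows "rel_A D e e' \<longleftrightarrow> e \<in> arcs D \<and> (e, e') \<in> (share D)\<^sup>*"
proof
  assume "rel_A D e e'"
  then obtain xs where xs: "alt_walk D xs" "step_arc D xs 0 = e" "step_arc D xs (length xs - 2) = e'"
    by (auto simp: rel_A_def)
  then have "length xs \<ge> 2" by (simp add: alt_walk_def)
  then show "e \<in> arcs D \<and> (e, e') \<in> (share D)\<^sup>*"
    using step_arc_in_arcs[OF xs(1), of 0] alt_walk_share[OF xs(1), of "length xs - 2"] xs by auto
next
  assume e: "e \<in> arcs D \<and> (e, e') \<in> (share D)\<^sup>*"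
  \<comment> \<open>The flag \<open>b\<close> records whether the walk traverses its last arc
    forwards.\<close>
  define W where "W b e' \<longleftrightarrow> (\<exists>xs n. alt_walk D xs \<and> length xs = Suc (Suc n) \<and> step_arc D xs 0 = e
     \<and> step_arc D xs n = e' \<and> (fwd_step D xs n \<longleftrightarrow> b))" for b e'
  have sink: "W False (x', y)" if w: "W True (x, y)" "(x', y) \<in> arcs D" for x y x'
  proof -
    obtain xs n where xs: "alt_walk D xs" "length xs = Suc (Suc n)" "step_arc D xs 0 = e"
      "step_arc D xs n = (x, y)" "fwd_step D xs n" using w(1) by (auto simp: W_def)
    then have y: "xs ! Suc n = y" by (simp add: step_arc_def)
    have "(y, x') \<notin> arcs D" using w(2) wf by (auto simp: wf_digraph_def)
    then have "uadj D (xs ! Suc n) x'" "(xs ! Suc n, x') \<in> arcs D \<longleftrightarrow> \<not> fwd_step D xs n"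
      using y w xs by (auto simp: uadj_def)
    from alt_walk_snoc[OF xs(1,2) this] show ?thesis
      using xs y \<open>(y, x') \<notin> arcs D\<close> unfolding W_def
      by (intro exI[of _ "xs @ [x']"] exI[of _ "Suc n"]) auto
  qed
  have source: "W True (x, y')" if w: "W False (x, y)" "(x, y') \<in> arcs D" for x y y'
  proof -
    obtain xs n where xs: "alt_walk D xs" "length xs = Suc (Suc n)" "step_arc D xs 0 = e"
      "step_arc D xs n = (x, y)" "\<not> fwd_step D xs n" using w(1) by (auto simp: W_def)
    then have y: "xs ! Suc n = x" by (simp add: step_arc_def)
    then have "uadj D (xs ! Suc n) y'" "(xs ! Suc n, y') \<in> arcs D \<longleftrightarrow> \<not> fwd_step D xs n"
      using w xs by (auto simp: uadj_def)
    from alt_walk_snoc[OF xs(1,2) this] show ?thesis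
      using xs y w(2) unfolding W_def
      by (intro exI[of _ "xs @ [y']"] exI[of _ "Suc n"]) auto
  qed
  obtain x y where xy: "e = (x, y)" by (cases e)
  have "(y, x) \<notin> arcs D" using e xy wf by (auto simp: wf_digraph_def)
  have "W True e" unfolding W_def
    using e xy by (intro exI[of _ "[x, y]"] exI[of _ 0])
      (auto simp: alt_walk_def step_arc_def fwd_step_def uadj_def)
  moreover have "W False e" unfolding W_def
    using e xy \<open>(y, x) \<notin> arcs D\<close> by (intro exI[of _ "[y, x]"] exI[of _ 0])
      (auto simp: alt_walk_def step_arc_def fwd_step_def uadj_def)
  ultimately have base: "W True e \<and> W False e" by simp
  have "(e, e') \<in> (share D)\<^sup>*" using e by simp
  then have "W True e' \<and> W False e'"
  proof (induction rule: rtrancl_induct)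
    case (step f f')
    obtain a b a' b' where ff: "f = (a, b)" "f' = (a', b')" by (cases f, cases f')
    have arcs: "(a', b') \<in> arcs D" and "a = a' \<or> b = b'" using step.hyps ff by (auto simp: share_def)
    then show ?case
    proof (elim disjE)
      assume "a = a'"
      then have "W True f'" using source[of a b b'] step.IH ff arcs by simp
      \<comment> \<open>Going back along the same arc yields the other orientation.\<close>
      then show ?thesis using sink[of a' b' a'] ff arcs by simp
    next
      assume "b = b'"
      then have "W False f'" using sink[of a b a'] step.IH ff arcs by simp
      then show ?thesis using source[of a' b' b'] ff arcs by simp
    qed
  qed (use base in simp)
  then obtain xs n where "alt_walk D xs" "length xs = Suc (Suc n)" "step_arc D xs 0 = e"
      "step_arc D xs n = e'" by (auto simp: W_def)
  then show "rel_A D e e'" unfolding rel_A_def by (intro exI[of _ xs]) simp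
qed

lemma A_class_iff: "wf_digraph D \<Longrightarrow> e \<in> arcs D \<Longrightarrow> e' \<in> A_class D e \<longleftrightarrow> (e, e') \<in> (share D)\<^sup>*"
  by (simp add: A_class_def rel_A_iff)

lemma share_rtrancl_arcs: "(e, e') \<in> (share D)\<^sup>* \<Longrightarrow> e \<in> arcs D \<Longrightarrow> e' \<in> arcs D"
  by (induction rule: rtrancl_induct) (auto simp: share_def)

section \<open>Reversal\<close>

text \<open>The underlying graph, its ends and the automorphisms are unchanged. Statements on
  in-neighbours are obtained by interpreting the locale below for the reversed digraph.\<close>

definition rev_dg :: "'a dg \<Rightarrow> 'a dg" where
  "rev_dg D = \<lparr>verts = verts D, arcs = (arcs D)\<inverse>\<rparr>"

lemma verts_rev [simp]: "verts (rev_dg D) = verts D"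
  and arcs_rev [simp]: "arcs (rev_dg D) = (arcs D)\<inverse>"
  by (auto simp: rev_dg_def)

lemma uadj_rev [simp]: "uadj (rev_dg D) = uadj D"
  by (auto simp: uadj_def fun_eq_iff)

lemma ugraph_rev [simp]: "ugraph (rev_dg D) = ugraph D"
  by (simp add: ugraph_def)

lemma induced_rev: "induced (rev_dg D) S = rev_dg (induced D S)"
  by (auto simp: induced_def rev_dg_def)

lemma wf_rev: "wf_digraph D \<Longrightarrow> wf_digraph (rev_dg D)"
  by (auto simp: wf_digraph_def)

lemma uconnected_rev: "uconnected (rev_dg D) \<longleftrightarrow> uconnected D"
  by (simp add: uconnected_def)

lemma locally_finite_rev: "locally_finite (rev_dg D) \<longleftrightarrow> locally_finite D"
  by (auto simp: locally_finite_def out_nbrs_def in_nbrs_def)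

lemma triangle_free_rev: "triangle_free (rev_dg D) \<longleftrightarrow> triangle_free D"
  by (simp add: triangle_free_def)

lemma is_ray_rev: "is_ray (rev_dg D) r \<longleftrightarrow> is_ray D r"
  by (simp add: is_ray_def)

lemma equiv_rays_rev: "equiv_rays (rev_dg D) r s \<longleftrightarrow> equiv_rays D r s"
  by (simp add: equiv_rays_def is_ray_rev)

lemma dg_iso_rev: "dg_iso f (rev_dg D) (rev_dg H) \<longleftrightarrow> dg_iso f D H"
  by (auto simp: dg_iso_def)

lemma automorphism_rev: "automorphism g (rev_dg D) \<longleftrightarrow> automorphism g D"
  by (simp add: automorphism_def dg_iso_rev)

lemma connected_homogeneous_rev: "connected_homogeneous (rev_dg D) \<longleftrightarrow> connected_homogeneous D"
  by (simp add: connected_homogeneous_def automorphism_rev induced_rev dg_iso_rev uconnected_rev)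

lemma is_tree_rev: "is_tree (rev_dg D) \<longleftrightarrow> is_tree D"
  by (simp add: is_tree_def uconnected_rev uacyclic_def)

lemma desc_rev: "desc (rev_dg D) u = anc D u"
  by (simp add: desc_def anc_def rtrancl_converse)

section \<open>Inequivalent rays are separated by a finite cut\<close>

definition separable :: "'a dg \<Rightarrow> (nat \<Rightarrow> 'a) \<Rightarrow> (nat \<Rightarrow> 'a) \<Rightarrow> bool" where
  "separable D r s \<longleftrightarrow> (\<exists>C. C \<subseteq> verts D \<and> finite (boundary (ugraph D) C)
     \<and> (\<exists>n. \<forall>i\<ge>n. r i \<in> C) \<and> (\<exists>n. \<forall>i\<ge>n. s i \<notin> C))"

lemma separable_sym:
  assumes wf: "wf_digraph D" and rays: "is_ray D r" "is_ray D s" and sep: "separable D s r"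
  shows "separable D r s"
proof -
  from sep obtain C m n where C: "C \<subseteq> verts D" "finite (boundary (ugraph D) C)"
    "\<forall>i\<ge>n. s i \<in> C" "\<forall>i\<ge>m. r i \<notin> C" by (auto simp: separable_def)
  have "boundary (ugraph D) (verts D - C) = (boundary (ugraph D) C)\<inverse>"
    using ugraph_sub[OF wf] C(1) by (auto simp: boundary_def ugraph_def uadj_commute)
  then have "finite (boundary (ugraph D) (verts D - C))" using C(2) by simp
  moreover have "\<forall>i\<ge>m. r i \<in> verts D - C" using C(4) rays by (auto simp: is_ray_def)
  moreover have "\<forall>i\<ge>n. s i \<notin> verts D - C" using C(3) by auto
  ultimately show ?thesis unfolding separable_def by (intro exI[of _ "verts D - C"]) blast
qed

lemma ray_avoids_finite:
  assumes "is_ray D s" "finite F" shows "\<exists>N. \<forall>k\<ge>N. s k \<notin> F"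
proof -
  have "finite {k. s k \<in> F}"
    using assms by (auto simp: is_ray_def intro!: finite_imageD[of s "{k. s k \<in> F}"]
        intro: finite_subset[of _ F] inj_on_subset)
  then obtain N where "\<forall>k\<in>{k. s k \<in> F}. k < N" using finite_nat_set_iff_bounded by auto
  then show ?thesis by (intro exI[of _ N]) (auto simp: not_le[symmetric])
qed

lemma finite_ugraph_nbrs:
  "wf_digraph D \<Longrightarrow> locally_finite D \<Longrightarrow> finite {w. uadj D v w}"
proof -
  assume a: "wf_digraph D" "locally_finite D"
  have "{w. uadj D v w} = out_nbrs D v \<union> in_nbrs D v" by (auto simp: uadj_def out_nbrs_def in_nbrs_def)
  moreover have "{w. uadj D v w} = {}" if "v \<notin> verts D" using a that by (auto simp: uadj_def wf_digraph_def)
  ultimately show ?thesis using a by (cases "v \<in> verts D") (auto simp: locally_finite_def)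
qed

text \<open>The component of the tail of \<open>r\<close> after deletion of \<open>F\<close> has
  finite boundary by local finiteness. If the rays are inseparable, \<open>s\<close> must visit it
  infinitely often, so a path avoiding \<open>F\<close> leads from the tail of \<open>r\<close> to
  \<open>s\<close>.\<close>

lemma ray_link:
  assumes wf: "wf_digraph D" and lf: "locally_finite D"
    and r: "is_ray D r" and s: "is_ray D s" and nsep: "\<not> separable D r s"
    and F: "finite F" and tail: "\<forall>k>i. r k \<notin> F"
  shows "\<exists>Q j. path_between (ugraph D) (r (Suc i)) (s j) Q \<and> set Q \<subseteq> verts D - F
           \<and> (\<forall>k>j. s k \<notin> F \<union> set Q)"
proof -
  let ?R = "ugraph D" and ?V = "verts D"
  define K where "K = {y. (r (Suc i), y) \<in> (?R \<inter> (?V - F) \<times> (?V - F))\<^sup>*}"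
  have rV: "r k \<in> ?V" "s k \<in> ?V" for k using r s by (auto simp: is_ray_def)
  have rS: "r (Suc i) \<in> ?V - F" using rV tail by auto
  have KV: "K \<subseteq> ?V - F"
    using rS by (auto simp: K_def elim!: rtrancl_stays)
  have bd: "boundary ?R K \<subseteq> (\<Union>v\<in>F. {w. uadj D v w} \<times> {v})"
  proof
    fix e assume "e \<in> boundary ?R K"
    then obtain u v where e: "e = (u, v)" "(u, v) \<in> ?R" "u \<in> K" "v \<notin> K" by (auto simp: boundary_def)
    have "v \<in> F"
    proof (rule ccontr)
      assume "v \<notin> F"
      then have "(u, v) \<in> ?R \<inter> (?V - F) \<times> (?V - F)" using e KV ugraph_sub[OF wf] by auto
      moreover have "(r (Suc i), u) \<in> (?R \<inter> (?V - F) \<times> (?V - F))\<^sup>*" using e by (simp add: K_def)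
      ultimately have "v \<in> K" unfolding K_def by (simp add: rtrancl.rtrancl_into_rtrancl)
      then show False using e by simp
    qed
    then show "e \<in> (\<Union>v\<in>F. {w. uadj D v w} \<times> {v})" using e by (auto simp: ugraph_def uadj_commute)
  qed
  have "finite (boundary ?R K)"
    by (rule finite_subset[OF bd]) (use F finite_ugraph_nbrs[OF wf lf] in auto)
  moreover have "r k \<in> K" if "k \<ge> Suc i" for k
    using that
  proof (induction k rule: dec_induct)
    case base show ?case by (simp add: K_def)
  next
    case (step k)
    have "(r k, r (Suc k)) \<in> ?R \<inter> (?V - F) \<times> (?V - F)"
      using r rV tail step.hyps by (auto simp: is_ray_def ugraph_def)
    then show ?case using step.IH unfolding K_def by (simp add: rtrancl.rtrancl_into_rtrancl)
  qed
  ultimately have inf: "\<forall>n. \<exists>k\<ge>n. s k \<in> K"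
    using nsep KV unfolding separable_def by (metis Diff_subset order_trans)
  obtain N where N: "\<forall>k\<ge>N. s k \<notin> F" using ray_avoids_finite[OF s F] by (elim exE)
  obtain k where k: "k \<ge> N" "s k \<in> K" using inf by blast
  then have "(r (Suc i), s k) \<in> (?R \<inter> (?V - F) \<times> (?V - F))\<^sup>*" by (simp add: K_def)
  from rtrancl_path_between[OF this] obtain P
    where P: "path_between (?R \<inter> (?V - F) \<times> (?V - F)) (r (Suc i)) (s k) P" by (elim exE)
  then have P': "set P \<subseteq> ?V - F" "successively (\<lambda>u v. (u, v) \<in> ?R) P" "distinct P" "P \<noteq> []"
      "hd P = r (Suc i)" "last P = s k"
    using successively_restrict[of ?R "?V - F" P] rS by (auto simp: path_between_def)
  obtain M where M: "\<forall>m\<ge>M. s m \<notin> set P" using ray_avoids_finite[OF s, of "set P"] by auto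
  define J where "J = {m. s m \<in> set P}"
  have "finite J" using M by (intro finite_subset[of J "{..<M}"]) (auto simp: J_def not_le[symmetric])
  have "k \<in> J" using P' last_in_set[of P] by (auto simp: J_def)
  \<comment> \<open>Cutting the path at the last index where \<open>s\<close> meets it keeps the
    later part of \<open>s\<close> disjoint from everything built so far.\<close>
  define j where "j = Max J"
  have j: "j \<in> J" "k \<le> j" "\<forall>m>j. s m \<notin> set P"
  proof -
    show "j \<in> J" unfolding j_def by (rule Max_in) (use \<open>finite J\<close> \<open>k \<in> J\<close> in auto)
    show "k \<le> j" unfolding j_def by (rule Max_ge[OF \<open>finite J\<close> \<open>k \<in> J\<close>])
    show "\<forall>m>j. s m \<notin> set P" using Max_ge[OF \<open>finite J\<close>] by (fastforce simp: j_def J_def)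
  qed
  then obtain Q1 Q2 where Q: "P = Q1 @ s j # Q2" by (auto simp: J_def dest: split_list)
  have "path_between ?R (r (Suc i)) (s j) (Q1 @ [s j])"
    using P' Q by (cases Q1) (auto simp: path_between_def successively_append_iff successively_Cons hd_append split: if_splits)
  moreover have "set (Q1 @ [s j]) \<subseteq> ?V - F" using P' Q by auto
  moreover have "\<forall>m>j. s m \<notin> F \<union> set (Q1 @ [s j])" using j k N Q by auto
  ultimately show ?thesis by blast
qed

text \<open>If no finite boundary separates the rays, links taken alternately from \<open>r\<close>
  to \<open>s\<close> and back concatenate to a ray that meets both infinitely often.\<close>

theorem inequivalent_rays_separable:
  assumes wf: "wf_digraph D" and lf: "locally_finite D"
    and r: "is_ray D r" and s: "is_ray D s" and neq: "\<not> equiv_rays D r s"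
  shows "separable D r s"
proof (rule ccontr)
  assume nsep: "\<not> separable D r s"
  then have nsep': "\<not> separable D s r" using separable_sym[OF wf r s] by blast
  define ray where "ray b = (if b then r else s)" for b :: bool
  have ray: "is_ray D (ray b)" "\<not> separable D (ray b) (ray (\<not> b))" for b
    using r s nsep nsep' by (auto simp: ray_def)
  let ?R = "ugraph D" and ?V = "verts D"
  \<comment> \<open>A state is a finite path \<open>p\<close> ending on ray \<open>b\<close> at
    index \<open>i\<close>, such that the later vertices of that ray avoid \<open>p\<close>.\<close>
  define ok where "ok st \<longleftrightarrow> (case st of (p, i, b) \<Rightarrow> p \<noteq> [] \<and> distinct p \<and> set p \<subseteq> ?V
      \<and> successively (\<lambda>u v. (u, v) \<in> ?R) p \<and> last p = ray b i \<and> (\<forall>k>i. ray b k \<notin> set p))" for st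
  define ext where "ext st st' \<longleftrightarrow> (case st of (p, i, b) \<Rightarrow> case st' of (p', i', b') \<Rightarrow>
      b' = (\<not> b) \<and> (\<exists>Q. Q \<noteq> [] \<and> p' = p @ Q))" for st st' :: "'a list \<times> nat \<times> bool"
  have ex0: "\<exists>st. ok st"
    using r by (intro exI[of _ "([r 0], 0, True)"]) (auto simp: ok_def ray_def is_ray_def inj_eq)
  have exS: "\<exists>st'. ok st' \<and> ext st st'" if ok: "ok st" for st
  proof -
    obtain p i b where st: "st = (p, i, b)" by (cases st)
    then have p: "p \<noteq> []" "distinct p" "set p \<subseteq> ?V" "successively (\<lambda>u v. (u, v) \<in> ?R) p"
      "last p = ray b i" "\<forall>k>i. ray b k \<notin> set p" using ok by (auto simp: ok_def)
    obtain Q j where Q: "path_between ?R (ray b (Suc i)) (ray (\<not> b) j) Q" "set Q \<subseteq> ?V - set p"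
      "\<forall>k>j. ray (\<not> b) k \<notin> set p \<union> set Q"
      using ray_link[OF wf lf ray(1) ray(1) ray(2) _ p(6)] by auto
    have adj: "(ray b i, ray b (Suc i)) \<in> ?R" using ray(1)[of b] by (auto simp: is_ray_def ugraph_def)
    have "ok (p @ Q, j, \<not> b)"
      using p Q adj by (auto simp: ok_def path_between_def successively_append_iff)
    moreover have "ext st (p @ Q, j, \<not> b)" using Q by (auto simp: ext_def st path_between_def)
    ultimately show ?thesis by blast
  qed
  obtain st where st: "\<And>n. ok (st n)" "\<And>n. ext (st n) (st (Suc n))"
    using dependent_nat_choice[of "\<lambda>_. ok" "\<lambda>_. ext"] ex0 exS by metis
  define p where "p n = fst (st n)" for n
  define b where "b n = snd (snd (st n))" for n
  define i where "i n = fst (snd (st n))" for n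
  have p: "p n \<noteq> []" "distinct (p n)" "set (p n) \<subseteq> ?V" "successively (\<lambda>u v. (u, v) \<in> ?R) (p n)"
    "last (p n) = ray (b n) (i n)" for n
    using st(1)[of n] by (auto simp: ok_def p_def b_def i_def split: prod.splits)
  have ext: "b (Suc n) = (\<not> b n)" "\<exists>Q. Q \<noteq> [] \<and> p (Suc n) = p n @ Q" for n
    using st(2)[of n] by (auto simp: ext_def p_def b_def split: prod.splits)
  have pre: "\<exists>Q. p (n + m) = p n @ Q" for n m
  proof (induction m)
    case (Suc m)
    then show ?case using ext(2)[of "n + m"] by auto
  qed simp
  have len: "n < length (p n)" for n
  proof (induction n)
    case 0 show ?case using p(1) by simp
  next
    case (Suc n)
    obtain Q where "Q \<noteq> []" "p (Suc n) = p n @ Q" using ext(2) by blast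
    then show ?case using Suc by (cases Q) auto
  qed
  have lenS: "length (p n) < length (p (Suc n))" for n using ext(2)[of n] by auto
  \<comment> \<open>The paths extend one another and \<open>p n\<close> has more than
    \<open>n\<close> vertices, so this is their common limit.\<close>
  define t where "t n = p n ! n" for n
  have t: "t k = p n ! k" if "k < length (p n)" for k n
  proof (cases "k \<le> n")
    case True
    then obtain Q where "p n = p k @ Q" using pre[of k "n - k"] by auto
    then show ?thesis using len[of k] by (simp add: t_def nth_append)
  next
    case False
    then obtain Q where "p k = p n @ Q" using pre[of n "k - n"] by auto
    then show ?thesis using that by (simp add: t_def nth_append)
  qed
  have "is_ray D t"
    unfolding is_ray_def
  proof (intro conjI allI)
    show "inj t"
    proof (rule injI)
      fix x y assume xy: "t x = t y"
      let ?n = "max x y"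
      have l: "x < length (p ?n)" "y < length (p ?n)" using len[of ?n] by auto
      then show "x = y" using xy t[OF l(1)] t[OF l(2)] p(2)[of ?n] by (simp add: nth_eq_iff_index_eq)
    qed
    show "range t \<subseteq> ?V"
    proof
      fix v assume "v \<in> range t"
      then obtain k where "v = p k ! k" by (auto simp: t_def)
      then show "v \<in> ?V" using nth_mem[OF len[of k]] p(3)[of k] by auto
    qed
    fix k
    have l: "k < length (p (Suc k))" "Suc k < length (p (Suc k))" using len[of "Suc k"] by auto
    then show "uadj D (t k) (t (Suc k))"
      using t[OF l(1)] t[OF l(2)] p(4)[of "Suc k"] by (auto simp: successively_conv_nth ugraph_def)
  qed
  moreover have meets: "infinite (range t \<inter> range (ray c))" for c
  proof -
    have tl: "t (length (p n) - 1) = ray (b n) (i n)" for n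
      using t[of "length (p n) - 1" n] p(1,5)[of n] by (simp add: last_conv_nth)
    have mono: "strict_mono (\<lambda>n. length (p n))" by (simp add: strict_mono_Suc_iff lenS)
    have bpar: "b (m + 2 * n) = b m" for n m
      by (induction n) (simp_all add: ext)
    obtain m where m: "b m = c" using ext(1)[of 0] by (metis (full_types))
    define h where "h n = length (p (m + 2 * n)) - 1" for n
    have "inj h"
    proof (rule injI)
      fix x y assume "h x = h y"
      then have "length (p (m + 2 * x)) = length (p (m + 2 * y))"
        unfolding h_def by (metis len Suc_pred' gr_zeroI less_nat_zero_code length_greater_0_conv p(1))
      then show "x = y" using strict_mono_eq[OF mono] by simp
    qed
    moreover have "inj t" using \<open>is_ray D t\<close> by (simp add: is_ray_def)
    ultimately have "inj (t \<circ> h)" by (rule inj_compose[rotated])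
    then have "infinite (range (t \<circ> h))" by (meson finite_imageD infinite_UNIV_nat)
    moreover have "range (t \<circ> h) \<subseteq> range t \<inter> range (ray c)"
    proof
      fix v assume "v \<in> range (t \<circ> h)"
      then obtain n where n: "v = t (h n)" by auto
      have "t (h n) = ray c (i (m + 2 * n))" using tl[of "m + 2 * n"] bpar[of m n] m by (simp add: h_def)
      then show "v \<in> range t \<inter> range (ray c)" using n by (metis IntI rangeI)
    qed
    ultimately show ?thesis using infinite_super by blast
  qed
  ultimately have "equiv_rays D r s"
    unfolding equiv_rays_def using meets[of True] meets[of False] by (auto simp: ray_def)
  then show False using neq by simp
qed

lemma separable_is_cut:
  assumes wf: "wf_digraph D" "uconnected D" and r: "is_ray D r" and s: "is_ray D s"
    and sep: "separable D r s"
  shows "\<exists>C. connected_graph.is_cut (verts D) (ugraph D) C"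
proof -
  interpret connected_graph "verts D" "ugraph D" using connected_graph_digraph[OF wf] .
  from sep obtain C m n where C: "C \<subseteq> verts D" "finite (boundary (ugraph D) C)"
    "\<forall>i\<ge>n. r i \<in> C" "\<forall>i\<ge>m. s i \<notin> C" by (auto simp: separable_def)
  have "infinite (r ` {n..})" "infinite (s ` {m..})"
    using r s by (auto simp: is_ray_def finite_image_iff inj_on_subset infinite_Ici)
  moreover have "r ` {n..} \<subseteq> C" "s ` {m..} \<subseteq> verts D - C"
    using C s by (auto simp: is_ray_def)
  ultimately have "is_cut C" using C unfolding is_cut_def by (meson infinite_super)
  then show ?thesis by (rule exI)
qed

section \<open>Invariant nested cuts in connected-homogeneous digraphs\<close>

text \<open>The cuts enter later arguments only through these properties, which do not change when
  arcs are reversed. \<open>E_nested\<close> states non-crossing pointwise: no four vertices occupy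
  the four corners of two cuts.\<close>

locale cut_homogeneous =
  fixes D :: "'a dg" and E :: "'a set set"
  assumes wf: "wf_digraph D" and uconn: "uconnected D" and lf: "locally_finite D"
    and tf: "triangle_free D" and hom: "connected_homogeneous D"
    and E_ne: "E \<noteq> {}"
    and E_sub: "C \<in> E \<Longrightarrow> C \<subseteq> verts D"
    and E_inf: "C \<in> E \<Longrightarrow> infinite C"
    and E_conn: "C \<in> E \<Longrightarrow> connected_on (ugraph D) C"
    and E_fin: "C \<in> E \<Longrightarrow> finite (boundary (ugraph D) C)"
    and E_compl: "C \<in> E \<Longrightarrow> verts D - C \<in> E"
    and E_nested: "C \<in> E \<Longrightarrow> C' \<in> E \<Longrightarrow> a \<in> C \<Longrightarrow> a \<in> C' \<Longrightarrow> b \<in> C \<Longrightarrow> b \<notin> C' \<Longrightarrow> c \<notin> C \<Longrightarrow> c \<in> C' \<Longrightarrow>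
        d \<in> verts D \<Longrightarrow> d \<notin> C \<Longrightarrow> d \<notin> C' \<Longrightarrow> False"
    and E_aut: "automorphism g D \<Longrightarrow> C \<in> E \<Longrightarrow> g ` C \<in> E"
    and E_sep_fin: "x \<in> verts D \<Longrightarrow> y \<in> verts D \<Longrightarrow> finite {C \<in> E. x \<in> C \<and> y \<notin> C}"

lemma cut_homogeneous_exists:
  assumes wf: "wf_digraph D" and uc: "uconnected D" and lf: "locally_finite D"
    and tf: "triangle_free D" and hom: "connected_homogeneous D" and ends: "more_than_one_end D"
  shows "\<exists>E. cut_homogeneous D E"
proof -
  interpret connected_graph "verts D" "ugraph D" using connected_graph_digraph[OF wf uc] .
  obtain r s where rs: "is_ray D r" "is_ray D s" "\<not> equiv_rays D r s"
    using ends by (auto simp: more_than_one_end_def)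
  obtain C where "is_cut C"
    using separable_is_cut[OF wf uc rs(1,2) inequivalent_rays_separable[OF wf lf rs]] by (elim exE)
  then have ne: "optimal_cuts \<noteq> {}" using optimal_cuts_exist by blast
  have M: "C \<in> min_cuts" if "C \<in> optimal_cuts" for C using that by (simp add: optimal_cuts_def)
  have "cut_homogeneous D optimal_cuts"
  proof
    fix C assume C: "C \<in> optimal_cuts"
    show "C \<subseteq> verts D" "infinite C" "finite (boundary (ugraph D) C)"
      using M[OF C] by (auto simp: min_cuts_def is_cut_def)
    show "connected_on (ugraph D) C" by (rule min_cut_connected[OF M[OF C]])
    show "verts D - C \<in> optimal_cuts" by (rule optimal_cuts_compl[OF C])
    fix g assume "automorphism g D"
    then have "graph_aut g"
      unfolding graph_aut_def by (simp add: automorphism_bij automorphism_uadj ugraph_def)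
    then show "g ` C \<in> optimal_cuts" using graph_aut_optimal_cuts C by blast
  next
    fix C C' a b c d
    assume C: "C \<in> optimal_cuts" "C' \<in> optimal_cuts" and corners: "a \<in> C" "a \<in> C'" "b \<in> C" "b \<notin> C'"
       "c \<notin> C" "c \<in> C'" "d \<in> verts D" "d \<notin> C" "d \<notin> C'"
    then have "crosses C C'" by (auto simp: crosses_def)
    then show False using optimal_cuts_not_crossing[OF C] by simp
  next
    fix x y assume "x \<in> verts D" "y \<in> verts D"
    then show "finite {C \<in> optimal_cuts. x \<in> C \<and> y \<notin> C}"
      by (rule finite_subset[rotated, OF finite_min_cuts_separating]) (auto dest: M)
  qed (use assms ne in auto)
  then show ?thesis by (rule exI)
qed

lemma automorphism_inv:
  assumes g: "automorphism g D" shows "automorphism (inv_into (verts D) g) D"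
proof -
  have b: "bij_betw g (verts D) (verts D)" by (rule automorphism_bij[OF g])
  have "inv_into (verts D) g x \<in> verts D" "g (inv_into (verts D) g x) = x" if "x \<in> verts D" for x
    using b that by (auto simp: bij_betw_def f_inv_into_f inv_into_into)
  then show ?thesis using b automorphism_arcs[OF g] unfolding automorphism_def dg_iso_def
    by (metis bij_betw_inv_into)
qed

text \<open>Typical use: an automorphism shows that two families of separating cuts have equal size,
  so a cut gained in one direction is paid for by a cut gained in the other.\<close>

lemma card_exchange:
  assumes "finite A" "finite B" "card A = card B" "a \<in> A" "a \<notin> B"
  shows "\<exists>b\<in>B. b \<notin> A"
proof (rule ccontr)
  assume "\<not> ?thesis"
  then have "B \<subset> A" using assms by blast
  then have "card B < card A" by (rule psubset_card_mono[OF assms(1)])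
  then show False using assms by simp
qed

context cut_homogeneous
begin

lemma rev_cut_homogeneous: "cut_homogeneous (rev_dg D) E"
  by unfold_locales
    (use wf uconn lf tf hom E_ne E_sub E_inf E_conn E_fin E_compl E_aut E_sep_fin in
      \<open>auto simp: wf_rev uconnected_rev locally_finite_rev triangle_free_rev connected_homogeneous_rev
         automorphism_rev intro: E_nested\<close>)

lemma arc_verts: "(x, y) \<in> arcs D \<Longrightarrow> x \<in> verts D" "(x, y) \<in> arcs D \<Longrightarrow> y \<in> verts D"
  using wf by (auto simp: wf_digraph_def)

lemma arc_antisym: "(x, y) \<in> arcs D \<Longrightarrow> (y, x) \<notin> arcs D"
  using wf by (auto simp: wf_digraph_def)

lemma arc_irrefl: "(x, x) \<notin> arcs D"
  using wf by (auto simp: wf_digraph_def)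

lemma no_triangle: "uadj D x y \<Longrightarrow> uadj D y z \<Longrightarrow> \<not> uadj D x z"
  using tf uadj_in_verts[OF wf] unfolding triangle_free_def by blast

section \<open>Small configurations and counts of separating cuts\<close>

lemma vertex_transitive:
  assumes "x \<in> verts D" "y \<in> verts D" shows "\<exists>g. automorphism g D \<and> g x = y"
  using homogeneous_list[OF hom, of "[x]" "[y]"] assms arc_irrefl by auto

lemma arc_transitive:
  assumes "(x, y) \<in> arcs D" "(x', y') \<in> arcs D"
  shows "\<exists>g. automorphism g D \<and> g x = x' \<and> g y = y'"
proof -
  have "\<exists>g. automorphism g D \<and> map g [x, y] = [x', y']"
    using assms arc_verts arc_irrefl arc_antisym
    by (intro homogeneous_list[OF hom]) (auto simp: less_Suc_eq uadj_def)
  then show ?thesis by auto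
qed

text \<open>Without triangles two neighbours of \<open>b\<close> are not adjacent, so the subdigraph
  induced on three such vertices is determined by the directions of its two arcs.\<close>

lemma homogeneous_3:
  assumes "uadj D b a" "uadj D b c" "a \<noteq> c" "uadj D b' a'" "uadj D b' c'" "a' \<noteq> c'"
    and "(b, a) \<in> arcs D \<longleftrightarrow> (b', a') \<in> arcs D" "(b, c) \<in> arcs D \<longleftrightarrow> (b', c') \<in> arcs D"
  shows "\<exists>g. automorphism g D \<and> g a = a' \<and> g b = b' \<and> g c = c'"
proof -
  have n: "(a, c) \<notin> arcs D" "(c, a) \<notin> arcs D" "(a', c') \<notin> arcs D" "(c', a') \<notin> arcs D"
    using no_triangle[of a b c] no_triangle[of a' b' c'] assms by (auto simp: uadj_def)
  have e: "(a, b) \<in> arcs D \<longleftrightarrow> (b, a) \<notin> arcs D" "(c, b) \<in> arcs D \<longleftrightarrow> (b, c) \<notin> arcs D"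
      "(a', b') \<in> arcs D \<longleftrightarrow> (b', a') \<notin> arcs D" "(c', b') \<in> arcs D \<longleftrightarrow> (b', c') \<notin> arcs D"
    using assms arc_antisym by (auto simp: uadj_def)
  have d: "b \<noteq> a" "b \<noteq> c" "b' \<noteq> a'" "b' \<noteq> c'" using e by auto
  have v: "{a, b, c, a', b', c'} \<subseteq> verts D" using assms uadj_in_verts[OF wf] by blast
  have "\<exists>g. automorphism g D \<and> map g [b, a, c] = [b', a', c']"
  proof (rule homogeneous_list[OF hom])
    fix i assume "0 < i" "i < length [b, a, c]"
    then show "\<exists>j<i. uadj D ([b, a, c] ! j) ([b, a, c] ! i)"
      using assms by (intro exI[of _ 0]) (auto simp: less_Suc_eq numeral_2_eq_2)
  next
    fix i j assume "i < length [b, a, c]" "j < length [b, a, c]"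
    then show "([b, a, c] ! i, [b, a, c] ! j) \<in> arcs D \<longleftrightarrow> ([b', a', c'] ! i, [b', a', c'] ! j) \<in> arcs D"
      using assms n e arc_irrefl by (auto simp: less_Suc_eq numeral_2_eq_2)
  qed (use d v assms in auto)
  then show ?thesis by auto
qed

definition cutset :: "'a set \<Rightarrow> 'a set \<Rightarrow> 'a set set" where
  "cutset A B = {C \<in> E. A \<subseteq> C \<and> B \<inter> C = {}}"

lemma cutset_compl: "C \<subseteq> verts D \<Longrightarrow> A \<subseteq> verts D \<Longrightarrow> B \<subseteq> verts D \<Longrightarrow> verts D - C \<in> cutset A B \<longleftrightarrow> C \<in> cutset B A"
  using E_compl[of C] E_compl[of "verts D - C"] by (auto simp: cutset_def double_diff)

lemma finite_cutset: "A \<noteq> {} \<Longrightarrow> B \<noteq> {} \<Longrightarrow> A \<subseteq> verts D \<Longrightarrow> B \<subseteq> verts D \<Longrightarrow> finite (cutset A B)"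
proof -
  assume a: "A \<noteq> {}" "B \<noteq> {}" "A \<subseteq> verts D" "B \<subseteq> verts D"
  then obtain x y where xy: "x \<in> A" "y \<in> B" by blast
  then have "finite {C \<in> E. x \<in> C \<and> y \<notin> C}" using a E_sep_fin by blast
  then show ?thesis by (rule finite_subset[rotated]) (use xy in \<open>auto simp: cutset_def\<close>)
qed

lemma card_cutset_aut:
  assumes g: "automorphism g D" and AB: "A \<subseteq> verts D" "B \<subseteq> verts D"
  shows "card (cutset (g ` A) (g ` B)) = card (cutset A B)"
proof -
  let ?V = "verts D" and ?h = "inv_into (verts D) g"
  have b: "inj_on g ?V" "g ` ?V = ?V" using automorphism_bij[OF g] by (auto simp: bij_betw_def)
  have h: "automorphism ?h D" by (rule automorphism_inv[OF g])
  have hg: "?h ` g ` C = C" if "C \<subseteq> ?V" for C using b that by (simp add: inv_into_image_cancel)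
  have gh: "g ` ?h ` C = C" if "C \<subseteq> ?V" for C using b that by (simp add: image_inv_into_cancel)
  have im: "g ` C \<in> cutset (g ` A) (g ` B)" if "C \<in> cutset A B" for C
    using that E_aut[OF g] E_sub AB inj_on_image_Int[OF b(1), of B C] by (auto simp: cutset_def)
  have im': "?h ` C \<in> cutset A B" if "C \<in> cutset (g ` A) (g ` B)" for C
  proof -
    have C: "C \<in> E" "g ` A \<subseteq> C" "g ` B \<inter> C = {}" "C \<subseteq> ?V" using that E_sub by (auto simp: cutset_def)
    have "?h ` g ` A \<subseteq> ?h ` C" using C by blast
    moreover have "B \<inter> ?h ` C = {}"
    proof (rule ccontr)
      assume "B \<inter> ?h ` C \<noteq> {}"
      then obtain z where "z \<in> B" "z \<in> ?h ` C" by blast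
      then have "g z \<in> g ` B" "g z \<in> g ` ?h ` C" by auto
      then show False using gh C by auto
    qed
    ultimately show ?thesis using E_aut[OF h C(1)] hg AB by (auto simp: cutset_def)
  qed
  have "bij_betw (image g) (cutset A B) (cutset (g ` A) (g ` B))"
  proof (rule bij_betw_byWitness[where f' = "image ?h"])
    have sub: "C \<subseteq> ?V" if "C \<in> cutset A B" for A B C using that E_sub by (simp add: cutset_def)
    show "\<forall>C\<in>cutset A B. ?h ` g ` C = C" by (intro ballI hg) (rule sub)
    show "\<forall>C\<in>cutset (g ` A) (g ` B). g ` ?h ` C = C" by (intro ballI gh) (rule sub)
    show "image g ` cutset A B \<subseteq> cutset (g ` A) (g ` B)" using im by blast
    show "image ?h ` cutset (g ` A) (g ` B) \<subseteq> cutset A B" using im' by blast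
  qed
  from bij_betw_same_card[OF this] show ?thesis by (rule sym)
qed

definition sep :: "'a \<Rightarrow> 'a \<Rightarrow> 'a set set" where
  "sep x y = cutset {y} {x}"

lemma sep_iff: "C \<in> sep x y \<longleftrightarrow> C \<in> E \<and> x \<notin> C \<and> y \<in> C"
  by (auto simp: sep_def cutset_def)

lemma finite_sep: "x \<in> verts D \<Longrightarrow> y \<in> verts D \<Longrightarrow> finite (sep x y)"
  by (simp add: sep_def finite_cutset)

text \<open>Some edge crosses some cut. Passing to the complement if necessary makes it an arc into
  the cut, and arc-transitivity moves it to \<open>(x, y)\<close>.\<close>

lemma arc_separated:
  assumes "(x, y) \<in> arcs D" shows "\<exists>C. C \<in> sep x y"
proof -
  obtain C where C: "C \<in> E" using E_ne by blast
  obtain u v where uv: "u \<in> C" "v \<in> verts D - C"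
    using E_inf[OF C] E_inf[OF E_compl[OF C]] by (metis ex_in_conv finite.emptyI)
  have "connected_on (ugraph D) (verts D)" using uconn by (simp add: uconnected_iff)
  then have "(u, v) \<in> (ugraph D)\<^sup>*" by (rule connected_on_rtrancl) (use uv C E_sub in auto)
  from rtrancl_leaves[OF this, of C] obtain u v where "uadj D u v" "u \<in> C" "v \<notin> C"
    using uv by (auto simp: ugraph_def)
  then obtain a b C' where ab: "(a, b) \<in> arcs D" "C' \<in> E" "a \<notin> C'" "b \<in> C'"
    using C E_compl arc_verts E_sub unfolding uadj_def by (metis Diff_iff)
  then obtain g where g: "automorphism g D" "g a = x" "g b = y" using arc_transitive assms by blast
  have "inj_on g (verts D)" using automorphism_bij[OF g(1)] by (simp add: bij_betw_def)
  then have "x \<notin> g ` C'" "y \<in> g ` C'"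
    using g ab arc_verts[OF ab(1)] E_sub[OF ab(2)] by (auto dest: inj_onD)
  then show ?thesis using E_aut[OF g(1) ab(2)] by (auto simp: sep_iff)
qed

lemma has_out_nbr: assumes "x \<in> verts D" shows "\<exists>y. (x, y) \<in> arcs D"
proof -
  obtain C where C: "C \<in> E" using E_ne by blast
  obtain u v where uv: "u \<in> C" "v \<in> verts D - C"
    using E_inf[OF C] E_inf[OF E_compl[OF C]] by (metis ex_in_conv finite.emptyI)
  have "connected_on (ugraph D) (verts D)" using uconn by (simp add: uconnected_iff)
  then have "(u, v) \<in> (ugraph D)\<^sup>*" by (rule connected_on_rtrancl) (use uv C E_sub in auto)
  from rtrancl_leaves[OF this, of C] obtain a b where "(a, b) \<in> arcs D"
    using uv by (auto simp: ugraph_def uadj_def)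
  moreover obtain g where "automorphism g D" "g a = x" using vertex_transitive assms arc_verts calculation by blast
  ultimately show ?thesis using automorphism_arcs arc_verts by metis
qed

lemma cut_has_nbr:
  assumes "C \<in> E" "y \<in> C" shows "\<exists>w\<in>C. uadj D y w"
proof -
  have "infinite (C - {y})" using E_inf assms by simp
  then obtain v where v: "v \<in> C" "v \<noteq> y" by (metis DiffE ex_in_conv finite.emptyI insertI1)
  then have "(y, v) \<in> (ugraph D \<inter> C \<times> C)\<^sup>*" using E_conn assms by (simp add: connected_on_def)
  then show ?thesis using v by (cases rule: converse_rtranclE) (auto simp: ugraph_def)
qed

text \<open>The number of cuts in \<open>E\<close> separating the middle vertex of a 2-arc from both ends does not
  depend on the 2-arc; a cut counted here would, by connectedness of its sides, force a crossing.\<close>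

lemma no_turn_aux:
  assumes xyz: "(x, y) \<in> arcs D" "(y, z) \<in> arcs D" and C: "C \<in> E" "y \<in> C" "x \<notin> C" "z \<notin> C"
    and w: "(y, w) \<in> arcs D" "w \<in> C"
  shows False
proof -
  have ne: "x \<noteq> z" "x \<noteq> w" using xyz w arc_antisym by auto
  \<comment> \<open>Both \<open>(x, y, z)\<close> and \<open>(x, y, w)\<close> are 2-arcs, so
    equally many cuts hold \<open>y\<close> apart from the two ends of each.\<close>
  obtain g where g: "automorphism g D" "g x = x" "g y = y" "g z = w"
    using homogeneous_3[of y x z y x w] xyz w ne by (auto simp: uadj_def)
  have V: "{y} \<subseteq> verts D" "{x, z} \<subseteq> verts D" "{x, w} \<subseteq> verts D" using xyz w arc_verts by blast+
  have "card (cutset {y} {x, z}) = card (cutset {y} {x, w})"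
    using card_cutset_aut[OF g(1) V(1,2)] g by simp
  moreover have "C \<in> cutset {y} {x, z}" "C \<notin> cutset {y} {x, w}" using C w by (auto simp: cutset_def)
  ultimately obtain C' where C': "C' \<in> cutset {y} {x, w}" "C' \<notin> cutset {y} {x, z}"
    using card_exchange[OF finite_cutset finite_cutset] V by (metis insert_not_empty)
  then have "C' \<in> E" "y \<in> C'" "x \<notin> C'" "w \<notin> C'" "z \<in> C'" by (auto simp: cutset_def)
  \<comment> \<open>The corners are occupied by \<open>y\<close> (in both cuts), \<open>w\<close>
    (only in \<open>C\<close>), \<open>z\<close> (only in \<open>C'\<close>) and \<open>x\<close>
    (in neither).\<close>
  then show False using E_nested[OF C(1), of C' y w z x] C w V by auto
qed

end

section \<open>Directed paths cross each cut at most once\<close>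

context cut_homogeneous
begin

interpretation rv: cut_homogeneous "rev_dg D" E by (rule rev_cut_homogeneous)

text \<open>Since \<open>C\<close> is infinite and connected, \<open>y\<close> has a neighbour
  \<open>w\<close> inside it. If the arc leads from \<open>y\<close> to \<open>w\<close>, the
  counting argument applies directly, otherwise it applies in the reversed digraph.\<close>

lemma no_turn:
  assumes xyz: "(x, y) \<in> arcs D" "(y, z) \<in> arcs D" and C: "C \<in> E" "y \<in> C"
  shows "x \<in> C \<or> z \<in> C"
proof (rule ccontr)
  assume "\<not> ?thesis"
  then have n: "x \<notin> C" "z \<notin> C" by auto
  obtain w where w: "w \<in> C" "uadj D y w" using cut_has_nbr[OF C] by blast
  then show False
    using no_turn_aux[OF xyz C n, of w] rv.no_turn_aux[of z y x C w] xyz C n by (auto simp: uadj_def)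
qed

lemma no_turn': 
  assumes xyz: "(x, y) \<in> arcs D" "(y, z) \<in> arcs D" and C: "C \<in> E" "y \<notin> C"
  shows "x \<notin> C \<or> z \<notin> C"
  using no_turn[OF xyz E_compl[OF C(1)]] C xyz arc_verts by blast

lemma has_in_nbr: "x \<in> verts D \<Longrightarrow> \<exists>y. (y, x) \<in> arcs D"
  using rv.has_out_nbr[of x] by auto

text \<open>The induction hypothesis is applied not to \<open>C\<close> but to a cut
  \<open>C'\<close> between \<open>y\<close> and the next vertex \<open>z\<close>. It contains
  \<open>w\<close> and omits \<open>x\<close>, so if \<open>w\<close> were outside \<open>C\<close>,
  then \<open>z\<close>, \<open>y\<close>, \<open>w\<close>, \<open>x\<close> would fill the corners
  of \<open>C\<close> and \<open>C'\<close>.\<close>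

lemma forward:
  assumes "(y, w) \<in> (arcs D)\<^sup>*" "(x, y) \<in> arcs D" "C \<in> E" "x \<notin> C" "y \<in> C"
  shows "w \<in> C"
  using assms
proof (induction arbitrary: x C rule: converse_rtrancl_induct)
  case (step y z)
  have zC: "z \<in> C" using no_turn[OF step.prems(1) step.hyps(1) step.prems(2)] step.prems by simp
  obtain C' where C': "C' \<in> E" "y \<notin> C'" "z \<in> C'" using arc_separated[OF step.hyps(1)] by (auto simp: sep_iff)
  have "x \<notin> C'" using no_turn'[OF step.prems(1) step.hyps(1) C'(1,2)] C'(3) by simp
  moreover have "w \<in> C'" using step.IH[OF step.hyps(1) C'] .
  moreover have "x \<in> verts D" using arc_verts step.prems by blast
  ultimately show ?case using E_nested[OF step.prems(2) C'(1) zC C'(3) step.prems(4) C'(2), of w x] step.prems(3) by blast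
qed

end

section \<open>Counting cuts along directed paths\<close>

context cut_homogeneous
begin

interpretation rv: cut_homogeneous "rev_dg D" E by (rule rev_cut_homogeneous)

lemma acyclic: "(x, y) \<in> arcs D \<Longrightarrow> (y, x) \<notin> (arcs D)\<^sup>*"
  using arc_separated forward by (metis sep_iff)

text \<open>By arc-transitivity every arc is crossed by equally many cuts, so the choice of the arc
  is immaterial.\<close>

definition cut_dist :: nat where
  "cut_dist = card (sep (fst (SOME e. e \<in> arcs D)) (snd (SOME e. e \<in> arcs D)))"

lemma card_sep_arc: assumes "(x, y) \<in> arcs D" shows "card (sep x y) = cut_dist"
proof -
  let ?e = "SOME e. e \<in> arcs D"
  have "?e \<in> arcs D" using assms by (rule someI)
  then have e: "(fst ?e, snd ?e) \<in> arcs D" by simp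
  then obtain g where g: "automorphism g D" "g (fst ?e) = x" "g (snd ?e) = y" using arc_transitive assms by blast
  then show ?thesis using card_cutset_aut[OF g(1), of "{snd ?e}" "{fst ?e}"] arc_verts[OF e]
    by (simp add: sep_def cut_dist_def)
qed

lemma cut_dist_pos: assumes "(x, y) \<in> arcs D" shows "cut_dist > 0"
  using arc_separated[OF assms] finite_sep[of x y] arc_verts[OF assms] card_sep_arc[OF assms]
  by (metis card_gt_0_iff ex_in_conv)

text \<open>Since no cut is crossed twice, the cuts between the ends of a directed path are
  distributed among its arcs.\<close>

lemma sep_split:
  assumes xy: "(x, y) \<in> arcs D" and yz: "(y, z) \<in> (arcs D)\<^sup>*"
  shows "sep x z = sep x y \<union> sep y z" "sep x y \<inter> sep y z = {}"
proof -
  show "sep x y \<inter> sep y z = {}" by (auto simp: sep_iff)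
  have "x \<notin> C" if "C \<in> sep y z" for C
  proof
    assume "x \<in> C"
    have C: "C \<in> E" "y \<notin> C" "z \<in> C" using that by (auto simp: sep_iff)
    have "z \<in> verts D - C"
      by (rule forward[OF yz xy E_compl[OF C(1)]]) (use \<open>x \<in> C\<close> C arc_verts[OF xy] in auto)
    then show False using C by simp
  qed
  then show "sep x z = sep x y \<union> sep y z"
    using forward[OF yz xy] by (auto simp: sep_iff)
qed

lemma desc_verts: "(x, y) \<in> (arcs D)\<^sup>* \<Longrightarrow> x \<in> verts D \<Longrightarrow> y \<in> verts D"
  by (induction rule: rtrancl_induct) (auto dest: arc_verts)

lemma anc_verts: "(x, y) \<in> (arcs D)\<^sup>* \<Longrightarrow> y \<in> verts D \<Longrightarrow> x \<in> verts D"
  by (induction rule: converse_rtrancl_induct) (auto dest: arc_verts)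

text \<open>This turns the number of separating cuts into a length: directed paths with the same
  ends have equally many arcs.\<close>

lemma card_sep_relpow:
  assumes "(x, z) \<in> arcs D ^^ n" "x \<in> verts D" shows "card (sep x z) = n * cut_dist"
  using assms
proof (induction n arbitrary: x)
  case 0
  then show ?case by (auto simp: sep_def cutset_def)
next
  case (Suc n)
  then obtain y where y: "(x, y) \<in> arcs D" "(y, z) \<in> arcs D ^^ n" by (metis relpow_Suc_D2)
  have yz: "(y, z) \<in> (arcs D)\<^sup>*" by (rule relpow_imp_rtrancl[OF y(2)])
  have V: "y \<in> verts D" "z \<in> verts D" using arc_verts y desc_verts[OF yz] by auto
  show ?case
    using sep_split[OF y(1) yz] card_sep_arc[OF y(1)] Suc.IH[OF y(2) V(1)]
    by (simp add: card_Un_disjoint finite_sep V Suc.prems)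
qed

text \<open>A chord would be a directed path of length one with the same ends as one of length at
  least two.\<close>

lemma no_chord:
  assumes "(x, y) \<in> arcs D" "(y, z) \<in> arcs D" "(z, w) \<in> (arcs D)\<^sup>*" shows "(x, w) \<notin> arcs D"
proof
  assume xw: "(x, w) \<in> arcs D"
  obtain n where n: "(z, w) \<in> arcs D ^^ n" using assms(3) rtrancl_imp_relpow by metis
  have "(x, w) \<in> arcs D ^^ (Suc (Suc n))" using assms n by (metis relpow_Suc_I2)
  then have "card (sep x w) = Suc (Suc n) * cut_dist" using card_sep_relpow arc_verts(1)[OF xw] by blast
  then show False using card_sep_arc[OF xw] cut_dist_pos[OF xw] by simp
qed

lemma k_arc_reach:
  assumes "is_k_arc D k xs" "i \<le> j" "j \<le> k" shows "(xs ! i, xs ! j) \<in> (arcs D)\<^sup>*"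
  using assms(2,3)
proof (induction j rule: dec_induct)
  case (step n)
  then have "(xs ! n, xs ! Suc n) \<in> arcs D" using assms(1) by (simp add: is_k_arc_def)
  with step show ?case by (meson Suc_leD rtrancl.rtrancl_into_rtrancl)
qed simp

lemma k_arc_induced:
  assumes xs: "is_k_arc D k xs" and ij: "i \<le> k" "j \<le> k"
  shows "(xs ! i, xs ! j) \<in> arcs D \<longleftrightarrow> j = Suc i" "xs ! i = xs ! j \<longleftrightarrow> i = j"
proof -
  have arc: "(xs ! i, xs ! Suc i) \<in> arcs D" if "i < k" for i using xs that by (simp add: is_k_arc_def)
  have lt: "xs ! i \<noteq> xs ! j" if "i < j" "j \<le> k" for i j
    using acyclic[OF arc[of i]] k_arc_reach[OF xs, of "Suc i" j] that by auto
  then show "xs ! i = xs ! j \<longleftrightarrow> i = j" using ij by (metis nat_neq_iff)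
  have "(xs ! i, xs ! j) \<notin> arcs D" if "j \<le> i"
    using k_arc_reach[OF xs that] ij acyclic by blast
  moreover have "(xs ! i, xs ! j) \<notin> arcs D" if "Suc (Suc i) \<le> j"
    using no_chord[OF arc[of i] arc[of "Suc i"] k_arc_reach[OF xs that]] ij that by simp
  ultimately show "(xs ! i, xs ! j) \<in> arcs D \<longleftrightarrow> j = Suc i"
    using arc[of i] ij by (metis Suc_le_eq le_less_Suc_eq not_less_eq_eq not_less)
qed

text \<open>Directed paths are induced, so matching two k-arcs vertex by vertex is an isomorphism
  between connected induced subdigraphs.\<close>

theorem cut_highly_arc_transitive: "highly_arc_transitive D"
  unfolding highly_arc_transitive_def
proof (intro allI impI)
  fix k xs ys assume "is_k_arc D k xs \<and> is_k_arc D k ys"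
  then have xs: "is_k_arc D k xs" and ys: "is_k_arc D k ys" by auto
  have len: "length xs = Suc k" "length ys = Suc k" using xs ys by (auto simp: is_k_arc_def)
  show "\<exists>g. automorphism g D \<and> map g xs = ys"
  proof (rule homogeneous_list[OF hom])
    show "distinct xs" "distinct ys"
      using k_arc_induced(2)[OF xs] k_arc_induced(2)[OF ys] len
      by (auto simp: distinct_conv_nth less_Suc_eq_le)
    show "set xs \<subseteq> verts D" "set ys \<subseteq> verts D" using xs ys by (auto simp: is_k_arc_def)
    show "xs \<noteq> []" "length ys = length xs" using len by auto
    fix i assume i: "0 < i" "i < length xs"
    then have "(xs ! (i - 1), xs ! i) \<in> arcs D" using k_arc_induced(1)[OF xs, of "i - 1" i] len by simp
    then show "\<exists>j<i. uadj D (xs ! j) (xs ! i)" using i by (intro exI[of _ "i - 1"]) (simp add: uadj_def)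
  next
    fix i j assume "i < length xs" "j < length xs"
    then show "(xs ! i, xs ! j) \<in> arcs D \<longleftrightarrow> (ys ! i, ys ! j) \<in> arcs D"
      using k_arc_induced(1)[OF xs] k_arc_induced(1)[OF ys] len by (simp add: less_Suc_eq_le)
  qed
qed

end

section \<open>Reachability classes are bipartite and induced\<close>

context cut_homogeneous
begin

definition out_cuts :: "'a \<Rightarrow> 'a set set" where
  "out_cuts x = cutset (out_nbrs D x) {x}"

definition in_cuts :: "'a \<Rightarrow> 'a set set" where
  "in_cuts y = cutset {y} (in_nbrs D y)"

lemma out_nbrs_verts: "out_nbrs D x \<subseteq> verts D" and in_nbrs_verts: "in_nbrs D x \<subseteq> verts D"
  using arc_verts by (auto simp: out_nbrs_def in_nbrs_def)

lemma out_cuts_sep: "(x, y) \<in> arcs D \<Longrightarrow> out_cuts x \<subseteq> sep x y"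
  by (auto simp: out_cuts_def cutset_def sep_iff out_nbrs_def)

lemma in_cuts_sep: "(x, y) \<in> arcs D \<Longrightarrow> in_cuts y \<subseteq> sep x y"
  by (auto simp: in_cuts_def cutset_def sep_iff in_nbrs_def)

text \<open>If \<open>C\<close> contained \<open>y\<close> and \<open>y'\<close> but omitted an
  out-neighbour \<open>z\<close>, then an automorphism fixing \<open>x\<close> and \<open>y\<close>
  and sending \<open>y'\<close> to \<open>z\<close> would lead to a cut containing \<open>y\<close>
  and \<open>z\<close> but not \<open>y'\<close>, and the two cuts would cross.\<close>

lemma out_cuts_common:
  assumes y: "(x, y) \<in> arcs D" "(x, y') \<in> arcs D" "y \<noteq> y'" and C: "C \<in> E" "x \<notin> C" "y \<in> C" "y' \<in> C"
  shows "C \<in> out_cuts x"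
proof (rule ccontr)
  assume "C \<notin> out_cuts x"
  then obtain z where z: "(x, z) \<in> arcs D" "z \<notin> C" using C by (auto simp: out_cuts_def cutset_def out_nbrs_def)
  then have "z \<noteq> y" using C by auto
  obtain g where g: "automorphism g D" "g y = y" "g x = x" "g y' = z"
    using homogeneous_3[of x y y' x y z] y z \<open>z \<noteq> y\<close> by (auto simp: uadj_def)
  have V: "{y, y'} \<subseteq> verts D" "{y, z} \<subseteq> verts D" "{x} \<subseteq> verts D" using y z arc_verts by blast+
  have "card (cutset {y, y'} {x}) = card (cutset {y, z} {x})"
    using card_cutset_aut[OF g(1) V(1,3)] g by simp
  moreover have "C \<in> cutset {y, y'} {x}" "C \<notin> cutset {y, z} {x}" using C z by (auto simp: cutset_def)
  ultimately obtain C' where C': "C' \<in> cutset {y, z} {x}" "C' \<notin> cutset {y, y'} {x}"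
    using card_exchange[OF finite_cutset finite_cutset] V by (metis insert_not_empty)
  then have "C' \<in> E" "y \<in> C'" "x \<notin> C'" "z \<in> C'" "y' \<notin> C'" by (auto simp: cutset_def)
  then show False using E_nested[OF C(1), of C' y y' z x] C z V by auto
qed

lemma card_out_cuts:
  assumes "x \<in> verts D" "x' \<in> verts D" shows "card (out_cuts x) = card (out_cuts x')"
proof -
  obtain g where g: "automorphism g D" "g x = x'" using vertex_transitive assms by blast
  have "g ` out_nbrs D x = out_nbrs D x'"
  proof (intro set_eqI iffI)
    fix w assume "w \<in> g ` out_nbrs D x"
    then show "w \<in> out_nbrs D x'" using g assms automorphism_arcs[OF g(1)] arc_verts by (auto simp: out_nbrs_def)
  next
    fix w assume w: "w \<in> out_nbrs D x'"
    then have "w \<in> verts D" using out_nbrs_verts by blast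
    then obtain v where v: "v \<in> verts D" "w = g v"
      using automorphism_bij[OF g(1)] by (auto simp: bij_betw_def)
    then show "w \<in> g ` out_nbrs D x" using w g assms automorphism_arcs[OF g(1)] by (auto simp: out_nbrs_def)
  qed
  then show ?thesis using card_cutset_aut[OF g(1) out_nbrs_verts, of "{x}" x] assms g by (simp add: out_cuts_def)
qed

text \<open>When this fails, \<open>out_cuts_common\<close> and its dual yield a cut that singles
  out one arc among all edges at its ends. When it holds, each cut crossed by an arc is governed by
  the source or by the target alone.\<close>

definition fat :: bool where
  "fat \<longleftrightarrow> (\<forall>x y. (x, y) \<in> arcs D \<longrightarrow> sep x y \<subseteq> out_cuts x \<union> in_cuts y)"

text \<open>In a structure tree for \<open>E\<close>, all arcs of a reachability class pass through a common point
  when \<open>fat\<close> holds; \<open>centre x\<close> is the orientation of \<open>E\<close> towards that point for arcs starting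
  at \<open>x\<close>.\<close>

definition centre :: "'a \<Rightarrow> 'a set set" where
  "centre x = {C \<in> E. x \<in> C \<and> verts D - C \<notin> out_cuts x} \<union> out_cuts x"

text \<open>Under \<open>fat\<close> the set \<open>in_cuts y - out_cuts x\<close> equals
  \<open>sep x y - out_cuts x\<close>, so its size is the same for all in-neighbours of
  \<open>y\<close>. The cut \<open>C\<close> is therefore matched by a cut \<open>C'\<close> with
  the roles of \<open>x\<close> and \<open>x'\<close> exchanged.\<close>

lemma fat_key:
  assumes fat and xy: "(x, y) \<in> arcs D" "(x', y) \<in> arcs D"
    and C: "C \<in> in_cuts y" "C \<in> out_cuts x" "C \<notin> out_cuts x'"
  shows False
proof -
  have V: "x \<in> verts D" "x' \<in> verts D" "y \<in> verts D" using xy arc_verts by auto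
  have diff: "in_cuts y - out_cuts x = sep x y - out_cuts x" if "(x, y) \<in> arcs D" for x
    using in_cuts_sep[OF that] \<open>fat\<close> that by (auto simp: fat_def)
  have card: "card (in_cuts y - out_cuts x) = cut_dist - card (out_cuts x)" if "(x, y) \<in> arcs D" for x
    using diff[OF that] out_cuts_sep[OF that] card_sep_arc[OF that] finite_sep arc_verts[OF that]
    by (simp add: card_Diff_subset finite_subset)
  have fin: "finite (in_cuts y - out_cuts x)" if "(x, y) \<in> arcs D" for x
    using diff[OF that] finite_sep arc_verts[OF that] by simp
  have "C \<in> in_cuts y - out_cuts x'" "C \<notin> in_cuts y - out_cuts x" using C by auto
  then obtain C' where "C' \<in> in_cuts y - out_cuts x" "C' \<notin> in_cuts y - out_cuts x'"
    using card_exchange[OF fin[OF xy(2)] fin[OF xy(1)]] card[OF xy(1)] card[OF xy(2)] card_out_cuts[OF V(1,2)] by auto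
  then have C': "C' \<in> in_cuts y" "C' \<notin> out_cuts x" "C' \<in> out_cuts x'" by auto
  have E: "C \<in> E" "C' \<in> E" using C C' by (auto simp: in_cuts_def cutset_def)
  have y: "y \<in> C" "y \<in> C'" "x \<notin> C" "x \<notin> C'" "x' \<notin> C" "x' \<notin> C'"
    using C C' xy by (auto simp: in_cuts_def cutset_def in_nbrs_def)
  \<comment> \<open>\<open>C\<close> misses an out-neighbour \<open>y1\<close> of \<open>x'\<close>,
    and \<open>C'\<close> misses an out-neighbour \<open>y2\<close> of \<open>x\<close>; together
    with \<open>y\<close> and \<open>x\<close> they fill the four corners.\<close>
  obtain y1 where y1: "(x', y1) \<in> arcs D" "y1 \<notin> C" "y1 \<in> C'"
    using C(3) C'(3) E y by (auto simp: out_cuts_def cutset_def out_nbrs_def)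
  obtain y2 where y2: "(x, y2) \<in> arcs D" "y2 \<notin> C'" "y2 \<in> C"
    using C(2) C'(2) E y by (auto simp: out_cuts_def cutset_def out_nbrs_def)
  show False using E_nested[OF E y(1,2) y2(3,2) y1(2,3), of x] y V by blast
qed

lemma out_cuts_target: "C \<in> out_cuts x \<Longrightarrow> (x, y) \<in> arcs D \<Longrightarrow> C \<in> E \<and> x \<notin> C \<and> y \<in> C"
  by (auto simp: out_cuts_def cutset_def out_nbrs_def)

text \<open>The two orientations could differ only on a cut crossed by one of the arcs;
  \<open>fat\<close> then places this cut in \<open>in_cuts y\<close>, where \<open>fat_key\<close>
  applies. If \<open>y\<close> lies outside, the complement is used.\<close>

lemma centre_sub:
  assumes fat and xy: "(x, y) \<in> arcs D" "(x', y) \<in> arcs D" and C: "C \<in> centre x"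
  shows "C \<in> centre x'"
proof (rule ccontr)
  assume n: "C \<notin> centre x'"
  have E: "C \<in> E" using C by (auto simp: centre_def out_cuts_def cutset_def)
  have V: "x \<in> verts D" "x' \<in> verts D" "y \<in> verts D" using xy arc_verts by auto
  have CV: "C \<subseteq> verts D" by (rule E_sub[OF E])
  show False
  proof (cases "y \<in> C")
    case True
    then have "verts D - C \<notin> out_cuts x'" using out_cuts_target[OF _ xy(2)] by blast
    then have x': "x' \<notin> C" "C \<notin> out_cuts x'" using n E by (auto simp: centre_def)
    have "sep x' y \<subseteq> out_cuts x' \<union> in_cuts y" using \<open>fat\<close> xy(2) unfolding fat_def by blast
    moreover have "C \<in> sep x' y" using E x' True by (simp add: sep_iff)
    ultimately have I: "C \<in> in_cuts y" using x' by blast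
    then have "x \<notin> C" using xy(1) by (auto simp: in_cuts_def cutset_def in_nbrs_def)
    then have "C \<in> out_cuts x" using C by (auto simp: centre_def)
    then show False using fat_key[OF \<open>fat\<close> xy I] x' by blast
  next
    case False
    then have "C \<notin> out_cuts x" using out_cuts_target[OF _ xy(1)] by blast
    then have x: "x \<in> C" "verts D - C \<notin> out_cuts x" using C by (auto simp: centre_def)
    then have "verts D - C \<in> sep x y" using False E V E_compl by (auto simp: sep_iff)
    then have I: "verts D - C \<in> in_cuts y" using \<open>fat\<close> xy(1) x by (auto simp: fat_def)
    then have "x' \<in> C" using xy(2) V by (auto simp: in_cuts_def cutset_def in_nbrs_def)
    then have "verts D - C \<in> out_cuts x'" using n E by (auto simp: centre_def)
    then show False using fat_key[OF \<open>fat\<close> xy(2,1) I] x by blast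
  qed
qed

lemma centre_share:
  assumes fat "(e, e') \<in> (share D)\<^sup>*" shows "centre (fst e) = centre (fst e')"
  using assms(2)
proof (induction rule: rtrancl_induct)
  case (step f f')
  have "centre (fst f) = centre (fst f')"
  proof (cases "fst f = fst f'")
    case False
    then have "(fst f, snd f) \<in> arcs D" "(fst f', snd f) \<in> arcs D" using step.hyps(2) by (auto simp: share_def) (metis prod.collapse)+
    then show ?thesis using centre_sub[OF \<open>fat\<close>] by blast
  qed simp
  then show ?case using step by simp
qed simp

text \<open>In one class the centres at \<open>x\<close> and \<open>y\<close> agree. Every cut
  crossed by \<open>(x, y)\<close> contains \<open>z\<close>, hence belongs to the centre and to
  \<open>out_cuts x\<close>, so \<open>out_cuts\<close> has the full size \<open>cut_dist\<close>. A
  cut in \<open>out_cuts y\<close> then belongs to the centre with \<open>x\<close> and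
  \<open>y\<close> outside, which is impossible for a member of \<open>out_cuts x\<close>.\<close>

lemma fat_bipartite:
  assumes fat and xyz: "(x, y) \<in> arcs D" "(y, z) \<in> arcs D"
  shows "((x, y), (y, z)) \<notin> (share D)\<^sup>*"
proof
  assume "((x, y), (y, z)) \<in> (share D)\<^sup>*"
  from centre_share[OF \<open>fat\<close> this] have eq: "centre x = centre y" by simp
  have "sep x y \<subseteq> out_cuts x"
  proof
    fix C assume "C \<in> sep x y"
    then have C: "C \<in> E" "x \<notin> C" "y \<in> C" by (auto simp: sep_iff)
    then have "z \<in> C" using no_turn[OF xyz] by blast
    then have "verts D - C \<notin> out_cuts y" using out_cuts_target[OF _ xyz(2)] by blast
    then have "C \<in> centre y" using C by (simp add: centre_def)
    then show "C \<in> out_cuts x" using eq C by (auto simp: centre_def)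
  qed
  then have "card (out_cuts x) = cut_dist"
    using out_cuts_sep[OF xyz(1)] card_sep_arc[OF xyz(1)] by (metis subset_antisym)
  then have "card (out_cuts y) = cut_dist" using card_out_cuts arc_verts[OF xyz(1)] by metis
  then have "out_cuts y \<noteq> {}" using cut_dist_pos[OF xyz(1)] by auto
  then obtain C where C: "C \<in> out_cuts y" by blast
  then have C': "C \<in> E" "y \<notin> C" "z \<in> C" using out_cuts_target[OF C xyz(2)] by auto
  then have "x \<notin> C" using no_turn'[OF xyz] by blast
  moreover have "C \<in> centre x" using C eq by (simp add: centre_def)
  ultimately have "C \<in> out_cuts x" by (auto simp: centre_def)
  then show False using out_cuts_target[OF _ xyz(1)] C' by blast
qed

text \<open>An arc from the sink \<open>y\<close> to the source \<open>x'\<close> would make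
  \<open>x\<close>, \<open>y\<close>, \<open>x'\<close> a 2-arc, whose ends are separated by
  \<open>2 * cut_dist\<close> cuts. These are accounted for by \<open>out_cuts x\<close> and
  \<open>out_cuts x'\<close>, so both are full. The sinks \<open>y\<close> and \<open>y'\<close>
  then both sit at the centre, although \<open>y\<close>, \<open>x'\<close>, \<open>y'\<close> is a
  2-arc as well.\<close>

lemma fat_induced:
  assumes fat and s: "((x, y), (x', y')) \<in> (share D)\<^sup>*" and xy: "(x, y) \<in> arcs D"
  shows "(y, x') \<notin> arcs D"
proof
  assume yx': "(y, x') \<in> arcs D"
  have x'y': "(x', y') \<in> arcs D" using share_rtrancl_arcs[OF s] xy by simp
  have V: "x \<in> verts D" "y \<in> verts D" "x' \<in> verts D" "y' \<in> verts D" using xy x'y' arc_verts by auto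
  from centre_share[OF \<open>fat\<close> s] have eq: "centre x = centre x'" by simp
  have two: "card (sep u w) = 2 * cut_dist" if "(u, v) \<in> arcs D" "(v, w) \<in> arcs D" for u v w
    using card_sep_relpow[of u w 2] that arc_verts(1)[OF that(1)] by (auto simp: numeral_2_eq_2)
  have "sep x x' \<subseteq> out_cuts x \<union> (\<lambda>C. verts D - C) ` out_cuts x'"
  proof
    fix C assume "C \<in> sep x x'"
    then have C: "C \<in> E" "x \<notin> C" "x' \<in> C" by (auto simp: sep_iff)
    show "C \<in> out_cuts x \<union> (\<lambda>C. verts D - C) ` out_cuts x'"
    proof (cases "C \<in> centre x")
      case True
      then show ?thesis using C by (auto simp: centre_def)
    next
      case False
      then have "verts D - C \<in> out_cuts x'" using eq C by (auto simp: centre_def)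
      moreover have "C = verts D - (verts D - C)" using E_sub[OF C(1)] by blast
      ultimately show ?thesis by blast
    qed
  qed
  moreover have fin: "finite (out_cuts x)" "finite (out_cuts x')"
    using out_cuts_sep[OF xy] out_cuts_sep[OF x'y'] finite_sep V by (meson finite_subset)+
  ultimately have "card (sep x x') \<le> card (out_cuts x) + card (out_cuts x')"
    by (meson card_Un_le card_image_le card_mono finite_UnI finite_imageI le_trans add_le_mono1 add_left_mono)
  then have "cut_dist \<le> card (out_cuts x)" "cut_dist \<le> card (out_cuts x')"
    using two[OF xy yx'] card_out_cuts[OF V(1,3)] by auto
  then have full: "out_cuts x = sep x y" "out_cuts x' = sep x' y'"
    using card_seteq[OF finite_sep out_cuts_sep[OF xy]] card_seteq[OF finite_sep out_cuts_sep[OF x'y']]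
      card_sep_arc xy x'y' V by auto
  \<comment> \<open>With \<open>out_cuts\<close> full, no cut lies between a sink and the
    centre.\<close>
  have "sep y y' = {}"
  proof (rule ccontr)
    assume "sep y y' \<noteq> {}"
    then obtain C where C: "C \<in> E" "y \<notin> C" "y' \<in> C" by (auto simp: sep_iff)
    show False
    proof (cases "C \<in> centre x")
      case True
      moreover have "C \<notin> out_cuts x" using out_cuts_target[OF _ xy] C by blast
      ultimately have "x \<in> C" "verts D - C \<notin> out_cuts x" by (auto simp: centre_def)
      then show False using full C V E_compl by (auto simp: sep_iff)
    next
      case False
      then have n: "C \<notin> centre x'" using eq by simp
      have "verts D - C \<notin> out_cuts x'" using out_cuts_target[OF _ x'y'] C by blast
      then have "x' \<notin> C" using n C by (auto simp: centre_def)
      then show False using n full C by (auto simp: sep_iff centre_def)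
    qed
  qed
  then show False using two[OF yx' x'y'] cut_dist_pos[OF xy] by simp
qed

text \<open>If \<open>fat\<close> fails, each edge is crossed by a cut that no other edge at its ends crosses.\<close>

definition isolates :: "'a \<Rightarrow> 'a \<Rightarrow> 'a set \<Rightarrow> bool" where
  "isolates x y C \<longleftrightarrow> C \<in> E \<and> x \<notin> C \<and> y \<in> C \<and> (\<forall>w. uadj D x w \<and> w \<noteq> y \<longrightarrow> w \<notin> C) \<and> (\<forall>w. uadj D y w \<and> w \<noteq> x \<longrightarrow> w \<in> C)"

lemma isolates_compl: 
  assumes "isolates x y C" "uadj D x y" shows "isolates y x (verts D - C)"
proof -
  have "x \<in> verts D" "y \<in> verts D" using uadj_in_verts[OF wf assms(2)] by auto
  then show ?thesis using assms E_compl uadj_in_verts[OF wf] unfolding isolates_def by blast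
qed

end

section \<open>The case in which every edge is a bridge; bipartiteness of classes\<close>

context cut_homogeneous
begin

interpretation rv: cut_homogeneous "rev_dg D" E by (rule rev_cut_homogeneous)

lemma in_cuts_common:
  assumes x: "(x, y) \<in> arcs D" "(x', y) \<in> arcs D" "x \<noteq> x'" and C: "C \<in> E" "x \<notin> C" "x' \<notin> C" "y \<in> C"
  shows "C \<in> in_cuts y"
proof -
  have V: "x \<in> verts D" "x' \<in> verts D" "y \<in> verts D" using x arc_verts by auto
  have "verts D - C \<in> rv.out_cuts y"
    by (rule rv.out_cuts_common[of y x x']) (use x C V E_compl in auto)
  then have "verts D - C \<in> cutset (in_nbrs D y) {y}"
    by (auto simp: rv.out_cuts_def rv.cutset_def cutset_def out_nbrs_def in_nbrs_def)
  then show ?thesis using cutset_compl[of C] E_sub[OF C(1)] in_nbrs_verts V by (auto simp: in_cuts_def)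
qed

text \<open>A cut outside \<open>out_cuts x\<close> and \<open>in_cuts y\<close> contains no second
  out-neighbour of \<open>x\<close> and omits no second in-neighbour of \<open>y\<close>. The other
  neighbours are settled by \<open>no_turn\<close> and \<open>no_turn'\<close>.\<close>

lemma thin_isolates_arc:
  assumes "\<not> fat" shows "\<exists>x y C. (x, y) \<in> arcs D \<and> isolates x y C"
proof -
  obtain x y C where C: "(x, y) \<in> arcs D" "C \<in> sep x y" "C \<notin> out_cuts x" "C \<notin> in_cuts y"
    using assms by (auto simp: fat_def)
  then have C': "C \<in> E" "x \<notin> C" "y \<in> C" by (auto simp: sep_iff)
  have "w \<notin> C" if "uadj D x w" "w \<noteq> y" for w
    using that(1) unfolding uadj_def
  proof
    assume "(x, w) \<in> arcs D"
    then show ?thesis using out_cuts_common[OF C(1) _ _ C'] C(3) that(2) by blast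
  next
    assume "(w, x) \<in> arcs D"
    then show ?thesis using no_turn'[OF _ C(1) C'(1,2)] C' by blast
  qed
  moreover have "w \<in> C" if "uadj D y w" "w \<noteq> x" for w
    using that(1) unfolding uadj_def
  proof
    assume "(y, w) \<in> arcs D"
    then show ?thesis using no_turn[OF C(1) _ C'(1,3)] C' by blast
  next
    assume "(w, y) \<in> arcs D"
    then show ?thesis using in_cuts_common[OF C(1), of w C] C(4) C' that(2) by blast
  qed
  ultimately have "isolates x y C" using C' by (simp add: isolates_def)
  then show ?thesis using C(1) by blast
qed

lemma isolates_aut:
  assumes g: "automorphism g D" and p: "isolates x y C" and V: "x \<in> verts D" "y \<in> verts D"
  shows "isolates (g x) (g y) (g ` C)"
proof -
  have inj: "inj_on g (verts D)" and im: "g ` verts D = verts D"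
    using automorphism_bij[OF g] by (auto simp: bij_betw_def)
  have CV: "C \<subseteq> verts D" using p E_sub by (simp add: isolates_def)
  have mem: "g w \<in> g ` C \<longleftrightarrow> w \<in> C" if "w \<in> verts D" for w
    using inj_on_image_mem_iff[OF inj that CV] .
  have nb: "\<exists>v. w = g v \<and> v \<in> verts D \<and> uadj D u v" if "uadj D (g u) w" "u \<in> verts D" for u w
  proof -
    have "w \<in> g ` verts D" using that uadj_in_verts[OF wf] im by blast
    then show ?thesis using automorphism_uadj[OF g] that by blast
  qed
  show ?thesis
    unfolding isolates_def
  proof (intro conjI allI impI)
    show "g ` C \<in> E" using E_aut[OF g] p by (simp add: isolates_def)
    show "g x \<notin> g ` C" "g y \<in> g ` C" using mem V p by (auto simp: isolates_def)
  next
    fix w assume w: "uadj D (g x) w \<and> w \<noteq> g y"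
    then obtain v where "w = g v" "v \<in> verts D" "uadj D x v" using nb V by blast
    then show "w \<notin> g ` C" using mem w p by (auto simp: isolates_def)
  next
    fix w assume w: "uadj D (g y) w \<and> w \<noteq> g x"
    then obtain v where "w = g v" "v \<in> verts D" "uadj D y v" using nb V by blast
    then show "w \<in> g ` C" using mem w p by (auto simp: isolates_def)
  qed
qed

lemma thin_isolates:
  assumes thin: "\<not> fat" and uv: "uadj D u v" shows "\<exists>C. isolates u v C"
proof -
  obtain x y C where C: "(x, y) \<in> arcs D" "isolates x y C" using thin_isolates_arc[OF thin] by blast
  have V: "x \<in> verts D" "y \<in> verts D" using C arc_verts by auto
  have *: "\<exists>C. isolates a b C" if ab: "(a, b) \<in> arcs D" for a b
  proof -
    obtain g where "automorphism g D" "g x = a" "g y = b" using arc_transitive[OF C(1) ab] by blast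
    then show ?thesis using isolates_aut[OF _ C(2) V] by blast
  qed
  show ?thesis using uv * isolates_compl[of v u] unfolding uadj_def by blast
qed

text \<open>Isolating cuts of consecutive edges are decreasing along a walk without backtracking, so
  the walk never returns. If its end left \<open>C\<close>, it would fill the missing corner of
  \<open>C\<close> and the cut \<open>C'\<close> of the next edge.\<close>

lemma reduced_walk_isolates:
  assumes thin: "\<not> fat"
  shows "successively (uadj D) (u # v # ws) \<Longrightarrow> (\<forall>i. Suc (Suc i) < length (u # v # ws) \<longrightarrow> (u # v # ws) ! i \<noteq> (u # v # ws) ! Suc (Suc i))
    \<Longrightarrow> isolates u v C \<Longrightarrow> last (v # ws) \<in> C"
proof (induction ws arbitrary: u v C)
  case Nil
  then show ?case by (simp add: isolates_def)
next
  case (Cons w ws)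
  have adj: "uadj D u v" "uadj D v w" using Cons.prems by auto
  have "u \<noteq> w" using Cons.prems(2)[rule_format, of 0] by simp
  obtain C' where C': "isolates v w C'" using thin_isolates[OF thin adj(2)] by blast
  have "last (w # ws) \<in> C'"
  proof (rule Cons.IH[OF _ _ C'])
    show "successively (uadj D) (v # w # ws)" using Cons.prems(1) by simp
    show "\<forall>i. Suc (Suc i) < length (v # w # ws) \<longrightarrow> (v # w # ws) ! i \<noteq> (v # w # ws) ! Suc (Suc i)"
      using Cons.prems(2) by (metis Suc_less_eq length_Cons nth_Cons_Suc)
  qed
  moreover have "w \<in> C" "u \<notin> C'" "v \<in> C" "u \<notin> C" "C \<in> E"
    using Cons.prems(3) C' adj \<open>u \<noteq> w\<close> by (auto simp: isolates_def uadj_commute)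
  moreover have "C' \<in> E" "w \<in> C'" "v \<notin> C'" using C' by (auto simp: isolates_def)
  moreover have "u \<in> verts D" using uadj_in_verts[OF wf adj(1)] by simp
  ultimately show ?case using E_nested[of C C' w v "last (w # ws)" u] by (metis last_ConsR list.distinct(1))
qed

text \<open>Once around a cycle back to its start is a walk without backtracking, yet it ends
  outside the cut that isolates its first edge.\<close>

lemma thin_acyclic:
  assumes thin: "\<not> fat" shows "uacyclic D"
  unfolding uacyclic_def
proof
  assume "\<exists>xs. length xs \<ge> 3 \<and> distinct xs \<and> set xs \<subseteq> verts D
       \<and> (\<forall>i. Suc i < length xs \<longrightarrow> uadj D (xs ! i) (xs ! Suc i)) \<and> uadj D (last xs) (hd xs)"
  then obtain xs where xs: "length xs \<ge> 3" "distinct xs" "\<forall>i. Suc i < length xs \<longrightarrow> uadj D (xs ! i) (xs ! Suc i)"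
    "uadj D (last xs) (hd xs)" by blast
  obtain u v ws where ws: "xs = u # v # ws" using xs(1) by (metis Suc_le_length_iff numeral_3_eq_3)
  have ne: "ws \<noteq> []" using xs(1) ws by auto
  have succ: "successively (uadj D) xs" using xs(3) by (simp add: successively_conv_nth)
  obtain C where C: "isolates u v C" using thin_isolates[OF thin, of u v] succ ws by auto
  have "last (v # (ws @ [u])) \<in> C"
  proof (rule reduced_walk_isolates[OF thin _ _ C])
    have "successively (uadj D) (xs @ [u])"
      unfolding successively_append_iff using succ xs(4) ws by simp
    then show "successively (uadj D) (u # v # ws @ [u])" using ws by simp
    show "\<forall>i. Suc (Suc i) < length (u # v # ws @ [u]) \<longrightarrow> (u # v # ws @ [u]) ! i \<noteq> (u # v # ws @ [u]) ! Suc (Suc i)"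
    proof (intro allI impI)
      fix i assume i: "Suc (Suc i) < length (u # v # ws @ [u])"
      then have i': "i < length xs" "Suc (Suc i) \<le> length xs" using ws by auto
      show "(u # v # ws @ [u]) ! i \<noteq> (u # v # ws @ [u]) ! Suc (Suc i)"
      proof (cases "Suc (Suc i) = length xs")
        case False
        then have "Suc (Suc i) < length xs" using i' by simp
        then have "xs ! i \<noteq> xs ! Suc (Suc i)" using xs(2) by (simp add: nth_eq_iff_index_eq)
        moreover have "(xs @ [u]) ! i = xs ! i" "(xs @ [u]) ! Suc (Suc i) = xs ! Suc (Suc i)"
          using \<open>Suc (Suc i) < length xs\<close> by (simp_all add: nth_append)
        ultimately show ?thesis using ws by simp
      next
        case True
        then have "i \<noteq> 0" using xs(1) by auto
        then have "xs ! i \<noteq> xs ! 0" using nth_eq_iff_index_eq[OF xs(2) i'(1), of 0] xs(1) by fastforce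
        moreover have "(xs @ [u]) ! i = xs ! i" "(xs @ [u]) ! Suc (Suc i) = u"
          using True i' by (simp_all add: nth_append)
        ultimately show ?thesis using ws by simp
      qed
    qed
  qed
  then show False using C by (simp add: isolates_def)
qed

text \<open>A path from \<open>y\<close> to \<open>v\<close> inside \<open>C\<close>, preceded by
  \<open>x\<close> and continued to \<open>u\<close>, would be a walk without backtracking that ends
  outside \<open>C\<close>.\<close>

lemma isolates_bridge:
  assumes thin: "\<not> fat" and p: "isolates x y C" and xy: "uadj D x y"
    and uv: "uadj D u v" "u \<notin> C" "v \<in> C"
  shows "u = x \<and> v = y"
proof (cases "v = y")
  case True
  then show ?thesis using p uv by (auto simp: isolates_def uadj_commute)
next
  case False
  have C: "C \<in> E" "x \<notin> C" "y \<in> C" using p by (auto simp: isolates_def)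
  obtain ps where ps: "path_between (ugraph D) y v ps" "set ps \<subseteq> C"
    using connected_on_path[OF E_conn[OF C(1)] C(3) uv(3)] by blast
  then obtain w ws where ws: "ps = y # w # ws" using False
    by (cases ps; cases "tl ps") (auto simp: path_between_def)
  have d: "distinct ps" and succ: "successively (uadj D) ps" and l: "last ps = v"
    using ps by (auto simp: path_between_def ugraph_def)
  have "last (y # (w # ws @ [u])) \<in> C"
  proof (rule reduced_walk_isolates[OF thin _ _ p])
    have "successively (uadj D) (ps @ [u])"
      unfolding successively_append_iff using succ l uv by (simp add: uadj_commute)
    then show "successively (uadj D) (x # y # w # ws @ [u])" using ws xy by simp
    show "\<forall>i. Suc (Suc i) < length (x # y # w # ws @ [u]) \<longrightarrow>
        (x # y # w # ws @ [u]) ! i \<noteq> (x # y # w # ws @ [u]) ! Suc (Suc i)"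
    proof (intro allI impI)
      fix i assume i: "Suc (Suc i) < length (x # y # w # ws @ [u])"
      show "(x # y # w # ws @ [u]) ! i \<noteq> (x # y # w # ws @ [u]) ! Suc (Suc i)"
      proof (cases i)
        case 0
        then show ?thesis using C ps(2) ws by auto
      next
        case (Suc k)
        then have k: "Suc (Suc k) \<le> length ps" using i ws by simp
        have e: "(x # ps @ [u]) ! i = ps ! k" using Suc k by (simp add: nth_append)
        show ?thesis
        proof (cases "Suc (Suc k) = length ps")
          case False
          then have "Suc (Suc k) < length ps" using k by simp
          then have "ps ! k \<noteq> ps ! Suc (Suc k)" using d by (simp add: nth_eq_iff_index_eq)
          moreover have "(x # ps @ [u]) ! Suc (Suc i) = ps ! Suc (Suc k)"
            using \<open>Suc (Suc k) < length ps\<close> Suc by (simp add: nth_append)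
          ultimately show ?thesis using e ws by simp
        next
          case True
          then have "(x # ps @ [u]) ! Suc (Suc i) = u" using Suc by (simp add: nth_append)
          moreover have "ps ! k \<in> C" using k ps(2) by (meson Suc_le_lessD Suc_lessD nth_mem subsetD)
          ultimately show ?thesis using e ws uv by auto
        qed
      qed
    qed
  qed
  then show ?thesis using uv by simp
qed

lemma thin_bipartite:
  assumes thin: "\<not> fat" and xyz: "(x, y) \<in> arcs D" "(y, z) \<in> arcs D"
  shows "((x, y), (y, z)) \<notin> (share D)\<^sup>*"
proof
  \<comment> \<open>Invariant: an arc reachable from \<open>(x, y)\<close> points into
    \<open>y\<close> or lies behind the bridge to some in-neighbour \<open>x1\<close> of
    \<open>y\<close>. Arcs leaving \<open>y\<close> are of neither kind.\<close>
  define P where "P e \<longleftrightarrow> snd e = y \<or> (\<exists>x1 C. (x1, y) \<in> arcs D \<and> isolates y x1 C \<and> fst e \<in> C \<and> snd e \<in> C)" for e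
  assume "((x, y), (y, z)) \<in> (share D)\<^sup>*"
  then have "P (y, z)"
  proof (induction rule: rtrancl_induct)
    case base show ?case by (simp add: P_def)
  next
    case (step e e')
    obtain a b a' b' where ab: "e = (a, b)" "e' = (a', b')" by (cases e, cases e')
    have arcs: "(a, b) \<in> arcs D" "(a', b') \<in> arcs D" and eq: "a = a' \<or> b = b'"
      using step.hyps ab by (auto simp: share_def)
    show ?case
    proof (cases "b' = y")
      case False
      have inside: "P e'" if c: "(x1, y) \<in> arcs D" "isolates y x1 C" "a' \<in> C \<or> b' \<in> C" for x1 C
      proof -
        have "uadj D y x1" using c by (simp add: uadj_def)
        moreover have "uadj D a' b'" using arcs by (simp add: uadj_def)
        ultimately have "a' \<in> C \<and> b' \<in> C \<or> (a' = y \<and> b' = x1) \<or> (b' = y \<and> a' = x1)"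
          using isolates_bridge[OF thin c(2)] c(3) uadj_commute by metis
        moreover have "\<not> (a' = y \<and> b' = x1)" using arcs(2) c(1) arc_antisym by blast
        ultimately show ?thesis using False c ab unfolding P_def by auto
      qed
      show ?thesis
      proof (cases "b = y")
        case True
        then have "a = a'" using eq False by simp
        have "(a, y) \<in> arcs D" using arcs True by simp
        moreover obtain C where "isolates y a C" using thin_isolates[OF thin, of y a] calculation by (auto simp: uadj_def)
        ultimately show ?thesis using inside[of a C] \<open>a = a'\<close> by (auto simp: isolates_def)
      next
        case bF: False
        then obtain x1 C where "(x1, y) \<in> arcs D" "isolates y x1 C" "a \<in> C" "b \<in> C"
          using step.IH ab by (auto simp: P_def)
        then show ?thesis using inside[of x1 C] eq by auto
      qed
    qed (simp add: P_def ab)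
  qed
  then show False using xyz arc_irrefl by (auto simp: P_def isolates_def)
qed

theorem class_bipartite:
  assumes "(x, y) \<in> arcs D" "(y, z) \<in> arcs D" shows "((x, y), (y, z)) \<notin> (share D)\<^sup>*"
  using fat_bipartite thin_bipartite assms by blast

lemma class_parts_disjoint:
  assumes e: "e \<in> arcs D" shows "fst ` A_class D e \<inter> snd ` A_class D e = {}"
proof (rule ccontr)
  assume "fst ` A_class D e \<inter> snd ` A_class D e \<noteq> {}"
  then obtain u v w where "(v, w) \<in> A_class D e" "(u, v) \<in> A_class D e" by auto
  then have *: "(e, (v, w)) \<in> (share D)\<^sup>*" "(e, (u, v)) \<in> (share D)\<^sup>*" using A_class_iff[OF wf e] by auto
  then have "((u, v), (v, w)) \<in> (share D)\<^sup>*" using rtrancl_sym_swap[OF sym_share] rtrancl_trans by metis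
  moreover have "(u, v) \<in> arcs D" "(v, w) \<in> arcs D" using * share_rtrancl_arcs e by blast+
  ultimately show False using class_bipartite by blast
qed

text \<open>Every vertex has an out-neighbour, so a 2-arc exists, and its two arcs lie in different
  classes.\<close>

theorem cut_reachability_not_universal: "\<exists>e\<in>arcs D. \<exists>e'\<in>arcs D. \<not> rel_A D e e'"
proof -
  obtain x where "x \<in> verts D" using uconn by (auto simp: uconnected_def)
  then obtain y where y: "(x, y) \<in> arcs D" using has_out_nbr by blast
  then obtain z where z: "(y, z) \<in> arcs D" using has_out_nbr arc_verts by blast
  show ?thesis using class_bipartite[OF y z] rel_A_iff[OF wf] y z by blast
qed

theorem cut_class_bipartite_dg:
  assumes "e \<in> arcs D" shows "bipartite_dg (Delta_of (A_class D e))"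
  unfolding bipartite_dg_def bipartite_parts_def Delta_of_def
  using class_parts_disjoint[OF assms]
  by (intro exI[of _ "fst ` A_class D e"] exI[of _ "snd ` A_class D e"]) (auto intro: rev_image_eqI)

end

section \<open>Descendants\<close>

text \<open>Both rays visit every sufficiently high level. A finite boundary stays below some level,
  while two vertices of one level are joined by a path descending at most \<open>M\<close>, which
  would have to cross that boundary.\<close>

lemma up_rays_not_separable:
  fixes h :: "'a \<Rightarrow> int"
  assumes ray: "is_ray D r" "is_ray D s"
    and step: "\<And>x y. uadj D x y \<Longrightarrow> \<bar>h x - h y\<bar> \<le> 1"
    and band: "\<And>x y. x \<in> verts D \<Longrightarrow> y \<in> verts D \<Longrightarrow> h x = h y \<Longrightarrow>
        (x, y) \<in> (ugraph D \<inter> {v. h x - M \<le> h v} \<times> {v. h x - M \<le> h v})\<^sup>*"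
    and up: "\<forall>n. \<exists>i. n \<le> h (r i)" "\<forall>n. \<exists>i. n \<le> h (s i)"
  shows "\<not> separable D r s"
proof
  assume "separable D r s"
  then obtain C i0 j0 where C: "finite (boundary (ugraph D) C)" "\<forall>i\<ge>i0. r i \<in> C" "\<forall>i\<ge>j0. s i \<notin> C"
    by (auto simp: separable_def)
  \<comment> \<open>A discrete intermediate value argument, as heights change by at most one along a
    ray.\<close>
  have attains: "\<exists>i\<ge>k. h (f i) = N" if f: "is_ray D f" "\<forall>n. \<exists>i. n \<le> h (f i)" and N: "\<forall>i\<le>k. h (f i) < N" for f k N
  proof -
    obtain i where i: "N \<le> h (f i)" using f(2) by blast
    then have "k \<le> i" using N by (metis linorder_not_le nle_le)
    moreover have "\<forall>j. k \<le> j \<and> j < i \<longrightarrow> \<bar>h (f (Suc j)) - h (f j)\<bar> \<le> 1"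
      using f(1) step by (metis abs_minus_commute is_ray_def)
    ultimately have "\<exists>j. k \<le> j \<and> j \<le> i \<and> h (f j) = N"
      using nat_intermed_int_val[of k i "\<lambda>j. h (f j)" N] i N by (simp add: less_imp_le)
    then show ?thesis by blast
  qed
  define B where "B = h ` fst ` boundary (ugraph D) C \<union> h ` r ` {..i0} \<union> h ` s ` {..j0}"
  have "finite B" using C by (simp add: B_def)
  then obtain b where b: "\<forall>x\<in>B. x < b"
    by (metis Max_ge add.commute less_add_one order_le_less_trans)
  \<comment> \<open>The additional \<bar>M\<bar> keeps the whole connecting path above the
    boundary.\<close>
  define N where "N = b + \<bar>M\<bar>"
  have "\<forall>i\<le>i0. h (r i) < N" "\<forall>i\<le>j0. h (s i) < N"
  proof -
    have "x < N" if "x \<in> B" for x using b that by (fastforce simp: N_def)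
    then show "\<forall>i\<le>i0. h (r i) < N" "\<forall>i\<le>j0. h (s i) < N" by (auto simp: B_def)
  qed
  then obtain i j where ij: "i \<ge> i0" "h (r i) = N" "j \<ge> j0" "h (s j) = N"
    using attains ray up by metis
  have "(r i, s j) \<in> (ugraph D \<inter> {v. N - M \<le> h v} \<times> {v. N - M \<le> h v})\<^sup>*"
    using band[of "r i" "s j"] ij range_subsetD[of r "verts D" i] range_subsetD[of s "verts D" j] ray
    by (simp add: is_ray_def)
  from rtrancl_leaves[OF this, of C] obtain u v
    where "(u, v) \<in> ugraph D" "u \<in> C" "v \<notin> C" "N - M \<le> h u" using C ij by auto
  then have "h u \<in> B" by (force simp: B_def boundary_def)
  then show False using b \<open>N - M \<le> h u\<close> by (auto simp: N_def)
qed

lemma relpow_split: "(x, z) \<in> R ^^ (i + j) \<Longrightarrow> \<exists>y. (x, y) \<in> R ^^ i \<and> (y, z) \<in> R ^^ j"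
  by (auto simp: relpow_add)

section \<open>Directed paths that diverge and meet again\<close>

context cut_homogeneous
begin

lemma crossing_persists:
  assumes "(u, z) \<in> (arcs D)\<^sup>*" "(z, w) \<in> (arcs D)\<^sup>*" "C \<in> E" "u \<notin> C" "z \<in> C"
  shows "w \<in> C"
  using assms
proof (induction rule: converse_rtrancl_induct)
  case (step u u')
  show ?case
  proof (cases "u' \<in> C")
    case True
    have "(u', w) \<in> (arcs D)\<^sup>*" using step.hyps(2) step.prems(1) by (rule rtrancl_trans)
    then show ?thesis using forward step True by blast
  next
    case False
    then show ?thesis using step by blast
  qed
qed simp

definition same :: "'a \<Rightarrow> 'a \<Rightarrow> bool" where
  "same x y \<longleftrightarrow> (\<forall>C\<in>E. x \<in> C \<longleftrightarrow> y \<in> C)"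

lemma same_refl: "same x x" and same_sym: "same x y \<Longrightarrow> same y x"
  and same_trans: "same x y \<Longrightarrow> same y z \<Longrightarrow> same x z"
  by (auto simp: same_def)

text \<open>\<open>z\<close> and \<open>z'\<close> are equally many steps after \<open>u\<close>, so
  equally many cuts separate them from \<open>u\<close>. A cut containing only \<open>z\<close> is
  matched by one containing only \<open>z'\<close>, and the common descendant \<open>w\<close> lies
  in both.\<close>

lemma diamond_aux:
  assumes u: "u \<in> verts D" and z: "(u, z) \<in> arcs D ^^ j" "(z, w) \<in> (arcs D)\<^sup>*"
    and z': "(u, z') \<in> arcs D ^^ j" "(z', w) \<in> (arcs D)\<^sup>*"
    and C: "C \<in> E" "u \<notin> C" "z \<in> C" "z' \<notin> C"
  shows False
proof -
  have uz: "(u, z) \<in> (arcs D)\<^sup>*" "(u, z') \<in> (arcs D)\<^sup>*" using z z' relpow_imp_rtrancl by metis+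
  then have V: "z \<in> verts D" "z' \<in> verts D" using u desc_verts by auto
  have "card (sep u z) = card (sep u z')" using card_sep_relpow z z' u by simp
  moreover have "C \<in> sep u z" "C \<notin> sep u z'" using C by (auto simp: sep_iff)
  ultimately obtain C' where C': "C' \<in> sep u z'" "C' \<notin> sep u z"
    using card_exchange[OF finite_sep[OF u V(1)] finite_sep[OF u V(2)]] by blast
  then have C'': "C' \<in> E" "u \<notin> C'" "z' \<in> C'" "z \<notin> C'" by (auto simp: sep_iff)
  have "w \<in> C" using crossing_persists[OF uz(1) z(2) C(1,2,3)] .
  moreover have "w \<in> C'" using crossing_persists[OF uz(2) z'(2) C''(1,2,3)] .
  ultimately show False using E_nested[OF C(1) C''(1), of w z z' u] C C'' u by blast
qed

lemma diamond:
  assumes u: "u \<in> verts D" and z: "(u, z) \<in> arcs D ^^ j" "(z, w) \<in> (arcs D)\<^sup>*"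
    and z': "(u, z') \<in> arcs D ^^ j" "(z', w) \<in> (arcs D)\<^sup>*"
  shows "same z z'"
  unfolding same_def
proof
  fix C assume C: "C \<in> E"
  have V: "z \<in> verts D" "z' \<in> verts D"
    using u desc_verts relpow_imp_rtrancl z(1) z'(1) by metis+
  show "z \<in> C \<longleftrightarrow> z' \<in> C"
    using diamond_aux[OF u z z' C] diamond_aux[OF u z' z C]
      diamond_aux[OF u z z' E_compl[OF C]] diamond_aux[OF u z' z E_compl[OF C]] u V by blast
qed

text \<open>Directed paths that diverge at a vertex can meet again after \<open>n\<close> further
  steps. By homogeneity one instance gives the same for every pair of out-neighbours of a
  vertex.\<close>

definition joins :: "nat \<Rightarrow> bool" where
  "joins n \<longleftrightarrow> (\<exists>x s s' w. (x, s) \<in> arcs D \<and> (x, s') \<in> arcs D \<and> s \<noteq> s' \<and> (s, w) \<in> arcs D ^^ n \<and> (s', w) \<in> arcs D ^^ n)"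

lemma relpow_aut:
  assumes "automorphism g D" "(a, b) \<in> arcs D ^^ n" "a \<in> verts D"
  shows "(g a, g b) \<in> arcs D ^^ n"
  using assms(2,3)
proof (induction n arbitrary: a)
  case (Suc n)
  then obtain c where c: "(a, c) \<in> arcs D" "(c, b) \<in> arcs D ^^ n" by (metis relpow_Suc_D2)
  then have "(g a, g c) \<in> arcs D" using automorphism_arcs[OF assms(1)] arc_verts by blast
  then show ?case using Suc.IH[OF c(2)] c arc_verts by (metis relpow_Suc_I2)
qed simp

lemma joins_all:
  assumes "joins n" "(x, y) \<in> arcs D" "(x, y') \<in> arcs D" "y \<noteq> y'"
  shows "\<exists>w. (y, w) \<in> arcs D ^^ n \<and> (y', w) \<in> arcs D ^^ n"
proof -
  obtain a s s' w where s: "(a, s) \<in> arcs D" "(a, s') \<in> arcs D" "s \<noteq> s'"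
      "(s, w) \<in> arcs D ^^ n" "(s', w) \<in> arcs D ^^ n" using assms by (auto simp: joins_def)
  obtain g where "automorphism g D" "g s = y" "g a = x" "g s' = y'"
    using homogeneous_3[of a s s' x y y'] s assms by (auto simp: uadj_def)
  then show ?thesis using relpow_aut s arc_verts by blast
qed

lemma out_relpow: "x \<in> verts D \<Longrightarrow> \<exists>y. (x, y) \<in> arcs D ^^ n"
proof (induction n)
  case (Suc n)
  then obtain y where y: "(x, y) \<in> arcs D ^^ n" by blast
  then have "y \<in> verts D" using Suc.prems desc_verts relpow_imp_rtrancl by metis
  then obtain z where "(y, z) \<in> arcs D" using has_out_nbr by blast
  then show ?case using y by (meson relpow_Suc_I)
qed auto

text \<open>If the meeting depth \<open>N\<close> is at most \<open>j\<close>, the meeting point is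
  continued to depth \<open>j\<close> and the induction hypothesis is used below both
  out-neighbours. Otherwise the paths to the meeting point are cut at depth \<open>j\<close> and
  compared by \<open>diamond\<close>.\<close>

lemma out_levels_same:
  assumes N: "joins N" and "x \<in> verts D" "(x, v) \<in> arcs D ^^ j" "(x, v') \<in> arcs D ^^ j"
  shows "same v v'"
  using assms(2-)
proof (induction j arbitrary: x v v')
  case 0
  then show ?case by (simp add: same_refl)
next
  case (Suc j)
  obtain y y' where y: "(x, y) \<in> arcs D" "(y, v) \<in> arcs D ^^ j" "(x, y') \<in> arcs D" "(y', v') \<in> arcs D ^^ j"
    using Suc.prems by (metis relpow_Suc_D2)
  have V: "y \<in> verts D" "y' \<in> verts D" using y arc_verts by auto
  show ?case
  proof (cases "y = y'")
    case True
    then show ?thesis using Suc.IH[OF V(1) y(2)] y(4) by simp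
  next
    case False
    then obtain w where w: "(y, w) \<in> arcs D ^^ N" "(y', w) \<in> arcs D ^^ N"
      using joins_all[OF N y(1,3)] by blast
    show ?thesis
    proof (cases "N \<le> j")
      case True
      have "w \<in> verts D" using w V desc_verts relpow_imp_rtrancl by metis
      then obtain w2 where w2: "(w, w2) \<in> arcs D ^^ (j - N)" using out_relpow by blast
      have "(y, w2) \<in> arcs D ^^ j" "(y', w2) \<in> arcs D ^^ j"
        using relpow_trans[OF w(1) w2] relpow_trans[OF w(2) w2] True by simp_all
      then have "same v w2" "same v' w2" using Suc.IH[OF V(1) y(2)] Suc.IH[OF V(2) y(4)] by simp_all
      then show ?thesis by (simp add: same_def)
    next
      case False
      then have eq: "N = j + (N - j)" by simp
      then obtain a a' where a: "(y, a) \<in> arcs D ^^ j" "(a, w) \<in> arcs D ^^ (N - j)"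
        "(y', a') \<in> arcs D ^^ j" "(a', w) \<in> arcs D ^^ (N - j)"
        using relpow_split[of y w j "N - j" "arcs D"] relpow_split[of y' w j "N - j" "arcs D"] w by auto
      have "same a a'"
      proof (rule diamond[OF Suc.prems(1)])
        show "(x, a) \<in> arcs D ^^ Suc j" "(x, a') \<in> arcs D ^^ Suc j" using y a by (metis relpow_Suc_I2)+
        show "(a, w) \<in> (arcs D)\<^sup>*" "(a', w) \<in> (arcs D)\<^sup>*" using a relpow_imp_rtrancl by metis+
      qed
      then show ?thesis
        using Suc.IH[OF V(1) y(2) a(1)] Suc.IH[OF V(2) y(4) a(3)] by (simp add: same_def)
    qed
  qed
qed

end

lemma relpow_converse:
  fixes R :: "('a \<times> 'a) set"
  shows "(R\<inverse>) ^^ n = (R ^^ n)\<inverse>"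
proof (induction n)
  case (Suc n)
  have "(R\<inverse>) ^^ Suc n = R\<inverse> O (R\<inverse>) ^^ n" by (simp add: relpow_commute)
  then show ?case using Suc by (simp add: converse_relcomp)
qed auto

section \<open>Integer levels and the number of ends\<close>

context cut_homogeneous
begin

interpretation rv: cut_homogeneous "rev_dg D" E by (rule rev_cut_homogeneous)

lemma joins_rev_iff:
  "rv.joins n \<longleftrightarrow> (\<exists>x s s' w. (s, x) \<in> arcs D \<and> (s', x) \<in> arcs D \<and> s \<noteq> s' \<and> (w, s) \<in> arcs D ^^ n \<and> (w, s') \<in> arcs D ^^ n)"
  by (simp add: rv.joins_def relpow_converse)

text \<open>At the vertex where two paths from \<open>u\<close> to distinct in-neighbours of
  \<open>w\<close> first diverge, they witness \<open>joins\<close>.\<close>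

lemma joins_of_rev:
  assumes "(u, z) \<in> arcs D ^^ n" "(u, z') \<in> arcs D ^^ n" "z \<noteq> z'" "(z, w) \<in> arcs D" "(z', w) \<in> arcs D"
  shows "\<exists>m. joins m"
  using assms(1,2)
proof (induction n arbitrary: u)
  case 0
  then show ?case using assms by auto
next
  case (Suc n)
  obtain y y' where y: "(u, y) \<in> arcs D" "(y, z) \<in> arcs D ^^ n" "(u, y') \<in> arcs D" "(y', z') \<in> arcs D ^^ n"
    using Suc.prems by (metis relpow_Suc_D2)
  show ?case
  proof (cases "y = y'")
    case True
    then show ?thesis using Suc.IH y by blast
  next
    case False
    moreover have "(y, w) \<in> arcs D ^^ Suc n" "(y', w) \<in> arcs D ^^ Suc n"
      using y assms by (meson relpow_Suc_I)+
    ultimately show ?thesis using y unfolding joins_def by blast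
  qed
qed

lemma in_levels_same:
  assumes "rv.joins N" "x \<in> verts D" "(v, x) \<in> arcs D ^^ j" "(v', x) \<in> arcs D ^^ j"
  shows "same v v'"
  using rv.out_levels_same[of N x v j v'] assms by (simp add: relpow_converse rv.same_def same_def)

lemma in_relpow: "x \<in> verts D \<Longrightarrow> \<exists>y. (y, x) \<in> arcs D ^^ n"
  using rv.out_relpow[of x n] by (simp add: relpow_converse)

text \<open>The sign lets levels before and after the base vertex be treated together.\<close>

definition walk_step :: "int \<Rightarrow> 'a \<Rightarrow> 'a \<Rightarrow> bool" where
  "walk_step i x y \<longleftrightarrow> (if i \<ge> 0 then (x, y) \<in> arcs D ^^ nat i else (y, x) \<in> arcs D ^^ nat (- i))"

lemma walk_step_nonpos: "i \<le> 0 \<Longrightarrow> walk_step i x y \<longleftrightarrow> (y, x) \<in> arcs D ^^ nat (- i)"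
  by (auto simp: walk_step_def)

lemma walk_step_nonneg: "i \<ge> 0 \<Longrightarrow> walk_step i x y \<longleftrightarrow> (x, y) \<in> arcs D ^^ nat i"
  by (auto simp: walk_step_def)

lemma walk_step_exists: "x \<in> verts D \<Longrightarrow> \<exists>y. walk_step i x y"
  using in_relpow out_relpow by (cases "i \<ge> 0") (auto simp: walk_step_def)

text \<open>Quantifying over every \<open>j\<close> makes the notion pass along arcs in both
  directions, and comparing end points up to \<open>same\<close> makes the choice of walks
  irrelevant.\<close>

definition at_level :: "'a \<Rightarrow> 'a \<Rightarrow> int \<Rightarrow> bool" where
  "at_level p v i \<longleftrightarrow> (\<forall>j a b. walk_step j v a \<longrightarrow> walk_step (i + j) p b \<longrightarrow> same a b)"

lemma at_level_base:
  assumes "joins N" "rv.joins N'" "p \<in> verts D" shows "at_level p p 0"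
  unfolding at_level_def
proof (intro allI impI)
  fix j a b assume "walk_step j p a" "walk_step (0 + j) p b"
  then show "same a b"
    using out_levels_same[OF assms(1,3)] in_levels_same[OF assms(2,3)]
    by (cases "j \<ge> 0") (auto simp: walk_step_def)
qed

lemma at_level_up:
  assumes N: "rv.joins N'" and L: "at_level p v i" and vw: "(v, w) \<in> arcs D"
  shows "at_level p w (i + 1)"
  unfolding at_level_def
proof (intro allI impI)
  fix j a b assume a: "walk_step j w a" and b: "walk_step (i + 1 + j) p b"
  have "\<exists>a'. walk_step (j + 1) v a' \<and> same a a'"
  proof (cases "j \<ge> 0")
    case True
    then have "(v, a) \<in> arcs D ^^ Suc (nat j)" using a vw walk_step_nonneg by (metis relpow_Suc_I2)
    moreover have "nat (j + 1) = Suc (nat j)" using True by simp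
    ultimately have "walk_step (j + 1) v a" using True by (simp add: walk_step_nonneg del: relpow.simps)
    then show ?thesis using same_refl by blast
  next
    case False
    \<comment> \<open>A backward walk from \<open>w\<close> need not pass through \<open>v\<close>,
      but \<open>in_levels_same\<close> identifies its end with one that does.\<close>
    obtain a' where a': "walk_step (j + 1) v a'" using walk_step_exists arc_verts vw by blast
    then have "(a', v) \<in> arcs D ^^ nat (- (j + 1))" using False by (simp add: walk_step_nonpos)
    then have "(a', w) \<in> arcs D ^^ Suc (nat (- (j + 1)))" using vw by (meson relpow_Suc_I)
    moreover have "nat (- j) = Suc (nat (- (j + 1)))" using False by simp
    ultimately have "(a', w) \<in> arcs D ^^ nat (- j)" by simp
    moreover have "(a, w) \<in> arcs D ^^ nat (- j)" using a False by (simp add: walk_step_nonpos)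
    ultimately show ?thesis using in_levels_same[OF N] arc_verts vw a' by blast
  qed
  then obtain a' where a': "walk_step (j + 1) v a'" "same a a'" by blast
  have "i + (j + 1) = i + 1 + j" by simp
  then have "same a' b" using L a'(1) b unfolding at_level_def by metis
  then show "same a b" using a'(2) same_trans by blast
qed

lemma at_level_down:
  assumes N: "joins N" and L: "at_level p v i" and wv: "(w, v) \<in> arcs D"
  shows "at_level p w (i - 1)"
  unfolding at_level_def
proof (intro allI impI)
  fix j a b assume a: "walk_step j w a" and b: "walk_step (i - 1 + j) p b"
  have "\<exists>a'. walk_step (j - 1) v a' \<and> same a a'"
  proof (cases "j \<le> 0")
    case True
    then have "(a, v) \<in> arcs D ^^ Suc (nat (- j))" using a wv walk_step_nonpos by (metis relpow_Suc_I)
    moreover have "nat (- (j - 1)) = Suc (nat (- j))" using True by simp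
    ultimately have "walk_step (j - 1) v a" using True by (simp add: walk_step_nonpos del: relpow.simps)
    then show ?thesis using same_refl by blast
  next
    case False
    obtain a' where a': "walk_step (j - 1) v a'" using walk_step_exists arc_verts wv by blast
    then have "(v, a') \<in> arcs D ^^ nat (j - 1)" using False by (simp add: walk_step_nonneg)
    then have "(w, a') \<in> arcs D ^^ Suc (nat (j - 1))" using wv by (meson relpow_Suc_I2)
    moreover have "nat j = Suc (nat (j - 1))" using False by simp
    ultimately have "(w, a') \<in> arcs D ^^ nat j" by simp
    moreover have "(w, a) \<in> arcs D ^^ nat j" using a False by (simp add: walk_step_nonneg)
    ultimately show ?thesis using out_levels_same[OF N] arc_verts wv a' by blast
  qed
  then obtain a' where a': "walk_step (j - 1) v a'" "same a a'" by blast
  have "i + (j - 1) = i - 1 + j" by simp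
  then have "same a' b" using L a'(1) b unfolding at_level_def by metis
  then show "same a b" using a'(2) same_trans by blast
qed

text \<open>Two levels are distinguished by the cuts along a directed path between them; a directed
  line through \<open>p\<close> supplies such a path.\<close>

lemma walk_step_chain:
  assumes p: "p \<in> verts D" and ik: "i < k"
  shows "\<exists>b b'. walk_step i p b \<and> walk_step k p b' \<and> (b, b') \<in> arcs D ^^ nat (k - i)"
proof -
  consider "0 \<le> i" | "k \<le> 0" | "i < 0" "0 < k" by linarith
  then show ?thesis
  proof cases
    case 1
    obtain b where b: "(p, b) \<in> arcs D ^^ nat i" using out_relpow p by blast
    then have "b \<in> verts D" using p desc_verts relpow_imp_rtrancl by metis
    then obtain b' where b': "(b, b') \<in> arcs D ^^ nat (k - i)" using out_relpow by blast
    have "nat k = nat i + nat (k - i)" using 1 ik by simp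
    then have "(p, b') \<in> arcs D ^^ nat k" using relpow_trans[OF b b'] by simp
    then show ?thesis using b b' 1 ik by (auto simp: walk_step_nonneg)
  next
    case 2
    obtain b' where b': "(b', p) \<in> arcs D ^^ nat (- k)" using in_relpow p by blast
    then have "b' \<in> verts D" using p anc_verts relpow_imp_rtrancl by metis
    then obtain b where b: "(b, b') \<in> arcs D ^^ nat (k - i)" using in_relpow by blast
    have "nat (- i) = nat (k - i) + nat (- k)" using 2 ik by simp
    then have "(b, p) \<in> arcs D ^^ nat (- i)" using relpow_trans[OF b b'] by simp
    then show ?thesis using b b' 2 ik by (auto simp: walk_step_nonpos)
  next
    case 3
    obtain b b' where b: "(b, p) \<in> arcs D ^^ nat (- i)" "(p, b') \<in> arcs D ^^ nat k"
      using in_relpow out_relpow p by blast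
    have "nat (k - i) = nat (- i) + nat k" using 3 by simp
    then have "(b, b') \<in> arcs D ^^ nat (k - i)" using relpow_trans[OF b] by simp
    then show ?thesis using b 3 by (auto simp: walk_step_nonpos walk_step_nonneg)
  qed
qed

text \<open>Two levels contain vertices joined by a nonempty directed path and hence separated by a
  cut, although neither is separated from \<open>v\<close>.\<close>

lemma at_level_unique:
  assumes p: "p \<in> verts D" and L: "at_level p v i" "at_level p v k"
  shows "i = k"
proof -
  have False if L: "at_level p v i" "at_level p v k" and ik: "i < k" for i k
  proof -
    obtain b b' where b: "walk_step i p b" "walk_step k p b'" "(b, b') \<in> arcs D ^^ nat (k - i)"
      using walk_step_chain[OF p ik] by blast
    have v0: "walk_step 0 v v" by (simp add: walk_step_def)
    have "same v b" "same v b'" using L v0 b(1,2) unfolding at_level_def by (metis add.right_neutral)+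
    then have "same b b'" using same_sym same_trans by blast
    have bV: "b \<in> verts D" "(p, b) \<in> (arcs D)\<^sup>* \<or> (b, p) \<in> (arcs D)\<^sup>*"
      using b(1) p desc_verts anc_verts relpow_imp_rtrancl unfolding walk_step_def by metis+
    obtain y where "(b, y) \<in> arcs D" using has_out_nbr bV by blast
    then have "card (sep b b') > 0" using card_sep_relpow[OF b(3) bV(1)] ik cut_dist_pos by simp
    then obtain C where "C \<in> sep b b'" by (metis card.empty ex_in_conv less_irrefl)
    then have "C \<in> E" "b \<notin> C" "b' \<in> C" by (simp_all add: sep_iff)
    then show False using \<open>same b b'\<close> unfolding same_def by blast
  qed
  from this[of i k] this[of k i] have "\<not> i < k" "\<not> k < i" using L by blast+
  then show ?thesis by simp
qed

text \<open>The level is a height function that changes by one along each arc. Levels are finite and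
  joined up within bands of uniform width, so all rays going up are equivalent, and so are all rays
  going down.\<close>

theorem joins_two_ended:
  assumes N: "joins N" and N': "rv.joins N'" shows "\<not> more_than_two_ends D"
proof -
  obtain p where p: "p \<in> verts D" using uconn by (auto simp: uconnected_def)
  have conn: "connected_on (ugraph D) (verts D)" using uconn by (simp add: uconnected_iff)
  have ex: "\<exists>i. at_level p v i" if "v \<in> verts D" for v
  proof -
    have "(p, v) \<in> (ugraph D)\<^sup>*" using connected_on_rtrancl[OF conn p that] .
    then show ?thesis
    proof (induction rule: rtrancl_induct)
      case base then show ?case using at_level_base[OF N N' p] by blast
    next
      case (step v w)
      then obtain i where i: "at_level p v i" by blast
      have "(v, w) \<in> arcs D \<or> (w, v) \<in> arcs D" using step.hyps(2) by (simp add: ugraph_def uadj_def)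
      then show ?case using at_level_up[OF N' i] at_level_down[OF N i] by blast
    qed
  qed
  define h where "h v = (THE i. at_level p v i)" for v
  have hI: "h v = i" if "at_level p v i" for v i
    unfolding h_def using that at_level_unique[OF p] by blast
  have hL: "at_level p v (h v)" if "v \<in> verts D" for v using ex[OF that] hI by blast
  have h_arc: "h w = h v + 1" if "(v, w) \<in> arcs D" for v w
    using hI[OF at_level_up[OF N' hL that]] arc_verts that by blast
  have hp: "h p = 0" using hI at_level_base[OF N N' p] by blast
  have h_step: "\<bar>h x - h y\<bar> \<le> 1" if "uadj D x y" for x y using that h_arc by (auto simp: uadj_def)
  have h_same: "same v v'" if v: "v \<in> verts D" "v' \<in> verts D" "h v = h v'" for v v'
  proof -
    obtain b where b: "walk_step (h v) p b" using walk_step_exists p by blast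
    have v0: "walk_step 0 v v" "walk_step 0 v' v'" by (simp_all add: walk_step_def)
    have "same v b" "same v' b" using hL[OF v(1)] hL[OF v(2)] v0 b v(3) unfolding at_level_def
      by (metis add.right_neutral)+
    then show ?thesis using same_sym same_trans by blast
  qed
  \<comment> \<open>Vertices of one level lie on the same side of every cut. A cut between this
    level and the next thus has a boundary edge at each vertex of the level, and its boundary is
    finite.\<close>
  have h_fin: "finite {v \<in> verts D. h v = n}" for n
  proof (cases "{v \<in> verts D. h v = n} = {}")
    case False
    then obtain a where a: "a \<in> verts D" "h a = n" by blast
    then obtain b where ab: "(a, b) \<in> arcs D" using has_out_nbr by blast
    then obtain C where C: "C \<in> sep a b" using arc_separated by blast
    have "{v \<in> verts D. h v = n} \<subseteq> snd ` boundary (ugraph D) C"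
    proof
      fix v assume "v \<in> {v \<in> verts D. h v = n}"
      then have v: "v \<in> verts D" "h v = n" by auto
      then obtain w where vw: "(v, w) \<in> arcs D" using has_out_nbr by blast
      have "same v a" "same w b"
        using h_same v a h_arc ab vw arc_verts by metis+
      then have "(w, v) \<in> boundary (ugraph D) C"
        using C vw by (auto simp: sep_iff same_def boundary_def ugraph_def uadj_def)
      then show "v \<in> snd ` boundary (ugraph D) C" by force
    qed
    then show ?thesis using E_fin C by (meson finite_imageI finite_subset sep_iff)
  next
    case True
    then show ?thesis by (simp only: finite.emptyI)
  qed
  define W where "W M = {v. \<bar>h v\<bar> \<le> M}" for M
  have "\<exists>M. (p, y) \<in> (ugraph D \<inter> W M \<times> W M)\<^sup>*" if y: "y \<in> verts D" for y
  proof -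
    have "(p, y) \<in> (ugraph D)\<^sup>*" using connected_on_rtrancl[OF conn p y] .
    then show ?thesis
    proof (induction rule: rtrancl_induct)
      case (step u v)
      then obtain M where M: "(p, u) \<in> (ugraph D \<inter> W M \<times> W M)\<^sup>*" by (elim exE)
      let ?M = "max M (max \<bar>h u\<bar> \<bar>h v\<bar>)"
      have "(ugraph D \<inter> W M \<times> W M)\<^sup>* \<subseteq> (ugraph D \<inter> W ?M \<times> W ?M)\<^sup>*"
        by (rule rtrancl_mono) (auto simp: W_def)
      then have "(p, u) \<in> (ugraph D \<inter> W ?M \<times> W ?M)\<^sup>*" using M by (rule subsetD)
      moreover have "(u, v) \<in> ugraph D \<inter> W ?M \<times> W ?M" using step.hyps by (auto simp: W_def)
      ultimately show ?case by (intro exI[of _ ?M]) (rule rtrancl_into_rtrancl)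
    qed blast
  qed
  then obtain Mf where Mf: "\<And>y. y \<in> verts D \<Longrightarrow> (p, y) \<in> (ugraph D \<inter> W (Mf y) \<times> W (Mf y))\<^sup>*" by metis
  \<comment> \<open>A width that works for all of level 0 exists because this level is
    finite.\<close>
  define M where "M = Max (Mf ` {v \<in> verts D. h v = 0})"
  have M: "(p, y) \<in> (ugraph D \<inter> W M \<times> W M)\<^sup>*" if y: "y \<in> verts D" "h y = 0" for y
  proof -
    have "Mf y \<le> M" unfolding M_def using h_fin[of 0] y by (intro Max_ge) auto
    then have "(ugraph D \<inter> W (Mf y) \<times> W (Mf y))\<^sup>* \<subseteq> (ugraph D \<inter> W M \<times> W M)\<^sup>*"
      by (intro rtrancl_mono) (auto simp: W_def)
    then show ?thesis using Mf[OF y(1)] by (rule subsetD)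
  qed
  have band: "(x, y) \<in> (ugraph D \<inter> {v. \<bar>h v - h x\<bar> \<le> M} \<times> {v. \<bar>h v - h x\<bar> \<le> M})\<^sup>*"
    if xy: "x \<in> verts D" "y \<in> verts D" "h x = h y" for x y
  proof -
    \<comment> \<open>This automorphism shifts all levels by \<open>h x\<close>, so it carries the
      band around level 0 to the band around the level of \<open>x\<close>.\<close>
    obtain g where g: "automorphism g D" "g p = x" using vertex_transitive p xy by blast
    have shift: "h (g v) = h v + h x" if "v \<in> verts D" for v
    proof -
      have "(p, v) \<in> (ugraph D)\<^sup>*" using connected_on_rtrancl[OF conn p that] .
      then show ?thesis
      proof (induction rule: rtrancl_induct)
        case base then show ?case using g hp by simp
      next
        case (step u v)
        have V: "u \<in> verts D" "v \<in> verts D" using step.hyps(2) uadj_in_verts[OF wf] by (auto simp: ugraph_def)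
        from step.hyps(2) consider "(u, v) \<in> arcs D" | "(v, u) \<in> arcs D" by (auto simp: ugraph_def uadj_def)
        then show ?case
        proof cases
          case 1
          then have "(g u, g v) \<in> arcs D" using automorphism_arcs[OF g(1)] V by simp
          then show ?thesis using h_arc[OF 1] h_arc[of "g u" "g v"] step.IH by simp
        next
          case 2
          then have "(g v, g u) \<in> arcs D" using automorphism_arcs[OF g(1)] V by simp
          then show ?thesis using h_arc[OF 2] h_arc[of "g v" "g u"] step.IH by simp
        qed
      qed
    qed
    obtain y0 where y0: "y0 \<in> verts D" "g y0 = y"
      using automorphism_bij[OF g(1)] xy(2) unfolding bij_betw_def by (metis imageE)
    then have "h y0 = 0" using shift[OF y0(1)] xy by simp
    have "(g p, g z) \<in> (ugraph D \<inter> {v. \<bar>h v - h x\<bar> \<le> M} \<times> {v. \<bar>h v - h x\<bar> \<le> M})\<^sup>*"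
      if "(p, z) \<in> (ugraph D \<inter> W M \<times> W M)\<^sup>*" for z
      using that
    proof (induction rule: rtrancl_induct)
      case (step u v)
      have V: "u \<in> verts D" "v \<in> verts D" using step.hyps(2) uadj_in_verts[OF wf] by (auto simp: ugraph_def)
      have "(g u, g v) \<in> ugraph D \<inter> {v. \<bar>h v - h x\<bar> \<le> M} \<times> {v. \<bar>h v - h x\<bar> \<le> M}"
        using step.hyps(2) shift V automorphism_uadj[OF g(1)] by (auto simp: ugraph_def W_def)
      then show ?case using step.IH by (rule rtrancl_into_rtrancl[rotated])
    qed simp
    then show ?thesis using M[OF y0(1) \<open>h y0 = 0\<close>] g y0 by blast
  qed
  have band_up: "(x, y) \<in> (ugraph D \<inter> {v. h x - M \<le> h v} \<times> {v. h x - M \<le> h v})\<^sup>*"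
    if xy: "x \<in> verts D" "y \<in> verts D" "h x = h y" for x y
    by (rule subsetD[OF rtrancl_mono band[OF xy]]) auto
  have band_down: "(x, y) \<in> (ugraph D \<inter> {v. - h x - M \<le> - h v} \<times> {v. - h x - M \<le> - h v})\<^sup>*"
    if xy: "x \<in> verts D" "y \<in> verts D" "h x = h y" for x y
    by (rule subsetD[OF rtrancl_mono band[OF xy]]) auto
  have up_equiv: "equiv_rays D r s"
    if "is_ray D r" "is_ray D s" "\<forall>n. \<exists>i. n \<le> h (r i)" "\<forall>n. \<exists>i. n \<le> h (s i)" for r s
    using up_rays_not_separable[of D r s h M] inequivalent_rays_separable[OF wf lf] that h_step band_up by blast
  have down_equiv: "equiv_rays D r s"
    if r: "is_ray D r" "is_ray D s" "\<forall>n. \<exists>i. n \<le> - h (r i)" "\<forall>n. \<exists>i. n \<le> - h (s i)" for r s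
  proof -
    have "\<not> separable D r s"
      using r h_step band_down by (intro up_rays_not_separable[of D r s "\<lambda>v. - h v" M]) (auto simp: abs_minus_commute)
    then show ?thesis using inequivalent_rays_separable[OF wf lf r(1,2)] by blast
  qed
  \<comment> \<open>A ray bounded on both sides would stay in finitely many finite levels.\<close>
  have dir: "(\<forall>n. \<exists>i. n \<le> h (r i)) \<or> (\<forall>n. \<exists>i. n \<le> - h (r i))" if r: "is_ray D r" for r
  proof (rule ccontr)
    assume "\<not> ?thesis"
    then obtain m n where mn: "\<forall>i. h (r i) < n" "\<forall>i. - h (r i) < m" by (auto simp: not_le)
    have "range r \<subseteq> (\<Union>k\<in>{-m..n}. {v \<in> verts D. h v = k})"
    proof
      fix v assume "v \<in> range r"
      then obtain i where i: "v = r i" by blast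
      then have "v \<in> verts D" using r by (auto simp: is_ray_def)
      moreover have "h v \<in> {-m..n}" using mn i by (auto simp: less_imp_le minus_less_iff)
      ultimately show "v \<in> (\<Union>k\<in>{-m..n}. {v \<in> verts D. h v = k})" by blast
    qed
    then have "finite (range r)" by (rule finite_subset) (use h_fin in auto)
    then show False using r by (auto simp: is_ray_def dest: finite_imageD)
  qed
  show ?thesis
  proof
    assume "more_than_two_ends D"
    then obtain r s t where "is_ray D r" "is_ray D s" "is_ray D t"
      "\<not> equiv_rays D r s" "\<not> equiv_rays D r t" "\<not> equiv_rays D s t" by (auto simp: more_than_two_ends_def)
    \<comment> \<open>Two of the three rays run in the same direction.\<close>
    then show False
      using dir[of r] dir[of s] dir[of t] up_equiv[of r s] up_equiv[of r t] up_equiv[of s t]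
        down_equiv[of r s] down_equiv[of r t] down_equiv[of s t] by argo
  qed
qed

lemma cycle_neighbours:
  assumes "length xs \<ge> 3" "distinct xs" "\<forall>i. Suc i < length xs \<longrightarrow> uadj D (xs ! i) (xs ! Suc i)"
    "uadj D (last xs) (hd xs)" "v \<in> set xs"
  shows "\<exists>a\<in>set xs. \<exists>b\<in>set xs. a \<noteq> b \<and> uadj D v a \<and> uadj D v b"
proof -
  let ?n = "length xs"
  have adj: "uadj D (xs ! i) (xs ! (Suc i mod ?n))" if "i < ?n" for i
  proof (cases "Suc i < ?n")
    case True then show ?thesis using assms(3) by simp
  next
    case False
    then have "i = ?n - 1" using that by simp
    moreover have "xs \<noteq> []" "Suc (?n - 1) = ?n" using assms(1) by auto
    ultimately show ?thesis using assms(4) by (simp add: last_conv_nth hd_conv_nth)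
  qed
  obtain k where k: "k < ?n" "v = xs ! k" using assms(5) by (auto simp: in_set_conv_nth)
  define i where "i = (if k = 0 then ?n - 1 else k - 1)"
  have i: "i < ?n" "Suc i mod ?n = k" using k assms(1) by (auto simp: i_def)
  have ne: "i \<noteq> Suc k mod ?n" using k assms(1) by (cases "Suc k = ?n") (auto simp: i_def)
  have "Suc k mod ?n < ?n" using assms(1) by (intro mod_less_divisor) linarith
  then have "xs ! i \<noteq> xs ! (Suc k mod ?n)" using ne i assms(2) by (simp add: nth_eq_iff_index_eq)
  moreover have "uadj D v (xs ! (Suc k mod ?n))" using adj k by simp
  moreover have "uadj D v (xs ! i)" using adj[OF i(1)] i k by (simp add: uadj_commute)
  ultimately show ?thesis using i \<open>Suc k mod ?n < ?n\<close> by (metis nth_mem)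
qed

text \<open>A vertex of a cycle farthest from \<open>u\<close> has two in-neighbours on the cycle at
  equal depth. Directed paths then meet again both forwards and backwards, which
  \<open>joins_two_ended\<close> rules out.\<close>

theorem desc_tree:
  assumes "more_than_two_ends D" "u \<in> verts D" shows "is_tree (induced D (desc D u))"
proof -
  let ?S = "desc D u"
  have nojoin: "z = z'" if z: "(u, z) \<in> arcs D ^^ n" "(u, z') \<in> arcs D ^^ n" "(z, w) \<in> arcs D" "(z', w) \<in> arcs D" for z z' w n
  proof (rule ccontr)
    assume ne: "z \<noteq> z'"
    obtain m where "joins m" using joins_of_rev[OF z(1,2) ne z(3,4)] by blast
    moreover have "rv.joins n" using z ne joins_rev_iff by blast
    ultimately show False using joins_two_ended assms(1) by blast
  qed
  have SV: "?S \<subseteq> verts D" using desc_verts assms(2) by (auto simp: desc_def)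
  have "connected_on (ugraph D) ?S"
  proof (rule connected_on_via[OF sym_ugraph])
    show "u \<in> ?S" by (simp add: desc_def)
    fix x assume "x \<in> ?S"
    then have "(u, x) \<in> (arcs D)\<^sup>*" by (simp add: desc_def)
    then show "(u, x) \<in> (ugraph D \<inter> ?S \<times> ?S)\<^sup>*"
    proof (induction rule: rtrancl_induct)
      case (step y z)
      have "(u, z) \<in> (arcs D)\<^sup>*" using step.hyps by (rule rtrancl_into_rtrancl)
      then have "(y, z) \<in> ugraph D \<inter> ?S \<times> ?S" using step.hyps by (simp add: desc_def ugraph_def uadj_def)
      then show ?case using step.IH by (rule rtrancl_into_rtrancl[rotated])
    qed simp
  qed
  then have "uconnected (induced D ?S)" by (auto simp: uconnected_induced_iff desc_def)
  moreover have "uacyclic (induced D ?S)"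
    unfolding uacyclic_def
  proof
    let ?H = "induced D ?S"
    assume "\<exists>xs. length xs \<ge> 3 \<and> distinct xs \<and> set xs \<subseteq> verts ?H
       \<and> (\<forall>i. Suc i < length xs \<longrightarrow> uadj ?H (xs ! i) (xs ! Suc i)) \<and> uadj ?H (last xs) (hd xs)"
    then obtain xs where xs: "length xs \<ge> 3" "distinct xs" "set xs \<subseteq> ?S"
      "\<forall>i. Suc i < length xs \<longrightarrow> uadj D (xs ! i) (xs ! Suc i)" "uadj D (last xs) (hd xs)"
      by (auto simp: uadj_induced)
    \<comment> \<open>Depth below \<open>u\<close> is measured by cuts: it is
      \<open>cut_dist\<close> times the number of steps.\<close>
    define f where "f v = card (sep u v)" for v
    obtain v where v: "v \<in> set xs" "\<forall>w\<in>set xs. f w \<le> f v"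
    proof -
      have "Max (f ` set xs) \<in> f ` set xs" using xs(1) by (intro Max_in) auto
      then obtain v where "v \<in> set xs" "f v = Max (f ` set xs)" by auto
      then show ?thesis using that[of v] by simp
    qed
    obtain a b where ab: "a \<in> set xs" "b \<in> set xs" "a \<noteq> b" "uadj D v a" "uadj D v b"
      using cycle_neighbours[OF xs(1,2,4,5) v(1)] by blast
    have lev: "\<exists>n. (u, w) \<in> arcs D ^^ n" if "w \<in> set xs" for w
      using that xs(3) rtrancl_imp_relpow by (fastforce simp: desc_def)
    have fl: "f w = n * cut_dist" if "(u, w) \<in> arcs D ^^ n" for w n
      using card_sep_relpow[OF that assms(2)] by (simp add: f_def)
    have down: "(w, v) \<in> arcs D \<and> (\<forall>n. (u, w) \<in> arcs D ^^ n \<longrightarrow> f v = Suc n * cut_dist)" if w: "w \<in> set xs" "uadj D v w" for w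
    proof -
      have "(v, w) \<notin> arcs D"
      proof
        assume vw: "(v, w) \<in> arcs D"
        obtain n where n: "(u, v) \<in> arcs D ^^ n" using lev v by blast
        then have "(u, w) \<in> arcs D ^^ Suc n" using vw by (meson relpow_Suc_I)
        then have "f w = Suc n * cut_dist" "f v = n * cut_dist" using fl n by blast+
        then show False using v(2) w(1) cut_dist_pos[OF vw] by fastforce
      qed
      then have wv: "(w, v) \<in> arcs D" using w by (simp add: uadj_def)
      then show ?thesis using fl relpow_Suc_I by metis
    qed
    obtain m n where mn: "(u, a) \<in> arcs D ^^ m" "(u, b) \<in> arcs D ^^ n" using lev ab by blast
    have av: "(a, v) \<in> arcs D" "(b, v) \<in> arcs D" using down ab by blast+
    have "f v = Suc m * cut_dist" "f v = Suc n * cut_dist" using down ab mn by blast+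
    then have "m = n" using cut_dist_pos[OF av(1)] by simp
    then show False using nojoin mn av ab(3) by blast
  qed
  ultimately show ?thesis by (simp add: is_tree_def)
qed

end

context cut_homogeneous
begin

interpretation rv: cut_homogeneous "rev_dg D" E by (rule rev_cut_homogeneous)

theorem anc_tree:
  assumes "more_than_two_ends D" "u \<in> verts D" shows "is_tree (induced D (anc D u))"
proof -
  have "more_than_two_ends (rev_dg D)" using assms by (simp add: more_than_two_ends_def is_ray_rev equiv_rays_rev)
  then have "is_tree (induced (rev_dg D) (desc (rev_dg D) u))" using rv.desc_tree assms by simp
  then show ?thesis by (simp add: desc_rev induced_rev is_tree_rev)
qed

end

section \<open>Homogeneous bipartite graphs\<close>

text \<open>A connected semiregular bipartite graph. A colour function instead of two parts lets
  lemmas with a colour parameter treat both sides at once.\<close>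

locale bip_graph =
  fixes G :: "'a dg" and col :: "'a \<Rightarrow> bool" and dgr :: "bool \<Rightarrow> nat"
  assumes adj_verts: "uadj G x y \<Longrightarrow> x \<in> verts G"
    and adj_col: "uadj G x y \<Longrightarrow> col x \<noteq> col y"
    and conn: "uconnected G"
    and finite_N: "x \<in> verts G \<Longrightarrow> finite {y. uadj G x y}"
    and card_N: "x \<in> verts G \<Longrightarrow> card {y. uadj G x y} = dgr (col x)"
    and dgr_pos: "dgr c \<ge> 1"
begin

abbreviation V :: "'a set" where "V \<equiv> verts G"
abbreviation adj :: "'a \<Rightarrow> 'a \<Rightarrow> bool" where "adj \<equiv> uadj G"
definition N :: "'a \<Rightarrow> 'a set" where "N x = {y. adj x y}"

lemma adj_sym: "adj x y \<Longrightarrow> adj y x" by (simp add: uadj_commute)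

lemma in_N [simp]: "y \<in> N x \<longleftrightarrow> adj x y" by (simp add: N_def)

lemma adj_irrefl: "\<not> adj x x" using adj_col by blast

lemma adj_verts2: "adj x y \<Longrightarrow> y \<in> V" using adj_verts adj_sym by blast

lemma N_fin: "x \<in> V \<Longrightarrow> finite (N x)" and N_card: "x \<in> V \<Longrightarrow> card (N x) = dgr (col x)"
  using finite_N card_N by (simp_all add: N_def)

lemma connD: "x \<in> V \<Longrightarrow> y \<in> V \<Longrightarrow> (x, y) \<in> (ugraph G)\<^sup>*"
  using conn connected_on_rtrancl by (fastforce simp: uconnected_iff)

lemma graph_induct:
  assumes "x \<in> V" "P x" "\<And>u v. P u \<Longrightarrow> adj u v \<Longrightarrow> P v" "y \<in> V" shows "P y"
  using connD[OF assms(1,4)] by (induction rule: rtrancl_induct) (use assms in \<open>auto simp: ugraph_def\<close>)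

lemma has_nbr: "x \<in> V \<Longrightarrow> \<exists>y. adj x y"
  using N_card[of x] dgr_pos[of "col x"] by (metis card.empty ex_in_conv in_N not_one_le_zero)

lemma colour_vertex: "\<exists>x\<in>V. col x = c"
proof -
  obtain x where "x \<in> V" using conn by (auto simp: uconnected_def)
  then obtain y where "adj x y" using has_nbr by blast
  then show ?thesis using \<open>x \<in> V\<close> adj_col adj_verts2 by metis
qed

lemma isomorphic_K_bip:
  assumes fin: "finite V" and c: "\<And>z w. z \<in> V \<Longrightarrow> w \<in> V \<Longrightarrow> adj z w \<longleftrightarrow> col z \<noteq> col w"
  shows "listed_graph G"
proof -
  define X where "X = {z \<in> V. col z}"
  define Y where "Y = {z \<in> V. \<not> col z}"
  have fXY: "finite X" "finite Y" using fin by (auto simp: X_def Y_def)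
  obtain hX where hX: "bij_betw hX X {0..<card X}" using ex_bij_betw_finite_nat[OF fXY(1)] by blast
  obtain hY where hY: "bij_betw hY Y {0..<card Y}" using ex_bij_betw_finite_nat[OF fXY(2)] by blast
  define f where "f z = (if col z then (False, hX z) else (True, hY z))" for z
  have "bij_betw f V (verts (K_bip (card X) (card Y)))"
  proof (rule bij_betw_imageI)
    show "inj_on f V"
      using bij_betw_imp_inj_on[OF hX] bij_betw_imp_inj_on[OF hY]
      by (auto simp: f_def X_def Y_def inj_on_def)
    show "f ` V = verts (K_bip (card X) (card Y))"
    proof (intro set_eqI iffI)
      fix p assume "p \<in> f ` V"
      then obtain z where z: "z \<in> V" "p = f z" by blast
      show "p \<in> verts (K_bip (card X) (card Y))"
        using bij_betwE[OF hX] bij_betwE[OF hY] z by (cases "col z") (auto simp: f_def K_bip_def X_def Y_def)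
    next
      fix p assume "p \<in> verts (K_bip (card X) (card Y))"
      then consider i where "p = (False, i)" "i < card X" | i where "p = (True, i)" "i < card Y"
        by (auto simp: K_bip_def)
      then show "p \<in> f ` V"
      proof cases
        case 1
        then obtain z where "z \<in> X" "hX z = i" using hX by (metis atLeastLessThan_iff bij_betw_def imageE zero_le)
        then show ?thesis using 1 by (auto simp: f_def X_def intro!: image_eqI[of _ _ z])
      next
        case 2
        then obtain z where "z \<in> Y" "hY z = i" using hY by (metis atLeastLessThan_iff bij_betw_def imageE zero_le)
        then show ?thesis using 2 by (auto simp: f_def Y_def intro!: image_eqI[of _ _ z])
      qed
    qed
  qed
  moreover have "uadj (K_bip (card X) (card Y)) (f x) (f y) \<longleftrightarrow> col x \<noteq> col y" if "x \<in> V" "y \<in> V" for x y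
    using bij_betwE[OF hX] bij_betwE[OF hY] that
    by (cases "col x"; cases "col y") (auto simp: uadj_def K_bip_def f_def X_def Y_def)
  ultimately have "u_isomorphic G (K_bip (card X) (card Y))"
    unfolding u_isomorphic_def using c by (intro exI[of _ f]) simp
  moreover have "card X \<ge> 1" "card Y \<ge> 1"
    using colour_vertex[of True] colour_vertex[of False] fXY by (auto simp: X_def Y_def Suc_le_eq card_gt_0_iff)
  ultimately show ?thesis unfolding listed_graph_def by blast
qed

text \<open>Along any walk from \<open>x0\<close>, vertices of colour \<open>c\<close> keep the
  neighbourhood of \<open>x0\<close>, so connectedness makes the graph complete bipartite.\<close>

lemma listed_if_twins:
  assumes "\<And>x x' y. adj x y \<Longrightarrow> adj x' y \<Longrightarrow> col x = c \<Longrightarrow> N x = N x'"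
  shows "listed_graph G"
proof -
  obtain x0 where x0: "x0 \<in> V" "col x0 = c" using colour_vertex by blast
  have all: "(col z = c \<longrightarrow> N z = N x0) \<and> (col z \<noteq> c \<longrightarrow> z \<in> N x0)" if "z \<in> V" for z
  proof (rule graph_induct[OF x0(1) _ _ that])
    show "(col x0 = c \<longrightarrow> N x0 = N x0) \<and> (col x0 \<noteq> c \<longrightarrow> x0 \<in> N x0)" using x0 by simp
    fix u v assume u: "(col u = c \<longrightarrow> N u = N x0) \<and> (col u \<noteq> c \<longrightarrow> u \<in> N x0)" and uv: "adj u v"
    show "(col v = c \<longrightarrow> N v = N x0) \<and> (col v \<noteq> c \<longrightarrow> v \<in> N x0)"
    proof (cases "col u = c")
      case True
      then have "v \<in> N x0" using u uv in_N by blast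
      then show ?thesis using True adj_col[OF uv] by auto
    next
      case False
      then have "adj x0 u" using u by simp
      then show ?thesis using assms[OF _ adj_sym[OF uv]] x0 adj_col[OF uv] False by blast
    qed
  qed
  obtain y0 where y0: "adj x0 y0" using has_nbr x0 by blast
  have adj: "adj z w \<longleftrightarrow> col z \<noteq> col w" if "z \<in> V" "w \<in> V" for z w
  proof
    assume ne: "col z \<noteq> col w"
    show "adj z w"
    proof (cases "col z = c")
      case True
      then show ?thesis using all[OF that(1)] all[OF that(2)] ne in_N by metis
    next
      case False
      then show ?thesis using all[OF that(1)] all[OF that(2)] ne in_N adj_sym by metis
    qed
  qed (rule adj_col)
  have "V \<subseteq> N x0 \<union> N y0"
  proof
    fix z assume z: "z \<in> V"
    show "z \<in> N x0 \<union> N y0"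
    proof (cases "col z = c")
      case True
      then have "adj z y0" using adj[OF z adj_verts2[OF y0]] adj_col[OF y0] x0 by simp
      then show ?thesis using adj_sym by simp
    next
      case False
      then show ?thesis using all[OF z] by simp
    qed
  qed
  then have "finite V" using N_fin x0 adj_verts2[OF y0] by (meson finite_UnI finite_subset)
  then show ?thesis by (rule isomorphic_K_bip[OF _ adj])
qed

lemma isomorphic_CP:
  assumes fin: "finite V" and bij: "bij_betw \<eta> {z \<in> V. col z = c} {z \<in> V. col z \<noteq> c}"
    and c: "\<And>z w. z \<in> V \<Longrightarrow> w \<in> V \<Longrightarrow> col z = c \<Longrightarrow> col w \<noteq> c \<Longrightarrow> adj z w \<longleftrightarrow> w \<noteq> \<eta> z"
  shows "listed_graph G"
proof -
  define X where "X = {z \<in> V. col z = c}"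
  define Y where "Y = {z \<in> V. col z \<noteq> c}"
  define \<theta> where "\<theta> = inv_into X \<eta>"
  have bij': "bij_betw \<eta> X Y" using bij by (simp add: X_def Y_def)
  then have b\<theta>: "bij_betw \<theta> Y X" unfolding \<theta>_def by (rule bij_betw_inv_into)
  have \<theta>: "\<eta> (\<theta> y) = y" "\<theta> y \<in> X" if "y \<in> Y" for y
    using bij' that b\<theta> by (auto simp: \<theta>_def bij_betw_inv_into_right bij_betwE)
  have \<theta>\<eta>: "\<theta> (\<eta> x) = x" "\<eta> x \<in> Y" if "x \<in> X" for x
    using bij' that by (auto simp: \<theta>_def bij_betw_inv_into_left bij_betwE)
  have fX: "finite X" using fin by (auto simp: X_def)
  obtain h where h: "bij_betw h X {0..<card X}" using ex_bij_betw_finite_nat[OF fX] by blast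
  have hinj: "h x = h x' \<longleftrightarrow> x = x'" if "x \<in> X" "x' \<in> X" for x x'
    using bij_betw_imp_inj_on[OF h] that by (auto dest: inj_onD)
  have hlt: "h x < card X" if "x \<in> X" for x using bij_betwE[OF h] that by auto
  define f where "f z = (if col z = c then (False, h z) else (True, h (\<theta> z)))" for z
  have XY: "z \<in> X \<or> z \<in> Y" if "z \<in> V" for z using that by (auto simp: X_def Y_def)
  have fX': "f z = (False, h z)" if "z \<in> X" for z using that by (simp add: f_def X_def)
  have fY': "f z = (True, h (\<theta> z))" if "z \<in> Y" for z using that by (simp add: f_def Y_def)
  have "bij_betw f V (verts (CP_graph (card X)))"
  proof (rule bij_betw_imageI)
    show "inj_on f V"
    proof (rule inj_onI)
      fix z w assume zw: "z \<in> V" "w \<in> V" "f z = f w"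
      show "z = w"
      proof (cases "z \<in> X")
        case True
        then have "w \<in> X" using zw XY[of w] fX'[of z] fY'[of w] by auto
        then show ?thesis using True zw fX' hinj by simp
      next
        case False
        then have z: "z \<in> Y" using XY zw by blast
        then have w: "w \<in> Y" using zw XY[of w] fY'[of z] fX'[of w] by auto
        have "\<theta> z = \<theta> w" using zw(3) fY' z w hinj \<theta> by simp
        then show ?thesis using \<theta> z w by metis
      qed
    qed
    show "f ` V = verts (CP_graph (card X))"
    proof (intro set_eqI iffI)
      fix p assume "p \<in> f ` V"
      then obtain z where z: "z \<in> V" "p = f z" by blast
      then show "p \<in> verts (CP_graph (card X))"
        using XY[OF z(1)] fX'[of z] fY'[of z] hlt \<theta> by (auto simp: CP_graph_def)
    next
      fix p assume "p \<in> verts (CP_graph (card X))"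
      then obtain b i where p: "p = (b, i)" "i < card X" by (auto simp: CP_graph_def)
      then obtain x where x: "x \<in> X" "h x = i" using h by (metis atLeastLessThan_iff bij_betw_def imageE zero_le)
      show "p \<in> f ` V"
      proof (cases b)
        case False
        then show ?thesis using x p fX' by (auto simp: X_def intro!: image_eqI[of _ _ x])
      next
        case True
        then have "f (\<eta> x) = p" using x p fY' \<theta>\<eta> by simp
        moreover have "\<eta> x \<in> V" using \<theta>\<eta>(2)[OF x(1)] by (simp add: Y_def)
        ultimately show ?thesis by blast
      qed
    qed
  qed
  moreover have "adj x y \<longleftrightarrow> uadj (CP_graph (card X)) (f x) (f y)" if xy: "x \<in> V" "y \<in> V" for x y
  proof -
    have one: "adj x y \<longleftrightarrow> uadj (CP_graph (card X)) (f x) (f y)" if "x \<in> X" "y \<in> Y" for x y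
    proof -
      have "adj x y \<longleftrightarrow> y \<noteq> \<eta> x" using c that by (simp add: X_def Y_def)
      also have "\<dots> \<longleftrightarrow> \<theta> y \<noteq> x" using \<theta> \<theta>\<eta> that by metis
      also have "\<dots> \<longleftrightarrow> h x \<noteq> h (\<theta> y)" using hinj \<theta> that by metis
      finally show ?thesis using that hlt \<theta> by (auto simp: fX' fY' uadj_def CP_graph_def)
    qed
    have two: "\<not> uadj (CP_graph (card X)) (f x) (f y)" "\<not> adj x y" if "x \<in> X \<and> y \<in> X \<or> x \<in> Y \<and> y \<in> Y" for x y
      using that adj_col[of x y] by (auto simp: fX' fY' uadj_def CP_graph_def X_def Y_def)
    consider "x \<in> X" "y \<in> Y" | "x \<in> Y" "y \<in> X" | "x \<in> X \<and> y \<in> X \<or> x \<in> Y \<and> y \<in> Y" using XY xy by blast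
    then show ?thesis
    proof cases
      case 1 then show ?thesis using one by blast
    next
      case 2 then show ?thesis using one uadj_commute by metis
    next
      case 3 then show ?thesis using two by blast
    qed
  qed
  ultimately have "u_isomorphic G (CP_graph (card X))"
    unfolding u_isomorphic_def by (intro exI[of _ f]) simp
  moreover have "card X \<ge> 1" using colour_vertex[of c] fX by (auto simp: X_def Suc_le_eq card_gt_0_iff)
  ultimately show ?thesis unfolding listed_graph_def by blast
qed

section \<open>Trees, and graphs with all degrees two\<close>

definition is_cyc :: "'a list \<Rightarrow> bool" where
  "is_cyc xs \<longleftrightarrow> length xs \<ge> 3 \<and> distinct xs \<and> successively adj xs \<and> adj (last xs) (hd xs)"

lemma successively_verts: "successively adj xs \<Longrightarrow> length xs \<ge> 2 \<Longrightarrow> set xs \<subseteq> V"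
proof (induction xs rule: induct_list012)
  case (3 x y zs)
  then show ?case using adj_verts adj_verts2 by (cases zs) auto
qed auto

lemma not_acyclic: "\<not> uacyclic G \<longleftrightarrow> (\<exists>xs. is_cyc xs)"
proof
  assume "\<not> uacyclic G"
  then show "\<exists>xs. is_cyc xs" by (auto simp: uacyclic_def is_cyc_def successively_conv_nth)
next
  assume "\<exists>xs. is_cyc xs"
  then obtain xs where xs: "is_cyc xs" by blast
  then have "set xs \<subseteq> V" using successively_verts[of xs] by (auto simp: is_cyc_def)
  then show "\<not> uacyclic G" using xs unfolding uacyclic_def is_cyc_def successively_conv_nth by blast
qed

text \<open>With all degrees at least two, a path in an acyclic graph can always be prolonged, so
  the graph is infinite.\<close>

lemma tree_case:
  assumes ac: "uacyclic G" and deg: "dgr True \<ge> 2" "dgr False \<ge> 2"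
  shows "listed_graph G"
proof -
  have deg': "dgr c \<ge> 2" for c using deg by (cases c) auto
  have walk: "\<exists>v w ws. distinct (v # w # ws) \<and> successively adj (v # w # ws) \<and> length ws = n" for n
  proof (induction n)
    case 0
    obtain v where "v \<in> V" using colour_vertex by blast
    then obtain w where "adj v w" using has_nbr by blast
    then show ?case using adj_irrefl by (intro exI[of _ v] exI[of _ w] exI[of _ "[]"]) auto
  next
    case (Suc n)
    then obtain v w ws where ws: "distinct (v # w # ws)" "successively adj (v # w # ws)" "length ws = n" by blast
    have v: "v \<in> V" using ws adj_verts by auto
    have "\<not> N v \<subseteq> {w}"
    proof
      assume "N v \<subseteq> {w}"
      then have "card (N v) \<le> 1" using card_mono[of "{w}" "N v"] by simp
      then show False using N_card[OF v] deg'[of "col v"] by simp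
    qed
    then obtain u where "u \<in> N v" "u \<notin> {w}" by (meson subsetI)
    then have u: "adj v u" "u \<noteq> w" by simp_all
    have "u \<notin> set (v # w # ws)"
    proof
      assume "u \<in> set (v # w # ws)"
      then have "u \<in> set ws" using u adj_irrefl by auto
      then obtain as bs where "ws = as @ u # bs" by (meson split_list)
      then have "is_cyc (v # w # as @ [u])"
        using ws u by (auto simp: is_cyc_def successively_append_iff adj_sym successively_Cons hd_append split: if_splits)
      then show False using ac not_acyclic by blast
    qed
    then show ?case using ws u adj_sym
      by (intro exI[of _ u] exI[of _ v] exI[of _ "w # ws"]) auto
  qed
  have "infinite V"
  proof
    assume fin: "finite V"
    obtain v w ws where ws: "distinct (v # w # ws)" "successively adj (v # w # ws)" "length ws = card V"
      using walk by blast
    have "set (v # w # ws) \<subseteq> V" by (rule successively_verts[OF ws(2)]) simp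
    then have "card (set (v # w # ws)) \<le> card V" using fin by (intro card_mono) auto
    then show False using distinct_card[OF ws(1)] ws(3) by simp
  qed
  let ?X = "{x \<in> V. col x}" and ?Y = "{x \<in> V. \<not> col x}"
  have "?X \<inter> ?Y = {} \<and> ?X \<union> ?Y = V \<and> (\<forall>x\<in>V. \<forall>y\<in>V. adj x y \<longrightarrow> (x \<in> ?X \<longleftrightarrow> y \<in> ?Y))
      \<and> (\<forall>x\<in>?X. finite {w. adj x w} \<and> card {w. adj x w} = dgr True)
      \<and> (\<forall>y\<in>?Y. finite {w. adj y w} \<and> card {w. adj y w} = dgr False)"
    using finite_N card_N adj_col by auto
  then have "is_T_ab G (dgr True) (dgr False)"
    unfolding is_T_ab_def is_tree_def using ac conn \<open>infinite V\<close> by blast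
  then have "\<exists>a b. a \<ge> 1 \<and> b \<ge> 1 \<and> is_T_ab G a b"
    using dgr_pos[of True] dgr_pos[of False] by metis
  then show ?thesis unfolding listed_graph_def by (intro disjI2)
qed

lemma alternate:
  assumes "successively adj xs" "i < length xs" shows "col (xs ! i) = (col (xs ! 0) = even i)"
  using assms(2)
proof (induction i)
  case (Suc i)
  then have "adj (xs ! i) (xs ! Suc i)" using assms(1) by (simp add: successively_conv_nth)
  then show ?case using adj_col Suc by auto
qed simp

lemma cyc_even: assumes "is_cyc xs" shows "even (length xs)" "length xs \<ge> 4"
proof -
  have xs: "length xs \<ge> 3" "successively adj xs" "adj (last xs) (hd xs)" using assms by (auto simp: is_cyc_def)
  have ne: "xs \<noteq> []" using xs(1) by auto
  have "col (xs ! (length xs - 1)) = (col (xs ! 0) = even (length xs - 1))"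
    by (rule alternate[OF xs(2)]) (use ne in simp)
  moreover have "col (xs ! (length xs - 1)) \<noteq> col (xs ! 0)"
    using adj_col[OF xs(3)] ne by (simp add: last_conv_nth hd_conv_nth)
  ultimately have "odd (length xs - 1)" by blast
  then show "even (length xs)" using ne by simp
  then show "length xs \<ge> 4" using xs(1) by (cases "length xs = 3") auto
qed

text \<open>Rotation by one step changes the colour of the first vertex, so cycles can be made to
  start with a prescribed colour.\<close>

lemma cyc_rotate: assumes "is_cyc (x # xs)" shows "is_cyc (xs @ [x])"
proof -
  have xs: "xs \<noteq> []" "successively adj xs" "adj x (hd xs)" "adj (last xs) x"
    using assms by (auto simp: is_cyc_def successively_Cons split: if_splits)
  then have "successively adj (xs @ [x])" unfolding successively_append_iff by simp
  then show ?thesis using xs assms by (auto simp: is_cyc_def)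
qed

lemma cyc_succ_adj:
  assumes "is_cyc xs" "i < length xs" shows "adj (xs ! i) (xs ! (Suc i mod length xs))"
proof (cases "Suc i < length xs")
  case True then show ?thesis using assms by (simp add: is_cyc_def successively_conv_nth)
next
  case False
  then have "i = length xs - 1" "xs \<noteq> []" "Suc i = length xs" using assms by auto
  then show ?thesis using assms(1) by (simp add: is_cyc_def last_conv_nth hd_conv_nth)
qed

text \<open>Each vertex of the cycle has both its neighbours on the cycle, so by connectedness the
  cycle is the whole graph.\<close>

lemma cycle_case:
  assumes xs: "is_cyc xs" and deg: "\<And>c. dgr c = 2"
  shows "listed_graph G"
proof -
  let ?n = "length xs"
  have n: "?n \<ge> 3" and d: "distinct xs" using xs by (auto simp: is_cyc_def)
  have xsV: "set xs \<subseteq> V" using successively_verts[of xs] xs by (auto simp: is_cyc_def)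
  define sc where "sc i = Suc i mod ?n" for i
  define pr where "pr i = (if i = 0 then ?n - 1 else i - 1)" for i
  have lt: "sc i < ?n" "pr i < ?n" if "i < ?n" for i
    using n that by (auto simp: sc_def pr_def intro: mod_less_divisor)
  have sp: "sc (pr i) = i" if "i < ?n" for i using n that by (auto simp: sc_def pr_def)
  have ne: "sc i \<noteq> pr i" if "i < ?n" for i
    using n that by (cases "Suc i = ?n") (auto simp: sc_def pr_def)
  have Neq: "N (xs ! i) = {xs ! sc i, xs ! pr i}" if i: "i < ?n" for i
  proof (rule card_seteq[symmetric])
    have v: "xs ! i \<in> V" using xsV i by (meson nth_mem subsetD)
    show "finite (N (xs ! i))" by (rule N_fin[OF v])
    have "adj (xs ! i) (xs ! sc i)" unfolding sc_def using cyc_succ_adj[OF xs i] .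
    moreover have "adj (xs ! pr i) (xs ! sc (pr i))" unfolding sc_def using cyc_succ_adj[OF xs lt(2)[OF i]] .
    then have "adj (xs ! i) (xs ! pr i)" using sp[OF i] adj_sym by simp
    ultimately show "{xs ! sc i, xs ! pr i} \<subseteq> N (xs ! i)" by simp
    have "xs ! sc i \<noteq> xs ! pr i" using ne[OF i] lt[OF i] d by (simp add: nth_eq_iff_index_eq)
    then show "card (N (xs ! i)) \<le> card {xs ! sc i, xs ! pr i}" using N_card[OF v] deg by simp
  qed
  have "y \<in> set xs" if "y \<in> V" for y
  proof (rule graph_induct[OF _ _ _ that])
    show "xs ! 0 \<in> V" "xs ! 0 \<in> set xs" using n xsV by (metis nth_mem length_greater_0_conv list.size(3) not_numeral_le_zero subsetD)+
    fix u v assume "u \<in> set xs" "adj u v"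
    then obtain i where "i < ?n" "u = xs ! i" "v \<in> N (xs ! i)" by (auto simp: in_set_conv_nth)
    then show "v \<in> set xs" using Neq[of i] lt[of i] by (auto simp: in_set_conv_nth)
  qed
  then have V: "V = set xs" using xsV by blast
  define f where "f = the_inv_into {..<?n} (\<lambda>i. xs ! i)"
  have bij: "bij_betw (\<lambda>i. xs ! i) {..<?n} V"
    unfolding V using bij_betw_nth[OF d refl refl] by simp
  have bf: "bij_betw f V {..<?n}" unfolding f_def by (rule bij_betw_the_inv_into[OF bij])
  have fx: "f (xs ! i) = i" if "i < ?n" for i
    unfolding f_def using the_inv_into_f_f[OF bij_betw_imp_inj_on[OF bij]] that by simp
  have "adj x y \<longleftrightarrow> uadj (cycle_graph ?n) (f x) (f y)" if xy: "x \<in> V" "y \<in> V" for x y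
  proof -
    obtain i j where ij: "i < ?n" "x = xs ! i" "j < ?n" "y = xs ! j" using xy V by (auto simp: in_set_conv_nth)
    have "adj x y \<longleftrightarrow> y \<in> {xs ! sc i, xs ! pr i}" using Neq[OF ij(1)] ij in_N by metis
    also have "\<dots> \<longleftrightarrow> j = sc i \<or> j = pr i" using ij lt[OF ij(1)] d by (simp add: nth_eq_iff_index_eq)
    also have "j = pr i \<longleftrightarrow> i = sc j"
    proof
      assume "i = sc j"
      then show "j = pr i" using ij by (cases "Suc j = ?n") (auto simp: sc_def pr_def)
    qed (use sp ij in simp)
    finally show ?thesis using fx ij by (auto simp: uadj_def cycle_graph_def sc_def)
  qed
  then have "u_isomorphic G (cycle_graph ?n)"
    unfolding u_isomorphic_def using bf by (intro exI[of _ f]) (simp add: cycle_graph_def)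
  then show ?thesis using cyc_even[OF xs] unfolding listed_graph_def by blast
qed

end

text \<open>Homogeneity for colour-preserving isomorphisms between connected subgraphs, in the list
  form of \<open>homogeneous_list\<close>.\<close>

locale hom_bip = bip_graph +
  assumes hom: "\<lbrakk>distinct xs; distinct ys; set xs \<subseteq> verts G; set ys \<subseteq> verts G; xs \<noteq> []; length ys = length xs;
      \<And>i. i < length xs \<Longrightarrow> col (xs ! i) = col (ys ! i);
      \<And>i. 0 < i \<Longrightarrow> i < length xs \<Longrightarrow> \<exists>j<i. uadj G (xs ! j) (xs ! i);
      \<And>i j. i < length xs \<Longrightarrow> j < length xs \<Longrightarrow> uadj G (xs ! i) (xs ! j) \<longleftrightarrow> uadj G (ys ! i) (ys ! j)\<rbrakk>
    \<Longrightarrow> \<exists>g. bij_betw g (verts G) (verts G) \<and> (\<forall>x\<in>verts G. \<forall>y\<in>verts G. uadj G (g x) (g y) \<longleftrightarrow> uadj G x y) \<and> map g xs = ys"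
begin

definition aut :: "('a \<Rightarrow> 'a) \<Rightarrow> bool" where
  "aut g \<longleftrightarrow> bij_betw g V V \<and> (\<forall>x\<in>V. \<forall>y\<in>V. adj (g x) (g y) \<longleftrightarrow> adj x y)"

lemma aut_adj: "aut g \<Longrightarrow> adj x y \<Longrightarrow> adj (g x) (g y)"
  unfolding aut_def using adj_verts adj_verts2 by blast

lemma aut_inj: "aut g \<Longrightarrow> x \<in> V \<Longrightarrow> y \<in> V \<Longrightarrow> g x = g y \<longleftrightarrow> x = y"
  unfolding aut_def bij_betw_def using inj_on_eq_iff by fastforce

lemma aut_N: assumes g: "aut g" and x: "x \<in> V" shows "g ` N x = N (g x)"
proof (intro set_eqI iffI)
  fix w assume "w \<in> g ` N x"
  then show "w \<in> N (g x)" using aut_adj[OF g] by auto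
next
  fix w assume "w \<in> N (g x)"
  then have w: "adj (g x) w" by simp
  then have "w \<in> g ` V" using g adj_verts2 by (auto simp: aut_def bij_betw_def)
  then obtain v where "v \<in> V" "w = g v" by blast
  then show "w \<in> g ` N x" using w g x by (auto simp: aut_def)
qed

lemma N_V: "N x \<subseteq> V" using adj_verts2 by auto

lemma aut_Int: assumes g: "aut g" and x: "A \<subseteq> V" "B \<subseteq> V" shows "g ` (A \<inter> B) = g ` A \<inter> g ` B"
proof (rule inj_on_image_Int[of g V])
  show "inj_on g V" using g by (simp add: aut_def bij_betw_def)
qed (use x in auto)

lemma aut_card: assumes g: "aut g" and x: "A \<subseteq> V" shows "card (g ` A) = card A"
  by (rule card_image) (use g x in \<open>auto simp: aut_def bij_betw_def intro: inj_on_subset\<close>)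

lemma hom_lists:
  assumes "distinct xs" "distinct ys" "set xs \<subseteq> V" "set ys \<subseteq> V" "xs \<noteq> []" "length ys = length xs"
    and "\<And>i. i < length xs \<Longrightarrow> col (xs ! i) = col (ys ! i)"
    and "\<And>i. 0 < i \<Longrightarrow> i < length xs \<Longrightarrow> \<exists>j<i. adj (xs ! j) (xs ! i)"
    and "\<And>i j. i < length xs \<Longrightarrow> j < length xs \<Longrightarrow> adj (xs ! i) (xs ! j) \<longleftrightarrow> adj (ys ! i) (ys ! j)"
  shows "\<exists>g. aut g \<and> map g xs = ys"
  using hom[OF assms] unfolding aut_def by blast

lemma hom_swap:
  assumes zs: "distinct zs" "set zs \<subseteq> V" "\<And>i. 0 < i \<Longrightarrow> i < length zs \<Longrightarrow> \<exists>j<i. adj (zs ! j) (zs ! i)"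
    and u: "u \<in> V" "u' \<in> V" "u \<notin> set zs" "u' \<notin> set zs" "col u = col u'"
    and adj: "\<And>z. z \<in> set zs \<Longrightarrow> adj z u \<longleftrightarrow> adj z u'" and ex: "\<exists>z\<in>set zs. adj z u"
  shows "\<exists>g. aut g \<and> (\<forall>z\<in>set zs. g z = z) \<and> g u = u'"
proof -
  let ?n = "length zs"
  have "\<exists>g. aut g \<and> map g (zs @ [u]) = zs @ [u']"
  proof (rule hom_lists)
    fix i assume i: "0 < i" "i < length (zs @ [u])"
    show "\<exists>j<i. adj ((zs @ [u]) ! j) ((zs @ [u]) ! i)"
    proof (cases "i < ?n")
      case True
      then obtain j where "j < i" "adj (zs ! j) (zs ! i)" using zs(3) i by blast
      then show ?thesis using True by (intro exI[of _ j]) (simp add: nth_append)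
    next
      case False
      then have "i = ?n" using i by simp
      moreover obtain j where "j < ?n" "adj (zs ! j) u" using ex by (auto simp: in_set_conv_nth)
      ultimately show ?thesis by (intro exI[of _ j]) (simp add: nth_append)
    qed
  next
    fix i j assume ij: "i < length (zs @ [u])" "j < length (zs @ [u])"
    have e: "(zs @ [a]) ! k = (if k < ?n then zs ! k else a)" if "k < length (zs @ [u])" for k a
      using that by (simp add: nth_append)
    have l: "adj (zs ! k) u \<longleftrightarrow> adj (zs ! k) u'" "adj u (zs ! k) \<longleftrightarrow> adj u' (zs ! k)" if "k < ?n" for k
      using adj[OF nth_mem[OF that]] by (simp_all add: uadj_commute[of G _ "zs ! k"])
    show "adj ((zs @ [u]) ! i) ((zs @ [u]) ! j) \<longleftrightarrow> adj ((zs @ [u']) ! i) ((zs @ [u']) ! j)"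
      unfolding e[OF ij(1)] e[OF ij(2)] using l[of i] l[of j] adj_irrefl by simp
  qed (use zs u in \<open>auto simp: nth_append\<close>)
  then obtain g where g: "aut g" "map g (zs @ [u]) = zs @ [u']" by blast
  then have "map g zs = zs" "g u = u'" by auto
  then show ?thesis using g(1) by (metis map_eq_conv map_ident)
qed

text \<open>Neighbours of \<open>x\<close> share a colour and are pairwise non-adjacent, so any two
  lists of equally many of them span isomorphic stars.\<close>

lemma star_hom:
  assumes x: "x \<in> V" and us: "distinct us" "distinct vs" "set us \<subseteq> N x" "set vs \<subseteq> N x" "length us = length vs"
  shows "\<exists>g. aut g \<and> g x = x \<and> map g us = vs"
proof -
  have nadj: "\<not> adj u v" if "u \<in> N x" "v \<in> N x" for u v using that adj_col by (metis in_N)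
  have mem: "us ! k \<in> N x" "vs ! k \<in> N x" if "k < length us" for k
    using us that nth_mem[of k us] nth_mem[of k vs] by (simp_all only: subset_iff)
  have xu: "x \<notin> set us" "x \<notin> set vs" using us adj_irrefl by auto
  have "\<exists>g. aut g \<and> map g (x # us) = x # vs"
  proof (rule hom_lists)
    fix i assume i: "0 < i" "i < length (x # us)"
    then obtain k where k: "i = Suc k" by (cases i) auto
    then have "us ! k \<in> N x" using i mem[of k] by simp
    then show "\<exists>j<i. adj ((x # us) ! j) ((x # us) ! i)"
      using k by (intro exI[of _ 0]) simp
  next
    fix i assume i: "i < length (x # us)"
    show "col ((x # us) ! i) = col ((x # vs) ! i)"
    proof (cases i)
      case (Suc k)
      then have "us ! k \<in> N x" "vs ! k \<in> N x" using i mem[of k] by simp_all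
      then have "col x \<noteq> col (us ! k)" "col x \<noteq> col (vs ! k)" using adj_col in_N by blast+
      then show ?thesis using Suc by auto
    qed simp
  next
    fix i j assume ij: "i < length (x # us)" "j < length (x # us)"
    show "adj ((x # us) ! i) ((x # us) ! j) \<longleftrightarrow> adj ((x # vs) ! i) ((x # vs) ! j)"
    proof (cases i)
      case 0
      show ?thesis
      proof (cases j)
        case (Suc l)
        then have "us ! l \<in> N x" "vs ! l \<in> N x" using ij mem[of l] by simp_all
        then show ?thesis using 0 Suc by simp
      qed (use 0 in simp)
    next
      case (Suc k)
      then have k: "us ! k \<in> N x" "vs ! k \<in> N x" using ij mem[of k] by simp_all
      show ?thesis
      proof (cases j)
        case 0
        then show ?thesis using k Suc adj_sym by auto
      next
        case (Suc l)
        then have "us ! l \<in> N x" "vs ! l \<in> N x" using ij mem[of l] by simp_all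
        then show ?thesis using Suc \<open>i = Suc k\<close> k nadj by simp
      qed
    qed
  qed (use x us xu N_V[of x] in auto)
  then show ?thesis by auto
qed

section \<open>Excluding girth greater than four\<close>

definition girth :: nat where
  "girth = (LEAST n. \<exists>xs. is_cyc xs \<and> length xs = n)"

lemma girth_le: "is_cyc xs \<Longrightarrow> girth \<le> length xs"
  unfolding girth_def by (rule Least_le) blast

lemma girth_cyc: "is_cyc xs \<Longrightarrow> \<exists>xs. is_cyc xs \<and> length xs = girth"
  unfolding girth_def by (rule LeastI_ex) blast

lemma short_path_induced:
  assumes xs: "distinct xs" "successively adj xs" "length xs < girth"
    and ij: "i < j" "j < length xs" "adj (xs ! i) (xs ! j)"
  shows "j = Suc i"
proof (rule ccontr)
  assume "j \<noteq> Suc i"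
  then have j: "j \<ge> Suc (Suc i)" using ij by simp
  define ys where "ys = take (Suc (j - i)) (drop i xs)"
  have len: "length ys = Suc (j - i)" using ij by (simp add: ys_def)
  have nth: "ys ! k = xs ! (i + k)" if "k < length ys" for k using that len ij by (simp add: ys_def)
  have "successively adj ys" unfolding successively_conv_nth
    using nth len xs(2) ij by (auto simp: successively_conv_nth)
  moreover have "distinct ys" using xs(1) by (simp add: ys_def)
  moreover have "last ys = xs ! j" "hd ys = xs ! i"
    using nth[of 0] nth[of "j - i"] len ij by (auto simp: last_conv_nth hd_conv_nth simp flip: length_greater_0_conv)
  ultimately have "is_cyc ys" using len j ij(3) adj_sym by (auto simp: is_cyc_def)
  then show False using girth_le[of ys] len xs(3) ij by simp
qed

lemma path_hom:
  assumes xs: "distinct xs" "successively adj xs" "length xs < girth" "length xs \<ge> 2"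
    and ys: "distinct ys" "successively adj ys" "length ys = length xs" and col: "col (xs ! 0) = col (ys ! 0)"
  shows "\<exists>g. aut g \<and> map g xs = ys"
proof (rule hom_lists)
  have ad: "adj (zs ! i) (zs ! j) \<longleftrightarrow> j = Suc i \<or> i = Suc j"
    if zs: "distinct zs" "successively adj zs" "length zs = length xs" and ij: "i < length zs" "j < length zs" for zs i j
  proof -
    have lt: "length zs < girth" using zs xs by simp
    have "adj (zs ! i) (zs ! Suc i)" if "Suc i < length zs" for i using zs that by (simp add: successively_conv_nth)
    then show ?thesis
      using short_path_induced[OF zs(1,2) lt, of i j] short_path_induced[OF zs(1,2) lt, of j i] ij adj_sym adj_irrefl
      by (metis linorder_neqE_nat)
  qed
  show "set xs \<subseteq> V" "set ys \<subseteq> V" using successively_verts xs ys by auto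
  fix i j assume ij: "i < length xs" "j < length xs"
  show "adj (xs ! i) (xs ! j) \<longleftrightarrow> adj (ys ! i) (ys ! j)"
    using ad[OF xs(1,2) refl ij] ad[OF ys, of i j] ij ys by simp
next
  fix i assume i: "i < length xs"
  show "col (xs ! i) = col (ys ! i)" using alternate[OF xs(2)] alternate[OF ys(2)] i ys(3) col by simp
next
  fix i assume i: "0 < i" "i < length xs"
  then have "adj (xs ! (i - 1)) (xs ! i)" using xs(2) by (metis Suc_pred' successively_conv_nth)
  then show "\<exists>j<i. adj (xs ! j) (xs ! i)" using i by (intro exI[of _ "i - 1"]) simp
qed (use xs ys in auto)

text \<open>Removing a vertex from a shortest cycle leaves an induced path with one vertex fewer
  than the girth. Homogeneity carries it to the given path, after a rotation if the colours
  disagree, and the image of the removed vertex closes that path.\<close>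

lemma paths_close:
  assumes cyc: "is_cyc zs" "length zs = girth"
    and xs: "distinct xs" "successively adj xs" "Suc (length xs) = girth"
  shows "\<exists>w. adj w (hd xs) \<and> adj w (last xs) \<and> w \<notin> set xs"
proof -
  have main: ?thesis if z: "is_cyc zs" "length zs = girth" "col (zs ! 0) = col (xs ! 0)" for zs
  proof -
    let ?b = "butlast zs"
    have n: "length zs \<ge> 4" "zs \<noteq> []" using cyc_even[OF z(1)] by auto
    then have len: "length ?b = length xs" "length xs \<ge> 3" using z xs by auto
    have zeq: "zs = ?b @ [last zs]" using n by simp
    have sb: "successively adj ?b" "adj (last ?b) (last zs)"
      using z(1) zeq len successively_append_iff[of adj ?b "[last zs]"] unfolding is_cyc_def
      by (metis list.sel(1) list.size(3) not_numeral_le_zero not_Cons_self2)+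
    have db: "distinct ?b" "last zs \<notin> set ?b" using z(1) zeq unfolding is_cyc_def by (metis distinct_butlast, metis distinct_append not_distinct_conv_prefix)
    have b0: "?b ! 0 = zs ! 0" "hd ?b = hd zs" 
    proof -
      have l: "0 < length ?b" using len by linarith
      show "?b ! 0 = zs ! 0" by (rule nth_butlast[OF l])
      then show "hd ?b = hd zs" using l n by (metis hd_conv_nth length_greater_0_conv)
    qed
    obtain g where g: "aut g" "map g ?b = xs"
      using path_hom[OF db(1) sb(1) _ _ xs(1,2)] len xs z b0 by (metis One_nat_def Suc_1 Suc_leD lessI numeral_3_eq_3)
    have ne: "?b \<noteq> []" using len by (metis list.size(3) not_numeral_le_zero)
    have hx: "hd xs = g (hd zs)" "last xs = g (last ?b)"
      using g(2) ne b0 by (metis hd_map, metis last_map)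
    have a: "adj (last zs) (hd zs)" "adj (last zs) (last ?b)" using z(1) sb adj_sym by (auto simp: is_cyc_def)
    have "g (last zs) \<notin> set xs"
    proof
      assume "g (last zs) \<in> set xs"
      then obtain v where v: "v \<in> set ?b" "g v = g (last zs)" using g(2) by (metis (no_types, lifting) image_iff list.set_map)
      have "v \<in> V" using v successively_verts[OF sb(1)] len by auto
      then have "v = last zs" using aut_inj[OF g(1) _ adj_verts[OF a(1)]] v by blast
      then show False using v db by simp
    qed
    then show ?thesis using aut_adj[OF g(1) a(1)] aut_adj[OF g(1) a(2)] hx by metis
  qed
  show ?thesis
  proof (cases "col (zs ! 0) = col (xs ! 0)")
    case True
    then show ?thesis using main cyc by blast
  next
    case False
    obtain a b zs' where ab: "zs = a # b # zs'" using cyc_even(2)[OF cyc(1)]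
      by (metis Suc_le_length_iff numeral_eq_Suc pred_numeral_simps(2) pred_numeral_simps(3))
    have "is_cyc (b # zs' @ [a])" using cyc_rotate[of a "b # zs'"] cyc ab by simp
    moreover have "adj a b" using cyc ab by (auto simp: is_cyc_def)
    ultimately show ?thesis using main[of "b # zs' @ [a]"] cyc(2) ab False adj_col[of a b] by auto
  qed
qed

lemma no_4_cycle:
  assumes "girth > 4" "adj a b" "adj b c" "adj c d" "adj d a" "a \<noteq> c" "b \<noteq> d" shows False
proof -
  have "is_cyc [a, b, c, d]" using assms adj_irrefl by (auto simp: is_cyc_def)
  then show False using girth_le assms(1) by fastforce
qed

lemma third_nbr:
  assumes "x \<in> V" "dgr (col x) \<ge> 3" shows "\<exists>z. adj x z \<and> z \<noteq> p \<and> z \<noteq> q"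
proof (rule ccontr)
  assume "\<not> ?thesis"
  then have "N x \<subseteq> {p, q}" by auto
  then have "card (N x) \<le> card {p, q}" by (intro card_mono) auto
  also have "\<dots> \<le> 2" by (simp add: card_insert_if)
  finally show False using N_card assms by simp
qed

lemma second_nbr:
  assumes "x \<in> V" "dgr (col x) \<ge> 2" shows "\<exists>z. adj x z \<and> z \<noteq> p"
proof (rule ccontr)
  assume "\<not> ?thesis"
  then have "N x \<subseteq> {p}" by auto
  then have "card (N x) \<le> card {p}" by (intro card_mono) auto
  then show False using N_card assms by simp
qed

text \<open>Two paths with one vertex fewer than the girth share all but their last vertices
  \<open>l\<close> and \<open>v'\<close>, both neighbours of \<open>v\<close>. Closing them by
  \<open>w\<close> and \<open>w'\<close> gives the hexagon
  \<open>w, a, w', v', v, l\<close>.\<close>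

lemma girth_at_most_6:
  assumes cyc: "is_cyc zs" "length zs = girth" and c: "dgr c \<ge> 3" and g: "girth > 4"
  shows "girth = 6"
proof -
  have ev: "even girth" using cyc_even cyc by metis
  then have g6: "girth \<ge> 6" using g by presburger
  obtain zs where zs: "is_cyc zs" "length zs = girth" "col (zs ! 0) \<noteq> c"
  proof (cases "col (zs ! 0) \<noteq> c")
    case True
    then show ?thesis using that cyc by blast
  next
    case False
    obtain a b zs' where ab: "zs = a # b # zs'" using cyc_even(2)[OF cyc(1)]
      by (metis Suc_le_length_iff numeral_eq_Suc pred_numeral_simps(2) pred_numeral_simps(3))
    have "is_cyc (b # zs' @ [a])" using cyc_rotate[of a "b # zs'"] cyc ab by simp
    moreover have "adj a b" using cyc ab by (auto simp: is_cyc_def)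
    ultimately show ?thesis using that[of "b # zs' @ [a]"] cyc(2) ab False adj_col[of a b] by auto
  qed
  \<comment> \<open>Each path has \<open>n + 2\<close> vertices and \<open>v\<close> is the last
    common one, at index \<open>n\<close>. This index is odd, so \<open>v\<close> has colour
    \<open>c\<close> and a third neighbour.\<close>
  define n where "n = girth - 3"
  have n: "girth = Suc (Suc (Suc n))" "odd n" "n \<ge> 3" using g6 ev by (auto simp: n_def)
  have sz: "successively adj zs" "distinct zs" using zs by (auto simp: is_cyc_def)
  define xs where "xs = take (Suc (Suc n)) zs"
  have xs: "distinct xs" "successively adj xs" "length xs = Suc (Suc n)"
    using sz zs n by (auto simp: xs_def successively_conv_nth)
  have nth: "xs ! i = zs ! i" if "i < Suc (Suc n)" for i using that by (simp add: xs_def)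
  define v where "v = xs ! n"
  have "col v = c" using alternate[OF xs(2), of n] xs(3) n zs(3) nth[of 0] by (auto simp: v_def)
  have vV: "v \<in> V" using successively_verts[OF xs(2)] xs(3) nth_mem[of n xs] by (auto simp: v_def)
  obtain v' where v': "adj v v'" "v' \<noteq> xs ! (n - 1)" "v' \<noteq> xs ! Suc n"
    using third_nbr[OF vV, of "xs ! (n - 1)" "xs ! Suc n"] c \<open>col v = c\<close> by blast
  define ys where "ys = take (Suc n) xs @ [v']"
  have "v' \<notin> set xs"
  proof
    assume "v' \<in> set xs"
    then obtain i where i: "i < length xs" "v' = xs ! i" by (auto simp: in_set_conv_nth)
    have lt: "length xs < girth" using xs n by simp
    consider "i < n" | "i = n" | "n < i" by linarith
    then show False
    proof cases
      case 1
      then have "n = Suc i" using short_path_induced[OF xs(1,2) lt, of i n] i v' xs(3) adj_sym by (simp add: v_def)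
      then show False using v' i by simp
    next
      case 2 then show False using v' i adj_irrefl by (simp add: v_def)
    next
      case 3
      then have "i = Suc n" using i xs by simp
      then show False using v' i by simp
    qed
  qed
  have ys: "distinct ys" "length ys = Suc (Suc n)" "last ys = v'" "hd ys = xs ! 0" "v \<in> set ys"
    using xs \<open>v' \<notin> set xs\<close> by (auto simp: ys_def v_def hd_append hd_conv_nth in_set_conv_nth dest: in_set_takeD)
  have sy: "successively adj ys"
  proof -
    have "successively adj (take (Suc n) xs)" using xs by (auto simp: successively_conv_nth)
    moreover have "last (take (Suc n) xs) = v" using xs(3) by (simp add: take_Suc_conv_app_nth v_def)
    ultimately show ?thesis using v' unfolding ys_def successively_append_iff by simp
  qed
  obtain w where w: "adj w (hd xs)" "adj w (last xs)" "w \<notin> set xs" using paths_close[OF zs(1,2) xs(1,2)] xs(3) n by auto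
  obtain w' where w': "adj w' (hd ys)" "adj w' (last ys)" "w' \<notin> set ys" using paths_close[OF zs(1,2) ys(1) sy] ys(2) n by auto
  define a where "a = xs ! 0"
  define l where "l = xs ! Suc n"
  have ha: "hd xs = a" "last xs = l" "hd ys = a" using xs(3) ys by (auto simp: a_def l_def hd_conv_nth last_conv_nth simp flip: length_greater_0_conv)
  have vl: "adj v l" using xs by (auto simp: v_def l_def successively_conv_nth)
  have ne: "a \<noteq> l" "a \<noteq> v" "v \<noteq> l" "a \<in> set xs" "l \<in> set xs" "v \<in> set xs"
    using xs n by (auto simp: a_def l_def v_def nth_eq_iff_index_eq)
  have "w \<noteq> w'"
  proof
    assume "w = w'"
    then show False using no_4_cycle[OF g, of w v' v l] w w' ys ha v' vl ne adj_sym by (metis l_def)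
  qed
  have cl: "col w \<noteq> col l" "col w' \<noteq> col v'" "col v \<noteq> col l" "col v \<noteq> col v'" using w w' ha ys vl v' adj_col by metis+
  have "is_cyc [w, a, w', v', v, l]"
    using w w' ha ys v' vl ne \<open>w \<noteq> w'\<close> \<open>v' \<notin> set xs\<close> cl adj_sym adj_irrefl
    by (auto simp: is_cyc_def l_def) 
  then show ?thesis using girth_le[of "[w, a, w', v', v, l]"] g6 by simp
qed

end

context hom_bip
begin

text \<open>At girth six two vertices of one colour have exactly one common neighbour, as points and
  lines of a projective plane do. Homogeneity would give an automorphism that fixes two points of a
  line and moves a third point off it.\<close>

lemma no_girth_6:
  assumes cyc: "is_cyc zs" "length zs = girth" and c: "dgr c \<ge> 3" and deg2: "\<And>c. dgr c \<ge> 2"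
    and g: "girth = 6"
  shows False
proof -
  have g4: "girth > 4" using g by simp
  note no4 = no_4_cycle[OF g4]
  \<comment> \<open>A path on five vertices is one vertex short of a shortest cycle.\<close>
  have five: "\<exists>y. adj p y \<and> adj y q" if path: "adj p a" "adj a b" "adj b d" "adj d q" "p \<noteq> b" "p \<noteq> q" "b \<noteq> q" "a \<noteq> d" for p a b d q
  proof -
    have col: "col p \<noteq> col a" "col a \<noteq> col b" "col b \<noteq> col d" "col d \<noteq> col q" using path adj_col by auto
    have dist: "distinct [p, a, b, d, q]" using path col by auto
    have succ: "successively adj [p, a, b, d, q]" using path by simp
    obtain w where "adj w p" "adj w q" using paths_close[OF cyc dist succ] g by auto
    then show ?thesis using adj_sym by blast
  qed
  \<comment> \<open>Along a walk from \<open>p\<close>, vertices of the colour of \<open>p\<close>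
    stay within distance two, since paths of length four can be shortened.\<close>
  have dist2: "\<exists>y. adj p y \<and> adj y q" if pq: "p \<in> V" "q \<in> V" "col p = col q" "p \<noteq> q" for p q
  proof -
    define near where "near r \<longleftrightarrow> r = p \<or> (\<exists>y. adj p y \<and> adj y r)" for r
    have "(col q = col p \<longrightarrow> near q) \<and> (col q \<noteq> col p \<longrightarrow> (\<exists>r. adj q r \<and> near r \<and> col r = col p))"
    proof (rule graph_induct[OF pq(1) _ _ pq(2)])
      show "(col p = col p \<longrightarrow> near p) \<and> (col p \<noteq> col p \<longrightarrow> (\<exists>r. adj p r \<and> near r \<and> col r = col p))"
        by (simp add: near_def)
      fix u v assume u: "(col u = col p \<longrightarrow> near u) \<and> (col u \<noteq> col p \<longrightarrow> (\<exists>r. adj u r \<and> near r \<and> col r = col p))" and uv: "adj u v"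
      show "(col v = col p \<longrightarrow> near v) \<and> (col v \<noteq> col p \<longrightarrow> (\<exists>r. adj v r \<and> near r \<and> col r = col p))"
      proof (cases "col u = col p")
        case True
        then show ?thesis using u adj_sym[OF uv] adj_col[OF uv] by auto
      next
        case False
        then obtain r where r: "adj u r" "near r" "col r = col p" using u by blast
        have "near v"
        proof (cases "v = p \<or> v = r \<or> r = p")
          case True
          then show ?thesis using r adj_sym[OF r(1)] uv by (auto simp: near_def)
        next
          case ne: False
          then obtain y where y: "adj p y" "adj y r" using r by (auto simp: near_def)
          show ?thesis
          proof (cases "y = u")
            case True
            then show ?thesis using y uv by (auto simp: near_def)
          next
            case False
            then show ?thesis using five[OF y adj_sym[OF r(1)] uv] ne by (auto simp: near_def)
          qed
        qed
        then show ?thesis using False adj_col[OF uv] by blast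
      qed
    qed
    then show ?thesis using pq by (auto simp: near_def)
  qed
  \<comment> \<open>The usual correspondence between the elements incident with \<open>x\<close> and
    those incident with a non-incident \<open>y\<close>.\<close>
  have deg_le: "dgr (col x) \<le> dgr (col y)" if xy: "x \<in> V" "y \<in> V" "col x \<noteq> col y" "\<not> adj x y" for x y
  proof -
    have ex: "\<exists>z. adj y' z \<and> adj z y" if "y' \<in> N x" for y'
      using dist2[of y' y] that xy adj_verts2[of x y'] adj_col[of x y'] by auto
    define f where "f y' = (SOME z. adj y' z \<and> adj z y)" for y'
    have f: "adj y' (f y')" "adj (f y') y" if "y' \<in> N x" for y'
      using someI_ex[OF ex[OF that]] by (auto simp: f_def)
    have "inj_on f (N x)"
    proof (rule inj_onI)
      fix y1 y2 assume y: "y1 \<in> N x" "y2 \<in> N x" "f y1 = f y2"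
      show "y1 = y2"
      proof (rule ccontr)
        assume "y1 \<noteq> y2"
        have "x \<noteq> f y1" using f[OF y(1)] xy(4) by auto
        then show False using no4[of x y1 "f y1" y2] f[OF y(1)] f[OF y(2)] y adj_sym \<open>y1 \<noteq> y2\<close> by auto
      qed
    qed
    moreover have "f ` N x \<subseteq> N y" using f adj_sym by auto
    ultimately have "card (N x) \<le> card (N y)" by (rule card_inj_on_le) (rule N_fin[OF xy(2)])
    then show ?thesis using N_card xy by simp
  qed
  have zs: "distinct zs" "successively adj zs" "length zs = 6" using cyc g by (auto simp: is_cyc_def)
  have nadj: "\<not> adj (zs ! 0) (zs ! 3)"
  proof
    assume a: "adj (zs ! 0) (zs ! 3)"
    have "3 = Suc 0"
      by (rule short_path_induced[of "take 5 zs"]) (use zs g a in \<open>auto simp: successively_conv_nth\<close>)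
    then show False by simp
  qed
  have zV: "zs ! 0 \<in> V" "zs ! 3 \<in> V" using successively_verts[OF zs(2)] zs(3) by (auto simp: subset_iff)
  have zc: "col (zs ! 0) \<noteq> col (zs ! 3)" using alternate[OF zs(2), of 3] zs(3) by auto
  have "dgr (col (zs ! 0)) = dgr (col (zs ! 3))"
    using deg_le[OF zV zc nadj] deg_le[OF zV(2,1)] zc nadj adj_sym by (metis le_antisym)
  then have d3: "dgr c' \<ge> 3" for c'
    using c zc by (cases "col (zs ! 0)"; cases "col (zs ! 3)"; cases c; cases c') auto
  obtain x where x: "x \<in> V" using zV by blast
  obtain y1 where y1: "adj x y1" using has_nbr[OF x] by blast
  obtain y2 where y2: "adj x y2" "y2 \<noteq> y1" using second_nbr[OF x deg2] by blast
  obtain y3 where y3: "adj x y3" "y3 \<noteq> y1" "y3 \<noteq> y2" using third_nbr[OF x d3] by blast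
  note yV = adj_verts2[OF y1] adj_verts2[OF y2(1)] adj_verts2[OF y3(1)]
  obtain x1 where x1: "adj y1 x1" "x1 \<noteq> x" using second_nbr[OF yV(1) deg2] by blast
  obtain x2 where x2: "adj y2 x2" "x2 \<noteq> x" using second_nbr[OF yV(2) deg2] by blast
  note s = adj_sym
  have n: "\<not> adj x1 y2" "\<not> adj x1 y3" "\<not> adj x2 y1" "\<not> adj x2 y3"
    using no4[of x y1 x1 y2] no4[of x y1 x1 y3] no4[of x y2 x2 y1] no4[of x y2 x2 y3] x1 x2 y1 y2 y3 s by blast+
  have "x1 \<noteq> x2" using n x2 s by blast
  have cx: "col x1 = col x" "col x2 = col x" using adj_col[OF y1] adj_col[OF y2(1)] adj_col[OF x1(1)] adj_col[OF x2(1)] by auto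
  \<comment> \<open>\<open>y'\<close> is the line through the points \<open>x1\<close> and
    \<open>x2\<close>; below, \<open>x3\<close> is its intersection with the line
    \<open>y3\<close>.\<close>
  obtain y' where y': "adj x1 y'" "adj y' x2"
    using dist2[of x1 x2] adj_verts2[OF x1(1)] adj_verts2[OF x2(1)] cx \<open>x1 \<noteq> x2\<close> by auto
  have "y' \<noteq> y1" using n y' s by blast
  then have nx: "\<not> adj y' x" using no4[of x y' x1 y1] x1 y1 y' s by blast
  have "y' \<noteq> y3" using nx y3 s by blast
  have cy: "col y' = col y3" using adj_col[OF y'(1)] cx adj_col[OF y3(1)] by auto
  obtain x3 where x3: "adj y' x3" "adj x3 y3"
    using dist2[of y' y3] adj_verts2[OF y'(1)] yV(3) cy \<open>y' \<noteq> y3\<close> by auto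
  have x3ne: "x3 \<noteq> x" "x3 \<noteq> x1" "x3 \<noteq> x2" using nx x3 n s by blast+
  obtain x3' where x3': "adj y3 x3'" "x3' \<noteq> x" "x3' \<noteq> x3" using third_nbr[OF yV(3) d3] by blast
  have x3'ne: "x3' \<noteq> x1" "x3' \<noteq> x2" using x3' n s by blast+
  have n3: "\<not> adj y1 z" "\<not> adj y2 z" if "adj y3 z" "z \<noteq> x" for z
    using no4[of x y1 z y3] no4[of x y2 z y3] that y1 y2 y3 s by blast+
  have cz: "col z = col x" "col z \<noteq> col y1" "col z \<noteq> col y2" "col z \<noteq> col y3" if "adj y3 z" for z
    using adj_col[OF that] adj_col[OF y3(1)] adj_col[OF y1] adj_col[OF y2(1)] by auto
  let ?zs = "[x, y1, y2, y3, x1, x2]"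
  have cyy: "col y1 \<noteq> col x" "col y2 \<noteq> col x" "col y3 \<noteq> col x" using y1 y2 y3 adj_col by blast+
  \<comment> \<open>Among the six listed vertices both \<open>x3\<close> and the further point
    \<open>x3'\<close> of \<open>y3\<close> are adjacent to \<open>y3\<close> alone.\<close>
  have "\<exists>g. aut g \<and> (\<forall>z\<in>set ?zs. g z = z) \<and> g x3 = x3'"
  proof (rule hom_swap)
    show "distinct ?zs" using y1 y2 y3 x1 x2 \<open>x1 \<noteq> x2\<close> cyy cx adj_irrefl by auto
    show "set ?zs \<subseteq> V" using x yV adj_verts2[OF x1(1)] adj_verts2[OF x2(1)] by auto
    show "\<exists>j<i. adj (?zs ! j) (?zs ! i)" if i: "0 < i" "i < length ?zs" for i
    proof -
      have "i = 1 \<or> i = 2 \<or> i = 3 \<or> i = 4 \<or> i = 5" using i by auto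
      then show ?thesis
      proof (elim disjE)
        assume "i = 4"
        then show ?thesis using x1 by (intro exI[of _ 1]) simp
      next
        assume "i = 5"
        then show ?thesis using x2 by (intro exI[of _ 2]) simp
      qed (use y1 y2 y3 in \<open>auto intro!: exI[of _ 0]\<close>)
    qed
    show "x3 \<in> V" "x3' \<in> V" using adj_verts2[OF x3(1)] adj_verts2[OF x3'(1)] .
    show "x3 \<notin> set ?zs" "x3' \<notin> set ?zs" using x3ne x3'ne x3' cz[OF s[OF x3(2)]] cz[OF x3'(1)] by auto
    show "col x3 = col x3'" using cz(1)[OF s[OF x3(2)]] cz(1)[OF x3'(1)] by simp
    show "\<exists>z\<in>set ?zs. adj z x3" using s[OF x3(2)] by auto
    fix z assume "z \<in> set ?zs"
    then have "z = x \<or> z = y1 \<or> z = y2 \<or> z = y3 \<or> z = x1 \<or> z = x2" by auto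
    moreover have "\<not> adj z x3 \<and> \<not> adj z x3'" if "col z = col x"
      using that cz(1)[OF s[OF x3(2)]] cz(1)[OF x3'(1)] adj_col by metis
    ultimately show "adj z x3 \<longleftrightarrow> adj z x3'"
      using n3[OF s[OF x3(2)] x3ne(1)] n3[OF x3'(1,2)] s[OF x3(2)] x3'(1) cx by blast
  qed
  then obtain g where g': "aut g" "g x1 = x1" "g x2 = x2" "g x3 = x3'" by auto
  have gy: "adj x1 (g y')" "adj (g y') x2" using aut_adj[OF g'(1) y'(1)] aut_adj[OF g'(1) y'(2)] g' by auto
  have "g y' = y'" using no4[of x1 "g y'" x2 y'] gy y' s \<open>x1 \<noteq> x2\<close> by blast
  then have "adj y' x3'" using aut_adj[OF g'(1) x3(1)] g' by simp
  then show False using no4[of y' x3 y3 x3'] x3 x3' s \<open>y' \<noteq> y3\<close> by blast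
qed

section \<open>Girth four: numbers of common neighbours\<close>

lemma codegree:
  assumes "adj x y" "adj x' y" "x \<noteq> x'" "adj z w" "adj z' w" "z \<noteq> z'" "col x = col z"
  shows "card (N x \<inter> N x') = card (N z \<inter> N z')"
proof -
  have col: "col x \<noteq> col y" "col x' = col x" "col z \<noteq> col w" "col z' = col z" using assms adj_col by metis+
  have V: "x \<in> V" "y \<in> V" "x' \<in> V" "z \<in> V" "w \<in> V" "z' \<in> V" using assms adj_verts adj_verts2 by blast+
  have nad: "\<not> adj x x'" "\<not> adj x' x" "\<not> adj z z'" "\<not> adj z' z" using col adj_col by metis+
  have "\<exists>g. aut g \<and> map g [y, x, x'] = [w, z, z']"
  proof (rule hom_lists)
    fix i assume "0 < i" "i < length [y, x, x']"
    then show "\<exists>j<i. adj ([y, x, x'] ! j) ([y, x, x'] ! i)"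
      using assms adj_sym by (intro exI[of _ 0]) (auto simp: less_Suc_eq numeral_2_eq_2)
  next
    fix i assume "i < length [y, x, x']"
    then show "col ([y, x, x'] ! i) = col ([w, z, z'] ! i)"
      using assms(7) col by (auto simp: less_Suc_eq numeral_2_eq_2)
  next
    fix i j assume "i < length [y, x, x']" "j < length [y, x, x']"
    then show "adj ([y, x, x'] ! i) ([y, x, x'] ! j) \<longleftrightarrow> adj ([w, z, z'] ! i) ([w, z, z'] ! j)"
      using assms nad adj_irrefl adj_sym by (auto simp: less_Suc_eq numeral_2_eq_2)
  qed (use assms V col in auto)
  then obtain g where g: "aut g" "g x = z" "g x' = z'" by auto
  have "g ` (N x \<inter> N x') = N z \<inter> N z'"
    using aut_Int[OF g(1) N_V N_V] aut_N[OF g(1)] V g by simp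
  then show ?thesis using aut_card[OF g(1), of "N x \<inter> N x'"] N_V by (metis inf.coboundedI1)
qed

text \<open>All \<open>k\<close>-subsets of \<open>N x - {y}\<close> occur as traces of neighbourhoods, and any two of these meet in
  equally many points; this forces \<open>k\<close> to be 1 or one less than the size of \<open>N x - {y}\<close>.\<close>

lemma all_subsets_occur:
  assumes xy: "adj x y" and x0: "adj y x0" "x0 \<noteq> x"
    and T: "T \<subseteq> N x - {y}" "card T = card (N x0 \<inter> (N x - {y}))"
  shows "\<exists>x'. adj y x' \<and> x' \<noteq> x \<and> N x' \<inter> (N x - {y}) = T"
proof -
  have V: "x \<in> V" "y \<in> V" "x0 \<in> V" using xy x0 adj_verts adj_verts2 by blast+
  let ?A = "N x - {y}" and ?S = "N x0 \<inter> (N x - {y})"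
  have fin: "finite ?A" using N_fin V by simp
  have finS: "finite ?S" "finite T" using fin T by (auto intro: finite_subset)
  \<comment> \<open>Listing the trace first and the rest of \<open>N x - {y}\<close> after it lets
    an automorphism of the star at \<open>x\<close> carry the trace to \<open>T\<close>.\<close>
  obtain s0 where s0: "set s0 = ?S" "distinct s0" using finite_distinct_list[OF finS(1)] by blast
  obtain s1 where s1: "set s1 = ?A - ?S" "distinct s1" using finite_distinct_list[of "?A - ?S"] fin by blast
  obtain t0 where t0: "set t0 = T" "distinct t0" using finite_distinct_list[OF finS(2)] by blast
  obtain t1 where t1: "set t1 = ?A - T" "distinct t1" using finite_distinct_list[of "?A - T"] fin by blast
  have l0: "length s0 = length t0" using s0 t0 T(2) distinct_card by metis
  have "card (?A - ?S) = card (?A - T)" using T finS by (simp add: card_Diff_subset)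
  then have l1: "length s1 = length t1" using s1 t1 distinct_card by metis
  have "\<exists>g. aut g \<and> g x = x \<and> map g (y # s0 @ s1) = y # t0 @ t1"
    by (rule star_hom[OF V(1)]) (use s0 s1 t0 t1 l0 l1 T xy in auto)
  then obtain g where g: "aut g" "g x = x" "g y = y" "map g s0 @ map g s1 = t0 @ t1" by auto
  then have "map g s0 = t0" using l0 by simp
  then have gS: "g ` ?S = T" using s0 t0 by (metis list.set_map)
  have ST: "?S = N x0 \<inter> N x - {y}" by blast
  have inj: "inj_on g V" using g(1) by (simp add: aut_def bij_betw_def)
  have "g ` (N x0 \<inter> N x - {y}) = g ` (N x0 \<inter> N x) - g ` {y}"
    by (rule inj_on_image_set_diff[OF inj]) (use N_V V in auto)
  also have "\<dots> = N (g x0) \<inter> N x - {y}" using aut_Int[OF g(1) N_V N_V] aut_N[OF g(1)] V g by simp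
  finally have "N (g x0) \<inter> (N x - {y}) = T" using gS ST by auto
  moreover have "adj y (g x0)" using aut_adj[OF g(1) x0(1)] g by simp
  moreover have "g x0 \<noteq> x" using aut_inj[OF g(1) V(3,1)] g x0 by simp
  ultimately show ?thesis by blast
qed

text \<open>Homogeneity of the star at \<open>y\<close> moves one pair to the other while fixing
  \<open>x\<close>, hence also the set \<open>N x - {y}\<close>.\<close>

lemma pair_intersections:
  assumes xy: "adj x y" and x1: "adj y x1" "x1 \<noteq> x" "adj y x2" "x2 \<noteq> x" "x1 \<noteq> x2"
    and x3: "adj y x3" "x3 \<noteq> x" "adj y x4" "x4 \<noteq> x" "x3 \<noteq> x4"
  shows "card (N x1 \<inter> N x2 \<inter> (N x - {y})) = card (N x3 \<inter> N x4 \<inter> (N x - {y}))"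
proof -
  have V: "x \<in> V" "y \<in> V" "x1 \<in> V" "x2 \<in> V" using xy x1 adj_verts adj_verts2 by blast+
  have "\<exists>g. aut g \<and> g y = y \<and> map g [x, x1, x2] = [x, x3, x4]"
    by (rule star_hom[OF V(2)]) (use x1 x3 adj_sym[OF xy] in auto)
  then obtain g where g: "aut g" "g y = y" "g x = x" "g x1 = x3" "g x2 = x4" by auto
  have inj: "inj_on g V" using g(1) by (simp add: aut_def bij_betw_def)
  have "g ` (N x1 \<inter> N x2 \<inter> N x - {y}) = g ` (N x1 \<inter> N x2 \<inter> N x) - g ` {y}"
    by (rule inj_on_image_set_diff[OF inj]) (use N_V V in auto)
  also have "\<dots> = N x3 \<inter> N x4 \<inter> N x - {y}"
    using aut_Int[OF g(1), of "N x1 \<inter> N x2" "N x"] aut_Int[OF g(1), of "N x1" "N x2"] N_V aut_N[OF g(1)] V g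
    by (simp add: le_infI1)
  finally have "card (N x1 \<inter> N x2 \<inter> N x - {y}) = card (N x3 \<inter> N x4 \<inter> N x - {y})"
    using aut_card[OF g(1), of "N x1 \<inter> N x2 \<inter> N x - {y}"] N_V by (metis Diff_subset inf_le2 order_trans)
  then show ?thesis by (simp add: Int_Diff)
qed

end

context hom_bip
begin

definition codeg :: "bool \<Rightarrow> nat \<Rightarrow> bool" where
  "codeg c k \<longleftrightarrow> (\<forall>x x' y. adj x y \<longrightarrow> adj x' y \<longrightarrow> x \<noteq> x' \<longrightarrow> col x = c \<longrightarrow> card (N x \<inter> N x') = k)"

lemma codegD: "codeg c k \<Longrightarrow> adj x y \<Longrightarrow> adj x' y \<Longrightarrow> x \<noteq> x' \<Longrightarrow> col x = c \<Longrightarrow> card (N x \<inter> N x') = k"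
  unfolding codeg_def by blast

text \<open>The common neighbour \<open>y\<close> is excluded from the trace, hence the drop from
  \<open>Suc k\<close> to \<open>k\<close>.\<close>

lemma link_card:
  assumes k: "codeg c (Suc k)" and xy: "adj x y" "col x = c" and x': "adj y x'" "x' \<noteq> x"
  shows "card (N x' \<inter> (N x - {y})) = k"
proof -
  have V: "x \<in> V" using xy adj_verts by blast
  have "card (N x \<inter> N x') = Suc k" using codegD[OF k xy(1) adj_sym[OF x'(1)]] x' xy by auto
  moreover have "N x \<inter> N x' = insert y (N x' \<inter> (N x - {y}))" using xy x' adj_sym by auto
  moreover have "finite (N x' \<inter> (N x - {y}))" using N_fin[OF V] by simp
  ultimately show ?thesis by simp
qed

text \<open>Since all sets of size \<open>k\<close> occur as traces, there are two traces that
  differ by exchanging one element.\<close>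

lemma link_exchange:
  assumes k: "codeg c (Suc k)" "1 \<le> k" "Suc k < dgr c" "dgr (\<not> c) \<ge> 2" and xy: "adj x y" "col x = c"
  shows "\<exists>x1 x2 p r. adj y x1 \<and> x1 \<noteq> x \<and> adj y x2 \<and> x2 \<noteq> x \<and> p \<in> N x1 \<inter> (N x - {y}) \<and> r \<in> (N x - {y}) - N x1
      \<and> N x2 \<inter> (N x - {y}) = insert r (N x1 \<inter> (N x - {y}) - {p})"
proof -
  have V: "x \<in> V" "y \<in> V" using xy adj_verts adj_verts2 by blast+
  have cy: "col y = (\<not> c)" using adj_col[OF xy(1)] xy(2) by auto
  let ?A = "N x - {y}"
  have fin: "finite ?A" using N_fin V by simp
  have cA: "card ?A = dgr c - 1" using N_card[OF V(1)] xy N_fin[OF V(1)] by (simp add: card_Diff_singleton)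
  have "2 \<le> dgr (col y)" using k(4) cy by simp
  then obtain x1 where x1: "adj y x1" "x1 \<noteq> x" using second_nbr[OF V(2)] by blast
  let ?T = "N x1 \<inter> ?A"
  have cT: "card ?T = k" using link_card[OF k(1) xy x1] .
  obtain p where p: "p \<in> ?T" using cT k(2) by (metis card.empty ex_in_conv not_one_le_zero)
  have "?A - ?T \<noteq> {}"
  proof
    assume "?A - ?T = {}"
    then have "?A = ?T" by blast
    then show False using cT cA k(3) by simp
  qed
  then obtain r where r: "r \<in> ?A - ?T" by blast
  have fT: "finite ?T" using fin by simp
  have "card (insert r (?T - {p})) = card ?T"
  proof -
    have "r \<notin> ?T - {p}" using r by blast
    then have "card (insert r (?T - {p})) = Suc (card (?T - {p}))" using fT by simp
    also have "\<dots> = card ?T" by (rule card_Suc_Diff1[OF fT p])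
    finally show ?thesis .
  qed
  moreover have "insert r (?T - {p}) \<subseteq> ?A" using r by auto
  ultimately obtain x2 where "adj y x2" "x2 \<noteq> x" "N x2 \<inter> ?A = insert r (?T - {p})"
    using all_subsets_occur[OF xy(1) x1] by metis
  then show ?thesis using x1 p r by blast
qed

text \<open>Two vertices with equal traces would meet in \<open>k\<close> elements there, whereas an
  exchanged pair meets in \<open>k - 1\<close>.\<close>

lemma link_injective:
  assumes k: "codeg c (Suc k)" "1 \<le> k" "Suc k < dgr c" "dgr (\<not> c) \<ge> 2" and xy: "adj x y" "col x = c"
    and z: "adj y z1" "z1 \<noteq> x" "adj y z2" "z2 \<noteq> x" and eq: "N z1 \<inter> (N x - {y}) = N z2 \<inter> (N x - {y})"
  shows "z1 = z2"
proof (rule ccontr)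
  assume ne: "z1 \<noteq> z2"
  let ?A = "N x - {y}"
  have fin: "finite ?A" using N_fin xy adj_verts by blast
  obtain x1 x2 p r where x: "adj y x1" "x1 \<noteq> x" "adj y x2" "x2 \<noteq> x" "p \<in> N x1 \<inter> ?A" "r \<in> ?A - N x1"
      "N x2 \<inter> ?A = insert r (N x1 \<inter> ?A - {p})" using link_exchange[OF k xy] by blast
  have "r \<in> N x2" using x(7) by blast
  then have "x1 \<noteq> x2" using x(6) by blast
  have "N x1 \<inter> N x2 \<inter> ?A = N x1 \<inter> (N x2 \<inter> ?A)" by blast
  also have "\<dots> = N x1 \<inter> ?A - {p}" unfolding x(7) using x(6) by blast
  finally have "N x1 \<inter> N x2 \<inter> ?A = N x1 \<inter> ?A - {p}" .
  then have "card (N x1 \<inter> N x2 \<inter> ?A) < card (N x1 \<inter> ?A)"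
    using x(5) fin by (metis card_Diff1_less finite_Int)
  moreover have "N z1 \<inter> N z2 \<inter> ?A = N z1 \<inter> ?A" using eq by auto
  ultimately show False
    using pair_intersections[OF xy(1) x(1-4) \<open>x1 \<noteq> x2\<close> z ne] link_card[OF k(1) xy x(1,2)] link_card[OF k(1) xy z(1,2)]
    by simp
qed

text \<open>If \<open>k\<close> is at least 2 and at most two less than the size of
  \<open>N x - {y}\<close>, then either one or two elements of a trace can be exchanged. The
  intersections have sizes \<open>k - 1\<close> and \<open>k - 2\<close>, against
  \<open>pair_intersections\<close>.\<close>

lemma codegree_cases:
  assumes k: "codeg c (Suc k)" "1 \<le> k" "Suc k < dgr c" "dgr (\<not> c) \<ge> 2"
  shows "k = 1 \<or> Suc (Suc k) = dgr c"
proof (rule ccontr)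
  assume no: "\<not> ?thesis"
  obtain x where x: "x \<in> V" "col x = c" using colour_vertex by blast
  obtain y where y: "adj x y" using has_nbr x by blast
  let ?A = "N x - {y}"
  have fin: "finite ?A" using N_fin x by simp
  have cA: "card ?A = dgr c - 1" using N_card[OF x(1)] x y N_fin[OF x(1)] by (simp add: card_Diff_singleton)
  obtain x1 x2 p r where x12: "adj y x1" "x1 \<noteq> x" "adj y x2" "x2 \<noteq> x" "p \<in> N x1 \<inter> ?A" "r \<in> ?A - N x1"
      "N x2 \<inter> ?A = insert r (N x1 \<inter> ?A - {p})" using link_exchange[OF k y x(2)] by blast
  let ?T = "N x1 \<inter> ?A"
  have fT: "finite ?T" using fin by simp
  have cT: "card ?T = k" using link_card[OF k(1) y x(2) x12(1,2)] .
  have k2: "k \<ge> 2" "Suc (Suc k) < dgr c" using no k(2,3) by linarith+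
  have c1: "card (?T - {p}) = k - 1" using cT x12(5) fT by simp
  then have "card (?T - {p}) \<ge> 1" using k2 by linarith
  then obtain q where q: "q \<in> ?T" "q \<noteq> p" by (metis DiffE card.empty ex_in_conv insertI1 not_one_le_zero)
  have "card (?A - ?T) = dgr c - 1 - k" using cT cA fT by (subst card_Diff_subset) auto
  moreover have "r \<in> ?A - ?T" using x12(6) by auto
  ultimately have "card (?A - ?T - {r}) = dgr c - 1 - k - 1" by (simp only: card_Diff_singleton)
  then have "card (?A - ?T - {r}) \<ge> 1" using k2 by linarith
  then obtain s where s: "s \<in> ?A - ?T" "s \<noteq> r" by (metis DiffE card.empty ex_in_conv insertI1 not_one_le_zero)
  let ?T3 = "insert r (insert s (?T - {p} - {q}))"
  have c3: "card (?T - {p} - {q}) = k - 2" using cT q x12(5) fT by simp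
  have "card ?T3 = Suc (Suc (k - 2))" using c3 s x12(6) fT by auto
  then have "card ?T3 = card ?T" using cT k2 by simp
  moreover have "?T3 \<subseteq> ?A" using s x12(6) by auto
  ultimately obtain x3 where x3: "adj y x3" "x3 \<noteq> x" "N x3 \<inter> ?A = ?T3"
    using all_subsets_occur[OF y x12(1,2)] by metis
  have "r \<in> N x2" "r \<in> N x3" using x12(7) x3(3) by blast+
  then have ne: "x1 \<noteq> x2" "x1 \<noteq> x3" using x12(6) by blast+
  have "N x1 \<inter> N x2 \<inter> ?A = N x1 \<inter> (N x2 \<inter> ?A)" by blast
  also have "\<dots> = ?T - {p}" unfolding x12(7) using x12(6) by blast
  finally have "N x1 \<inter> N x2 \<inter> ?A = ?T - {p}" .
  moreover have "N x1 \<inter> N x3 \<inter> ?A = ?T - {p} - {q}"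
  proof -
    have "N x1 \<inter> N x3 \<inter> ?A = N x1 \<inter> ?T3" by (simp only: Int_assoc x3(3))
    moreover have "s \<notin> N x1" "r \<notin> N x1" using s x12(6) by blast+
    ultimately show ?thesis by (simp only: Int_insert_right) auto
  qed
  ultimately show False
    using pair_intersections[OF y x12(1-4) ne(1) x12(1,2) x3(1,2) ne(2)] c1 c3 k2 by simp
qed

text \<open>A vertex at distance two from \<open>x\<close> misses exactly one neighbour
  \<open>y\<close> of \<open>x\<close> and is determined by it; it is called \<open>\<xi> y\<close>.
  All \<open>\<xi> y\<close> share one more neighbour \<open>z\<close>, and the missing matching
  pairs \<open>x\<close> with \<open>z\<close> and \<open>\<xi> y\<close> with
  \<open>y\<close>.\<close>

lemma CP_case:
  assumes k: "codeg c (Suc k)" "1 \<le> k" "Suc (Suc k) = dgr c" "dgr (\<not> c) \<ge> 2"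
  shows "listed_graph G"
proof -
  have lt: "Suc k < dgr c" using k by simp
  obtain x where x: "x \<in> V" "col x = c" using colour_vertex by blast
  have cN: "card (N x) = Suc (Suc k)" and fN: "finite (N x)" using N_card N_fin x k by auto
  have other: "\<exists>y. adj x y \<and> y \<noteq> p \<and> y \<noteq> q" for p q
    by (rule third_nbr[OF x(1)]) (use x k in simp)
  \<comment> \<open>The trace on \<open>N x - {w}\<close> that also omits \<open>y\<close> has size
    \<open>k\<close> and so occurs; the auxiliary \<open>w\<close> is itself adjacent to the vertex
    found.\<close>
  have ex: "\<exists>x'. x' \<noteq> x \<and> N x' \<inter> N x = N x - {y}" if y: "adj x y" for y
  proof -
    obtain w where w: "adj x w" "w \<noteq> y" using other by blast
    have wV: "w \<in> V" "col w = (\<not> c)" using w adj_verts2 adj_col[OF w(1)] x by auto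
    have "2 \<le> dgr (col w)" using k(4) wV(2) by simp
    then obtain x0 where x0: "adj w x0" "x0 \<noteq> x" using second_nbr[OF wV(1)] by blast
    have "card (N x - {w} - {y}) = k" using cN fN w y by simp
    then obtain x' where x': "adj w x'" "x' \<noteq> x" "N x' \<inter> (N x - {w}) = N x - {w} - {y}"
      using all_subsets_occur[OF w(1) x0, of "N x - {w} - {y}"] link_card[OF k(1) w(1) x(2) x0] by auto
    have "N x' \<inter> N x = N x - {y}"
    proof (rule set_eqI)
      fix v
      have "v \<in> N x' \<inter> (N x - {w}) \<longleftrightarrow> v \<in> N x - {w} - {y}" by (simp only: x'(3))
      then show "v \<in> N x' \<inter> N x \<longleftrightarrow> v \<in> N x - {y}"
        using w adj_sym[OF x'(1)] by (cases "v = w") simp_all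
    qed
    then show ?thesis using x'(2) by blast
  qed
  define \<xi> where "\<xi> y = (SOME x'. x' \<noteq> x \<and> N x' \<inter> N x = N x - {y})" for y
  have \<xi>: "\<xi> y \<noteq> x" "N (\<xi> y) \<inter> N x = N x - {y}" if "adj x y" for y
    using someI_ex[OF ex[OF that]] by (auto simp: \<xi>_def)
  have \<xi>_adj: "adj (\<xi> y) w \<longleftrightarrow> w \<noteq> y" if "adj x y" "adj x w" for y w
    using \<xi>(2)[OF that(1)] that(2) by (metis DiffD2 DiffI IntD1 IntI in_N insertCI singletonD)
  have uniq: "x' = \<xi> y" if y: "adj x y" "x' \<noteq> x" "N x' \<inter> N x = N x - {y}" for x' y
  proof -
    obtain w where w: "adj x w" "w \<noteq> y" using other by blast
    then have "w \<in> N x' \<inter> N x" using y by simp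
    then have "adj w x'" using adj_sym by simp
    moreover have "adj w (\<xi> y)" using \<xi>_adj[OF y(1) w(1)] w adj_sym by blast
    moreover have "N x' \<inter> (N x - {w}) = N (\<xi> y) \<inter> (N x - {w})" using y(3) \<xi>(2)[OF y(1)] by blast
    ultimately show ?thesis using link_injective[OF k(1,2) lt k(4) w(1) x(2)] y(2) \<xi>(1)[OF y(1)] by blast
  qed
  have c\<xi>: "col (\<xi> y) = c" and \<xi>V: "\<xi> y \<in> V" if y: "adj x y" for y
  proof -
    obtain w where w: "adj x w" "w \<noteq> y" using other by blast
    then have a: "adj (\<xi> y) w" using \<xi>_adj y by blast
    then show "\<xi> y \<in> V" using adj_verts by blast
    show "col (\<xi> y) = c" using adj_col[OF a] adj_col[OF w(1)] x by auto
  qed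
  have inj: "inj_on \<xi> (N x)"
  proof (rule inj_onI)
    fix y w assume yw: "y \<in> N x" "w \<in> N x" "\<xi> y = \<xi> w"
    have "\<not> adj (\<xi> w) w" using \<xi>_adj[of w w] yw(2) by simp
    then have "\<not> adj (\<xi> y) w" unfolding yw(3) .
    then show "y = w" using \<xi>_adj[of y w] yw(1,2) by simp
  qed
  have dist2: "\<exists>y. adj x y \<and> x' = \<xi> y" if x': "adj x w" "adj w x'" "x' \<noteq> x" for w x'
  proof -
    have "card (N x \<inter> N x') = Suc k" using codegD[OF k(1) x'(1) adj_sym[OF x'(2)]] x' x by auto
    then have "card (N x - N x') = 1" using cN fN by (metis Suc_eq_plus1 add_diff_cancel_left' card_Diff_subset_Int finite_Int plus_1_eq_Suc)
    then obtain y where y: "N x - N x' = {y}" by (metis card_1_singletonE)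
    then have "N x' \<inter> N x = N x - {y}" by blast
    moreover have "adj x y" using y by auto
    ultimately show ?thesis using uniq x'(3) by blast
  qed
  have Ny: "N y = insert x (\<xi> ` (N x - {y}))" if y: "adj x y" for y
  proof (intro set_eqI iffI)
    fix x' assume "x' \<in> N y"
    then have a: "adj y x'" by simp
    show "x' \<in> insert x (\<xi> ` (N x - {y}))"
    proof (cases "x' = x")
      case False
      then obtain w where w: "adj x w" "x' = \<xi> w" using dist2[OF y a] by blast
      then have "y \<noteq> w" using \<xi>_adj[OF w(1) y] a adj_sym by blast
      then show ?thesis using w by auto
    qed simp
  next
    fix x' assume x': "x' \<in> insert x (\<xi> ` (N x - {y}))"
    show "x' \<in> N y"
    proof (cases "x' = x")
      case False
      then have "x' \<in> \<xi> ` (N x - {y})" using x' by blast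
      then obtain w where w: "x' = \<xi> w" "w \<in> N x - {y}" by (rule imageE)
      then have "adj x w" "y \<noteq> w" by auto
      then have "adj (\<xi> w) y" using \<xi>_adj y by blast
      then show ?thesis using adj_sym w(1) by simp
    qed (use adj_sym[OF y] in simp)
  qed
  have out1: "card (N (\<xi> y) - N x) = 1" if y: "adj x y" for y
  proof -
    have "card (N (\<xi> y)) = Suc (Suc k)" "finite (N (\<xi> y))" using N_card N_fin \<xi>V[OF y] c\<xi>[OF y] k(3) by auto
    moreover have "card (N (\<xi> y) \<inter> N x) = Suc k" using \<xi>(2)[OF y] cN fN y by simp
    ultimately show ?thesis by (simp add: card_Diff_subset_Int)
  qed
  obtain y0 where y0: "adj x y0" using has_nbr x by blast
  obtain z where z: "N (\<xi> y0) - N x = {z}" using out1[OF y0] by (metis card_1_singletonE)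
  have zN: "z \<notin> N x" using z by blast
  have N\<xi>: "N (\<xi> y) = insert z (N x - {y})" if y: "adj x y" for y
  proof -
    have "N (\<xi> y) - N x = {z}"
    proof (cases "y = y0")
      case False
      obtain w where w: "adj x w" "w \<noteq> y" "w \<noteq> y0" using other by blast
      have ne: "\<xi> y \<noteq> \<xi> y0" using inj y y0 False by (auto dest: inj_onD)
      have "card (N (\<xi> y) \<inter> N (\<xi> y0)) = Suc k"
        using codegD[OF k(1), of "\<xi> y" w "\<xi> y0"] \<xi>_adj y y0 w ne c\<xi> by simp
      \<comment> \<open>Only \<open>k\<close> of the \<open>Suc k\<close> common neighbours lie in
        \<open>N x\<close>; one lies outside, and \<open>z\<close> is the only candidate.\<close>
      moreover have "N (\<xi> y) \<inter> N (\<xi> y0) \<inter> N x = N x - {y} - {y0}" using \<xi>(2)[OF y] \<xi>(2)[OF y0] by blast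
      then have "card (N (\<xi> y) \<inter> N (\<xi> y0) \<inter> N x) = k" using cN fN y y0 False by simp
      ultimately have "\<not> N (\<xi> y) \<inter> N (\<xi> y0) \<subseteq> N x" by (metis inf.absorb1 n_not_Suc_n)
      then obtain v where v: "v \<in> N (\<xi> y)" "v \<in> N (\<xi> y0)" "v \<notin> N x" by blast
      then have "v = z" using z by blast
      obtain v' where v': "N (\<xi> y) - N x = {v'}" using out1[OF y] by (metis card_1_singletonE)
      have "v \<in> N (\<xi> y) - N x" using v by blast
      then have "v \<in> {v'}" unfolding v' .
      then show ?thesis using v' \<open>v = z\<close> by (simp only: singleton_iff)
    qed (use z in simp)
    then show ?thesis using \<xi>(2)[OF y] by blast
  qed
  have az: "adj (\<xi> y0) z" using z by (metis Diff_iff in_N insertI1)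
  have zV: "z \<in> V" "col z = (\<not> c)" using adj_verts2[OF az] adj_col[OF az] c\<xi>[OF y0] by auto
  \<comment> \<open>\<open>z\<close> has as many neighbours as \<open>y0\<close>, namely
    \<open>k + 2\<close>, and the vertices \<open>\<xi> y\<close> exhaust them.\<close>
  have "col y0 = col z" using adj_col[OF y0] x(2) zV(2) by auto
  then have "card (N y0) = card (N z)"
    using N_card[OF adj_verts2[OF y0]] N_card[OF zV(1)] by simp
  moreover have "card (N y0) = Suc (Suc k)"
  proof -
    have "x \<notin> \<xi> ` (N x - {y0})" using \<xi>(1) by force
    moreover have "card (\<xi> ` (N x - {y0})) = Suc k"
      using card_image[of \<xi> "N x - {y0}"] inj_on_subset[OF inj, of "N x - {y0}"] cN fN y0 by auto
    ultimately show ?thesis using Ny[OF y0] fN by simp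
  qed
  ultimately have "card (N z) = card (\<xi> ` N x)" using card_image[OF inj] cN by simp
  moreover have "\<xi> ` N x \<subseteq> N z"
  proof
    fix v assume "v \<in> \<xi> ` N x"
    then obtain y where y: "v = \<xi> y" "y \<in> N x" by (rule imageE)
    then have "adj x y" by simp
    then have "z \<in> N (\<xi> y)" using N\<xi> by blast
    then show "v \<in> N z" using y adj_sym by simp
  qed
  ultimately have Nz: "N z = \<xi> ` N x" using N_fin[OF zV(1)] by (metis card_subset_eq)
  have all: "v = x \<or> v \<in> N x \<or> v = z \<or> v \<in> \<xi> ` N x" if "v \<in> V" for v
  proof (rule graph_induct[OF x(1) _ _ that])
    fix u v assume u: "u = x \<or> u \<in> N x \<or> u = z \<or> u \<in> \<xi> ` N x" and uv: "adj u v"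
    have "v \<in> N u" using uv by simp
    from u show "v = x \<or> v \<in> N x \<or> v = z \<or> v \<in> \<xi> ` N x"
    proof (elim disjE)
      assume "u \<in> N x"
      then have "adj x u" by simp
      then have "v \<in> insert x (\<xi> ` (N x - {u}))" using Ny \<open>v \<in> N u\<close> by blast
      then show ?thesis by blast
    next
      assume "u \<in> \<xi> ` N x"
      then obtain y where "adj x y" "u = \<xi> y" by auto
      then have "v \<in> insert z (N x - {y})" using N\<xi>[of y] \<open>v \<in> N u\<close> by blast
      then show ?thesis by blast
    next
      assume "u = x"
      then show ?thesis using \<open>v \<in> N u\<close> by blast
    next
      assume "u = z"
      then show ?thesis using \<open>v \<in> N u\<close> Nz by blast
    qed
  qed simp
  have cNx: "col y = (\<not> c)" if "adj x y" for y using adj_col[OF that] x by auto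
  have X: "{v \<in> V. col v = c} = insert x (\<xi> ` N x)"
  proof (intro set_eqI iffI)
    fix v assume v: "v \<in> {v \<in> V. col v = c}"
    then have "v \<notin> N x" "v \<noteq> z" using cNx zV(2) by auto
    then show "v \<in> insert x (\<xi> ` N x)" using all[of v] v by blast
  next
    fix v assume "v \<in> insert x (\<xi> ` N x)"
    then show "v \<in> {v \<in> V. col v = c}" using x c\<xi> \<xi>V by auto
  qed
  have Y: "{v \<in> V. col v \<noteq> c} = insert z (N x)"
  proof (intro set_eqI iffI)
    fix v assume v: "v \<in> {v \<in> V. col v \<noteq> c}"
    then have "v \<notin> \<xi> ` N x" "v \<noteq> x" using c\<xi> x(2) by auto
    then show "v \<in> insert z (N x)" using all[of v] v by blast
  next
    fix v assume "v \<in> insert z (N x)"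
    then show "v \<in> {v \<in> V. col v \<noteq> c}" using zV cNx adj_verts2 by auto
  qed
  define \<eta> where "\<eta> v = (if v = x then z else THE y. adj x y \<and> \<xi> y = v)" for v
  have \<eta>x: "\<eta> x = z" by (simp add: \<eta>_def)
  have \<eta>\<xi>: "\<eta> (\<xi> y) = y" if "adj x y" for y
  proof -
    have "(THE w. adj x w \<and> \<xi> w = \<xi> y) = y"
      by (rule the_equality) (use that inj in \<open>auto dest: inj_onD\<close>)
    then show ?thesis using \<xi>(1)[OF that] by (simp add: \<eta>_def)
  qed
  show ?thesis
  proof (rule isomorphic_CP)
    have "V \<subseteq> insert x (insert z (N x \<union> \<xi> ` N x))" using all by blast
    moreover have "finite (insert x (insert z (N x \<union> \<xi> ` N x)))" using fN by simp
    ultimately show "finite V" by (rule finite_subset)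
    show "bij_betw \<eta> {v \<in> V. col v = c} {v \<in> V. col v \<noteq> c}"
      unfolding X Y
    proof (rule bij_betw_imageI)
      show "inj_on \<eta> (insert x (\<xi> ` N x))"
      proof (rule inj_onI)
        fix u v assume uv: "u \<in> insert x (\<xi> ` N x)" "v \<in> insert x (\<xi> ` N x)" "\<eta> u = \<eta> v"
        have "u' = x \<or> (adj x (\<eta> u') \<and> u' = \<xi> (\<eta> u'))" if u': "u' \<in> insert x (\<xi> ` N x)" for u'
        proof (cases "u' = x")
          case False
          then have "u' \<in> \<xi> ` N x" using u' by blast
          then obtain y where y: "u' = \<xi> y" "y \<in> N x" by (rule imageE)
          then have "\<eta> u' = y" using \<eta>\<xi> by simp
          then show ?thesis using y by auto
        qed simp
        then show "u = v" using uv \<eta>x zN by (metis in_N)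
      qed
      have "(\<lambda>y. \<eta> (\<xi> y)) ` N x = (\<lambda>y. y) ` N x" by (rule image_cong) (use \<eta>\<xi> in auto)
      then show "\<eta> ` insert x (\<xi> ` N x) = insert z (N x)" using \<eta>x by (simp add: image_image)
    qed
    fix u w assume uw: "u \<in> V" "w \<in> V" "col u = c" "col w \<noteq> c"
    then have "u \<in> {v \<in> V. col v = c}" "w \<in> {v \<in> V. col v \<noteq> c}" by auto
    then have u: "u \<in> insert x (\<xi> ` N x)" and w: "w \<in> insert z (N x)" unfolding X Y .
    have nz: "\<not> adj x z" using zN by simp
    show "adj u w \<longleftrightarrow> w \<noteq> \<eta> u"
    proof (cases "u = x")
      case True
      have "adj x w \<or> w = z" using w by auto
      then show ?thesis unfolding True \<eta>x using nz by blast
    next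
      case False
      then have "u \<in> \<xi> ` N x" using u by blast
      then obtain y where y: "u = \<xi> y" "y \<in> N x" by (rule imageE)
      then have xy: "adj x y" by simp
      have "adj u w \<longleftrightarrow> w \<in> N (\<xi> y)" using y(1) by simp
      also have "\<dots> \<longleftrightarrow> w \<in> insert z (N x - {y})" by (simp only: N\<xi>[OF xy])
      also have "\<dots> \<longleftrightarrow> w \<noteq> y" using w y(2) zN by blast
      finally show ?thesis using \<eta>\<xi>[OF xy] y(1) by (simp only:)
    qed
  qed
qed

text \<open>With both codegrees two, each pair of neighbours of \<open>x\<close> is the trace of a
  further vertex. Let \<open>a\<close>, \<open>b\<close>, \<open>d\<close> have the traces 13, 23,
  24. An automorphism fixing \<open>x\<close> and \<open>a\<close> and sending \<open>b\<close> to
  \<open>d\<close> maps \<open>y3\<close> to a common neighbour of \<open>x\<close>,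
  \<open>a\<close> and \<open>d\<close>, but 13 and 24 are disjoint.\<close>

lemma no_rectagraph:
  assumes c: "codeg True 2" "codeg False 2" and d: "dgr True \<ge> 4"
  shows False
proof -
  obtain x where x: "x \<in> V" "col x" using colour_vertex[of True] by blast
  have "card (N x) \<ge> 4" using N_card[OF x(1)] x d by simp
  then obtain Y where Y: "Y \<subseteq> N x" "card Y = 4" by (meson obtain_subset_with_card_n)
  then obtain ys where ys: "set ys = Y" "distinct ys" "length ys = 4"
    using finite_distinct_list[of Y] distinct_card by (metis card.infinite zero_neq_numeral)
  then obtain y1 y2 y3 y4 where ys4: "ys = [y1, y2, y3, y4]"
    by (auto simp: length_Suc_conv numeral_eq_Suc)
  have "set [y1, y2, y3, y4] \<subseteq> N x" using ys(1) Y(1) unfolding ys4 by blast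
  then have y: "adj x y1" "adj x y2" "adj x y3" "adj x y4" "distinct [y1, y2, y3, y4]"
    using ys(2) unfolding ys4 by simp_all
  have ex: "\<exists>z. z \<noteq> x \<and> N x \<inter> N z = {p, q}" if pq: "adj x p" "adj x q" "p \<noteq> q" for p q
  proof -
    have "card (N p \<inter> N q) = 2"
      using codegD[OF c(2) adj_sym[OF pq(1)] adj_sym[OF pq(2)] pq(3)] adj_col[OF pq(1)] x by auto
    moreover have "x \<in> N p \<inter> N q" using pq adj_sym by simp
    ultimately obtain z where z: "z \<in> N p \<inter> N q" "z \<noteq> x" by (metis card_2_iff' )
    then have zz: "adj z p" "adj z q" using adj_sym by auto
    have "card (N x \<inter> N z) = 2" using codegD[OF c(1) pq(1) zz(1)] z x by auto
    then have "finite (N x \<inter> N z)" by (metis card.infinite zero_neq_numeral)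
    then have "{p, q} = N x \<inter> N z"
      by (rule card_subset_eq) (use pq zz \<open>card (N x \<inter> N z) = 2\<close> in auto)
    then show ?thesis using z by blast
  qed
  obtain a where a: "a \<noteq> x" "N x \<inter> N a = {y1, y3}" using ex[of y1 y3] y by auto
  obtain b where b: "b \<noteq> x" "N x \<inter> N b = {y2, y3}" using ex[of y2 y3] y by auto
  obtain d where d: "d \<noteq> x" "N x \<inter> N d = {y2, y4}" using ex[of y2 y4] y by auto
  have adj_iff: "adj u w \<longleftrightarrow> w \<in> {p, q}" if "N x \<inter> N u = {p, q}" "adj x w" for u w p q
  proof -
    have "w \<in> N x \<inter> N u \<longleftrightarrow> w \<in> {p, q}" by (simp only: that(1))
    then show ?thesis using that(2) by simp
  qed
  have aa: "adj a y1" "adj a y3" "\<not> adj a y2"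
    using adj_iff[OF a(2) y(1)] adj_iff[OF a(2) y(3)] adj_iff[OF a(2) y(2)] y(5) by auto
  have bb: "adj b y2" "adj b y3" "\<not> adj b y1"
    using adj_iff[OF b(2) y(2)] adj_iff[OF b(2) y(3)] adj_iff[OF b(2) y(1)] y(5) by auto
  have dd: "adj d y2" "adj d y4" "\<not> adj d y1" "\<not> adj d y3"
    using adj_iff[OF d(2) y(2)] adj_iff[OF d(2) y(4)] adj_iff[OF d(2) y(1)] adj_iff[OF d(2) y(3)] y(5) by auto
  have ne: "a \<noteq> b" "a \<noteq> d" using aa bb dd by auto
  have col: "\<not> col y1" "\<not> col y2" "\<not> col y3" "col a" "col b" "col d"
    using adj_col y x aa bb dd by metis+
  have "\<exists>g. aut g \<and> (\<forall>z\<in>set [x, y1, y2, a]. g z = z) \<and> g b = d"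
  proof (rule hom_swap)
    show "distinct [x, y1, y2, a]" using y a col x by auto
    show "set [x, y1, y2, a] \<subseteq> V" using x y adj_verts2 adj_verts aa by auto
    show "\<exists>j<i. adj ([x, y1, y2, a] ! j) ([x, y1, y2, a] ! i)" if "0 < i" "i < length [x, y1, y2, a]" for i
    proof -
      have "i = 1 \<or> i = 2 \<or> i = 3" using that by auto
      then show ?thesis
      proof (elim disjE)
        assume "i = 3"
        then show ?thesis using adj_sym[OF aa(1)] by (intro exI[of _ 1]) simp
      qed (use y in \<open>auto intro!: exI[of _ 0]\<close>)
    qed
    show "b \<in> V" "d \<in> V" using bb dd adj_verts by blast+
    show "b \<notin> set [x, y1, y2, a]" "d \<notin> set [x, y1, y2, a]" using b d ne col by auto
    show "col b = col d" using col by simp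
    show "\<exists>z\<in>set [x, y1, y2, a]. adj z b" using adj_sym[OF bb(1)] by auto
    fix z assume "z \<in> set [x, y1, y2, a]"
    moreover have "\<not> adj z b \<and> \<not> adj z d" if "col z" using adj_col that col by metis
    ultimately show "adj z b \<longleftrightarrow> adj z d" using bb dd x col by (auto simp: uadj_commute)
  qed
  then obtain g where g: "aut g" "g x = x" "g a = a" "g b = d" by auto
  have "adj x (g y3)" "adj a (g y3)" "adj d (g y3)"
    using aut_adj[OF g(1) y(3)] aut_adj[OF g(1) aa(2)] aut_adj[OF g(1) bb(2)] g by auto
  then have "g y3 \<in> {y1, y3}" "g y3 \<in> {y2, y4}" using adj_iff[OF a(2)] adj_iff[OF d(2)] by blast+
  then show False using y(5) by auto
qed

lemma codeg_exists:
  assumes "adj x y" "adj x' y" "x \<noteq> x'" "col x = c"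
  shows "codeg c (card (N x \<inter> N x'))"
  unfolding codeg_def using codegree[OF _ _ _ assms(1,2,3)] assms(4) by blast

end

text \<open>Vertices of degree one with a common neighbour are twins.\<close>

lemma (in bip_graph) star_case:
  assumes c: "dgr c = 1" shows "listed_graph G"
proof (rule listed_if_twins)
  fix x x' y assume a: "adj x y" "adj x' y" "col x = c"
  then have c': "col x' = c" using adj_col by metis
  have "N z = {y}" if "adj z y" "col z = c" for z
  proof -
    have "card (N z) = 1" using N_card[OF adj_verts[OF that(1)]] that c by simp
    then obtain w where "N z = {w}" by (metis card_1_singletonE)
    then show ?thesis using that by (metis in_N singletonD)
  qed
  then show "N x = N x'" using a c' by simp
qed

context hom_bip
begin

theorem homogeneous_bipartite_listed: "listed_graph G"
proof (cases "dgr True = 1 \<or> dgr False = 1")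
  case True
  then show ?thesis using star_case by blast
next
  case False
  then have deg: "dgr c \<ge> 2" for c
    using dgr_pos[of True] dgr_pos[of False] by (cases c) auto
  show ?thesis
  proof (cases "uacyclic G")
    case True
    then show ?thesis using tree_case deg by blast
  next
    case cyclic: False
    then obtain zs where zs: "is_cyc zs" "length zs = girth" using not_acyclic girth_cyc by metis
    show ?thesis
    proof (cases "\<forall>c. dgr c = 2")
      case True
      then show ?thesis using cycle_case[OF zs(1)] by blast
    next
      case False
      then obtain c where c: "dgr c \<ge> 3" using deg by (metis le_antisym not_less_eq_eq numeral_2_eq_2 numeral_3_eq_3)
      \<comment> \<open>Some degree is at least three, so the shortest cycle has length four, and
        its opposite vertices show that both codegrees are at least two.\<close>
      have "\<not> girth > 4"
        using girth_at_most_6[OF zs c] no_girth_6[OF zs c deg] by blast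
      then have len: "length zs = 4" using cyc_even(2)[OF zs(1)] zs(2) by simp
      then obtain p q r s where "zs = [p, q, r, s]" by (auto simp: length_Suc_conv numeral_eq_Suc)
      then have pq: "adj p q" "adj q r" "adj r s" "adj s p" "p \<noteq> r" "q \<noteq> s"
        using zs(1) by (auto simp: is_cyc_def)
      have two: "2 \<le> card (N u \<inter> N v)" if "adj u a" "adj v a" "adj u b" "adj v b" "a \<noteq> b" for u v a b
      proof -
        have "card {a, b} \<le> card (N u \<inter> N v)"
          using that N_fin[of u] adj_verts[of u a] by (intro card_mono) auto
        then show ?thesis using that by simp
      qed
      have ex: "\<exists>k. codeg c (Suc k) \<and> 1 \<le> k" for c
      proof -
        have "codeg (col p) (card (N p \<inter> N r))" "2 \<le> card (N p \<inter> N r)"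
          using codeg_exists[of p q r] two[of p q r s] pq adj_sym by auto
        moreover have "codeg (col q) (card (N q \<inter> N s))" "2 \<le> card (N q \<inter> N s)"
          using codeg_exists[of q r s] two[of q r s p] pq adj_sym by auto
        moreover have "c = col p \<or> c = col q" using adj_col[OF pq(1)] by auto
        ultimately obtain n where n: "codeg c n" "2 \<le> n" by blast
        then show ?thesis by (intro exI[of _ "n - 1"]) simp
      qed
      obtain k where k: "\<And>c. codeg c (Suc (k c)) \<and> 1 \<le> k c" using ex by metis
      have le: "Suc (k c) \<le> dgr c" for c
      proof -
        have "\<exists>x y x'. adj x y \<and> adj x' y \<and> x \<noteq> x' \<and> col x = c"
        proof (cases "col p = c")
          case True
          then show ?thesis using pq adj_sym by blast
        next
          case False
          then have "col q = c" using adj_col[OF pq(1)] by auto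
          then show ?thesis using pq adj_sym by blast
        qed
        then obtain x y x' where xy: "adj x y" "adj x' y" "x \<noteq> x'" "col x = c" by blast
        then have "card (N x \<inter> N x') = Suc (k c)" using codegD k by blast
        moreover have "card (N x \<inter> N x') \<le> card (N x)" using N_fin adj_verts[OF xy(1)] by (intro card_mono) auto
        ultimately show ?thesis using N_card[OF adj_verts[OF xy(1)]] xy(4) by simp
      qed
      \<comment> \<open>Full codegree gives twins, codegree one below the degree gives the
        complement of a matching, and otherwise both codegrees are two.\<close>
      consider c where "Suc (k c) = dgr c" | c where "Suc (Suc (k c)) = dgr c" |
         "\<And>c. Suc (Suc (k c)) < dgr c"
      proof (cases "(\<exists>c. Suc (k c) = dgr c) \<or> (\<exists>c. Suc (Suc (k c)) = dgr c)")
        case True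
        then show ?thesis using that(1,2) by blast
      next
        case False
        then have "Suc (Suc (k c)) < dgr c" for c using le[of c] by (metis Suc_leI le_neq_implies_less)
        then show ?thesis using that(3) by blast
      qed
      then show ?thesis
      proof cases
        case (1 c)
        show ?thesis
        proof (rule listed_if_twins)
          fix x x' y assume a: "adj x y" "adj x' y" "col x = c"
          then have c': "col x' = c" using adj_col by metis
          show "N x = N x'"
          proof (cases "x = x'")
            case False
            then have I: "card (N x \<inter> N x') = dgr c" using codegD[OF conjunct1[OF k] a(1,2)] a 1 by simp
            have V: "x \<in> V" "x' \<in> V" using a adj_verts by auto
            have "N x \<inter> N x' = N x" "N x \<inter> N x' = N x'"
              using card_subset_eq[OF N_fin[OF V(1)], of "N x \<inter> N x'"] card_subset_eq[OF N_fin[OF V(2)], of "N x \<inter> N x'"]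
                N_card V a c' I by auto
            then show ?thesis by simp
          qed simp
        qed
      next
        case (2 c)
        then show ?thesis using CP_case[of c "k c"] k deg by blast
      next
        case 3
        have one: "k c = 1" for c
          using codegree_cases[of c "k c"] k deg 3[of c] by (metis Suc_lessD less_irrefl)
        then have "codeg True 2" "codeg False 2" using k[of True] k[of False] by (simp_all add: numeral_2_eq_2)
        then show ?thesis using no_rectagraph 3[of True] one[of True] by simp
      qed
    qed
  qed
qed

end

section \<open>One-point extensions\<close>

text \<open>The set \<open>S\<close> is not required to be finite, so that Zorn's lemma applies.\<close>

definition one_point_extendable :: "'a dg \<Rightarrow> bool" where
  "one_point_extendable D \<longleftrightarrow> (\<forall>S f v. S \<subseteq> verts D \<longrightarrow> connected_on (ugraph D) S \<longrightarrow> inj_on f S \<longrightarrow> f ` S \<subseteq> verts D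
     \<longrightarrow> (\<forall>x\<in>S. \<forall>y\<in>S. (f x, f y) \<in> arcs D \<longleftrightarrow> (x, y) \<in> arcs D) \<longrightarrow> v \<in> verts D - S \<longrightarrow> (\<exists>s\<in>S. uadj D s v)
     \<longrightarrow> (\<exists>w\<in>verts D - f ` S. \<forall>u\<in>S. ((f u, w) \<in> arcs D \<longleftrightarrow> (u, v) \<in> arcs D) \<and> ((w, f u) \<in> arcs D \<longleftrightarrow> (v, u) \<in> arcs D)))"

text \<open>Encoded as a relation, so that inverses and unions of chains are again of this
  kind.\<close>

definition partial_iso :: "'a dg \<Rightarrow> ('a \<times> 'a) set \<Rightarrow> bool" where
  "partial_iso D F \<longleftrightarrow> F \<subseteq> verts D \<times> verts D \<and> connected_on (ugraph D) (Domain F) \<and>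
     (\<forall>x y x' y'. (x, y) \<in> F \<longrightarrow> (x', y') \<in> F \<longrightarrow> (x = x' \<longleftrightarrow> y = y') \<and> ((x, x') \<in> arcs D \<longleftrightarrow> (y, y') \<in> arcs D))"

lemma partial_isoD:
  assumes "partial_iso D F" "(x, y) \<in> F" "(x', y') \<in> F"
  shows "x = x' \<longleftrightarrow> y = y'" "(x, x') \<in> arcs D \<longleftrightarrow> (y, y') \<in> arcs D" "uadj D x x' \<longleftrightarrow> uadj D y y'"
  using assms unfolding partial_iso_def uadj_def by blast+

text \<open>The point is connectedness of the range: walks in the domain are carried over step by
  step.\<close>

lemma partial_iso_converse:
  assumes F: "partial_iso D F" shows "partial_iso D (F\<inverse>)"
proof -
  have conn: "connected_on (ugraph D) (Range F)"
    unfolding connected_on_def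
  proof (intro ballI)
    fix y y' assume "y \<in> Range F" "y' \<in> Range F"
    then obtain x x' where x: "(x, y) \<in> F" "(x', y') \<in> F" by blast
    have "(x, x') \<in> (ugraph D \<inter> Domain F \<times> Domain F)\<^sup>*"
      using F x unfolding partial_iso_def connected_on_def by blast
    then have "\<forall>z'. (x', z') \<in> F \<longrightarrow> (y, z') \<in> (ugraph D \<inter> Range F \<times> Range F)\<^sup>*"
    proof (induction rule: rtrancl_induct)
      case base
      show ?case using partial_isoD(1)[OF F x(1)] by auto
    next
      case (step a b)
      obtain a' where a': "(a, a') \<in> F" using step.hyps(2) by blast
      show ?case
      proof (intro allI impI)
        fix b' assume b': "(b, b') \<in> F"
        have "(a', b') \<in> ugraph D \<inter> Range F \<times> Range F"
          using step.hyps(2) partial_isoD(3)[OF F a' b'] a' b' by (auto simp: ugraph_def)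
        then show "(y, b') \<in> (ugraph D \<inter> Range F \<times> Range F)\<^sup>*"
          using step.IH a' by (meson rtrancl.rtrancl_into_rtrancl)
      qed
    qed
    then show "(y, y') \<in> (ugraph D \<inter> Range F \<times> Range F)\<^sup>*" using x by blast
  qed
  show ?thesis
    unfolding partial_iso_def
  proof (intro conjI allI impI)
    show "F\<inverse> \<subseteq> verts D \<times> verts D" using F by (auto simp: partial_iso_def)
    show "connected_on (ugraph D) (Domain (F\<inverse>))" using conn by simp
    fix x y x' y' assume xy: "(x, y) \<in> F\<inverse>" "(x', y') \<in> F\<inverse>"
    show "x = x' \<longleftrightarrow> y = y'" using partial_isoD(1)[OF F, of y x y' x'] xy by auto
    show "(x, x') \<in> arcs D \<longleftrightarrow> (y, y') \<in> arcs D" using partial_isoD(2)[OF F, of y x y' x'] xy by auto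
  qed
qed

lemma connected_on_insert:
  assumes R: "sym R" and S: "connected_on R S" and s: "s \<in> S" "(s, v) \<in> R"
  shows "connected_on R (insert v S)"
proof (rule connected_on_via[OF R, of s])
  show "s \<in> insert v S" using s by simp
  have sub: "(R \<inter> S \<times> S)\<^sup>* \<subseteq> (R \<inter> insert v S \<times> insert v S)\<^sup>*" by (rule rtrancl_mono) auto
  fix x assume "x \<in> insert v S"
  then show "(s, x) \<in> (R \<inter> insert v S \<times> insert v S)\<^sup>*"
  proof
    assume "x = v"
    then show ?thesis using s by (intro r_into_rtrancl) auto
  next
    assume "x \<in> S"
    then have "(s, x) \<in> (R \<inter> S \<times> S)\<^sup>*" using S s unfolding connected_on_def by blast
    then show ?thesis using sub by (rule subsetD[rotated])
  qed
qed

text \<open>Connectedness of the digraph supplies a new vertex adjacent to the domain, so the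
  extension property applies.\<close>

lemma partial_iso_extend:
  assumes wf: "wf_digraph D" and uc: "uconnected D" and ope: "one_point_extendable D"
    and F: "partial_iso D F" "F \<noteq> {}" and dom: "Domain F \<noteq> verts D"
  shows "\<exists>v w. v \<notin> Domain F \<and> partial_iso D (insert (v, w) F)"
proof -
  let ?S = "Domain F"
  have SV: "?S \<subseteq> verts D" and RV: "Range F \<subseteq> verts D" using F(1) by (auto simp: partial_iso_def)
  obtain x0 where x0: "x0 \<in> ?S" using F(2) by auto
  obtain y0 where y0: "y0 \<in> verts D" "y0 \<notin> ?S" using dom SV by blast
  have "(x0, y0) \<in> (ugraph D)\<^sup>*"
    using uc x0 SV y0 by (intro connected_on_rtrancl[of _ "verts D"]) (auto simp: uconnected_iff)
  from rtrancl_leaves[OF this x0 y0(2)] obtain s v where sv: "uadj D s v" "s \<in> ?S" "v \<notin> ?S"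
    by (auto simp: ugraph_def)
  have vV: "v \<in> verts D" using sv uadj_in_verts[OF wf] by blast
  define f where "f x = (SOME y. (x, y) \<in> F)" for x
  have f: "(x, f x) \<in> F" if "x \<in> ?S" for x using that unfolding f_def by (metis DomainE someI_ex)
  have f_uniq: "y = f x" if "(x, y) \<in> F" for x y
    using partial_isoD(1)[OF F(1) that f] that by blast
  have rng: "f ` ?S = Range F" using f f_uniq by blast
  have "inj_on f ?S" using partial_isoD(1)[OF F(1) f f] by (auto intro: inj_onI)
  moreover have "\<forall>x\<in>?S. \<forall>y\<in>?S. (f x, f y) \<in> arcs D \<longleftrightarrow> (x, y) \<in> arcs D" using partial_isoD(2)[OF F(1) f f] by blast
  moreover have "connected_on (ugraph D) ?S" using F(1) by (simp add: partial_iso_def)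
  ultimately obtain w where w: "w \<in> verts D - Range F"
     "\<forall>u\<in>?S. ((f u, w) \<in> arcs D \<longleftrightarrow> (u, v) \<in> arcs D) \<and> ((w, f u) \<in> arcs D \<longleftrightarrow> (v, u) \<in> arcs D)"
    using ope[unfolded one_point_extendable_def, rule_format, of ?S f v] SV RV rng sv vV by auto
  have "partial_iso D (insert (v, w) F)"
    unfolding partial_iso_def
  proof (intro conjI allI impI)
    show "insert (v, w) F \<subseteq> verts D \<times> verts D" using F(1) vV w(1) by (auto simp: partial_iso_def)
    have "connected_on (ugraph D) (insert v ?S)"
      by (rule connected_on_insert[OF sym_ugraph _ sv(2)]) (use F(1) sv in \<open>auto simp: partial_iso_def ugraph_def\<close>)
    then show "connected_on (ugraph D) (Domain (insert (v, w) F))" by (simp only: Domain_insert fst_conv prod.case)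
    fix x y x' y' assume xy: "(x, y) \<in> insert (v, w) F" "(x', y') \<in> insert (v, w) F"
    have irr: "(z, z) \<notin> arcs D" for z using wf by (simp add: wf_digraph_def)
    have new: "z \<noteq> v" "u \<noteq> w" "(z, v) \<in> arcs D \<longleftrightarrow> (u, w) \<in> arcs D" "(v, z) \<in> arcs D \<longleftrightarrow> (w, u) \<in> arcs D"
      if "(z, u) \<in> F" for z u
      using that sv(3) w f_uniq[OF that] by blast+
    consider "(x, y) = (v, w)" "(x', y') = (v, w)" | "(x, y) = (v, w)" "(x', y') \<in> F"
      | "(x, y) \<in> F" "(x', y') = (v, w)" | "(x, y) \<in> F" "(x', y') \<in> F" using xy by blast
    then have "(x = x' \<longleftrightarrow> y = y') \<and> ((x, x') \<in> arcs D \<longleftrightarrow> (y, y') \<in> arcs D)"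
    proof cases
      case 1 then show ?thesis using irr by simp
    next
      case 2 then show ?thesis using new[of x' y'] by auto
    next
      case 3 then show ?thesis using new[of x y] by auto
    next
      case 4 then show ?thesis using partial_isoD(1,2)[OF F(1)] by blast
    qed
    then show "x = x' \<longleftrightarrow> y = y'" "(x, x') \<in> arcs D \<longleftrightarrow> (y, y') \<in> arcs D" by blast+
  qed
  then show ?thesis using sv(3) by blast
qed

text \<open>A maximal partial isomorphism above the given one is total by the extension property,
  and surjective by the same property for its inverse.\<close>

theorem one_point_extendable_homogeneous:
  assumes wf: "wf_digraph D" and uc: "uconnected D" and ope: "one_point_extendable D"
  shows "connected_homogeneous D"
  unfolding connected_homogeneous_def
proof (intro allI impI)
  fix A B f assume "A \<subseteq> verts D \<and> B \<subseteq> verts D \<and> finite A \<and> finite B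
        \<and> uconnected (induced D A) \<and> uconnected (induced D B) \<and> dg_iso f (induced D A) (induced D B)"
  then have AB: "A \<subseteq> verts D" "B \<subseteq> verts D" "connected_on (ugraph D) A" "A \<noteq> {}" "bij_betw f A B"
    "\<And>x y. x \<in> A \<Longrightarrow> y \<in> A \<Longrightarrow> (x, y) \<in> arcs D \<longleftrightarrow> (f x, f y) \<in> arcs D"
    by (auto simp: uconnected_induced_iff dg_iso_def arcs_induced bij_betwE)
  define F0 where "F0 = {(x, f x) | x. x \<in> A}"
  have F0: "partial_iso D F0"
    unfolding partial_iso_def
  proof (intro conjI allI impI)
    show "F0 \<subseteq> verts D \<times> verts D" using AB(1,2) bij_betwE[OF AB(5)] by (auto simp: F0_def)
    have "Domain F0 = A" by (auto simp: F0_def)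
    then show "connected_on (ugraph D) (Domain F0)" using AB(3) by simp
    fix x y x' y' assume "(x, y) \<in> F0" "(x', y') \<in> F0"
    then have x: "x \<in> A" "x' \<in> A" "y = f x" "y' = f x'" by (auto simp: F0_def)
    show "x = x' \<longleftrightarrow> y = y'" using x bij_betw_imp_inj_on[OF AB(5)] by (auto dest: inj_onD)
    show "(x, x') \<in> arcs D \<longleftrightarrow> (y, y') \<in> arcs D" using AB(6) x by simp
  qed
  define P where "P = {F. partial_iso D F \<and> F0 \<subseteq> F}"
  have "\<exists>M\<in>P. \<forall>F\<in>P. M \<subseteq> F \<longrightarrow> F = M"
  proof (rule subset_Zorn_nonempty)
    show "P \<noteq> {}" using F0 by (auto simp: P_def)
    fix \<C> assume ne: "\<C> \<noteq> {}" and ch: "subset.chain P \<C>"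
    have CP: "F \<in> P" if "F \<in> \<C>" for F using ch that by (auto simp: subset.chain_def)
    have two: "\<exists>F\<in>\<C>. e \<in> F \<and> e' \<in> F" if e: "e \<in> \<Union>\<C>" "e' \<in> \<Union>\<C>" for e e'
    proof -
      obtain F F' where F: "F \<in> \<C>" "e \<in> F" "F' \<in> \<C>" "e' \<in> F'" using e by blast
      then have "F \<subseteq> F' \<or> F' \<subseteq> F" using ch unfolding subset_chain_def by blast
      then show ?thesis using F by blast
    qed
    have "partial_iso D (\<Union>\<C>)"
      unfolding partial_iso_def
    proof (intro conjI allI impI)
      show "\<Union>\<C> \<subseteq> verts D \<times> verts D" using CP unfolding P_def partial_iso_def by blast
      show "connected_on (ugraph D) (Domain (\<Union>\<C>))"
        unfolding connected_on_def
      proof (intro ballI)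
        fix x x' assume "x \<in> Domain (\<Union>\<C>)" "x' \<in> Domain (\<Union>\<C>)"
        then obtain y y' where "(x, y) \<in> \<Union>\<C>" "(x', y') \<in> \<Union>\<C>" by blast
        then obtain F where F: "F \<in> \<C>" "(x, y) \<in> F" "(x', y') \<in> F" using two by blast
        then have "connected_on (ugraph D) (Domain F)" using CP by (auto simp: P_def partial_iso_def)
        then have "(x, x') \<in> (ugraph D \<inter> Domain F \<times> Domain F)\<^sup>*" using F unfolding connected_on_def by blast
        moreover have "(ugraph D \<inter> Domain F \<times> Domain F)\<^sup>* \<subseteq> (ugraph D \<inter> Domain (\<Union>\<C>) \<times> Domain (\<Union>\<C>))\<^sup>*"
          by (rule rtrancl_mono) (use F in blast)
        ultimately show "(x, x') \<in> (ugraph D \<inter> Domain (\<Union>\<C>) \<times> Domain (\<Union>\<C>))\<^sup>*" by (rule subsetD[rotated])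
      qed
      fix x y x' y' assume "(x, y) \<in> \<Union>\<C>" "(x', y') \<in> \<Union>\<C>"
      then obtain F where F: "F \<in> \<C>" "(x, y) \<in> F" "(x', y') \<in> F" using two by blast
      then have "partial_iso D F" using CP by (simp add: P_def)
      from partial_isoD[OF this F(2,3)] show "x = x' \<longleftrightarrow> y = y'" "(x, x') \<in> arcs D \<longleftrightarrow> (y, y') \<in> arcs D" by auto
    qed
    moreover have "F0 \<subseteq> \<Union>\<C>" using ne CP by (auto simp: P_def)
    ultimately show "\<Union>\<C> \<in> P" by (simp add: P_def)
  qed
  then obtain M where M0: "M \<in> P" "\<forall>F\<in>P. M \<subseteq> F \<longrightarrow> F = M" by (elim bexE)
  then have M: "partial_iso D M" "F0 \<subseteq> M" by (simp_all add: P_def)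
  have max: "F = M" if "partial_iso D F" "M \<subseteq> F" for F
  proof -
    have "F \<in> P" unfolding P_def using that M(2) by blast
    then show ?thesis using M0(2) that(2) by blast
  qed
  have ne: "M \<noteq> {}" using M(2) AB(4) by (auto simp: F0_def)
  have dom: "Domain M = verts D"
  proof (rule ccontr)
    assume "Domain M \<noteq> verts D"
    from partial_iso_extend[OF wf uc ope M(1) ne this] obtain v w where
      "v \<notin> Domain M" "partial_iso D (insert (v, w) M)" by blast
    moreover from max[OF this(2)] have "insert (v, w) M = M" by blast
    ultimately show False by blast
  qed
  have rng: "Range M = verts D"
  proof (rule ccontr)
    assume "Range M \<noteq> verts D"
    then have "Domain (M\<inverse>) \<noteq> verts D" by simp
    from partial_iso_extend[OF wf uc ope partial_iso_converse[OF M(1)] _ this] ne obtain v w where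
      vw: "v \<notin> Domain (M\<inverse>)" "partial_iso D (insert (v, w) (M\<inverse>))" by auto
    have "partial_iso D ((insert (v, w) (M\<inverse>))\<inverse>)" by (rule partial_iso_converse[OF vw(2)])
    moreover have "(insert (v, w) (M\<inverse>))\<inverse> = insert (w, v) M" by auto
    ultimately have "partial_iso D (insert (w, v) M)" by simp
    from max[OF this] have "insert (w, v) M = M" by blast
    then show False using vw(1) by blast
  qed
  define g where "g x = (SOME y. (x, y) \<in> M)" for x
  have g: "(x, g x) \<in> M" if "x \<in> verts D" for x using that dom unfolding g_def by (metis DomainE someI_ex)
  have g_uniq: "y = g x" if "(x, y) \<in> M" for x y
  proof -
    have "x \<in> verts D" using that dom by blast
    then show ?thesis using partial_isoD(1)[OF M(1) that g] by blast
  qed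
  have "bij_betw g (verts D) (verts D)"
  proof (rule bij_betw_imageI)
    show "inj_on g (verts D)" using partial_isoD(1)[OF M(1) g g] by (auto intro: inj_onI)
    show "g ` verts D = verts D"
    proof (intro set_eqI iffI)
      fix y assume "y \<in> g ` verts D"
      then show "y \<in> verts D" using g rng by blast
    next
      fix y assume "y \<in> verts D"
      then obtain x where "(x, y) \<in> M" using rng by blast
      then show "y \<in> g ` verts D" using g_uniq dom by blast
    qed
  qed
  moreover have "(x, y) \<in> arcs D \<longleftrightarrow> (g x, g y) \<in> arcs D" if "x \<in> verts D" "y \<in> verts D" for x y
    using partial_isoD(2)[OF M(1) g g] that by blast
  ultimately have "automorphism g D" by (simp add: automorphism_def dg_iso_def)
  moreover have "\<forall>x\<in>A. g x = f x"
  proof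
    fix x assume "x \<in> A"
    then have "(x, f x) \<in> M" using M(2) by (auto simp: F0_def)
    from g_uniq[OF this] show "g x = f x" by simp
  qed
  ultimately show "\<exists>g. automorphism g D \<and> (\<forall>x\<in>A. g x = f x)" by blast
qed

section \<open>One-point extensions in the listed bipartite graphs\<close>

text \<open>Sides must be preserved because in a digraph glued from copies of \<open>B\<close> they
  are the sources and the sinks of a copy.\<close>

definition coloured_ope :: "'b dg \<Rightarrow> 'b set \<Rightarrow> bool" where
  "coloured_ope B X \<longleftrightarrow> (\<forall>W f v. W \<subseteq> verts B \<longrightarrow> connected_on (ugraph B) W \<longrightarrow> inj_on f W \<longrightarrow> f ` W \<subseteq> verts B
     \<longrightarrow> (\<forall>u\<in>W. f u \<in> X \<longleftrightarrow> u \<in> X) \<longrightarrow> (\<forall>u\<in>W. \<forall>u'\<in>W. uadj B (f u) (f u') \<longleftrightarrow> uadj B u u')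
     \<longrightarrow> v \<in> verts B - W \<longrightarrow> (\<exists>s\<in>W. uadj B s v)
     \<longrightarrow> (\<exists>w\<in>verts B - f ` W. (w \<in> X \<longleftrightarrow> v \<in> X) \<and> (\<forall>u\<in>W. uadj B (f u) w \<longleftrightarrow> uadj B u v)))"

locale bip_parts =
  fixes B :: "'b dg" and X Y :: "'b set"
  assumes bip: "bipartite_parts B X Y" and uconn: "uconnected B"
begin

lemma arcs_parts: "(x, y) \<in> arcs B \<Longrightarrow> x \<in> X \<and> y \<in> Y"
  using bip by (auto simp: bipartite_parts_def)

lemma parts: "X \<inter> Y = {}" "X \<union> Y = verts B" using bip by (auto simp: bipartite_parts_def)

lemma uadj_parts: "uadj B x y \<Longrightarrow> (x \<in> X \<longleftrightarrow> y \<notin> X)"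
  using arcs_parts parts unfolding uadj_def by blast

lemma uadj_V: "uadj B x y \<Longrightarrow> x \<in> verts B \<and> y \<in> verts B"
  using arcs_parts parts unfolding uadj_def by blast

text \<open>A connected graph has one 2-colouring up to exchange, so the given side \<open>X\<close>
  can be compared with the parts of a model graph.\<close>

lemma colours_agree:
  fixes c :: "'b \<Rightarrow> bool"
  assumes c: "\<And>x y. uadj B x y \<Longrightarrow> c x \<noteq> c y" and xy: "x \<in> verts B" "y \<in> verts B"
  shows "c x = c y \<longleftrightarrow> (x \<in> X \<longleftrightarrow> y \<in> X)"
proof -
  have "(x, y) \<in> (ugraph B)\<^sup>*" using uconn xy by (intro connected_on_rtrancl[of _ "verts B"]) (auto simp: uconnected_iff)
  then show ?thesis
  proof (induction rule: rtrancl_induct)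
    case (step u v)
    then have "uadj B u v" by (simp add: ugraph_def)
    from c[OF this] uadj_parts[OF this] show ?case using step.IH by blast
  qed simp
qed

lemma ope_I:
  assumes "\<And>W f v s. W \<subseteq> verts B \<Longrightarrow> connected_on (ugraph B) W \<Longrightarrow> inj_on f W \<Longrightarrow> f ` W \<subseteq> verts B
     \<Longrightarrow> (\<And>u. u \<in> W \<Longrightarrow> f u \<in> X \<longleftrightarrow> u \<in> X) \<Longrightarrow> (\<And>u u'. u \<in> W \<Longrightarrow> u' \<in> W \<Longrightarrow> uadj B (f u) (f u') \<longleftrightarrow> uadj B u u')
     \<Longrightarrow> v \<in> verts B \<Longrightarrow> v \<notin> W \<Longrightarrow> s \<in> W \<Longrightarrow> uadj B s v
     \<Longrightarrow> \<exists>w\<in>verts B - f ` W. (w \<in> X \<longleftrightarrow> v \<in> X) \<and> (\<forall>u\<in>W. uadj B (f u) w \<longleftrightarrow> uadj B u v)"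
  shows "coloured_ope B X"
  unfolding coloured_ope_def
proof (intro allI impI, goal_cases)
  case (1 W f v)
  then obtain s where "s \<in> W" "uadj B s v" by blast
  then show ?case using 1 by (intro assms[of W f v s]) simp_all
qed

lemma ope_complete:
  assumes fin: "finite (verts B)" and adj: "\<And>x y. x \<in> verts B \<Longrightarrow> y \<in> verts B \<Longrightarrow> uadj B x y \<longleftrightarrow> (x \<in> X \<longleftrightarrow> y \<notin> X)"
  shows "coloured_ope B X"
proof (rule ope_I)
  fix W f v s assume W: "W \<subseteq> verts B" "inj_on f W" "f ` W \<subseteq> verts B" "\<And>u. u \<in> W \<Longrightarrow> f u \<in> X \<longleftrightarrow> u \<in> X"
    and v: "v \<in> verts B" "v \<notin> W"
  let ?cl = "{u \<in> verts B. u \<in> X \<longleftrightarrow> v \<in> X}"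
  have "W \<inter> ?cl \<subset> ?cl" using v by blast
  then have "card (W \<inter> ?cl) < card ?cl" using fin by (intro psubset_card_mono) auto
  moreover have "card (f ` (W \<inter> ?cl)) \<le> card (W \<inter> ?cl)" using fin by (intro card_image_le) auto
  ultimately have lt: "card (f ` (W \<inter> ?cl)) < card ?cl" by (rule le_less_trans[rotated])
  have "\<not> ?cl \<subseteq> f ` (W \<inter> ?cl)"
  proof
    assume "?cl \<subseteq> f ` (W \<inter> ?cl)"
    then have "card ?cl \<le> card (f ` (W \<inter> ?cl))" using fin by (intro card_mono) auto
    then show False using lt by simp
  qed
  then obtain w where w: "w \<in> ?cl" "w \<notin> f ` (W \<inter> ?cl)" by blast
  have "w \<notin> f ` W"
  proof
    assume "w \<in> f ` W"
    then obtain u where u: "u \<in> W" "w = f u" by blast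
    then have "u \<in> W \<inter> ?cl" using W(1,4) w(1) by blast
    then show False using w(2) u(2) by blast
  qed
  moreover have "uadj B (f u) w \<longleftrightarrow> uadj B u v" if "u \<in> W" for u
  proof -
    have "uadj B (f u) w \<longleftrightarrow> (f u \<in> X \<longleftrightarrow> w \<notin> X)" using adj W(3) w(1) that by blast
    moreover have "uadj B u v \<longleftrightarrow> (u \<in> X \<longleftrightarrow> v \<notin> X)" using adj W(1) v that by blast
    ultimately show ?thesis using W(4)[OF that] w(1) by blast
  qed
  ultimately show "\<exists>w\<in>verts B - f ` W. (w \<in> X \<longleftrightarrow> v \<in> X) \<and> (\<forall>u\<in>W. uadj B (f u) w \<longleftrightarrow> uadj B u v)"
    using w(1) by blast
qed

lemma ope_K_bip:
  assumes "u_isomorphic B (K_bip m n)" shows "coloured_ope B X \<and> finite (verts B)"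
proof -
  obtain h where h: "bij_betw h (verts B) (verts (K_bip m n))"
    "\<And>x y. x \<in> verts B \<Longrightarrow> y \<in> verts B \<Longrightarrow> uadj B x y \<longleftrightarrow> uadj (K_bip m n) (h x) (h y)"
    using assms unfolding u_isomorphic_def by blast
  have ad: "uadj B x y \<longleftrightarrow> fst (h x) \<noteq> fst (h y)" if "x \<in> verts B" "y \<in> verts B" for x y
  proof -
    have "h x \<in> verts (K_bip m n)" "h y \<in> verts (K_bip m n)" using bij_betwE[OF h(1)] that by auto
    then show ?thesis unfolding h(2)[OF that] by (auto simp: K_bip_def uadj_def)
  qed
  have agree: "fst (h x) = fst (h y) \<longleftrightarrow> (x \<in> X \<longleftrightarrow> y \<in> X)" if "x \<in> verts B" "y \<in> verts B" for x y
    by (rule colours_agree[OF _ that]) (use ad uadj_V in blast)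
  have "{(False, i) |i. i < m} = Pair False ` {..<m}" "{(True, j) |j. j < n} = Pair True ` {..<n}" by auto
  then have "finite (verts (K_bip m n))" by (simp add: K_bip_def)
  then have fin: "finite (verts B)" using h(1) bij_betw_finite by blast
  have "coloured_ope B X" by (rule ope_complete[OF fin]) (use ad agree in blast)
  then show ?thesis using fin by blast
qed

lemma ope_CP:
  assumes "u_isomorphic B (CP_graph n)" shows "coloured_ope B X \<and> finite (verts B)"
proof -
  obtain h where h: "bij_betw h (verts B) (verts (CP_graph n))"
    "\<And>x y. x \<in> verts B \<Longrightarrow> y \<in> verts B \<Longrightarrow> uadj B x y \<longleftrightarrow> uadj (CP_graph n) (h x) (h y)"
    using assms unfolding u_isomorphic_def by blast
  have vCP: "p \<in> verts (CP_graph n) \<longleftrightarrow> snd p < n" for p by (cases p) (auto simp: CP_graph_def)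
  have hlt: "snd (h x) < n" if "x \<in> verts B" for x using bij_betwE[OF h(1)] that vCP by blast
  have ad: "uadj B x y \<longleftrightarrow> fst (h x) \<noteq> fst (h y) \<and> snd (h x) \<noteq> snd (h y)" if "x \<in> verts B" "y \<in> verts B" for x y
    unfolding h(2)[OF that] using hlt[OF that(1)] hlt[OF that(2)]
    by (cases "h x"; cases "h y") (auto simp: CP_graph_def uadj_def)
  have agree: "fst (h x) = fst (h y) \<longleftrightarrow> (x \<in> X \<longleftrightarrow> y \<in> X)" if "x \<in> verts B" "y \<in> verts B" for x y
    by (rule colours_agree[OF _ that]) (use ad uadj_V in blast)
  have "{(False, i) |i. i < n} = Pair False ` {..<n}" "{(True, j) |j. j < n} = Pair True ` {..<n}" by auto
  then have "finite (verts (CP_graph n))" by (simp add: CP_graph_def)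
  then have fin: "finite (verts B)" using h(1) bij_betw_finite by blast
  have hinj: "x = y \<longleftrightarrow> fst (h x) = fst (h y) \<and> snd (h x) = snd (h y)" if "x \<in> verts B" "y \<in> verts B" for x y
    using inj_on_eq_iff[OF bij_betw_imp_inj_on[OF h(1)] that] by (auto simp: prod_eq_iff)
  have hsurj: "\<exists>w\<in>verts B. fst (h w) = b \<and> snd (h w) = i" if "i < n" for b i
  proof -
    have "(b, i) \<in> h ` verts B" using h(1) vCP that by (simp add: bij_betw_def)
    then obtain w where "(b, i) = h w" "w \<in> verts B" by (rule imageE)
    then show ?thesis by (metis fst_conv snd_conv)
  qed
  have "coloured_ope B X"
  proof (rule ope_I)
    fix W f v s assume W: "W \<subseteq> verts B" "inj_on f W" "f ` W \<subseteq> verts B" "\<And>u. u \<in> W \<Longrightarrow> f u \<in> X \<longleftrightarrow> u \<in> X"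
      "\<And>u u'. u \<in> W \<Longrightarrow> u' \<in> W \<Longrightarrow> uadj B (f u) (f u') \<longleftrightarrow> uadj B u u'"
      and v: "v \<in> verts B" "v \<notin> W"
    have uV: "u \<in> verts B" "f u \<in> verts B" if "u \<in> W" for u using that W by blast+
    have fcol: "fst (h (f u)) = fst (h (f u')) \<longleftrightarrow> fst (h u) = fst (h u')" if "u \<in> W" "u' \<in> W" for u u'
      using agree uV that W(4) by simp
    have fidx: "snd (h (f u)) = snd (h (f u')) \<longleftrightarrow> snd (h u) = snd (h u')" if u: "u \<in> W" "u' \<in> W" for u u'
    proof (cases "fst (h u) = fst (h u')")
      case True
      then have "snd (h u) = snd (h u') \<longleftrightarrow> u = u'" "snd (h (f u)) = snd (h (f u')) \<longleftrightarrow> f u = f u'"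
        using hinj uV u fcol by simp_all
      then show ?thesis using W(2) u by (metis inj_onD)
    next
      case False
      then show ?thesis using W(5)[OF u] ad uV u fcol by simp
    qed
    show "\<exists>w\<in>verts B - f ` W. (w \<in> X \<longleftrightarrow> v \<in> X) \<and> (\<forall>u\<in>W. uadj B (f u) w \<longleftrightarrow> uadj B u v)"
    proof (cases "\<exists>u0\<in>W. snd (h u0) = snd (h v)")
      case True
      then obtain u0 where u0: "u0 \<in> W" "snd (h u0) = snd (h v)" by blast
      have c0: "fst (h u0) \<noteq> fst (h v)" using u0 v hinj[of u0 v] uV by auto
      obtain w where w: "w \<in> verts B" "fst (h w) = (\<not> fst (h (f u0)))" "snd (h w) = snd (h (f u0))"
        using hsurj hlt uV u0 by blast
      have col: "fst (h (f u)) = fst (h w) \<longleftrightarrow> fst (h u) = fst (h v)" if "u \<in> W" for u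
        using fcol[OF that u0(1)] w(2) c0 by auto
      have colX: "w \<in> X \<longleftrightarrow> v \<in> X"
        using agree[OF w(1) uV(2)[OF u0(1)]] agree[OF v(1) uV(1)[OF u0(1)]] w(2) c0 W(4)[OF u0(1)] by auto
      have idx: "snd (h (f u)) = snd (h w) \<longleftrightarrow> snd (h u) = snd (h v)" if "u \<in> W" for u
        using fidx[OF that u0(1)] w(3) u0(2) by simp
      have "w \<notin> f ` W"
      proof
        assume "w \<in> f ` W"
        then obtain u where u: "u \<in> W" "w = f u" by blast
        then have "fst (h u) = fst (h v)" "snd (h u) = snd (h v)" using col[OF u(1)] idx[OF u(1)] by simp_all
        then have "u = v" using hinj uV(1)[OF u(1)] v by blast
        then show False using u v by blast
      qed
      moreover have "uadj B (f u) w \<longleftrightarrow> uadj B u v" if "u \<in> W" for u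
        using ad[OF uV(2)[OF that] w(1)] ad[OF uV(1)[OF that] v(1)] col[OF that] idx[OF that] by simp
      ultimately show ?thesis using w(1) colX by blast
    next
      case False
      define I where "I = (\<lambda>u. snd (h u)) ` W"
      define J where "J = (\<lambda>u. snd (h (f u))) ` W"
      have "I \<subseteq> {..<n} - {snd (h v)}" using False hlt uV by (auto simp: I_def)
      then have "card I \<le> card ({..<n} - {snd (h v)})" by (intro card_mono) auto
      then have cI: "card I < n" using hlt[OF v(1)] by simp
      \<comment> \<open>Representatives show that the image uses no more indices than
        \<open>W\<close>, hence fewer than \<open>n\<close>.\<close>
      define r where "r i = (SOME u. u \<in> W \<and> snd (h u) = i)" for i
      have r: "r i \<in> W" "snd (h (r i)) = i" if "i \<in> I" for i
      proof -
        have "\<exists>u. u \<in> W \<and> snd (h u) = i" using that by (auto simp: I_def)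
        from someI_ex[OF this] show "r i \<in> W" "snd (h (r i)) = i" by (auto simp: r_def)
      qed
      have "J \<subseteq> (\<lambda>i. snd (h (f (r i)))) ` I"
      proof
        fix j assume "j \<in> J"
        then obtain u where u: "u \<in> W" "j = snd (h (f u))" by (auto simp: J_def)
        then have i: "snd (h u) \<in> I" by (auto simp: I_def)
        have "snd (h (f (r (snd (h u))))) = j" using fidx[OF r(1)[OF i] u(1)] r(2)[OF i] u(2) by simp
        then show "j \<in> (\<lambda>i. snd (h (f (r i)))) ` I" using i by blast
      qed
      moreover have "finite I" using fin W(1) finite_subset by (auto simp: I_def)
      ultimately have "card J \<le> card I" by (meson card_image_le card_mono finite_imageI le_trans)
      then have "card J < card {..<n}" using cI by simp
      moreover have "finite J" using fin W(1) finite_subset by (auto simp: J_def)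
      ultimately have "\<not> {..<n} \<subseteq> J" using card_mono[of J "{..<n}"] by linarith
      then obtain i where i: "i < n" "i \<notin> J" by auto
      obtain w where w: "w \<in> verts B" "fst (h w) = fst (h v)" "snd (h w) = i" using hsurj[OF i(1)] by blast
      have nJ: "snd (h (f u)) \<noteq> snd (h w)" if "u \<in> W" for u
      proof -
        have "snd (h (f u)) \<in> J" unfolding J_def using that by (rule imageI)
        then show ?thesis using i(2) w(3) by metis
      qed
      have colX: "w \<in> X \<longleftrightarrow> v \<in> X" using agree[OF w(1) v(1)] w(2) by simp
      have "w \<notin> f ` W" using nJ by blast
      moreover have "uadj B (f u) w \<longleftrightarrow> uadj B u v" if "u \<in> W" for u
      proof -
        have "fst (h (f u)) = fst (h w) \<longleftrightarrow> fst (h u) = fst (h v)"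
          using agree[OF uV(2)[OF that] w(1)] agree[OF uV(1)[OF that] v(1)] W(4)[OF that] colX by blast
        then show ?thesis
          using ad[OF uV(2)[OF that] w(1)] ad[OF uV(1)[OF that] v(1)] nJ[OF that] False that by auto
      qed
      ultimately show ?thesis using w(1) colX by blast
    qed
  qed
  then show ?thesis using fin by blast
qed

end

text \<open>Adjacency in a cycle as a congruence: the dihedral maps then are \<open>x \<mapsto> \<plusminus> x + k\<close>.\<close>

definition cadj :: "int \<Rightarrow> int \<Rightarrow> int \<Rightarrow> bool" where
  "cadj m i j \<longleftrightarrow> m dvd j - i - 1 \<or> m dvd i - j - 1"

lemma cycle_graph_adj:
  assumes "i < m" "j < m" shows "uadj (cycle_graph m) i j \<longleftrightarrow> cadj (int m) (int i) (int j)"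
proof -
  have one: "j = Suc i mod m \<longleftrightarrow> int m dvd int j - int i - 1" if "i < m" "j < m" for i j
  proof -
    have "j = Suc i mod m \<longleftrightarrow> int j = int (Suc i) mod int m" by (metis of_nat_eq_iff zmod_int)
    also have "\<dots> \<longleftrightarrow> int j mod int m = int (Suc i) mod int m" using that by simp
    also have "\<dots> \<longleftrightarrow> int m dvd int j - int (Suc i)" by (rule mod_eq_dvd_iff)
    also have "int j - int (Suc i) = int j - int i - 1" by simp
    finally show ?thesis .
  qed
  show ?thesis using one[OF assms] one[OF assms(2,1)] assms by (auto simp: uadj_def cycle_graph_def cadj_def)
qed

lemma int_dvd_small: "0 \<le> a \<Longrightarrow> a < m \<Longrightarrow> 0 \<le> b \<Longrightarrow> b < m \<Longrightarrow> m dvd a - b \<Longrightarrow> a = (b :: int)"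
  by (metis mod_eq_dvd_iff mod_pos_pos_trivial)

text \<open>Of three neighbours of \<open>i\<close> in a cycle, two lie on the same side of
  \<open>i\<close> and are congruent.\<close>

lemma cadj_unique:
  assumes "cadj m i x" "cadj m i y" "cadj m i z" "\<not> m dvd x - z" "\<not> m dvd y - z"
  shows "m dvd x - y"
proof -
  have 1: "m dvd a - b" if "m dvd a - i - 1" "m dvd b - i - 1" for a b
    using dvd_diff[OF that] by (simp add: algebra_simps)
  have 2: "m dvd a - b" if "m dvd i - a - 1" "m dvd i - b - 1" for a b
    using dvd_diff[OF that(2,1)] by (simp add: algebra_simps)
  show ?thesis using assms 1 2 unfolding cadj_def by blast
qed

section \<open>Extension property of cycles and trees\<close>

context bip_parts
begin

text \<open>A dihedral map agreeing with \<open>f\<close> on one edge agrees with it on the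
  connected set \<open>W\<close>, because each further vertex is the only remaining neighbour of its
  predecessor. The image of \<open>v\<close> under this map then extends \<open>f\<close>.\<close>

lemma ope_cycle:
  assumes iso: "u_isomorphic B (cycle_graph m)" and m: "m \<ge> 3"
  shows "coloured_ope B X \<and> finite (verts B)"
proof -
  obtain h0 where h0: "bij_betw h0 (verts B) (verts (cycle_graph m))"
    "\<And>x y. x \<in> verts B \<Longrightarrow> y \<in> verts B \<Longrightarrow> uadj B x y \<longleftrightarrow> uadj (cycle_graph m) (h0 x) (h0 y)"
    using iso unfolding u_isomorphic_def by blast
  define h where "h x = int (h0 x)" for x
  have vC: "verts (cycle_graph m) = {..<m}" by (simp add: cycle_graph_def)
  have hr: "0 \<le> h x" "h x < int m" if "x \<in> verts B" for x
    using bij_betwE[OF h0(1)] that by (auto simp: h_def vC)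
  have hinj: "x = y" if "x \<in> verts B" "y \<in> verts B" "int m dvd h x - h y" for x y
  proof -
    have "h x = h y" using int_dvd_small[OF hr[OF that(1)] hr[OF that(2)] that(3)] .
    then show ?thesis using bij_betw_imp_inj_on[OF h0(1)] that by (auto simp: h_def dest: inj_onD)
  qed
  have hsurj: "\<exists>x\<in>verts B. h x = i" if "0 \<le> i" "i < int m" for i
  proof -
    have "nat i \<in> h0 ` verts B" using h0(1) that by (simp add: bij_betw_def vC)
    then obtain x where x: "nat i = h0 x" "x \<in> verts B" by (rule imageE)
    then have "h x = i" unfolding h_def x(1)[symmetric] using that by simp
    then show ?thesis using x(2) by blast
  qed
  have ad: "uadj B x y \<longleftrightarrow> cadj (int m) (h x) (h y)" if "x \<in> verts B" "y \<in> verts B" for x y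
    unfolding h0(2)[OF that] h_def using cycle_graph_adj bij_betwE[OF h0(1)] that by (simp add: vC)
  have fin: "finite (verts B)" using h0(1) bij_betw_finite by (metis finite_lessThan vC)
  have uniq: "x = y" if "uadj B i x" "uadj B i y" "uadj B i z" "x \<noteq> z" "y \<noteq> z" for i x y z
  proof -
    have V: "i \<in> verts B" "x \<in> verts B" "y \<in> verts B" "z \<in> verts B" using that uadj_V by blast+
    have "int m dvd h x - h y"
      by (rule cadj_unique[of _ "h i" "h x" "h y" "h z"]) (use that ad V hinj in blast)+
    then show ?thesis using hinj V by blast
  qed
  have dihedral: "\<exists>g. g ` verts B \<subseteq> verts B \<and> inj_on g (verts B) \<and> (\<forall>x\<in>verts B. \<forall>y\<in>verts B. uadj B (g x) (g y) \<longleftrightarrow> uadj B x y)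
      \<and> g a = a' \<and> g b = b'" if ab: "uadj B a b" "uadj B a' b'" for a b a' b'
  proof -
    have V: "a \<in> verts B" "b \<in> verts B" "a' \<in> verts B" "b' \<in> verts B" using ab uadj_V by blast+
    have sgn: "\<exists>\<delta>. (\<delta> = 1 \<or> \<delta> = -1) \<and> int m dvd h y - h x - \<delta>" if "uadj B x y" for x y
    proof -
      have "cadj (int m) (h x) (h y)" using that ad uadj_V by blast
      then show ?thesis unfolding cadj_def
      proof
        assume "int m dvd h x - h y - 1"
        then have "int m dvd - (h x - h y - 1)" by (simp only: dvd_minus_iff)
        then show ?thesis by (intro exI[of _ "-1"]) (simp add: algebra_simps)
      qed (intro exI[of _ 1], simp)
    qed
    obtain \<delta> where \<delta>: "\<delta> = 1 \<or> \<delta> = -1" "int m dvd h b - h a - \<delta>" using sgn[OF ab(1)] by blast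
    obtain \<delta>' where \<delta>': "\<delta>' = 1 \<or> \<delta>' = -1" "int m dvd h b' - h a' - \<delta>'" using sgn[OF ab(2)] by blast
    \<comment> \<open>The sign compares the directions of the edges \<open>ab\<close> and
      \<open>a'b'\<close> around the cycle, and \<open>k\<close> then moves \<open>a\<close> to
      \<open>a'\<close>.\<close>
    define \<epsilon> where "\<epsilon> = \<delta> * \<delta>'"
    have \<epsilon>: "\<epsilon> = 1 \<or> \<epsilon> = -1" "\<epsilon> * \<delta> = \<delta>'" using \<delta>(1) \<delta>'(1) by (auto simp: \<epsilon>_def)
    define k where "k = h a' - \<epsilon> * h a"
    define g where "g x = (SOME y. y \<in> verts B \<and> h y = (\<epsilon> * h x + k) mod int m)" for x
    have g: "g x \<in> verts B \<and> h (g x) = (\<epsilon> * h x + k) mod int m" for x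
    proof -
      have "\<exists>y. y \<in> verts B \<and> h y = (\<epsilon> * h x + k) mod int m"
        using hsurj[of "(\<epsilon> * h x + k) mod int m"] m by (auto simp: pos_mod_bound)
      from someI_ex[OF this] show ?thesis unfolding g_def .
    qed
    have gd: "int m dvd h (g x) - (\<epsilon> * h x + k)" for x
      using g[of x] by (metis mod_eq_dvd_iff mod_mod_trivial)
    have gdiff: "int m dvd (h (g x) - h (g y)) - \<epsilon> * (h x - h y)" for x y
      using dvd_diff[OF gd[of x] gd[of y]] by (simp add: algebra_simps)
    have trans: "int m dvd p \<longleftrightarrow> int m dvd q" if "int m dvd p - q" for p q
      using that by (metis dvd_diff_right_iff dvd_diff_left_iff)
    have \<epsilon>dvd: "int m dvd \<epsilon> * p \<longleftrightarrow> int m dvd p" for p using \<epsilon>(1) by auto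
    have shift: "int m dvd h (g x) - h (g y) \<longleftrightarrow> int m dvd h x - h y" for x y
      using trans[OF gdiff] \<epsilon>dvd by blast
    have adg: "uadj B (g x) (g y) \<longleftrightarrow> uadj B x y" if xy: "x \<in> verts B" "y \<in> verts B" for x y
    proof -
      have "(h (g y) - h (g x) - \<epsilon>) - \<epsilon> * (h y - h x - 1) = (h (g y) - h (g x)) - \<epsilon> * (h y - h x)"
        by (simp add: algebra_simps)
      then have 1: "int m dvd h (g y) - h (g x) - \<epsilon> \<longleftrightarrow> int m dvd h y - h x - 1"
        using trans[of "h (g y) - h (g x) - \<epsilon>" "\<epsilon> * (h y - h x - 1)"] gdiff[of y x] \<epsilon>dvd by metis
      have "(h (g x) - h (g y) - \<epsilon>) - \<epsilon> * (h x - h y - 1) = (h (g x) - h (g y)) - \<epsilon> * (h x - h y)"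
        by (simp add: algebra_simps)
      then have 2: "int m dvd h (g x) - h (g y) - \<epsilon> \<longleftrightarrow> int m dvd h x - h y - 1"
        using trans[of "h (g x) - h (g y) - \<epsilon>" "\<epsilon> * (h x - h y - 1)"] gdiff[of x y] \<epsilon>dvd by metis
      have "cadj (int m) (h (g x)) (h (g y)) \<longleftrightarrow> int m dvd h (g y) - h (g x) - \<epsilon> \<or> int m dvd h (g x) - h (g y) - \<epsilon>"
        using \<epsilon>(1)
      proof
        assume "\<epsilon> = -1"
        moreover have "int m dvd h (g y) - h (g x) - -1 \<longleftrightarrow> int m dvd h (g x) - h (g y) - 1"
          using dvd_minus_iff[of "int m" "h (g y) - h (g x) - -1"] by (simp add: algebra_simps)
        moreover have "int m dvd h (g x) - h (g y) - -1 \<longleftrightarrow> int m dvd h (g y) - h (g x) - 1"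
          using dvd_minus_iff[of "int m" "h (g x) - h (g y) - -1"] by (simp add: algebra_simps)
        ultimately show ?thesis unfolding cadj_def by blast
      qed (auto simp: cadj_def)
      then have "cadj (int m) (h (g x)) (h (g y)) \<longleftrightarrow> cadj (int m) (h x) (h y)" using 1 2 unfolding cadj_def by blast
      then show ?thesis using ad xy g by blast
    qed
    have "g a = a'"
    proof (rule hinj)
      show "int m dvd h (g a) - h a'" using gd[of a] by (simp add: k_def)
    qed (use g V in blast)+
    moreover have "g b = b'"
    proof (rule hinj)
      have 1: "int m dvd \<epsilon> * (h b - h a - \<delta>)" using \<delta>(2) by simp
      have eq: "h (g b) - h b' = (h (g b) - (\<epsilon> * h b + k)) + \<epsilon> * (h b - h a - \<delta>) - (h b' - h a' - \<delta>')"
        using \<epsilon>(2) by (simp add: k_def algebra_simps)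
      show "int m dvd h (g b) - h b'"
        unfolding eq by (intro dvd_diff dvd_add gd 1 \<delta>'(2))
    qed (use g V in blast)+
    moreover have "inj_on g (verts B)"
    proof (rule inj_onI)
      fix x y assume "x \<in> verts B" "y \<in> verts B" "g x = g y"
      then show "x = y" using shift[of x y] hinj by simp
    qed
    ultimately show ?thesis using g adg by (intro exI[of _ g]) blast
  qed
  have "coloured_ope B X"
  proof (rule ope_I)
    fix W f v s assume W: "W \<subseteq> verts B" "connected_on (ugraph B) W" "inj_on f W" "f ` W \<subseteq> verts B"
      "\<And>u. u \<in> W \<Longrightarrow> f u \<in> X \<longleftrightarrow> u \<in> X" "\<And>u u'. u \<in> W \<Longrightarrow> u' \<in> W \<Longrightarrow> uadj B (f u) (f u') \<longleftrightarrow> uadj B u u'"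
      and v: "v \<in> verts B" "v \<notin> W" and s: "s \<in> W" "uadj B s v"
    have "\<exists>g. g ` verts B \<subseteq> verts B \<and> inj_on g (verts B) \<and> (\<forall>x\<in>verts B. \<forall>y\<in>verts B. uadj B (g x) (g y) \<longleftrightarrow> uadj B x y)
        \<and> (\<forall>u\<in>W. g u = f u)"
    proof (cases "\<exists>s1\<in>W. uadj B s s1")
      case True
      then obtain s1 where s1: "s1 \<in> W" "uadj B s s1" by blast
      then have "uadj B (f s) (f s1)" using W(6) s by blast
      from dihedral[OF s1(2) this] obtain g where g: "g ` verts B \<subseteq> verts B" "inj_on g (verts B)"
        "\<forall>x\<in>verts B. \<forall>y\<in>verts B. uadj B (g x) (g y) \<longleftrightarrow> uadj B x y" "g s = f s" "g s1 = f s1" by blast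
      \<comment> \<open>A neighbour \<open>u'\<close> on which the maps already agree is carried
        along: it excludes one of the two candidates for the next vertex.\<close>
      have "f u = g u \<and> (\<exists>u'\<in>W. uadj B u u' \<and> f u' = g u')" if "u \<in> W" for u
      proof -
        have "(s, u) \<in> (ugraph B \<inter> W \<times> W)\<^sup>*" using W(2) s that unfolding connected_on_def by blast
        then show ?thesis
        proof (induction rule: rtrancl_induct)
          case base
          show ?case using g s1 by auto
        next
          case (step x y)
          then obtain x' where x': "f x = g x" "x' \<in> W" "uadj B x x'" "f x' = g x'" by blast
          have xy: "uadj B x y" "x \<in> W" "y \<in> W" using step.hyps(2) by (auto simp: ugraph_def)
          have "f y = g y"
          proof (cases "y = x'")
            case False
            have V: "x \<in> verts B" "y \<in> verts B" "x' \<in> verts B" using xy x' W(1) by blast+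
            show ?thesis
            proof (rule uniq[of "f x" "f y" "g y" "f x'"])
              show "uadj B (f x) (f y)" "uadj B (f x) (f x')" using W(6) xy x' by blast+
              show "uadj B (f x) (g y)" using g(3) V xy(1) x'(1) by simp
              show "f y \<noteq> f x'" using inj_on_eq_iff[OF W(3) xy(3) x'(2)] False by blast
              show "g y \<noteq> f x'" using inj_on_eq_iff[OF g(2) V(2,3)] x'(4) False by simp
            qed
          qed (use x' in simp)
          then show ?case using xy x' uadj_commute by metis
        qed
      qed
      then show ?thesis using g(1-3) by metis
    next
      case False
      \<comment> \<open>Without an edge at \<open>s\<close>, connectedness reduces \<open>W\<close>
        to \<open>s\<close>, and any edge at \<open>f s\<close> can serve as the target of
        \<open>sv\<close>.\<close>
      have W1: "u = s" if "u \<in> W" for u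
      proof (rule ccontr)
        assume "u \<noteq> s"
        have "(s, u) \<in> (ugraph B \<inter> W \<times> W)\<^sup>*" using W(2) s that unfolding connected_on_def by blast
        then show False using \<open>u \<noteq> s\<close> False by (cases rule: converse_rtranclE) (auto simp: ugraph_def)
      qed
      have fs: "f s \<in> verts B" using W(4) s by blast
      have "\<exists>b. uadj B (f s) b"
      proof -
        obtain b where b: "b \<in> verts B" "h b = (h (f s) + 1) mod int m"
          using hsurj[of "(h (f s) + 1) mod int m"] m by auto
        have "int m dvd h b - (h (f s) + 1)" unfolding b(2) by (metis mod_eq_dvd_iff mod_mod_trivial)
        then have "cadj (int m) (h (f s)) (h b)" by (simp add: cadj_def algebra_simps)
        then show ?thesis using ad fs b by blast
      qed
      then obtain b where "uadj B (f s) b" by blast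
      from dihedral[OF s(2) this] obtain g where "g ` verts B \<subseteq> verts B" "inj_on g (verts B)"
        "\<forall>x\<in>verts B. \<forall>y\<in>verts B. uadj B (g x) (g y) \<longleftrightarrow> uadj B x y" "g s = f s" by blast
      then show ?thesis using W1 by blast
    qed
    then obtain g where g: "g ` verts B \<subseteq> verts B" "inj_on g (verts B)"
      "\<forall>x\<in>verts B. \<forall>y\<in>verts B. uadj B (g x) (g y) \<longleftrightarrow> uadj B x y" "\<forall>u\<in>W. g u = f u" by blast
    have a: "uadj B (f u) (g v) \<longleftrightarrow> uadj B u v" if "u \<in> W" for u
    proof -
      have "uadj B (g u) (g v) \<longleftrightarrow> uadj B u v" using g(3) W(1) v(1) that by blast
      then show ?thesis using g(4) that by simp
    qed
    have "g v \<notin> f ` W"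
    proof
      assume "g v \<in> f ` W"
      then obtain u where "u \<in> W" "g v = g u" using g(4) by auto
      then have "v = u" using inj_onD[OF g(2)] v W(1) by blast
      then show False using v \<open>u \<in> W\<close> by blast
    qed
    moreover have "g v \<in> X \<longleftrightarrow> v \<in> X"
      using a[OF s(1)] s(2) uadj_parts[of "f s" "g v"] uadj_parts[of s v] W(5)[OF s(1)] by blast
    ultimately show "\<exists>w\<in>verts B - f ` W. (w \<in> X \<longleftrightarrow> v \<in> X) \<and> (\<forall>u\<in>W. uadj B (f u) w \<longleftrightarrow> uadj B u v)"
      using a g(1) v(1) by blast
  qed
  then show ?thesis using fin by blast
qed

text \<open>Two neighbours of \<open>v\<close> in a connected set avoiding \<open>v\<close> would
  close a cycle through \<open>v\<close>.\<close>

lemma tree_unique_nbr: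
  assumes ac: "uacyclic B" and W: "connected_on (ugraph B) W" "W \<subseteq> verts B" "v \<notin> W" "u \<in> W" "s \<in> W"
    and a: "uadj B u v" "uadj B s v"
  shows "u = s"
proof (rule ccontr)
  assume ne: "u \<noteq> s"
  obtain xs where xs: "path_between (ugraph B) u s xs" "set xs \<subseteq> W" using connected_on_path[OF W(1,4,5)] by blast
  have len: "length xs \<ge> 2" using xs ne by (cases xs; cases "tl xs") (auto simp: path_between_def)
  have v: "v \<in> verts B" using uadj_V a by blast
  have succ: "successively (uadj B) (xs @ [v])"
    using xs a unfolding successively_append_iff path_between_def by (simp add: ugraph_def)
  have "distinct (xs @ [v])" using xs W(3) by (auto simp: path_between_def)
  moreover have "length (xs @ [v]) \<ge> 3" using len by simp
  moreover have "set (xs @ [v]) \<subseteq> verts B" using xs W v by auto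
  moreover have "uadj B (last (xs @ [v])) (hd (xs @ [v]))"
    using xs a len by (auto simp: path_between_def uadj_commute)
  ultimately show False using ac succ unfolding uacyclic_def successively_conv_nth by blast
qed

lemma ope_tree:
  assumes T: "is_T_ab B a b"
  shows "coloured_ope B X \<and> (\<forall>x\<in>verts B. finite {y. uadj B x y})"
proof -
  obtain X' Y' where XY: "X' \<inter> Y' = {}" "X' \<union> Y' = verts B"
    "\<forall>x\<in>verts B. \<forall>y\<in>verts B. uadj B x y \<longrightarrow> (x \<in> X' \<longleftrightarrow> y \<in> Y')"
    "\<forall>x\<in>X'. finite {w. uadj B x w} \<and> card {w. uadj B x w} = a"
    "\<forall>y\<in>Y'. finite {w. uadj B y w} \<and> card {w. uadj B y w} = b"
    using T unfolding is_T_ab_def by blast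
  have ac: "uacyclic B" using T by (simp add: is_T_ab_def is_tree_def)
  have fin: "finite {y. uadj B x y}" if "x \<in> verts B" for x using XY that by blast
  have agree: "(x \<in> X') = (y \<in> X') \<longleftrightarrow> (x \<in> X \<longleftrightarrow> y \<in> X)" if "x \<in> verts B" "y \<in> verts B" for x y
  proof (rule colours_agree[OF _ that])
    fix x y assume "uadj B x y"
    then show "(x \<in> X') \<noteq> (y \<in> X')" using XY(1-3) uadj_V by blast
  qed
  have deg: "card {w. uadj B x w} = card {w. uadj B y w}" if "x \<in> verts B" "y \<in> verts B" "x \<in> X \<longleftrightarrow> y \<in> X" for x y
  proof (cases "x \<in> X'")
    case True
    then have "y \<in> X'" using agree that by blast
    then show ?thesis using True XY(4) by simp
  next
    case False
    then have "y \<notin> X'" using agree that by blast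
    then have "x \<in> Y'" "y \<in> Y'" using False XY(2) that by blast+
    then show ?thesis using XY(5) by simp
  qed
  have "coloured_ope B X"
  proof (rule ope_I)
    fix W f v s assume W: "W \<subseteq> verts B" "connected_on (ugraph B) W" "inj_on f W" "f ` W \<subseteq> verts B"
      "\<And>u. u \<in> W \<Longrightarrow> f u \<in> X \<longleftrightarrow> u \<in> X" "\<And>u u'. u \<in> W \<Longrightarrow> u' \<in> W \<Longrightarrow> uadj B (f u) (f u') \<longleftrightarrow> uadj B u u'"
      and v: "v \<in> verts B" "v \<notin> W" and s: "s \<in> W" "uadj B s v"
    let ?N = "\<lambda>x. {w. uadj B x w}"
    have sV: "s \<in> verts B" "f s \<in> verts B" using s W by blast+
    have "?N (f s) \<inter> f ` W \<subseteq> f ` (?N s \<inter> W)" using W(6) s by blast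
    then have "card (?N (f s) \<inter> f ` W) \<le> card (f ` (?N s \<inter> W))" using fin[OF sV(1)] by (intro card_mono) auto
    also have "\<dots> \<le> card (?N s \<inter> W)" using fin[OF sV(1)] by (intro card_image_le) auto
    also have "\<dots> < card (?N s)" using fin[OF sV(1)] s v by (intro psubset_card_mono) auto
    also have "\<dots> = card (?N (f s))" by (rule deg[OF sV]) (use W(5) s in blast)
    finally have "\<not> ?N (f s) \<subseteq> f ` W" by (metis inf.absorb1 less_irrefl)
    then obtain w where w: "uadj B (f s) w" "w \<notin> f ` W" by blast
    have wV: "w \<in> verts B" using w uadj_V by blast
    have connf: "connected_on (ugraph B) (f ` W)"
      unfolding connected_on_def
    proof (intro ballI)
      fix y y' assume "y \<in> f ` W" "y' \<in> f ` W"
      then obtain x x' where x: "x \<in> W" "y = f x" "x' \<in> W" "y' = f x'" by blast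
      have "(x, x') \<in> (ugraph B \<inter> W \<times> W)\<^sup>*" using W(2) x unfolding connected_on_def by blast
      then have "(f x, f x') \<in> (ugraph B \<inter> f ` W \<times> f ` W)\<^sup>*"
      proof (induction rule: rtrancl_induct)
        case (step p q)
        have "(f p, f q) \<in> ugraph B \<inter> f ` W \<times> f ` W" using step.hyps(2) W(6) by (auto simp: ugraph_def)
        then show ?case using step.IH by (rule rtrancl_into_rtrancl[rotated])
      qed simp
      then show "(y, y') \<in> (ugraph B \<inter> f ` W \<times> f ` W)\<^sup>*" using x by simp
    qed
    have "uadj B (f u) w \<longleftrightarrow> uadj B u v" if u: "u \<in> W" for u
    proof (cases "u = s")
      case False
      then have "\<not> uadj B u v" using tree_unique_nbr[OF ac W(2,1) v(2) u s(1) _ s(2)] by blast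
      moreover have "f u \<noteq> f s" using W(3) u s False by (auto dest: inj_onD)
      then have "\<not> uadj B (f u) w"
        using tree_unique_nbr[OF ac connf W(4) w(2), of "f u" "f s"] u s w(1) by blast
      ultimately show ?thesis by blast
    qed (use w s in simp)
    moreover have "w \<in> X \<longleftrightarrow> v \<in> X"
      using uadj_parts[OF w(1)] uadj_parts[OF s(2)] W(5)[OF s(1)] by blast
    ultimately show "\<exists>w\<in>verts B - f ` W. (w \<in> X \<longleftrightarrow> v \<in> X) \<and> (\<forall>u\<in>W. uadj B (f u) w \<longleftrightarrow> uadj B u v)"
      using w(2) wV by blast
  qed
  then show ?thesis using fin by blast
qed

theorem listed_ope:
  assumes "listed_graph B"
  shows "coloured_ope B X" "x \<in> verts B \<Longrightarrow> finite {y. uadj B x y}"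
proof -
  have fin: "finite {y. uadj B x y}" if "finite (verts B)" for x
    by (rule finite_subset[OF _ that]) (use uadj_V in blast)
  have "coloured_ope B X \<and> (\<forall>x\<in>verts B. finite {y. uadj B x y})"
    using assms unfolding listed_graph_def
  proof (elim disjE exE conjE)
    fix m :: nat assume "m \<ge> 4" "u_isomorphic B (cycle_graph m)"
    then show ?thesis using ope_cycle[of m] fin by auto
  next
    fix m n assume "u_isomorphic B (K_bip m n)"
    then show ?thesis using ope_K_bip fin by blast
  next
    fix n assume "u_isomorphic B (CP_graph n)"
    then show ?thesis using ope_CP fin by blast
  next
    fix a b assume "is_T_ab B a b"
    then show ?thesis using ope_tree by blast
  qed
  then show "coloured_ope B X" "x \<in> verts B \<Longrightarrow> finite {y. uadj B x y}" by blast+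
qed

end

section \<open>The digraphs DL\<close>

text \<open>Membership in the list enters only through the extension property, local finiteness and
  the presence of an arc.\<close>

locale dl = bip_parts B X Y for B :: "'b dg" and X Y +
  fixes T :: "'t dg" and \<phi> \<psi> :: "'t \<Rightarrow> 't \<Rightarrow> 'b"
  assumes wfB: "wf_digraph B" and data: "DL_data X Y T \<phi> \<psi>" and arcsB: "arcs B \<noteq> {}"
    and ope: "coloured_ope B X" and finB: "x \<in> verts B \<Longrightarrow> finite {y. uadj B x y}"
begin

abbreviation D :: "('t \<times> 't) dg" where "D \<equiv> DL B T \<phi> \<psi>"

text \<open>The copy of \<open>B\<close> glued in at \<open>t\<close>. Blocks at different vertices
  share at most one vertex of the digraph, namely the tree arc between them.\<close>

definition block :: "'t \<Rightarrow> ('t \<times> 't) set" where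
  "block t = {e \<in> arcs T. fst e = t \<or> snd e = t}"

definition \<beta> :: "'t \<Rightarrow> 't \<times> 't \<Rightarrow> 'b" where
  "\<beta> t e = (if snd e = t then \<phi> t (fst e) else \<psi> t (snd e))"

lemma wfT: "wf_digraph T" and treeT: "uconnected T" "uacyclic T"
  and bijs: "t \<in> verts T \<Longrightarrow> bij_betw (\<phi> t) (in_nbrs T t) X" "t \<in> verts T \<Longrightarrow> bij_betw (\<psi> t) (out_nbrs T t) Y"
  using data by (auto simp: DL_data_def is_tree_def)

lemma T_irrefl: "(a, a) \<notin> arcs T" and T_antisym: "(a, b) \<in> arcs T \<Longrightarrow> (b, a) \<notin> arcs T"
  using wfT by (auto simp: wf_digraph_def)

lemma loop_free: "e \<in> arcs T \<Longrightarrow> fst e \<noteq> snd e"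
  using T_irrefl by (metis prod.collapse)

lemma T_verts: "e \<in> arcs T \<Longrightarrow> fst e \<in> verts T \<and> snd e \<in> verts T"
  using arcs_in_verts[OF wfT] by (metis prod.collapse)

lemma verts_D [simp]: "verts D = arcs T" by (simp add: DL_def)

lemma arcs_D: "(e, e') \<in> arcs D \<longleftrightarrow> e \<in> arcs T \<and> e' \<in> arcs T \<and> snd e = fst e' \<and> (\<beta> (snd e) e, \<beta> (snd e) e') \<in> arcs B"
proof -
  obtain a b c d where e: "e = (a, b)" "e' = (c, d)" by (cases e, cases e')
  have "(b, d) \<in> arcs T \<Longrightarrow> d \<noteq> b" using T_irrefl by blast
  then show ?thesis unfolding e by (auto simp: DL_def \<beta>_def)
qed

lemma \<beta>_source: "e \<in> arcs T \<Longrightarrow> snd e = t \<Longrightarrow> \<beta> t e \<in> X"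
  using bijs(1)[of t] T_verts[of e] bij_betwE by (cases e) (fastforce simp: \<beta>_def in_nbrs_def)

lemma \<beta>_sink: "e \<in> arcs T \<Longrightarrow> fst e = t \<Longrightarrow> \<beta> t e \<in> Y"
  using bijs(2)[of t] T_verts[of e] bij_betwE loop_free[of e] by (cases e) (fastforce simp: \<beta>_def out_nbrs_def)

lemma \<beta>_role: "e \<in> block t \<Longrightarrow> \<beta> t e \<in> X \<longleftrightarrow> snd e = t"
  using \<beta>_source[of e t] \<beta>_sink[of e t] parts(1) loop_free[of e] unfolding block_def by blast

lemma \<beta>_bij: assumes t: "t \<in> verts T" shows "bij_betw (\<beta> t) (block t) (verts B)"
proof (rule bij_betw_imageI)
  have i1: "inj_on (\<phi> t) (in_nbrs T t)" "\<phi> t ` in_nbrs T t = X" using bijs(1)[OF t] by (auto simp: bij_betw_def)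
  have i2: "inj_on (\<psi> t) (out_nbrs T t)" "\<psi> t ` out_nbrs T t = Y" using bijs(2)[OF t] by (auto simp: bij_betw_def)
  show "inj_on (\<beta> t) (block t)"
  proof (rule inj_onI)
    fix e e' assume e: "e \<in> block t" "e' \<in> block t" "\<beta> t e = \<beta> t e'"
    obtain a b a' b' where ab: "e = (a, b)" "e' = (a', b')" by (cases e, cases e')
    have role: "snd e = t \<longleftrightarrow> snd e' = t" using \<beta>_role[OF e(1)] \<beta>_role[OF e(2)] e(3) by simp
    show "e = e'"
    proof (cases "snd e = t")
      case True
      then have "\<phi> t a = \<phi> t a'" "a \<in> in_nbrs T t" "a' \<in> in_nbrs T t"
        using role e ab by (auto simp: \<beta>_def block_def in_nbrs_def)
      then have "a = a'" using i1(1) by (auto dest: inj_onD)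
      then show ?thesis using True role ab by simp
    next
      case False
      then have "fst e = t" "fst e' = t" using e role by (auto simp: block_def)
      then have "\<psi> t b = \<psi> t b'" "b \<in> out_nbrs T t" "b' \<in> out_nbrs T t"
        using False role e ab by (auto simp: \<beta>_def block_def out_nbrs_def)
      then have "b = b'" using i2(1) by (auto dest: inj_onD)
      then show ?thesis using \<open>fst e = t\<close> \<open>fst e' = t\<close> ab by simp
    qed
  qed
  show "\<beta> t ` block t = verts B"
  proof (intro set_eqI iffI)
    fix x assume "x \<in> \<beta> t ` block t"
    then obtain e where "x = \<beta> t e" "e \<in> block t" by (rule imageE)
    then show "x \<in> verts B" using \<beta>_source \<beta>_sink parts(2) unfolding block_def by blast
  next
    fix x assume "x \<in> verts B"
    then consider "x \<in> X" | "x \<in> Y" using parts(2) by blast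
    then show "x \<in> \<beta> t ` block t"
    proof cases
      case 1
      then obtain a where "x = \<phi> t a" "a \<in> in_nbrs T t" using i1(2) by blast
      then have "\<beta> t (a, t) = x" "(a, t) \<in> block t" by (auto simp: \<beta>_def block_def in_nbrs_def)
      then show ?thesis by blast
    next
      case 2
      then obtain b where b: "x = \<psi> t b" "b \<in> out_nbrs T t" using i2(2) by blast
      then have "b \<noteq> t" using T_irrefl by (auto simp: out_nbrs_def)
      then have "\<beta> t (t, b) = x" "(t, b) \<in> block t" using b by (auto simp: \<beta>_def block_def out_nbrs_def)
      then show ?thesis by blast
    qed
  qed
qed

lemma block_arc_ends:
  assumes "e \<in> block t" "e' \<in> block t" "(e, e') \<in> arcs D" shows "snd e = t" "fst e' = t"
proof -
  have e: "e \<in> arcs T" "e' \<in> arcs T" "snd e = fst e'" using assms(3) arcs_D by blast+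
  have "snd e = t"
  proof (rule ccontr)
    assume n: "snd e \<noteq> t"
    then have "fst e = t" "snd e' = t" using assms e by (auto simp: block_def)
    then have "e = (t, snd e)" "e' = (snd e, t)" using e by (metis prod.collapse)+
    then show False using e T_antisym by metis
  qed
  then show "snd e = t" "fst e' = t" using e by simp_all
qed

lemma block_arcs:
  assumes "e \<in> block t" "e' \<in> block t" shows "(e, e') \<in> arcs D \<longleftrightarrow> (\<beta> t e, \<beta> t e') \<in> arcs B"
proof
  assume "(e, e') \<in> arcs D"
  then show "(\<beta> t e, \<beta> t e') \<in> arcs B" using block_arc_ends[OF assms] arcs_D by metis
next
  assume b: "(\<beta> t e, \<beta> t e') \<in> arcs B"
  then have "\<beta> t e \<in> X" "\<beta> t e' \<notin> X" using arcs_parts parts(1) by blast+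
  then have "snd e = t" "snd e' \<noteq> t" using \<beta>_role assms by blast+
  moreover have "e \<in> arcs T" "e' \<in> arcs T" "fst e' = t" using assms calculation by (auto simp: block_def)
  ultimately show "(e, e') \<in> arcs D" using b arcs_D by simp
qed

lemma block_uadj: "e \<in> block t \<Longrightarrow> e' \<in> block t \<Longrightarrow> uadj D e e' \<longleftrightarrow> uadj B (\<beta> t e) (\<beta> t e')"
  using block_arcs by (simp add: uadj_def)

lemma arc_block: "(e, e') \<in> arcs D \<Longrightarrow> e \<in> block (snd e) \<and> e' \<in> block (snd e)"
  using arcs_D by (auto simp: block_def)

lemma uadj_block: "uadj D e e' \<Longrightarrow> \<exists>t. e \<in> block t \<and> e' \<in> block t"
  using arc_block unfolding uadj_def by blast

lemma wf_D: "wf_digraph D"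
  unfolding wf_digraph_def
proof (intro conjI allI impI)
  show "arcs D \<subseteq> verts D \<times> verts D"
  proof
    fix p assume "p \<in> arcs D"
    then show "p \<in> verts D \<times> verts D" by (cases p) (simp add: arcs_D)
  qed
  show "(e, e) \<notin> arcs D" for e using arcs_D loop_free by metis
  fix e e' assume 1: "(e, e') \<in> arcs D"
  show "(e', e) \<notin> arcs D"
  proof
    assume 2: "(e', e) \<in> arcs D"
    have "e \<in> arcs T" "e' \<in> arcs T" "snd e = fst e'" "snd e' = fst e" using 1 2 arcs_D by blast+
    then have "(fst e, snd e) \<in> arcs T" "(snd e, fst e) \<in> arcs T" by (metis prod.collapse)+
    then show False using T_antisym by blast
  qed
qed

text \<open>Three mutually adjacent tree arcs would form a directed triangle in
  \<open>T\<close>.\<close>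

lemma triangle_free_D: "triangle_free D"
  unfolding triangle_free_def
proof
  assume "\<exists>x\<in>verts D. \<exists>y\<in>verts D. \<exists>z\<in>verts D. uadj D x y \<and> uadj D y z \<and> uadj D x z"
  then obtain x y z where xyz: "x \<in> arcs T" "y \<in> arcs T" "z \<in> arcs T" "uadj D x y" "uadj D y z" "uadj D x z" by auto
  have chain: "snd e = fst e' \<or> snd e' = fst e" if "uadj D e e'" for e e' using that arcs_D unfolding uadj_def by blast
  have tri: False if abc: "(a, b) \<in> arcs T" "(b, c) \<in> arcs T" "(c, a) \<in> arcs T" for a b c
  proof -
    have "distinct [a, b, c]" using abc T_irrefl by auto
    moreover have "set [a, b, c] \<subseteq> verts T" using abc arcs_in_verts[OF wfT] by auto
    moreover have "\<forall>i. Suc i < length [a, b, c] \<longrightarrow> uadj T ([a, b, c] ! i) ([a, b, c] ! Suc i)"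
      using abc by (auto simp: less_Suc_eq uadj_def)
    moreover have "uadj T (last [a, b, c]) (hd [a, b, c])" using abc by (simp add: uadj_def)
    moreover have "length [a, b, c] \<ge> 3" by simp
    ultimately show False using treeT(2) unfolding uacyclic_def by blast
  qed
  obtain x1 x2 y1 y2 z1 z2 where e: "x = (x1, x2)" "y = (y1, y2)" "z = (z1, z2)" by (cases x, cases y, cases z)
  have c: "x2 = y1 \<or> y2 = x1" "y2 = z1 \<or> z2 = y1" "x2 = z1 \<or> z2 = x1"
    using chain[OF xyz(4)] chain[OF xyz(5)] chain[OF xyz(6)] e by auto
  have ne: "x1 \<noteq> x2" "y1 \<noteq> y2" "z1 \<noteq> z2" using loop_free[OF xyz(1)] loop_free[OF xyz(2)] loop_free[OF xyz(3)] e by simp_all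
  show False
    using c ne tri[of x1 x2 y2] tri[of x1 x2 z2] tri[of y1 y2 x2] tri[of y1 y2 z2] xyz(1-3) e by auto
qed

lemma locally_finite_D: "locally_finite D"
  unfolding locally_finite_def
proof
  fix e assume "e \<in> verts D"
  then have e: "e \<in> arcs T" by simp
  have V: "fst e \<in> verts T" "snd e \<in> verts T" using T_verts[OF e] by auto
  have fin: "finite {e' \<in> block t. uadj D e e'}" if t: "e \<in> block t" "t \<in> verts T" for t
  proof (rule finite_imageD[of "\<beta> t"])
    have "\<beta> t ` {e' \<in> block t. uadj D e e'} \<subseteq> {y. uadj B (\<beta> t e) y}" using block_uadj[OF t(1)] by blast
    moreover have "\<beta> t e \<in> verts B" using bij_betwE[OF \<beta>_bij[OF t(2)]] t(1) by blast
    ultimately show "finite (\<beta> t ` {e' \<in> block t. uadj D e e'})" using finB finite_subset by blast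
    show "inj_on (\<beta> t) {e' \<in> block t. uadj D e e'}"
      using bij_betw_imp_inj_on[OF \<beta>_bij[OF t(2)]] by (rule inj_on_subset) blast
  qed
  have eb: "e \<in> block (fst e)" "e \<in> block (snd e)" using e by (auto simp: block_def)
  have "out_nbrs D e \<subseteq> {e' \<in> block (snd e). uadj D e e'}" using arc_block unfolding out_nbrs_def uadj_def by blast
  moreover have "in_nbrs D e \<subseteq> {e' \<in> block (fst e). uadj D e e'}"
  proof
    fix e' assume "e' \<in> in_nbrs D e"
    then have a: "(e', e) \<in> arcs D" by (simp add: in_nbrs_def)
    then have "snd e' = fst e" using arcs_D by blast
    then show "e' \<in> {e' \<in> block (fst e). uadj D e e'}" using arc_block[OF a] a by (simp add: uadj_def)
  qed
  ultimately show "finite (out_nbrs D e) \<and> finite (in_nbrs D e)"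
    using fin[OF eb(2) V(2)] fin[OF eb(1) V(1)] finite_subset by blast
qed

lemma block_connected:
  assumes t: "t \<in> verts T" and e: "e \<in> block t" "e' \<in> block t"
  shows "(e, e') \<in> (ugraph D)\<^sup>*"
proof -
  have bij: "bij_betw (\<beta> t) (block t) (verts B)" by (rule \<beta>_bij[OF t])
  define \<gamma> where "\<gamma> = inv_into (block t) (\<beta> t)"
  have \<gamma>: "\<gamma> x \<in> block t" "\<beta> t (\<gamma> x) = x" if "x \<in> verts B" for x
    using bij that by (auto simp: \<gamma>_def bij_betw_def inv_into_into f_inv_into_f)
  have \<gamma>\<beta>: "\<gamma> (\<beta> t e) = e" if "e \<in> block t" for e using bij that by (simp add: \<gamma>_def bij_betw_inv_into_left)
  have V: "\<beta> t e \<in> verts B" "\<beta> t e' \<in> verts B" using bij_betwE[OF bij] e by blast+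
  have "(\<beta> t e, \<beta> t e') \<in> (ugraph B)\<^sup>*"
    using uconn V by (intro connected_on_rtrancl[of _ "verts B"]) (auto simp: uconnected_iff)
  then have "(\<gamma> (\<beta> t e), \<gamma> (\<beta> t e')) \<in> (ugraph D)\<^sup>*"
  proof (induction rule: rtrancl_induct)
    case (step x y)
    have xy: "uadj B x y" using step.hyps(2) by (simp add: ugraph_def)
    then have "x \<in> verts B" "y \<in> verts B" using uadj_V by blast+
    then have "uadj D (\<gamma> x) (\<gamma> y)" using block_uadj[OF \<gamma>(1) \<gamma>(1)] \<gamma>(2) xy by simp
    then show ?case using step.IH by (simp add: ugraph_def rtrancl.rtrancl_into_rtrancl)
  qed simp
  then show ?thesis using \<gamma>\<beta> e by simp
qed

text \<open>Each block is connected, and blocks at adjacent vertices of \<open>T\<close> share the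
  arc between them.\<close>

lemma uconnected_D: "uconnected D"
proof -
  obtain x y where "(x, y) \<in> arcs B" using arcsB by auto
  then have x: "x \<in> X" using arcs_parts by blast
  obtain t0 where t0: "t0 \<in> verts T" using treeT(1) by (auto simp: uconnected_def)
  have "x \<in> \<phi> t0 ` in_nbrs T t0" using bijs(1)[OF t0] x by (simp add: bij_betw_def)
  then obtain a where a: "(a, t0) \<in> arcs T" by (auto simp: in_nbrs_def)
  then have e0: "(a, t0) \<in> block t0" by (simp add: block_def)
  have reach: "\<forall>e\<in>block t. ((a, t0), e) \<in> (ugraph D)\<^sup>*" if "t \<in> verts T" for t
  proof -
    have "(t0, t) \<in> (ugraph T)\<^sup>*" using treeT(1) t0 that
      by (intro connected_on_rtrancl[of _ "verts T"]) (auto simp: uconnected_iff)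
    then show ?thesis
    proof (induction rule: rtrancl_induct)
      case base
      show ?case using block_connected[OF t0 e0] by blast
    next
      case (step u v)
      then have uv: "uadj T u v" by (simp add: ugraph_def)
      have "\<exists>e. e \<in> block u \<and> e \<in> block v" using uv unfolding uadj_def block_def by force
      then obtain e where e: "e \<in> block u" "e \<in> block v" by blast
      have v: "v \<in> verts T" using uadj_in_verts[OF wfT uv] by blast
      show ?case
      proof
        fix e' assume "e' \<in> block v"
        then have "(e, e') \<in> (ugraph D)\<^sup>*" using block_connected[OF v e(2)] by blast
        moreover have "((a, t0), e) \<in> (ugraph D)\<^sup>*" using step.IH e(1) by blast
        ultimately show "((a, t0), e') \<in> (ugraph D)\<^sup>*" by (rule rtrancl_trans[rotated])
      qed
    qed
  qed
  have "connected_on (ugraph D) (verts D)"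
  proof (rule connected_on_via[OF sym_ugraph])
    show "(a, t0) \<in> verts D" using a by simp
    fix e assume "e \<in> verts D"
    then have "e \<in> block (fst e)" "fst e \<in> verts T" using T_verts by (auto simp: block_def)
    then have "((a, t0), e) \<in> (ugraph D)\<^sup>*" using reach by blast
    moreover have "ugraph D \<inter> verts D \<times> verts D = ugraph D" using ugraph_sub[OF wf_D] by blast
    ultimately show "((a, t0), e) \<in> (ugraph D \<inter> verts D \<times> verts D)\<^sup>*" by (simp only:)
  qed
  then show ?thesis using a by (auto simp: uconnected_iff)
qed

section \<open>Retraction onto a block\<close>

definition away :: "'t \<Rightarrow> ('t \<times> 't) set" where
  "away t = ugraph T \<inter> (- {t}) \<times> (- {t})"

definition root :: "'t \<Rightarrow> 't \<Rightarrow> 't" where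
  "root t a = (SOME n. uadj T t n \<and> (n, a) \<in> (away t)\<^sup>*)"

text \<open>Two neighbours of \<open>t\<close> joined by a path avoiding \<open>t\<close> would
  close a cycle in the tree.\<close>

lemma root_unique:
  assumes "uadj T t n" "uadj T t n'" "(n, n') \<in> (away t)\<^sup>*" shows "n = n'"
proof (rule ccontr)
  assume ne: "n \<noteq> n'"
  have nt: "n \<noteq> t" using assms(1) T_irrefl by (auto simp: uadj_def)
  obtain xs where "path_between (away t) n n' xs" using rtrancl_path_between[OF assms(3)] by (elim exE)
  then have xs: "xs \<noteq> []" "distinct xs" "hd xs = n" "last xs = n'" "set xs \<subseteq> - {t}" "successively (uadj T) xs"
    using successively_restrict[of "ugraph T" "- {t}" xs] nt
    by (auto simp: path_between_def away_def ugraph_def)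
  have len: "length xs \<ge> 2" using xs ne by (cases xs; cases "tl xs") auto
  have succ: "successively (uadj T) (xs @ [t])"
    unfolding successively_append_iff using xs assms by (simp add: uadj_commute)
  have adjs: "\<forall>i. Suc i < length (xs @ [t]) \<longrightarrow> uadj T ((xs @ [t]) ! i) ((xs @ [t]) ! Suc i)"
    using succ unfolding successively_conv_nth by blast
  have "set (xs @ [t]) \<subseteq> verts T"
  proof
    fix v assume "v \<in> set (xs @ [t])"
    then obtain i where i: "i < length (xs @ [t])" "v = (xs @ [t]) ! i" by (metis in_set_conv_nth)
    show "v \<in> verts T"
    proof (cases "Suc i < length (xs @ [t])")
      case True
      then show ?thesis using adjs i uadj_in_verts[OF wfT] by blast
    next
      case False
      then have "i = length xs" using i by simp
      then have "v = t" using i by simp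
      then show ?thesis using assms uadj_in_verts[OF wfT] by blast
    qed
  qed
  moreover have "distinct (xs @ [t])" using xs by auto
  moreover have "uadj T (last (xs @ [t])) (hd (xs @ [t]))" using xs assms by simp
  moreover have "length (xs @ [t]) \<ge> 3" using len by simp
  ultimately show False using treeT(2) adjs unfolding uacyclic_def by blast
qed

lemma away_sym: "sym (away t)"
  using sym_ugraph[of T] by (auto simp: away_def sym_def)

lemma root:
  assumes "t \<in> verts T" "a \<in> verts T" "a \<noteq> t"
  shows "uadj T t (root t a)" "(root t a, a) \<in> (away t)\<^sup>*"
proof -
  have "connected_on (ugraph T) (verts T)" using treeT(1) by (simp add: uconnected_iff)
  then obtain xs where xs: "path_between (ugraph T) t a xs" using connected_on_path assms by metis
  then obtain n ys where ns: "xs = t # n # ys" using assms(3)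
    by (cases xs; cases "tl xs") (auto simp: path_between_def)
  have succ: "successively (\<lambda>u v. (u, v) \<in> ugraph T) (n # ys)" "t \<notin> set (n # ys)" "last (n # ys) = a" "uadj T t n"
    using xs ns by (auto simp: path_between_def ugraph_def)
  have "(n, last (n # ys)) \<in> (away t)\<^sup>*" using succ(1,2)
  proof (induction ys arbitrary: n)
    case (Cons m ys)
    have "(n, m) \<in> away t" using Cons.prems by (auto simp: away_def)
    moreover have "(m, last (m # ys)) \<in> (away t)\<^sup>*" using Cons by simp
    ultimately show ?case by (simp add: converse_rtrancl_into_rtrancl)
  qed simp
  then have "\<exists>n. uadj T t n \<and> (n, a) \<in> (away t)\<^sup>*" using succ by blast
  from someI_ex[OF this] show "uadj T t (root t a)" "(root t a, a) \<in> (away t)\<^sup>*" by (auto simp: root_def)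
qed

lemma root_nbr: "uadj T t n \<Longrightarrow> root t n = n"
  using root[of t n] root_unique[of t "root t n" n] uadj_in_verts[OF wfT] T_irrefl by (metis uadj_def)

lemma root_adj:
  assumes t: "t \<in> verts T" and ab: "uadj T a b" "a \<noteq> t" "b \<noteq> t" shows "root t a = root t b"
proof (rule root_unique[of t])
  have V: "a \<in> verts T" "b \<in> verts T" using uadj_in_verts[OF wfT ab(1)] by auto
  note ra = root[OF t V(1) ab(2)] and rb = root[OF t V(2) ab(3)]
  show "uadj T t (root t a)" "uadj T t (root t b)" using ra rb by blast+
  have "(a, b) \<in> away t" using ab by (simp add: away_def ugraph_def)
  then have "(root t a, b) \<in> (away t)\<^sup>*" using ra(2) by (rule rtrancl_into_rtrancl[rotated])
  moreover have "(b, root t b) \<in> (away t)\<^sup>*" by (rule rtrancl_sym_swap[OF away_sym rb(2)])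
  ultimately show "(root t a, root t b) \<in> (away t)\<^sup>*" by (rule rtrancl_trans)
qed

text \<open>The retraction onto the block of \<open>t\<close>: the arc at \<open>t\<close> on the way from \<open>t\<close> to \<open>e\<close>.\<close>

definition proj :: "'t \<Rightarrow> 't \<times> 't \<Rightarrow> 't \<times> 't" where
  "proj t e = (let n = root t (if fst e \<noteq> t then fst e else snd e) in if (t, n) \<in> arcs T then (t, n) else (n, t))"

lemma proj_block: assumes "e \<in> block t" shows "proj t e = e"
proof -
  obtain a b where e: "e = (a, b)" "(a, b) \<in> arcs T" "a = t \<or> b = t" using assms by (cases e) (auto simp: block_def)
  have ne: "a \<noteq> b" using e(2) T_irrefl by blast
  show ?thesis
  proof (cases "a = t")
    case True
    then have "root t b = b" using root_nbr e by (simp add: uadj_def)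
    then show ?thesis using True e by (simp add: proj_def)
  next
    case False
    then have b: "b = t" using e by simp
    then have "root t a = a" using root_nbr e by (simp add: uadj_def)
    moreover have "(t, a) \<notin> arcs T" using T_antisym e b by blast
    ultimately show ?thesis using False b e by (simp add: proj_def)
  qed
qed

text \<open>The two tree arcs meet in a vertex other than \<open>t\<close>, so they lie in the same
  branch at \<open>t\<close>.\<close>

lemma proj_step:
  assumes t: "t \<in> verts T" and e: "(e, e') \<in> arcs D" and n: "\<not> (e \<in> block t \<and> e' \<in> block t)"
  shows "proj t e = proj t e'"
proof -
  obtain a b c d where ab: "e = (a, b)" "e' = (c, d)" by (cases e, cases e')
  have T: "(a, b) \<in> arcs T" "(c, d) \<in> arcs T" "b = c" using e ab by (auto simp: arcs_D)
  have bt: "b \<noteq> t" using n T ab by (auto simp: block_def)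
  have "root t (if a \<noteq> t then a else b) = root t b"
    using root_adj[OF t, of a b] bt T by (auto simp: uadj_def)
  then have "proj t e = (if (t, root t b) \<in> arcs T then (t, root t b) else (root t b, t))"
    unfolding proj_def ab Let_def fst_conv snd_conv by (simp only:)
  moreover have "proj t e' = (if (t, root t b) \<in> arcs T then (t, root t b) else (root t b, t))"
    unfolding proj_def ab using bt T(3) by (simp add: Let_def)
  ultimately show ?thesis by simp
qed

lemma proj_uadj:
  assumes "t \<in> verts T" "uadj D e e'" "\<not> (e \<in> block t \<and> e' \<in> block t)" shows "proj t e = proj t e'"
  using assms proj_step[of t e e'] proj_step[of t e' e] unfolding uadj_def by metis

text \<open>The projection of a walk in \<open>S\<close> moves only along edges whose ends are both
  in the block; there it coincides with the walk, so it never leaves \<open>S\<close>.\<close>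

lemma connected_proj:
  assumes S: "connected_on (ugraph D) S" and t: "t \<in> verts T" and s: "s \<in> S" "s \<in> block t" and e: "e \<in> S"
  shows "proj t e \<in> S \<inter> block t \<and> (s, proj t e) \<in> (ugraph D \<inter> (S \<inter> block t) \<times> (S \<inter> block t))\<^sup>*"
proof -
  have "(s, e) \<in> (ugraph D \<inter> S \<times> S)\<^sup>*" using S s e unfolding connected_on_def by blast
  then show ?thesis
  proof (induction rule: rtrancl_induct)
    case base
    show ?case using proj_block[OF s(2)] s by simp
  next
    case (step p q)
    have pq: "uadj D p q" "p \<in> S" "q \<in> S" using step.hyps(2) by (auto simp: ugraph_def)
    show ?case
    proof (cases "p \<in> block t \<and> q \<in> block t")
      case True
      then have pr: "proj t p = p" "proj t q = q" using proj_block by blast+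
      have "(p, q) \<in> ugraph D \<inter> (S \<inter> block t) \<times> (S \<inter> block t)" using True pq by (simp add: ugraph_def)
      then show ?thesis using step.IH True pq unfolding pr by (meson IntI rtrancl.rtrancl_into_rtrancl)
    next
      case False
      then show ?thesis using step.IH proj_uadj[OF t pq(1)] by metis
    qed
  qed
qed

lemma connected_block_Int:
  assumes S: "connected_on (ugraph D) S" and t: "t \<in> verts T"
  shows "connected_on (ugraph D) (S \<inter> block t)"
  unfolding connected_on_def
proof (intro ballI)
  fix s e assume "s \<in> S \<inter> block t" "e \<in> S \<inter> block t"
  then show "(s, e) \<in> (ugraph D \<inter> (S \<inter> block t) \<times> (S \<inter> block t))\<^sup>*"
    using connected_proj[OF S t, of s e] proj_block[of e t] by simp
qed

text \<open>An edge from \<open>u\<close> to \<open>v\<close> would make \<open>v\<close> the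
  projection of \<open>u\<close>, but projections of elements of \<open>S\<close> stay in
  \<open>S\<close>.\<close>

lemma outside_not_adjacent:
  assumes S: "connected_on (ugraph D) S" and t: "t \<in> verts T" and s: "s \<in> S" "s \<in> block t"
    and v: "v \<notin> S" "v \<in> block t" and u: "u \<in> S" "u \<notin> block t"
  shows "\<not> uadj D u v"
proof
  assume "uadj D u v"
  then have "proj t u = v" using proj_uadj[OF t] proj_block[OF v(2)] u(2) by metis
  then show False using connected_proj[OF S t s u(1)] v(1) by simp
qed

text \<open>Adjacent vertices of a block alternate between entering and leaving \<open>t\<close>,
  and their images meet in one vertex of \<open>T\<close>. Along walks in the connected set
  \<open>S \<inter> block t\<close> this vertex remains \<open>t'\<close>.\<close>

lemma roles_preserved:
  assumes S: "connected_on (ugraph D) S" and t: "t \<in> verts T" and s: "s \<in> S" "s \<in> block t"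
    and f: "\<And>x y. x \<in> S \<Longrightarrow> y \<in> S \<Longrightarrow> (x, y) \<in> arcs D \<Longrightarrow> (f x, f y) \<in> arcs D"
    and t': "t' = (if snd s = t then snd (f s) else fst (f s))" and e: "e \<in> S" "e \<in> block t"
  shows "if snd e = t then snd (f e) = t' else fst (f e) = t'"
proof -
  let ?W = "S \<inter> block t"
  have "(s, e) \<in> (ugraph D \<inter> ?W \<times> ?W)\<^sup>*"
    using connected_block_Int[OF S t] s e unfolding connected_on_def by blast
  then show ?thesis
  proof (induction rule: rtrancl_induct)
    case base
    then show ?case using t' by simp
  next
    case (step p q)
    have pq: "uadj D p q" "p \<in> ?W" "q \<in> ?W" using step.hyps(2) by (auto simp: ugraph_def)
    from pq(1) consider "(p, q) \<in> arcs D" | "(q, p) \<in> arcs D" by (auto simp: uadj_def)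
    then show ?case
    proof cases
      case 1
      have e: "snd p = t" "fst q = t" using block_arc_ends[OF _ _ 1] pq by blast+
      have "snd q \<noteq> t" using e(2) loop_free[of q] pq by (auto simp: block_def)
      moreover have "snd (f p) = fst (f q)" using f[of p q] 1 pq arcs_D by blast
      ultimately show ?thesis using step.IH e by simp
    next
      case 2
      have e: "snd q = t" "fst p = t" using block_arc_ends[OF _ _ 2] pq by blast+
      have "snd p \<noteq> t" using e(2) loop_free[of p] pq by (auto simp: block_def)
      moreover have "snd (f q) = fst (f p)" using f[of q p] 2 pq arcs_D by blast
      ultimately show ?thesis using step.IH e by simp
    qed
  qed
qed

text \<open>The new vertex shares a block with a neighbour in \<open>S\<close>, and nothing in
  \<open>S\<close> outside this block is adjacent to it. The problem thus lives in one block, where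
  the labels turn it into the extension property of \<open>B\<close>.\<close>

lemma one_point_extendable_D: "one_point_extendable D"
  unfolding one_point_extendable_def
proof (intro allI impI)
  fix S f v assume SV: "S \<subseteq> verts D" and S: "connected_on (ugraph D) S" and inj: "inj_on f S" and fV: "f ` S \<subseteq> verts D"
    and f: "\<forall>x\<in>S. \<forall>y\<in>S. (f x, f y) \<in> arcs D \<longleftrightarrow> (x, y) \<in> arcs D" and v: "v \<in> verts D - S" and ex: "\<exists>s\<in>S. uadj D s v"
  obtain s where s: "s \<in> S" "uadj D s v" using ex by blast
  obtain t where st: "s \<in> block t" and vt: "v \<in> block t" using uadj_block[OF s(2)] by blast
  have t: "t \<in> verts T" using st T_verts[of s] by (auto simp: block_def)
  define t' where "t' = (if snd s = t then snd (f s) else fst (f s))"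
  have fS: "f e \<in> arcs T" if "e \<in> S" for e using fV that by auto
  have t'V: "t' \<in> verts T" using T_verts[OF fS[OF s(1)]] by (simp add: t'_def)
  have role: "if snd e = t then snd (f e) = t' else fst (f e) = t'" if "e \<in> S" "e \<in> block t" for e
    by (rule roles_preserved[where f = f, OF S t s(1) st _ t'_def that]) (use f in blast)
  have fb: "f e \<in> block t'" if "e \<in> S" "e \<in> block t" for e
    using role[OF that] fS[OF that(1)] by (auto simp: block_def split: if_splits)
  have rt: "snd (f e) = t' \<longleftrightarrow> snd e = t" if "e \<in> S" "e \<in> block t" for e
    using role[OF that] loop_free[OF fS[OF that(1)]] by (auto split: if_splits)
  define f' where "f' = inv_into S f"
  have f'f: "f' (f e) = e" if "e \<in> S" for e using inj that by (simp add: f'_def)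
  have S': "connected_on (ugraph D) (f ` S)"
    unfolding connected_on_def
  proof (intro ballI)
    fix y y' assume "y \<in> f ` S" "y' \<in> f ` S"
    then obtain x x' where x: "x \<in> S" "y = f x" "x' \<in> S" "y' = f x'" by blast
    have "(x, x') \<in> (ugraph D \<inter> S \<times> S)\<^sup>*" using S x unfolding connected_on_def by blast
    then have "(f x, f x') \<in> (ugraph D \<inter> f ` S \<times> f ` S)\<^sup>*"
    proof (induction rule: rtrancl_induct)
      case (step p q)
      have "(f p, f q) \<in> ugraph D \<inter> f ` S \<times> f ` S" using step.hyps(2) f by (auto simp: ugraph_def uadj_def)
      then show ?case using step.IH by (rule rtrancl_into_rtrancl[rotated])
    qed simp
    then show "(y, y') \<in> (ugraph D \<inter> f ` S \<times> f ` S)\<^sup>*" using x by simp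
  qed
  \<comment> \<open>The inverse map respects blocks as well, so nothing in \<open>S\<close> outside
    \<open>block t\<close> is sent into \<open>block t'\<close>.\<close>
  have pull: "u \<in> block t" if u: "u \<in> S" "f u \<in> block t'" for u
  proof -
    have "if snd (f u) = t' then snd (f' (f u)) = t else fst (f' (f u)) = t"
    proof (rule roles_preserved[where f = f' and s = "f s", OF S' t'V])
      show "f s \<in> f ` S" "f s \<in> block t'" "f u \<in> f ` S" "f u \<in> block t'" using s u fb st by blast+
      show "t = (if snd (f s) = t' then snd (f' (f s)) else fst (f' (f s)))"
        using rt[OF s(1) st] f'f[OF s(1)] st by (auto simp: block_def)
      fix x y assume "x \<in> f ` S" "y \<in> f ` S" "(x, y) \<in> arcs D"
      then show "(f' x, f' y) \<in> arcs D" using f f'f by auto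
    qed
    then have "snd u = t \<or> fst u = t" using f'f[OF u(1)] by (auto split: if_splits)
    then show ?thesis using SV u(1) by (auto simp: block_def)
  qed
  have bij: "bij_betw (\<beta> t) (block t) (verts B)" and bij': "bij_betw (\<beta> t') (block t') (verts B)"
    using \<beta>_bij t t'V by blast+
  define \<gamma> where "\<gamma> = inv_into (block t) (\<beta> t)"
  have \<gamma>\<beta>: "\<gamma> (\<beta> t e) = e" if "e \<in> block t" for e using bij that by (simp add: \<gamma>_def bij_betw_inv_into_left)
  let ?W = "S \<inter> block t"
  let ?Wb = "\<beta> t ` ?W"
  define fb' where "fb' x = \<beta> t' (f (\<gamma> x))" for x
  have fb\<beta>: "fb' (\<beta> t e) = \<beta> t' (f e)" if "e \<in> ?W" for e using \<gamma>\<beta> that by (simp add: fb'_def)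
  have adj_f: "uadj B (\<beta> t' (f e)) (\<beta> t' (f e')) \<longleftrightarrow> uadj B (\<beta> t e) (\<beta> t e')" if "e \<in> ?W" "e' \<in> ?W" for e e'
  proof -
    have "uadj B (\<beta> t' (f e)) (\<beta> t' (f e')) \<longleftrightarrow> uadj D (f e) (f e')" using block_uadj fb that by blast
    also have "\<dots> \<longleftrightarrow> uadj D e e'" using f that unfolding uadj_def by blast
    also have "\<dots> \<longleftrightarrow> uadj B (\<beta> t e) (\<beta> t e')" using block_uadj that by blast
    finally show ?thesis .
  qed
  have col_f: "\<beta> t' (f e) \<in> X \<longleftrightarrow> \<beta> t e \<in> X" if "e \<in> ?W" for e
    using \<beta>_role[OF fb] \<beta>_role[of e t] rt that by blast
  have "\<exists>w\<in>verts B - fb' ` ?Wb. (w \<in> X \<longleftrightarrow> \<beta> t v \<in> X) \<and> (\<forall>u\<in>?Wb. uadj B (fb' u) w \<longleftrightarrow> uadj B u (\<beta> t v))"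
  proof (rule ope[unfolded coloured_ope_def, rule_format])
    show "?Wb \<subseteq> verts B" using bij_betwE[OF bij] by blast
    show "connected_on (ugraph B) ?Wb"
      unfolding connected_on_def
    proof (intro ballI)
      fix y y' assume "y \<in> ?Wb" "y' \<in> ?Wb"
      then obtain x x' where x: "x \<in> ?W" "y = \<beta> t x" "x' \<in> ?W" "y' = \<beta> t x'" by blast
      have "(x, x') \<in> (ugraph D \<inter> ?W \<times> ?W)\<^sup>*" using connected_block_Int[OF S t] x unfolding connected_on_def by blast
      then have "(\<beta> t x, \<beta> t x') \<in> (ugraph B \<inter> ?Wb \<times> ?Wb)\<^sup>*"
      proof (induction rule: rtrancl_induct)
        case (step p q)
        have "(\<beta> t p, \<beta> t q) \<in> ugraph B \<inter> ?Wb \<times> ?Wb" using step.hyps(2) block_uadj[of p t q] by (auto simp: ugraph_def)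
        then show ?case using step.IH by (rule rtrancl_into_rtrancl[rotated])
      qed simp
      then show "(y, y') \<in> (ugraph B \<inter> ?Wb \<times> ?Wb)\<^sup>*" using x by simp
    qed
    show "inj_on fb' ?Wb"
    proof (rule inj_onI)
      fix y y' assume "y \<in> ?Wb" "y' \<in> ?Wb" and eq: "fb' y = fb' y'"
      then obtain x x' where x: "x \<in> ?W" "y = \<beta> t x" "x' \<in> ?W" "y' = \<beta> t x'" by blast
      then have "\<beta> t' (f x) = \<beta> t' (f x')" using eq fb\<beta> by simp
      then have "f x = f x'" using inj_on_eq_iff[OF bij_betw_imp_inj_on[OF bij'], of "f x" "f x'"] fb x by blast
      then have "x = x'" using inj_on_eq_iff[OF inj, of x x'] x by blast
      then show "y = y'" using x by simp
    qed
    show "fb' ` ?Wb \<subseteq> verts B"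
    proof
      fix y assume "y \<in> fb' ` ?Wb"
      then obtain x where "x \<in> ?W" "y = fb' (\<beta> t x)" by blast
      then show "y \<in> verts B" using fb\<beta> bij_betwE[OF bij'] fb by auto
    qed
    show "fb' u \<in> X \<longleftrightarrow> u \<in> X" if "u \<in> ?Wb" for u using that fb\<beta> col_f by auto
    show "uadj B (fb' u) (fb' u') \<longleftrightarrow> uadj B u u'" if "u \<in> ?Wb" "u' \<in> ?Wb" for u u'
      using that fb\<beta> adj_f by auto
    have "\<beta> t v \<notin> ?Wb"
    proof
      assume "\<beta> t v \<in> ?Wb"
      then obtain x where "\<beta> t v = \<beta> t x" "x \<in> ?W" by (rule imageE)
      then have "v = x" using inj_on_eq_iff[OF bij_betw_imp_inj_on[OF bij], of v x] vt by blast
      then show False using v \<open>x \<in> ?W\<close> by blast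
    qed
    then show "\<beta> t v \<in> verts B - ?Wb" using bij_betwE[OF bij] vt by blast
    show "\<exists>s\<in>?Wb. uadj B s (\<beta> t v)" using block_uadj[OF st vt] s st by blast
  qed
  then obtain wb where wb: "wb \<in> verts B" "wb \<notin> fb' ` ?Wb" "wb \<in> X \<longleftrightarrow> \<beta> t v \<in> X"
    "\<forall>u\<in>?Wb. uadj B (fb' u) wb \<longleftrightarrow> uadj B u (\<beta> t v)" by blast
  obtain w where w: "w \<in> block t'" "\<beta> t' w = wb" using bij' wb(1) by (metis bij_betw_def imageE)
  have wS: "w \<notin> f ` S"
  proof
    assume "w \<in> f ` S"
    then obtain u where u: "w = f u" "u \<in> S" by (rule imageE)
    then have "u \<in> ?W" using pull w(1) by blast
    then have "fb' (\<beta> t u) = wb" using fb\<beta> u w by simp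
    then show False using wb(2) \<open>u \<in> ?W\<close> by blast
  qed
  have ad: "uadj D (f u) w \<longleftrightarrow> uadj D u v" if u: "u \<in> ?W" for u
  proof -
    have "uadj D (f u) w \<longleftrightarrow> uadj B (\<beta> t' (f u)) wb" using block_uadj[OF fb w(1)] w(2) u by blast
    also have "\<dots> \<longleftrightarrow> uadj B (\<beta> t u) (\<beta> t v)" using wb(4) fb\<beta>[OF u] u by force
    also have "\<dots> \<longleftrightarrow> uadj D u v" using block_uadj vt u by blast
    finally show ?thesis .
  qed
  have dir: "(x, y) \<in> arcs D \<longleftrightarrow> uadj D x y \<and> \<beta> r x \<in> X" if "x \<in> block r" "y \<in> block r" for x y r
    using block_arcs[OF that] block_arcs[OF that(2,1)] arcs_parts parts(1) unfolding uadj_def by blast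
  have main: "((f u, w) \<in> arcs D \<longleftrightarrow> (u, v) \<in> arcs D) \<and> ((w, f u) \<in> arcs D \<longleftrightarrow> (v, u) \<in> arcs D)" if u: "u \<in> S" for u
  proof (cases "u \<in> block t")
    case True
    then have uW: "u \<in> ?W" using u by blast
    have "(f u, w) \<in> arcs D \<longleftrightarrow> (u, v) \<in> arcs D"
      using dir[OF fb[OF u True] w(1)] dir[OF True vt] ad[OF uW] col_f[OF uW] by blast
    moreover have "(w, f u) \<in> arcs D \<longleftrightarrow> (v, u) \<in> arcs D"
      using dir[OF w(1) fb[OF u True]] dir[OF vt True] ad[OF uW] w(2) wb(3) uadj_commute by metis
    ultimately show ?thesis by blast
  next
    case False
    then have "\<not> uadj D u v" using outside_not_adjacent[OF S t s(1) st _ vt u] v by blast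
    moreover have "f u \<notin> block t'" using pull[OF u] False by blast
    then have "\<not> uadj D (f u) w"
      using outside_not_adjacent[OF S' t'V _ fb[OF s(1) st] wS w(1), of "f u"] s u by blast
    ultimately show ?thesis unfolding uadj_def by blast
  qed
  have "w \<in> verts D" using w(1) by (simp add: block_def)
  then show "\<exists>w\<in>verts D - f ` S. \<forall>u\<in>S. ((f u, w) \<in> arcs D \<longleftrightarrow> (u, v) \<in> arcs D) \<and> ((w, f u) \<in> arcs D \<longleftrightarrow> (v, u) \<in> arcs D)"
    using wS main by blast
qed

theorem connected_homogeneous_D: "connected_homogeneous D"
  by (rule one_point_extendable_homogeneous[OF wf_D uconnected_D one_point_extendable_D])

end

section \<open>Reachability classes as homogeneous bipartite graphs\<close>

context cut_homogeneous
begin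

lemma aut_out_nbrs:
  assumes g: "automorphism g D" and x: "x \<in> verts D" shows "g ` out_nbrs D x = out_nbrs D (g x)"
proof (intro set_eqI iffI)
  fix w assume "w \<in> g ` out_nbrs D x"
  then obtain v where "w = g v" "v \<in> out_nbrs D x" by (rule imageE)
  then show "w \<in> out_nbrs D (g x)" using automorphism_arcs[OF g x] arc_verts by (simp add: out_nbrs_def)
next
  fix w assume w: "w \<in> out_nbrs D (g x)"
  then have "w \<in> g ` verts D" using out_nbrs_verts automorphism_bij[OF g] unfolding bij_betw_def by blast
  then obtain v where "w = g v" "v \<in> verts D" by (rule imageE)
  then show "w \<in> g ` out_nbrs D x" using w automorphism_arcs[OF g x] by (auto simp: out_nbrs_def)
qed

lemma card_out_nbrs:
  assumes "x \<in> verts D" "y \<in> verts D" shows "card (out_nbrs D x) = card (out_nbrs D y)"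
proof -
  obtain g where g: "automorphism g D" "g x = y" using vertex_transitive assms by blast
  have "inj_on g (out_nbrs D x)"
    using automorphism_bij[OF g(1)] inj_on_subset[OF _ out_nbrs_verts] unfolding bij_betw_def by blast
  then show ?thesis using aut_out_nbrs[OF g(1) assms(1)] g(2) card_image by metis
qed

lemma finite_out_nbrs: "x \<in> verts D \<Longrightarrow> finite (out_nbrs D x)"
  using lf by (simp add: locally_finite_def)

end

context cut_homogeneous
begin

interpretation rv: cut_homogeneous "rev_dg D" E by (rule rev_cut_homogeneous)

lemma in_nbrs_rev: "out_nbrs (rev_dg D) x = in_nbrs D x"
  by (simp add: out_nbrs_def in_nbrs_def)

lemma card_in_nbrs:
  assumes "x \<in> verts D" "y \<in> verts D" shows "card (in_nbrs D x) = card (in_nbrs D y)"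
  using rv.card_out_nbrs[of x y] assms by (simp add: in_nbrs_rev)

lemma finite_in_nbrs: "x \<in> verts D \<Longrightarrow> finite (in_nbrs D x)"
  using lf by (simp add: locally_finite_def)

lemma share_aut:
  assumes g: "automorphism g D" and s: "((a, b), (c, d)) \<in> (share D)\<^sup>*" and ab: "(a, b) \<in> arcs D"
  shows "((g a, g b), (g c, g d)) \<in> (share D)\<^sup>*"
proof -
  have "((a, b), e) \<in> (share D)\<^sup>* \<Longrightarrow> ((g a, g b), (g (fst e), g (snd e))) \<in> (share D)\<^sup>*" for e
  proof (induction rule: rtrancl_induct)
    case (step e e')
    obtain p q p' q' where e: "e = (p, q)" "e' = (p', q')" by (cases e, cases e')
    have arcs: "(p, q) \<in> arcs D" "(p', q') \<in> arcs D" and eq: "p = p' \<or> q = q'" using step.hyps(2) e by (auto simp: share_def)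
    have "(g p, g q) \<in> arcs D" "(g p', g q') \<in> arcs D" using automorphism_arcs[OF g] arcs arc_verts by blast+
    then have "((g p, g q), (g p', g q')) \<in> share D" using eq by (auto simp: share_def)
    then show ?case using step.IH e by (simp add: rtrancl.rtrancl_into_rtrancl)
  qed simp
  from this[OF s] show ?thesis by simp
qed

lemma class_closed:
  assumes "e \<in> arcs D" "(u, v) \<in> A_class D e" "(u', v') \<in> arcs D" "u = u' \<or> v = v'"
  shows "(u', v') \<in> A_class D e"
proof -
  have s: "(e, (u, v)) \<in> (share D)\<^sup>*" using A_class_iff[OF wf assms(1)] assms(2) by blast
  have "((u, v), (u', v')) \<in> share D"
    using share_rtrancl_arcs[OF s assms(1)] assms by (auto simp: share_def)
  then show ?thesis using s A_class_iff[OF wf assms(1)] by (simp add: rtrancl.rtrancl_into_rtrancl)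
qed

lemma class_arcs: "e \<in> arcs D \<Longrightarrow> f \<in> A_class D e \<Longrightarrow> f \<in> arcs D"
  using A_class_iff[OF wf] share_rtrancl_arcs by blast

text \<open>A class contains every arc leaving one of its sources or entering one of its sinks, so
  its degrees are the constant out- and in-degrees of the digraph.\<close>

lemma class_bip_graph:
  assumes e: "e \<in> arcs D"
  shows "bip_graph (Delta_of (A_class D e)) (\<lambda>v. v \<in> fst ` A_class D e)
     (\<lambda>c. if c then card (out_nbrs D (fst e)) else card (in_nbrs D (fst e)))"
proof -
  let ?C = "A_class D e"
  let ?G = "Delta_of ?C"
  have vG: "verts ?G = fst ` ?C \<union> snd ` ?C" and aG: "arcs ?G = ?C" by (simp_all add: Delta_of_def)
  have disj: "fst ` ?C \<inter> snd ` ?C = {}" by (rule class_parts_disjoint[OF e])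
  have eC: "e \<in> ?C" using A_class_iff[OF wf e] by simp
  have ends: "u \<in> fst ` ?C" "v \<in> snd ` ?C" if "(u, v) \<in> ?C" for u v using that by force+
  have eV: "fst e \<in> verts D" using arc_verts e by (metis prod.collapse)
  have GD: "v \<in> verts D" if "v \<in> verts ?G" for v
  proof -
    from that obtain f where "f \<in> ?C" "v = fst f \<or> v = snd f" unfolding vG by blast
    then show ?thesis using class_arcs[OF e] arc_verts by (metis prod.collapse)
  qed
  have N1: "{y. uadj ?G x y} = out_nbrs D x" if x: "x \<in> fst ` ?C" for x
  proof (intro set_eqI iffI)
    fix y assume "y \<in> {y. uadj ?G x y}"
    then have "(x, y) \<in> ?C \<or> (y, x) \<in> ?C" by (simp add: uadj_def aG)
    then have "(x, y) \<in> ?C" using ends x disj by blast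
    then show "y \<in> out_nbrs D x" using class_arcs[OF e] by (simp add: out_nbrs_def)
  next
    fix y assume "y \<in> out_nbrs D x"
    then have a: "(x, y) \<in> arcs D" by (simp add: out_nbrs_def)
    obtain w where "(x, w) \<in> ?C" using x by force
    then have "(x, y) \<in> ?C" using class_closed[OF e _ a] by blast
    then show "y \<in> {y. uadj ?G x y}" by (simp add: uadj_def aG)
  qed
  have N2: "{y. uadj ?G x y} = in_nbrs D x" if x: "x \<in> snd ` ?C" for x
  proof (intro set_eqI iffI)
    fix y assume "y \<in> {y. uadj ?G x y}"
    then have "(x, y) \<in> ?C \<or> (y, x) \<in> ?C" by (simp add: uadj_def aG)
    then have "(y, x) \<in> ?C" using ends x disj by blast
    then show "y \<in> in_nbrs D x" using class_arcs[OF e] by (simp add: in_nbrs_def)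
  next
    fix y assume "y \<in> in_nbrs D x"
    then have a: "(y, x) \<in> arcs D" by (simp add: in_nbrs_def)
    obtain w where "(w, x) \<in> ?C" using x by force
    then have "(y, x) \<in> ?C" using class_closed[OF e _ a] by blast
    then show "y \<in> {y. uadj ?G x y}" by (simp add: uadj_def aG)
  qed
  show ?thesis
  proof
    fix x y assume "uadj ?G x y"
    then have xy: "(x, y) \<in> ?C \<or> (y, x) \<in> ?C" by (simp add: uadj_def aG)
    then show "x \<in> verts ?G" unfolding vG using ends by blast
    show "(x \<in> fst ` ?C) \<noteq> (y \<in> fst ` ?C)" using xy ends disj by blast
  next
    have "connected_on (ugraph ?G) (verts ?G)"
    proof (rule connected_on_via[OF sym_ugraph, of "fst e"])
      show "fst e \<in> verts ?G" unfolding vG using eC by blast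
      let ?R = "ugraph ?G \<inter> verts ?G \<times> verts ?G"
      have edge: "(u, v) \<in> ?R" "(v, u) \<in> ?R" if "(u, v) \<in> ?C" for u v
        using that ends[OF that] by (simp_all add: ugraph_def uadj_def aG vG)
      have reach: "(fst e, fst f) \<in> ?R\<^sup>* \<and> (fst e, snd f) \<in> ?R\<^sup>*" if "(e, f) \<in> (share D)\<^sup>*" for f
        using that
      proof (induction rule: rtrancl_induct)
        case base
        have "(fst e, snd e) \<in> ?R" using edge eC by (metis prod.collapse)
        then show ?case by blast
      next
        case (step f f')
        have "(e, f') \<in> (share D)\<^sup>*" using step.hyps by (rule rtrancl_into_rtrancl)
        then have "f' \<in> ?C" using A_class_iff[OF wf e] by blast
        then have ed: "(fst f', snd f') \<in> ?R" "(snd f', fst f') \<in> ?R" using edge by (metis prod.collapse)+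
        have "fst f = fst f' \<or> snd f = snd f'" using step.hyps(2) by (simp add: share_def)
        then show ?case
        proof
          assume "fst f = fst f'"
          then have "(fst e, fst f') \<in> ?R\<^sup>*" using step.IH by simp
          then show ?thesis using ed(1) by (meson rtrancl.rtrancl_into_rtrancl)
        next
          assume "snd f = snd f'"
          then have "(fst e, snd f') \<in> ?R\<^sup>*" using step.IH by simp
          then show ?thesis using ed(2) by (meson rtrancl.rtrancl_into_rtrancl)
        qed
      qed
      fix v assume "v \<in> verts ?G"
      then obtain f where "f \<in> ?C" "v = fst f \<or> v = snd f" unfolding vG by blast
      then show "(fst e, v) \<in> ?R\<^sup>*" using reach A_class_iff[OF wf e] by blast
    qed
    moreover have "verts ?G \<noteq> {}" unfolding vG using eC by blast
    ultimately show "uconnected ?G" by (simp add: uconnected_iff)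
  next
    fix x assume x: "x \<in> verts ?G"
    have xV: "x \<in> verts D" by (rule GD[OF x])
    consider "x \<in> fst ` ?C" | "x \<in> snd ` ?C" "x \<notin> fst ` ?C" using x disj unfolding vG by blast
    then show "finite {y. uadj ?G x y}"
      by cases (use N1 N2 finite_out_nbrs[OF xV] finite_in_nbrs[OF xV] in simp_all)
    show "card {y. uadj ?G x y} = (if x \<in> fst ` ?C then card (out_nbrs D (fst e)) else card (in_nbrs D (fst e)))"
    proof (cases "x \<in> fst ` ?C")
      case True
      then show ?thesis using N1 card_out_nbrs[OF xV eV] by simp
    next
      case False
      then have "x \<in> snd ` ?C" using x unfolding vG by blast
      then show ?thesis using N2 False card_in_nbrs[OF xV eV] by simp
    qed
  next
    fix c :: bool
    have "out_nbrs D (fst e) \<noteq> {}" "in_nbrs D (fst e) \<noteq> {}"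
      using has_out_nbr[OF eV] has_in_nbr[OF eV] by (auto simp: out_nbrs_def in_nbrs_def)
    then show "(if c then card (out_nbrs D (fst e)) else card (in_nbrs D (fst e))) \<ge> 1"
      using finite_out_nbrs[OF eV] finite_in_nbrs[OF eV] by (simp add: Suc_le_eq card_gt_0_iff)
  qed
qed

text \<open>Automorphisms permute the classes, so keeping one arc inside the class suffices.\<close>

lemma class_aut:
  assumes e: "e \<in> arcs D" and g: "automorphism g D"
    and c: "(a, b) \<in> A_class D e" "(g a, g b) \<in> A_class D e" and f: "(u, v) \<in> A_class D e"
  shows "(g u, g v) \<in> A_class D e"
proof -
  have "(e, (a, b)) \<in> (share D)\<^sup>*" "(e, (u, v)) \<in> (share D)\<^sup>*" using c f A_class_iff[OF wf e] by blast+
  then have "((a, b), (u, v)) \<in> (share D)\<^sup>*" using rtrancl_sym_swap[OF sym_share] rtrancl_trans by metis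
  then have "((g a, g b), (g u, g v)) \<in> (share D)\<^sup>*" using share_aut[OF g] class_arcs[OF e c(1)] by blast
  moreover have "(e, (g a, g b)) \<in> (share D)\<^sup>*" using c A_class_iff[OF wf e] by blast
  ultimately have "(e, (g u, g v)) \<in> (share D)\<^sup>*" by (rule rtrancl_trans[rotated])
  then show ?thesis using A_class_iff[OF wf e] by blast
qed

text \<open>The class is induced, so a colour-preserving isomorphism between its connected subgraphs
  is one in the digraph and extends to an automorphism, which preserves the class.\<close>

lemma fat_class_hom_bip:
  assumes fat and e: "e \<in> arcs D"
  shows "hom_bip (Delta_of (A_class D e)) (\<lambda>v. v \<in> fst ` A_class D e)
     (\<lambda>c. if c then card (out_nbrs D (fst e)) else card (in_nbrs D (fst e)))"
proof -
  let ?C = "A_class D e"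
  let ?G = "Delta_of ?C"
  let ?col = "\<lambda>v. v \<in> fst ` ?C"
  interpret bip_graph ?G ?col "\<lambda>c. if c then card (out_nbrs D (fst e)) else card (in_nbrs D (fst e))"
    by (rule class_bip_graph[OF e])
  have vG: "verts ?G = fst ` ?C \<union> snd ` ?C" and aG: "arcs ?G = ?C" by (simp_all add: Delta_of_def)
  have disj: "fst ` ?C \<inter> snd ` ?C = {}" by (rule class_parts_disjoint[OF e])
  have ends: "u \<in> fst ` ?C" "v \<in> snd ` ?C" if "(u, v) \<in> ?C" for u v using that by force+
  have GD: "v \<in> verts D" if "v \<in> verts ?G" for v
  proof -
    from that obtain f where "f \<in> ?C" "v = fst f \<or> v = snd f" unfolding vG by blast
    then show ?thesis using class_arcs[OF e] arc_verts by (metis prod.collapse)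
  qed
  have src: "(u, v) \<in> ?C" if m: "u \<in> fst ` ?C" "(u, v) \<in> arcs D" for u v
  proof -
    obtain w where "(u, w) \<in> ?C" using m(1) by force
    then show ?thesis using class_closed[OF e _ m(2)] by blast
  qed
  have snk: "(u, v) \<in> ?C" if m: "v \<in> snd ` ?C" "(u, v) \<in> arcs D" for u v
  proof -
    obtain w where "(w, v) \<in> ?C" using m(1) by force
    then show ?thesis using class_closed[OF e _ m(2)] by blast
  qed
  have ind: "(u, v) \<in> arcs D \<longleftrightarrow> (u, v) \<in> ?C" if uv: "u \<in> verts ?G" "v \<in> verts ?G" for u v
  proof
    assume a: "(u, v) \<in> arcs D"
    show "(u, v) \<in> ?C"
    proof (cases "u \<in> fst ` ?C \<or> v \<in> snd ` ?C")
      case True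
      then show ?thesis using src snk a by blast
    next
      case False
      then have "u \<in> snd ` ?C" "v \<in> fst ` ?C" using uv vG by blast+
      then obtain x y where xy: "(x, u) \<in> ?C" "(v, y) \<in> ?C" by force
      have "(e, (x, u)) \<in> (share D)\<^sup>*" "(e, (v, y)) \<in> (share D)\<^sup>*" using xy A_class_iff[OF wf e] by blast+
      then have "((x, u), (v, y)) \<in> (share D)\<^sup>*" using rtrancl_sym_swap[OF sym_share] rtrancl_trans by metis
      then show ?thesis using fat_induced[OF \<open>fat\<close> _ class_arcs[OF e xy(1)]] a by blast
    qed
  qed (rule class_arcs[OF e])
  have adjC: "(u, v) \<in> ?C \<longleftrightarrow> adj u v \<and> ?col u" for u v
    using ends disj by (auto simp: uadj_def aG)
  show ?thesis
  proof (unfold_locales, goal_cases)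
    case (1 xs ys)
    have xsV: "xs ! i \<in> verts ?G" "ys ! i \<in> verts ?G" if "i < length xs" for i
      using that 1(3,4,6) nth_mem by (metis subsetD)+
    have "\<exists>g. automorphism g D \<and> map g xs = ys"
    proof (rule homogeneous_list[OF hom])
      show "set xs \<subseteq> verts D" "set ys \<subseteq> verts D" using 1(3,4) GD by blast+
      show "\<exists>j<i. uadj D (xs ! j) (xs ! i)" if m: "0 < i" "i < length xs" for i
      proof -
        obtain j where j: "j < i" "adj (xs ! j) (xs ! i)" using 1(8)[OF m] by blast
        then have "uadj D (xs ! j) (xs ! i)" using class_arcs[OF e] by (auto simp: uadj_def aG)
        then show ?thesis using j by blast
      qed
      show "(xs ! i, xs ! j) \<in> arcs D \<longleftrightarrow> (ys ! i, ys ! j) \<in> arcs D" if "i < length xs" "j < length xs" for i j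
        using ind[OF xsV(1)[OF that(1)] xsV(1)[OF that(2)]] ind[OF xsV(2)[OF that(1)] xsV(2)[OF that(2)]]
          adjC 1(7)[OF that(1)] 1(9)[OF that] by metis
    qed (use 1 in blast)+
    then obtain g where g: "automorphism g D" "map g xs = ys" by blast
    have gx: "g (xs ! i) = ys ! i" if "i < length xs" for i using g(2) that by (metis nth_map)
    have len: "0 < length xs" using 1(5) by simp
    \<comment> \<open>The list may consist of one vertex, so an arc of the class at the first vertex
      is used; its colour decides whether the arc leaves or enters.\<close>
    have "\<exists>a b. (a, b) \<in> ?C \<and> (g a, g b) \<in> ?C"
    proof -
      have x0: "xs ! 0 \<in> verts ?G" "ys ! 0 \<in> verts ?G" "?col (xs ! 0) = ?col (ys ! 0)" using xsV[OF len] 1(7)[OF len] by auto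
      show ?thesis
      proof (cases "?col (xs ! 0)")
        case True
        then obtain w where w: "(xs ! 0, w) \<in> ?C" by force
        have "(g (xs ! 0), g w) \<in> arcs D" using automorphism_arcs[OF g(1)] class_arcs[OF e w] arc_verts by blast
        then have "(g (xs ! 0), g w) \<in> ?C" using src gx[OF len] True x0(3) by simp
        then show ?thesis using w by blast
      next
        case False
        then have "xs ! 0 \<in> snd ` ?C" "ys ! 0 \<in> snd ` ?C" using x0 vG by blast+
        then obtain w where w: "(w, xs ! 0) \<in> ?C" by force
        have "(g w, g (xs ! 0)) \<in> arcs D" using automorphism_arcs[OF g(1)] class_arcs[OF e w] arc_verts by blast
        then have "(g w, g (xs ! 0)) \<in> ?C" using snk gx[OF len] \<open>ys ! 0 \<in> snd ` ?C\<close> by simp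
        then show ?thesis using w by blast
      qed
    qed
    then obtain a b where ab: "(a, b) \<in> ?C" "(g a, g b) \<in> ?C" by blast
    let ?h = "inv_into (verts D) g"
    have inj: "inj_on g (verts D)" and sur: "g ` verts D = verts D" using automorphism_bij[OF g(1)] by (auto simp: bij_betw_def)
    have hg: "?h (g v) = v" if "v \<in> verts D" for v using inj that by simp
    have gh: "g (?h v) = v" if "v \<in> verts D" for v using sur that by (simp add: f_inv_into_f)
    have abV: "a \<in> verts D" "b \<in> verts D" using arc_verts class_arcs[OF e ab(1)] by blast+
    have fwd: "(g u, g v) \<in> ?C" if "(u, v) \<in> ?C" for u v using class_aut[OF e g(1) ab that] .
    have bwd: "(?h u, ?h v) \<in> ?C" if "(u, v) \<in> ?C" for u v
      by (rule class_aut[OF e automorphism_inv[OF g(1)] ab(2) _ that]) (use ab(1) hg abV in simp)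
    have gV: "g v \<in> verts ?G" if "v \<in> verts ?G" for v
    proof -
      from that consider w where "(v, w) \<in> ?C" | w where "(w, v) \<in> ?C" unfolding vG by force
      then show ?thesis by cases (use fwd ends vG in blast)+
    qed
    have hV: "?h v \<in> verts ?G" if "v \<in> verts ?G" for v
    proof -
      from that consider w where "(v, w) \<in> ?C" | w where "(w, v) \<in> ?C" unfolding vG by force
      then show ?thesis by cases (use bwd ends vG in blast)+
    qed
    have "bij_betw g (verts ?G) (verts ?G)"
      by (rule bij_betw_byWitness[where f' = ?h]) (use gV hV hg gh GD in auto)
    moreover have "uadj ?G (g x) (g y) \<longleftrightarrow> uadj ?G x y" if xy: "x \<in> verts ?G" "y \<in> verts ?G" for x y
    proof -
      have "(g x, g y) \<in> ?C \<longleftrightarrow> (x, y) \<in> ?C" if "x \<in> verts ?G" "y \<in> verts ?G" for x y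
        using fwd[of x y] bwd[of "g x" "g y"] hg GD that by metis
      then show ?thesis using xy by (simp add: uadj_def aG)
    qed
    ultimately show ?case using g(2) by blast
  qed
qed

text \<open>If \<open>fat\<close> fails, the class is a subgraph of an acyclic graph with constant
  degrees on each side, hence a star or a semiregular tree.\<close>

theorem cut_class_listed:
  assumes e: "e \<in> arcs D" shows "listed_graph (Delta_of (A_class D e))"
proof (cases fat)
  case True
  then show ?thesis by (rule hom_bip.homogeneous_bipartite_listed[OF fat_class_hom_bip[OF _ e]])
next
  case False
  let ?G = "Delta_of (A_class D e)"
  interpret bip_graph ?G "\<lambda>v. v \<in> fst ` A_class D e" "\<lambda>c. if c then card (out_nbrs D (fst e)) else card (in_nbrs D (fst e))"
    by (rule class_bip_graph[OF e])
  let ?d = "\<lambda>c. if c then card (out_nbrs D (fst e)) else card (in_nbrs D (fst e))"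
  show ?thesis
  proof (cases "?d True = 1 \<or> ?d False = 1")
    case True
    then show ?thesis using star_case by blast
  next
    case n: False
    have "uacyclic ?G"
    proof -
      have sub: "uadj D x y" if "uadj ?G x y" for x y
        using that class_arcs[OF e] by (auto simp: uadj_def Delta_of_def)
      have V: "verts ?G \<subseteq> verts D"
      proof
        fix v assume "v \<in> verts ?G"
        then obtain f where "f \<in> A_class D e" "v = fst f \<or> v = snd f" by (auto simp: Delta_of_def)
        then show "v \<in> verts D" using class_arcs[OF e] arc_verts by (metis prod.collapse)
      qed
      show ?thesis
        unfolding uacyclic_def
      proof (rule notI, elim exE conjE)
        fix xs assume xs: "3 \<le> length xs" "distinct xs" "set xs \<subseteq> verts ?G"
          "\<forall>i. Suc i < length xs \<longrightarrow> uadj ?G (xs ! i) (xs ! Suc i)" "uadj ?G (last xs) (hd xs)"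
        have "\<forall>i. Suc i < length xs \<longrightarrow> uadj D (xs ! i) (xs ! Suc i)" "uadj D (last xs) (hd xs)" "set xs \<subseteq> verts D"
          using xs(3-5) sub V by blast+
        then show False using thin_acyclic[OF False] xs(1,2) unfolding uacyclic_def by blast
      qed
    qed
    moreover have "?d True \<ge> 2" "?d False \<ge> 2" using n dgr_pos[of True] dgr_pos[of False] by linarith+
    ultimately show ?thesis by (rule tree_case)
  qed
qed

end

section \<open>Reachability classes of DL\<close>

text \<open>Ensures that the vertex set of a class, which consists of ends of arcs, is the whole
  block.\<close>

lemma (in bip_parts) incident_arc:
  assumes "arcs B \<noteq> {}" "v \<in> verts B" shows "\<exists>w. uadj B v w"
proof -
  obtain x y where xy: "(x, y) \<in> arcs B" using assms(1) by auto
  have "(v, x) \<in> (ugraph B)\<^sup>*" using uconn arcs_parts[OF xy] parts assms(2)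
    by (intro connected_on_rtrancl[of _ "verts B"]) (auto simp: uconnected_iff)
  then show ?thesis
    by (cases rule: converse_rtranclE) (use xy in \<open>auto simp: ugraph_def uadj_def\<close>)
qed

text \<open>The induction follows a walk in \<open>B\<close> and speaks of all arcs at its current
  end: on a fixed side, arcs with a common end share their source or share their target.\<close>

lemma (in bip_parts) arcs_share_connected:
  assumes e: "e \<in> arcs B" "e' \<in> arcs B" shows "(e, e') \<in> (share B)\<^sup>*"
proof -
  obtain a b a' b' where ab: "e = (a, b)" "e' = (a', b')" by (cases e, cases e')
  have V: "a \<in> verts B" "a' \<in> verts B" using arcs_parts parts e ab by blast+
  have "(a, a') \<in> (ugraph B)\<^sup>*" using uconn V
    by (intro connected_on_rtrancl[of _ "verts B"]) (auto simp: uconnected_iff)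
  then have "\<forall>f\<in>arcs B. fst f = a' \<or> snd f = a' \<longrightarrow> (e, f) \<in> (share B)\<^sup>*"
  proof (induction rule: rtrancl_induct)
    case base
    have "a \<notin> Y" using arcs_parts e(1) ab(1) parts(1) by blast
    show ?case
    proof (intro ballI impI)
      fix f assume f: "f \<in> arcs B" "fst f = a \<or> snd f = a"
      then have "fst f = a" using arcs_parts \<open>a \<notin> Y\<close> by (metis prod.collapse)
      then have "(e, f) \<in> share B" using e ab f by (simp add: share_def)
      then show "(e, f) \<in> (share B)\<^sup>*" by blast
    qed
  next
    case (step v w)
    have vw: "uadj B v w" using step.hyps(2) by (simp add: ugraph_def)
    then obtain h where h: "h \<in> arcs B" "h = (v, w) \<or> h = (w, v)" by (auto simp: uadj_def)
    then have eh: "(e, h) \<in> (share B)\<^sup>*" using step.IH by auto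
    show ?case
    proof (intro ballI impI)
      fix f assume f: "f \<in> arcs B" "fst f = w \<or> snd f = w"
      have "fst f \<in> X" "snd f \<in> Y" "fst h \<in> X" "snd h \<in> Y" using arcs_parts f(1) h(1) by (metis prod.collapse)+
      then have "fst f = fst h \<or> snd f = snd h" using f(2) h(2) parts(1) by auto
      then have "(h, f) \<in> share B" using f(1) h(1) by (auto simp: share_def)
      then show "(e, f) \<in> (share B)\<^sup>*" using eh by (rule rtrancl_into_rtrancl[rotated])
    qed
  qed
  then show ?thesis using e(2) ab(2) by simp
qed

section \<open>Classes of the constructed digraph are its blocks\<close>

context dl
begin

text \<open>An arc of the digraph is a pair of consecutive tree arcs. Sharing a source or a target
  preserves their middle vertex, so a class stays in one block; connectedness of \<open>B\<close>
  makes it fill the block.\<close>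

lemma A_class_D:
  assumes pq: "(p, q) \<in> arcs D" shows "A_class D (p, q) = {(x, y). (x, y) \<in> arcs D \<and> x \<in> block (snd p) \<and> y \<in> block (snd p)}"
proof -
  let ?t = "snd p"
  have t: "?t \<in> verts T" using pq arcs_D T_verts by blast
  have fwd: "snd (fst f) = ?t \<and> f \<in> arcs D" if "((p, q), f) \<in> (share D)\<^sup>*" for f
    using that
  proof (induction rule: rtrancl_induct)
    case base
    show ?case using pq by simp
  next
    case (step f f')
    have a: "f \<in> arcs D" "f' \<in> arcs D" and eq: "fst f = fst f' \<or> snd f = snd f'" using step.hyps(2) by (auto simp: share_def)
    have "snd (fst f) = fst (snd f)" "snd (fst f') = fst (snd f')" using a arcs_D by (metis prod.collapse)+
    then show ?case using eq step.IH a by auto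
  qed
  have bij: "bij_betw (\<beta> ?t) (block ?t) (verts B)" by (rule \<beta>_bij[OF t])
  define \<gamma> where "\<gamma> = inv_into (block ?t) (\<beta> ?t)"
  have \<gamma>: "\<gamma> x \<in> block ?t" "\<beta> ?t (\<gamma> x) = x" if "x \<in> verts B" for x
    using bij that by (auto simp: \<gamma>_def bij_betw_def inv_into_into f_inv_into_f)
  have \<gamma>\<beta>: "\<gamma> (\<beta> ?t e) = e" if "e \<in> block ?t" for e using bij that by (simp add: \<gamma>_def bij_betw_inv_into_left)
  have bwd: "((p, q), (x, y)) \<in> (share D)\<^sup>*" if xy: "(x, y) \<in> arcs D" "x \<in> block ?t" "y \<in> block ?t" for x y
  proof -
    have pb: "p \<in> block ?t" "q \<in> block ?t" using arc_block[OF pq] by blast+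
    have "(\<beta> ?t p, \<beta> ?t q) \<in> arcs B" "(\<beta> ?t x, \<beta> ?t y) \<in> arcs B" using block_arcs pq xy pb by blast+
    then have "((\<beta> ?t p, \<beta> ?t q), (\<beta> ?t x, \<beta> ?t y)) \<in> (share B)\<^sup>*" by (rule arcs_share_connected)
    then have "((\<gamma> (\<beta> ?t p), \<gamma> (\<beta> ?t q)), (\<gamma> (fst (\<beta> ?t x, \<beta> ?t y)), \<gamma> (snd (\<beta> ?t x, \<beta> ?t y)))) \<in> (share D)\<^sup>*"
    proof (induction rule: rtrancl_induct)
      case (step f f')
      have lift: "(\<gamma> (fst f), \<gamma> (snd f)) \<in> arcs D" if "f \<in> arcs B" for f
      proof -
        have f: "(fst f, snd f) \<in> arcs B" using that by simp
        then have V: "fst f \<in> verts B" "snd f \<in> verts B" using arcs_parts parts by blast+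
        show ?thesis using block_arcs[OF \<gamma>(1)[OF V(1)] \<gamma>(1)[OF V(2)]] \<gamma>(2)[OF V(1)] \<gamma>(2)[OF V(2)] f by simp
      qed
      have "((\<gamma> (fst f), \<gamma> (snd f)), (\<gamma> (fst f'), \<gamma> (snd f'))) \<in> share D"
        using step.hyps(2) lift[of f] lift[of f'] by (auto simp: share_def)
      then show ?case using step.IH by (rule rtrancl_into_rtrancl[rotated])
    qed simp
    then show ?thesis using \<gamma>\<beta> pb xy by simp
  qed
  show ?thesis
  proof (intro set_eqI iffI)
    fix f assume "f \<in> A_class D (p, q)"
    then have "((p, q), f) \<in> (share D)\<^sup>*" using A_class_iff[OF wf_D pq] by blast
    then have f: "snd (fst f) = ?t" "f \<in> arcs D" using fwd by blast+
    then have "(fst f, snd f) \<in> arcs D" by simp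
    then have "fst f \<in> block ?t" "snd f \<in> block ?t" using arc_block[of "fst f" "snd f"] f(1) by simp_all
    then show "f \<in> {(x, y). (x, y) \<in> arcs D \<and> x \<in> block ?t \<and> y \<in> block ?t}" using f(2) by (simp add: case_prod_beta)
  next
    fix f assume "f \<in> {(x, y). (x, y) \<in> arcs D \<and> x \<in> block ?t \<and> y \<in> block ?t}"
    then show "f \<in> A_class D (p, q)" using bwd A_class_iff[OF wf_D pq] by auto
  qed
qed

theorem class_isomorphic_B:
  assumes "f \<in> arcs D" shows "u_isomorphic (Delta_of (A_class D f)) B"
proof -
  obtain p q where f: "f = (p, q)" by (cases f)
  then have pq: "(p, q) \<in> arcs D" using assms by simp
  let ?t = "snd p" and ?G = "Delta_of (A_class D f)"
  have t: "?t \<in> verts T" using pq arcs_D T_verts by blast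
  have bij: "bij_betw (\<beta> ?t) (block ?t) (verts B)" by (rule \<beta>_bij[OF t])
  have A: "(x, y) \<in> A_class D f \<longleftrightarrow> (x, y) \<in> arcs D \<and> x \<in> block ?t \<and> y \<in> block ?t" for x y
    unfolding f A_class_D[OF pq] by simp
  have ug: "uadj ?G x y \<longleftrightarrow> uadj D x y" if "x \<in> block ?t" "y \<in> block ?t" for x y
    using A that by (auto simp: uadj_def Delta_of_def)
  have vG: "verts ?G = block ?t"
  proof (intro set_eqI iffI)
    fix v assume "v \<in> verts ?G"
    then obtain h where h: "h \<in> A_class D f" "v = fst h \<or> v = snd h" by (auto simp: Delta_of_def)
    then have "(fst h, snd h) \<in> A_class D f" by simp
    then show "v \<in> block ?t" using A h(2) by blast
  next
    fix v assume v: "v \<in> block ?t"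
    have "\<beta> ?t v \<in> verts B" using bij_betwE[OF bij] v by blast
    then obtain w where w: "uadj B (\<beta> ?t v) w" using incident_arc[OF arcsB] by blast
    then have "w \<in> \<beta> ?t ` block ?t" using bij uadj_V unfolding bij_betw_def by blast
    then obtain u where u: "w = \<beta> ?t u" "u \<in> block ?t" by (rule imageE)
    have "uadj D v u" using block_uadj[OF v u(2)] w u(1) by simp
    then have "uadj ?G v u" using ug v u(2) by blast
    then show "v \<in> verts ?G" by (force simp: uadj_def Delta_of_def)
  qed
  show ?thesis
    unfolding u_isomorphic_def
  proof (intro exI conjI ballI)
    show "bij_betw (\<beta> ?t) (verts ?G) (verts B)" using bij vG by simp
    fix x y assume "x \<in> verts ?G" "y \<in> verts ?G"
    then show "uadj ?G x y \<longleftrightarrow> uadj B (\<beta> ?t x) (\<beta> ?t y)" using ug block_uadj vG by blast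
  qed
qed

end

text \<open>Used to see that a connected listed graph has an arc; the list itself contains the
  edgeless graph \<open>CP_graph 1\<close>.\<close>

lemma listed_two_vertices:
  assumes "listed_graph B" shows "\<exists>x\<in>verts B. \<exists>y\<in>verts B. x \<noteq> y"
proof -
  have iso: "\<exists>x\<in>verts B. \<exists>y\<in>verts B. x \<noteq> y"
    if m: "u_isomorphic B H" "p \<in> verts H" "q \<in> verts H" "p \<noteq> q" for H :: "'c dg" and p q
  proof -
    obtain h where "bij_betw h (verts B) (verts H)" using m(1) unfolding u_isomorphic_def by blast
    then have "h ` verts B = verts H" by (simp add: bij_betw_def)
    then obtain x y where "x \<in> verts B" "h x = p" "y \<in> verts B" "h y = q" using m(2,3) by (metis imageE)
    moreover have "x \<noteq> y" using calculation m(4) by metis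
    ultimately show ?thesis by blast
  qed
  show ?thesis
    using assms unfolding listed_graph_def
  proof (elim disjE exE conjE)
    fix m :: nat assume "m \<ge> 4" "u_isomorphic B (cycle_graph m)"
    then show ?thesis using iso[of "cycle_graph m" 0 1] by (simp add: cycle_graph_def)
  next
    fix m n :: nat assume "m \<ge> 1" "n \<ge> 1" "u_isomorphic B (K_bip m n)"
    then show ?thesis using iso[of "K_bip m n" "(False, 0)" "(True, 0)"] by (simp add: K_bip_def)
  next
    fix n :: nat assume "n \<ge> 1" "u_isomorphic B (CP_graph n)"
    then show ?thesis using iso[of "CP_graph n" "(False, 0)" "(True, 0)"] by (simp add: CP_graph_def)
  next
    fix a b assume "is_T_ab B a b"
    then have inf: "infinite (verts B)" by (simp add: is_T_ab_def)
    then obtain x where x: "x \<in> verts B" by (metis ex_in_conv finite.emptyI)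
    have "infinite (verts B - {x})" using inf by simp
    then obtain y where "y \<in> verts B - {x}" by (metis ex_in_conv finite.emptyI)
    then show ?thesis using x by blast
  qed
qed

lemma listed_dl:
  assumes B: "wf_digraph B" "bipartite_parts B X Y" "uconnected B" "listed_graph B" and data: "DL_data X Y T \<phi> \<psi>"
  shows "dl B X Y T \<phi> \<psi>"
proof -
  interpret bip_parts B X Y by unfold_locales (use B in auto)
  have "arcs B \<noteq> {}"
  proof
    assume no: "arcs B = {}"
    obtain x y where xy: "x \<in> verts B" "y \<in> verts B" "x \<noteq> y" using listed_two_vertices[OF B(4)] by blast
    have "(x, y) \<in> (ugraph B)\<^sup>*" using B(3) xy by (intro connected_on_rtrancl[of _ "verts B"]) (auto simp: uconnected_iff)
    then show False using xy(3) no by (cases rule: converse_rtranclE) (auto simp: ugraph_def uadj_def)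
  qed
  then show ?thesis
    by unfold_locales (use B data listed_ope[OF B(4)] in auto)
qed

theorem theorem4p1:
  shows "(\<forall>D :: 'a dg.
            wf_digraph D \<and> uconnected D \<and> locally_finite D \<and> triangle_free D
            \<and> more_than_one_end D \<and> connected_homogeneous D
          \<longrightarrow>
            highly_arc_transitive D
          \<and> (\<exists>e\<in>arcs D. \<exists>e'\<in>arcs D. \<not> rel_A D e e')
          \<and> (\<forall>e\<in>arcs D. bipartite_dg (Delta_of (A_class D e)))
          \<and> (\<forall>e\<in>arcs D. listed_graph (Delta_of (A_class D e)))
          \<and> (more_than_two_ends D \<longrightarrow>
               (\<forall>u\<in>verts D. is_tree (induced D (desc D u)) \<and> is_tree (induced D (anc D u)))))
       \<and> (\<forall>(B :: 'b dg) X Y (T :: 't dg) \<phi> \<psi>.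
            wf_digraph B \<and> bipartite_parts B X Y \<and> uconnected B \<and> listed_graph B
            \<and> DL_data X Y T \<phi> \<psi>
          \<longrightarrow>
            (let D' = DL B T \<phi> \<psi> in
               wf_digraph D' \<and> uconnected D' \<and> triangle_free D' \<and> locally_finite D'
             \<and> connected_homogeneous D'
             \<and> (\<forall>e\<in>arcs D'. u_isomorphic (Delta_of (A_class D' e)) B)))"
proof (rule conjI)
  show "\<forall>D :: 'a dg. wf_digraph D \<and> uconnected D \<and> locally_finite D \<and> triangle_free D
            \<and> more_than_one_end D \<and> connected_homogeneous D
          \<longrightarrow> highly_arc_transitive D
          \<and> (\<exists>e\<in>arcs D. \<exists>e'\<in>arcs D. \<not> rel_A D e e')
          \<and> (\<forall>e\<in>arcs D. bipartite_dg (Delta_of (A_class D e)))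
          \<and> (\<forall>e\<in>arcs D. listed_graph (Delta_of (A_class D e)))
          \<and> (more_than_two_ends D \<longrightarrow>
               (\<forall>u\<in>verts D. is_tree (induced D (desc D u)) \<and> is_tree (induced D (anc D u))))"
  proof (intro allI impI, elim conjE)
    fix D :: "'a dg"
    assume "wf_digraph D" "uconnected D" "locally_finite D" "triangle_free D"
      "more_than_one_end D" "connected_homogeneous D"
    then obtain E where "cut_homogeneous D E" using cut_homogeneous_exists by blast
    then interpret cut_homogeneous D E .
    show "highly_arc_transitive D
          \<and> (\<exists>e\<in>arcs D. \<exists>e'\<in>arcs D. \<not> rel_A D e e')
          \<and> (\<forall>e\<in>arcs D. bipartite_dg (Delta_of (A_class D e)))
          \<and> (\<forall>e\<in>arcs D. listed_graph (Delta_of (A_class D e)))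
          \<and> (more_than_two_ends D \<longrightarrow>
               (\<forall>u\<in>verts D. is_tree (induced D (desc D u)) \<and> is_tree (induced D (anc D u))))"
      using cut_highly_arc_transitive cut_reachability_not_universal cut_class_bipartite_dg
        cut_class_listed desc_tree anc_tree by blast
  qed
  show "\<forall>(B :: 'b dg) X Y (T :: 't dg) \<phi> \<psi>.
            wf_digraph B \<and> bipartite_parts B X Y \<and> uconnected B \<and> listed_graph B
            \<and> DL_data X Y T \<phi> \<psi>
          \<longrightarrow>
            (let D' = DL B T \<phi> \<psi> in
               wf_digraph D' \<and> uconnected D' \<and> triangle_free D' \<and> locally_finite D'
             \<and> connected_homogeneous D'
             \<and> (\<forall>e\<in>arcs D'. u_isomorphic (Delta_of (A_class D' e)) B))"
  proof (intro allI impI, elim conjE)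
    fix B :: "'b dg" and X Y and T :: "'t dg" and \<phi> \<psi>
    assume "wf_digraph B" "bipartite_parts B X Y" "uconnected B" "listed_graph B" "DL_data X Y T \<phi> \<psi>"
    then interpret dl B X Y T \<phi> \<psi> by (rule listed_dl)
    show "let D' = DL B T \<phi> \<psi> in
               wf_digraph D' \<and> uconnected D' \<and> triangle_free D' \<and> locally_finite D'
             \<and> connected_homogeneous D'
             \<and> (\<forall>e\<in>arcs D'. u_isomorphic (Delta_of (A_class D' e)) B)"
      unfolding Let_def
      using wf_D uconnected_D triangle_free_D locally_finite_D connected_homogeneous_D class_isomorphic_B by blast
  qed
qed

end
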